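(* Let $p$ be an odd prime and $g\ge1$. Let $G$ be a Schur$+1$ $\sigma$-ancestor group of $p$-class $c$ and rank $g$, and let $h=h(G)$. Then $$\mathrm{Meas}_c(G)=\frac{y(G)}{|\mathrm{Aut}_\sigma(G)|\,|G|}\,p^{g(g+1)}\,\frac{\eta_g(p)\,\eta_{g+1}(p)}{\eta_{g+1-h}(p)}.$$ If $G$ is moreover a Schur$+1$ $\sigma$-group, with $r=r(G)$, then $$\mathrm{Meas}(G)=\frac{y(G)}{|\mathrm{Aut}_\sigma(G)|\,|G|}\,p^{g(g+1)}\,\frac{\eta_g(p)\,\eta_{g+1}(p)}{\eta_{g+1-r}(p)};$$ otherwise $\mathrm{Meas}(G)=0$.
   Context: For a pro-$p$ group $G$, $d(G)=\dim_{\mathbb{F}_p}H^1(G,\mathbb{F}_p)$, $r(G)=\dim_{\mathbb{F}_p}H^2(G,\mathbb{F}_p)$. A GI-automorphism of $G$ is an automorphism $\sigma$ of order $2$ acting as inversion on $G^{\mathrm{ab}}$. A finitely presented pro-$p$ group $G$ is a Schur$+1$ $\sigma$-group of rank $g$ if $G^{\mathrm{ab}}$ is finite, $(d(G),r(G))\in\{(g,g),(g,g+1)\}$, and there is a GI-automorphism $\sigma$ of $G$ acting as inversion on $H^2(G,\mathbb{F}_p)$. Lower $p$-central series: $P_0(G)=G$, $P_{n+1}(G)=[G,P_n(G)]P_n(G)^p$; $G$ has $p$-class $c$ if $P_c(G)=1$ and $P_n(G)\ne1$ for $n<c$; $G_c=G/P_c(G)$. A Schur$+1$ $\sigma$-ancestor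 group is any quotient $G_c$ ($c\ge1$) of a Schur$+1$ $\sigma$-group $G$ (so finite Schur$+1$ $\sigma$-groups are included). Let $F$ be the free pro-$p$ group on $x_1,\dots,x_g$ with the automorphism $\sigma(x_i)=x_i^{-1}$, $F_c=F/P_c(F)$ with induced $\sigma$, and $X_c=\{s\in\Phi(F_c):\sigma(s)=s^{-1}\}$ ($\Phi$ = Frattini subgroup). For a Schur$+1$ $\sigma$-ancestor group $G$ of $p$-class $c$ and rank $g$ and $c'\ge c$, let $T_{c'}(G)$ be the set of tuples $(t_1,\dots,t_{g+1})\in X_{c'}^{g+1}$ with $F_{c'}/\langle t_1,\dots,t_{g+1}\rangle\cong G$ (closed normal subgroup generated), and $\mathrm{Meas}_{c'}(G)=|T_{c'}(G)|/|X_{c'}|^{g+1}$; $\mathrm{Meas}(G):=\mathrm{Meas}_{c+1}(G)$. For a finite $p$-group $G$ with GI-automorphism $\sigma$, $Y(G,\sigma)=\{s\in G:\sigma(s)=s\}$ and $y(G)=|Y(G,\sigma)|$ (independent of the choice of $\sigma$); $\mathrm{Aut}_\sigma(G)$ is the group of automorphisms of $G$ commuting with $\sigma$. If $G=F/R$ has $p$-class $c$, let $R^*$ be the closure of $R^p[F,R]$; $h(G)=\dim_{\mathbb{F}_p} R/R^*P_c(F)$. Finally $\eta_j(p)=\prod_{k=1}^j(1-p^{-k})$ (with $\eta_0(p)=1$). *)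

theory Defs
  imports "HOL-Analysis.Analysis" "HOL-Algebra.Solvable_Groups"
begin

text \<open>A (topological) group is a pair of a HOL-Algebra group G and a topology tau on carrier G.
  Finite groups are regarded as topological groups with the discrete topology.\<close>

definition pro_p_group :: "nat \<Rightarrow> ('a, 'b) monoid_scheme \<Rightarrow> 'a topology \<Rightarrow> bool" where
  "pro_p_group p G tau \<longleftrightarrow>
     group G \<and> topspace tau = carrier G \<and>
     continuous_map (prod_topology tau tau) tau (\<lambda>z. fst z \<otimes>\<^bsub>G\<^esub> snd z) \<and>
     continuous_map tau tau (\<lambda>x. inv\<^bsub>G\<^esub> x) \<and>
     compact_space tau \<and> Hausdorff_space tau \<and>
     (\<forall>x \<in> carrier G. connected_component_of_set tau x = {x}) \<and>
     (\<forall>N. N \<lhd> G \<and> openin tau N \<longrightarrow> (\<exists>k. card (rcosets\<^bsub>G\<^esub> N) = p ^ k))"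

fun plcs :: "nat \<Rightarrow> ('a, 'b) monoid_scheme \<Rightarrow> 'a topology \<Rightarrow> nat \<Rightarrow> 'a set" where
  "plcs p G tau 0 = carrier G"
| "plcs p G tau (Suc n) =
     tau closure_of (generate G
       ({x \<otimes>\<^bsub>G\<^esub> y \<otimes>\<^bsub>G\<^esub> inv\<^bsub>G\<^esub> x \<otimes>\<^bsub>G\<^esub> inv\<^bsub>G\<^esub> y | x y. x \<in> carrier G \<and> y \<in> plcs p G tau n}
        \<union> {y [^]\<^bsub>G\<^esub> p | y. y \<in> plcs p G tau n}))"

definition has_p_class :: "nat \<Rightarrow> ('a, 'b) monoid_scheme \<Rightarrow> 'a topology \<Rightarrow> nat \<Rightarrow> bool" where
  "has_p_class p G tau c \<longleftrightarrow>
     plcs p G tau c = {\<one>\<^bsub>G\<^esub>} \<and> (\<forall>n < c. plcs p G tau n \<noteq> {\<one>\<^bsub>G\<^esub>})"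

definition cl_ncl :: "('a, 'b) monoid_scheme \<Rightarrow> 'a topology \<Rightarrow> 'a set \<Rightarrow> 'a set" where
  "cl_ncl G tau S =
     tau closure_of generate G {x \<otimes>\<^bsub>G\<^esub> s \<otimes>\<^bsub>G\<^esub> inv\<^bsub>G\<^esub> x | x s. x \<in> carrier G \<and> s \<in> S}"

definition frattini :: "('a, 'b) monoid_scheme \<Rightarrow> 'a set" where
  "frattini G = carrier G \<inter> \<Inter> {H. subgroup H G \<and> H \<noteq> carrier G \<and>
       (\<forall>K. subgroup K G \<and> H \<subseteq> K \<longrightarrow> K = H \<or> K = carrier G)}"

text \<open>Free group on x_0,...,x_{g-1}: reduced words; letter (i,True) = x_i, (i,False) = x_i^{-1}.\<close>

fun cancel_letter :: "nat \<times> bool \<Rightarrow> (nat \<times> bool) list \<Rightarrow> (nat \<times> bool) list" where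
  "cancel_letter x [] = [x]"
| "cancel_letter x (y # ys) =
     (if fst x = fst y \<and> snd x \<noteq> snd y then ys else x # y # ys)"

definition reduce_word :: "(nat \<times> bool) list \<Rightarrow> (nat \<times> bool) list" where
  "reduce_word w = foldr cancel_letter w []"

definition reduced_word :: "(nat \<times> bool) list \<Rightarrow> bool" where
  "reduced_word w \<longleftrightarrow> (\<forall>i. Suc i < length w \<longrightarrow>
       \<not> (fst (w ! i) = fst (w ! Suc i) \<and> snd (w ! i) \<noteq> snd (w ! Suc i)))"

definition free_grp :: "nat \<Rightarrow> (nat \<times> bool) list monoid" where
  "free_grp g = \<lparr>carrier = {w. reduced_word w \<and> (\<forall>x \<in> set w. fst x < g)},
                 mult = (\<lambda>u v. reduce_word (u @ v)), one = []\<rparr>"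

definition sigma_word :: "(nat \<times> bool) list \<Rightarrow> (nat \<times> bool) list" where
  "sigma_word w = map (\<lambda>x. (fst x, \<not> snd x)) w"

definition Fc :: "nat \<Rightarrow> nat \<Rightarrow> nat \<Rightarrow> (nat \<times> bool) list set monoid" where
  "Fc p g c = free_grp g Mod plcs p (free_grp g) (discrete_topology (carrier (free_grp g))) c"

definition sigma_Fc :: "(nat \<times> bool) list set \<Rightarrow> (nat \<times> bool) list set" where
  "sigma_Fc C = sigma_word ` C"

definition Xc :: "nat \<Rightarrow> nat \<Rightarrow> nat \<Rightarrow> (nat \<times> bool) list set set" where
  "Xc p g c = {s \<in> frattini (Fc p g c). sigma_Fc s = inv\<^bsub>Fc p g c\<^esub> s}"

text \<open>Free pro-p group on g generators: inverse limit of the F_n.\<close>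

definition free_prop :: "nat \<Rightarrow> nat \<Rightarrow> (nat \<Rightarrow> (nat \<times> bool) list set) monoid" where
  "free_prop p g = \<lparr>carrier = {a. \<forall>n. a n \<in> carrier (Fc p g n) \<and> a (Suc n) \<subseteq> a n},
                    mult = (\<lambda>a b n. a n \<otimes>\<^bsub>Fc p g n\<^esub> b n),
                    one = (\<lambda>n. \<one>\<^bsub>Fc p g n\<^esub>)\<rparr>"

definition free_prop_top :: "nat \<Rightarrow> nat \<Rightarrow> (nat \<Rightarrow> (nat \<times> bool) list set) topology" where
  "free_prop_top p g =
     subtopology (product_topology (\<lambda>n. discrete_topology (carrier (Fc p g n))) UNIV)
                 (carrier (free_prop p g))"

definition finitely_presented :: "nat \<Rightarrow> ('a, 'b) monoid_scheme \<Rightarrow> 'a topology \<Rightarrow> bool" where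
  "finitely_presented p G tau \<longleftrightarrow>
     (\<exists>n S \<phi>. finite S \<and> S \<subseteq> carrier (free_prop p n) \<and>
        \<phi> \<in> hom (free_prop p n) G \<and> \<phi> ` carrier (free_prop p n) = carrier G \<and>
        continuous_map (free_prop_top p n) tau \<phi> \<and>
        kernel (free_prop p n) G \<phi> = cl_ncl (free_prop p n) (free_prop_top p n) S)"

text \<open>F_p is represented by the integers 0..p-1, with equalities taken mod p.\<close>

definition cochain1 :: "nat \<Rightarrow> ('a, 'b) monoid_scheme \<Rightarrow> 'a topology \<Rightarrow> ('a \<Rightarrow> int) set" where
  "cochain1 p G tau = {u \<in> carrier G \<rightarrow>\<^sub>E {0..<int p}.
       \<forall>k. openin tau {x \<in> carrier G. u x = k}}"

definition cochain2 :: "nat \<Rightarrow> ('a, 'b) monoid_scheme \<Rightarrow> 'a topology \<Rightarrow> ('a \<times> 'a \<Rightarrow> int) set" where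
  "cochain2 p G tau = {f \<in> (carrier G \<times> carrier G) \<rightarrow>\<^sub>E {0..<int p}.
       \<forall>k. openin (prod_topology tau tau) {z \<in> carrier G \<times> carrier G. f z = k}}"

definition H1 :: "nat \<Rightarrow> ('a, 'b) monoid_scheme \<Rightarrow> 'a topology \<Rightarrow> ('a \<Rightarrow> int) set" where
  "H1 p G tau = {u \<in> cochain1 p G tau. \<forall>a \<in> carrier G. \<forall>b \<in> carrier G.
       (u (a \<otimes>\<^bsub>G\<^esub> b) - (u a + u b)) mod int p = 0}"

definition Z2 :: "nat \<Rightarrow> ('a, 'b) monoid_scheme \<Rightarrow> 'a topology \<Rightarrow> ('a \<times> 'a \<Rightarrow> int) set" where
  "Z2 p G tau = {f \<in> cochain2 p G tau. \<forall>a \<in> carrier G. \<forall>b \<in> carrier G. \<forall>c \<in> carrier G.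
       (f (b, c) - f (a \<otimes>\<^bsub>G\<^esub> b, c) + f (a, b \<otimes>\<^bsub>G\<^esub> c) - f (a, b)) mod int p = 0}"

definition B2 :: "nat \<Rightarrow> ('a, 'b) monoid_scheme \<Rightarrow> 'a topology \<Rightarrow> ('a \<times> 'a \<Rightarrow> int) set" where
  "B2 p G tau = {f \<in> cochain2 p G tau. \<exists>u \<in> cochain1 p G tau. \<forall>a \<in> carrier G. \<forall>b \<in> carrier G.
       (f (a, b) - (u b - u (a \<otimes>\<^bsub>G\<^esub> b) + u a)) mod int p = 0}"

definition cohomologous :: "nat \<Rightarrow> ('a, 'b) monoid_scheme \<Rightarrow> 'a topology
    \<Rightarrow> ('a \<times> 'a \<Rightarrow> int) \<Rightarrow> ('a \<times> 'a \<Rightarrow> int) \<Rightarrow> bool" where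
  "cohomologous p G tau f f' \<longleftrightarrow> (\<exists>b \<in> B2 p G tau. \<forall>z \<in> carrier G \<times> carrier G.
       (f z - f' z - (b z)) mod int p = 0)"

definition H2 :: "nat \<Rightarrow> ('a, 'b) monoid_scheme \<Rightarrow> 'a topology \<Rightarrow> ('a \<times> 'a \<Rightarrow> int) set set" where
  "H2 p G tau = Z2 p G tau // {(f, f'). f \<in> Z2 p G tau \<and> f' \<in> Z2 p G tau \<and> cohomologous p G tau f f'}"

text \<open>d(G) = dim H^1 and r(G) = dim H^2 over F_p (via |H^i| = p^dim).\<close>

definition d_inv :: "nat \<Rightarrow> ('a, 'b) monoid_scheme \<Rightarrow> 'a topology \<Rightarrow> nat" where
  "d_inv p G tau = (THE d. card (H1 p G tau) = p ^ d)"

definition r_inv :: "nat \<Rightarrow> ('a, 'b) monoid_scheme \<Rightarrow> 'a topology \<Rightarrow> nat" where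
  "r_inv p G tau = (THE r. card (H2 p G tau) = p ^ r)"

definition gi_aut :: "('a, 'b) monoid_scheme \<Rightarrow> 'a topology \<Rightarrow> ('a \<Rightarrow> 'a) \<Rightarrow> bool" where
  "gi_aut G tau \<sigma> \<longleftrightarrow>
     \<sigma> \<in> iso G G \<and> continuous_map tau tau \<sigma> \<and>
     (\<forall>x \<in> carrier G. \<sigma> (\<sigma> x) = x) \<and> (\<exists>x \<in> carrier G. \<sigma> x \<noteq> x) \<and>
     (\<forall>x \<in> carrier G. \<sigma> x \<otimes>\<^bsub>G\<^esub> x \<in> tau closure_of derived G (carrier G))"

definition inverts_H2 :: "nat \<Rightarrow> ('a, 'b) monoid_scheme \<Rightarrow> 'a topology \<Rightarrow> ('a \<Rightarrow> 'a) \<Rightarrow> bool" where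
  "inverts_H2 p G tau \<sigma> \<longleftrightarrow> (\<forall>f \<in> Z2 p G tau. \<exists>b \<in> B2 p G tau.
       \<forall>a \<in> carrier G. \<forall>c \<in> carrier G. (f (\<sigma> a, \<sigma> c) + f (a, c) - (b (a, c))) mod int p = 0)"

definition schur1_sigma_group :: "nat \<Rightarrow> nat \<Rightarrow> ('a, 'b) monoid_scheme \<Rightarrow> 'a topology \<Rightarrow> bool" where
  "schur1_sigma_group p g G tau \<longleftrightarrow>
     pro_p_group p G tau \<and> finitely_presented p G tau \<and>
     finite (rcosets\<^bsub>G\<^esub> (tau closure_of derived G (carrier G))) \<and>
     card (H1 p G tau) = p ^ g \<and>
     (card (H2 p G tau) = p ^ g \<or> card (H2 p G tau) = p ^ (g + 1)) \<and>
     (\<exists>\<sigma>. gi_aut G tau \<sigma> \<and> inverts_H2 p G tau \<sigma>)"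

definition schur1_ancestor_of :: "nat \<Rightarrow> nat \<Rightarrow> ('a, 'b) monoid_scheme
    \<Rightarrow> ('h, 'k) monoid_scheme \<Rightarrow> 'h topology \<Rightarrow> bool" where
  "schur1_ancestor_of p g G H tauH \<longleftrightarrow>
     schur1_sigma_group p g H tauH \<and> (\<exists>c \<ge> 1. G \<cong> H Mod plcs p H tauH c)"

definition ncl_tuple :: "nat \<Rightarrow> nat \<Rightarrow> nat \<Rightarrow> (nat \<Rightarrow> (nat \<times> bool) list set) \<Rightarrow> (nat \<times> bool) list set set" where
  "ncl_tuple p g c t = cl_ncl (Fc p g c) (discrete_topology (carrier (Fc p g c))) (t ` {0..g})"

definition Tc :: "nat \<Rightarrow> nat \<Rightarrow> nat \<Rightarrow> ('a, 'b) monoid_scheme \<Rightarrow> (nat \<Rightarrow> (nat \<times> bool) list set) set" where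
  "Tc p g c G = {t \<in> {0..g} \<rightarrow>\<^sub>E Xc p g c. Fc p g c Mod ncl_tuple p g c t \<cong> G}"

definition Meas :: "nat \<Rightarrow> nat \<Rightarrow> nat \<Rightarrow> ('a, 'b) monoid_scheme \<Rightarrow> real" where
  "Meas p g c G = real (card (Tc p g c G)) / real (card (Xc p g c)) ^ (g + 1)"

definition y_inv :: "('a, 'b) monoid_scheme \<Rightarrow> ('a \<Rightarrow> 'a) \<Rightarrow> nat" where
  "y_inv G \<sigma> = card {s \<in> carrier G. \<sigma> s = s}"

definition Aut_sigma :: "('a, 'b) monoid_scheme \<Rightarrow> ('a \<Rightarrow> 'a) \<Rightarrow> ('a \<Rightarrow> 'a) set" where
  "Aut_sigma G \<sigma> = {\<alpha> \<in> iso G G \<inter> extensional (carrier G).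
       \<forall>x \<in> carrier G. \<alpha> (\<sigma> x) = \<sigma> (\<alpha> x)}"

text \<open>h(G) for a finite p-group G of p-class c and rank g: G = F/R with F free pro-p on g
  generators, R^* = closure of R^p[F,R], h = dim_{F_p} R / R^* P_c(F).\<close>

definition h_inv :: "nat \<Rightarrow> nat \<Rightarrow> nat \<Rightarrow> ('a, 'b) monoid_scheme \<Rightarrow> nat" where
  "h_inv p g c G =
     (let F = free_prop p g; tauF = free_prop_top p g;
          \<pi> = (SOME \<pi>. \<pi> \<in> hom F G \<and> \<pi> ` carrier F = carrier G \<and>
                 continuous_map tauF (discrete_topology (carrier G)) \<pi>);
          R = kernel F G \<pi>;
          Rstar = tauF closure_of generate F
                    ({r [^]\<^bsub>F\<^esub> p | r. r \<in> R} \<union>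
                     {x \<otimes>\<^bsub>F\<^esub> r \<otimes>\<^bsub>F\<^esub> inv\<^bsub>F\<^esub> x \<otimes>\<^bsub>F\<^esub> inv\<^bsub>F\<^esub> r | x r. x \<in> carrier F \<and> r \<in> R});
          K = Rstar <#>\<^bsub>F\<^esub> plcs p F tauF c
      in THE h. card {K #>\<^bsub>F\<^esub> r | r. r \<in> R} = p ^ h)"

definition eta :: "nat \<Rightarrow> nat \<Rightarrow> real" where
  "eta j p = (\<Prod>k = 1..j. 1 - 1 / real p ^ k)"

end

theory Submission
  imports Defs "HOL-Algebra.Sylow" "HOL-Algebra.Zassenhaus" "HOL-Algebra.SndIsomorphismGrp"
    "HOL-Algebra.Multiplicative_Group" "HOL-Combinatorics.Cycles" "HOL-Number_Theory.Cong"
begin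

text \<open>Fix a GI-automorphism \<open>\<sigma>\<close> of \<open>G\<close>. The tuples in \<open>T\<^sub>m(G)\<close> are counted through the pairs \<open>(t, \<psi>)\<close> where
  \<open>\<psi> : F\<^sub>m \<rightarrow> G\<close> is an equivariant surjection whose kernel \<open>N\<close> is the normal subgroup generated by \<open>t\<close>.
  For a given \<open>t\<close> the choices of \<open>\<psi>\<close> form a torsor under \<open>Aut\<^sub>\<sigma>(G)\<close>, as any two involutions inverting
  \<open>G\<close> modulo its Frattini subgroup are conjugate. For a given \<open>\<psi>\<close>, the tuple \<open>t\<close> generates \<open>N\<close> normally
  iff it generates \<open>N\<close> modulo \<open>N\<^sup>* = N\<^sup>p[F\<^sub>m, N]\<close>, an elementary abelian quotient on which \<open>\<sigma>\<close> acts as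
  inversion, so one counts generating \<open>(g+1)\<close>-tuples of an \<open>F\<^sub>p\<close>-space. Its dimension is \<open>h(G)\<close> for
  \<open>m = c\<close>. Transgression embeds the dual of \<open>N/N\<^sup>*\<close> into \<open>H\<^sup>2\<close> of any pro-\<open>p\<close> group \<open>H\<close> with
  \<open>H/P\<^sub>n(H) \<cong> G\<close>, \<open>n \<ge> m\<close>, and onto \<open>H\<^sup>2(G)\<close> when \<open>m = c + 1\<close> and \<open>H = G\<close>; this supplies the action of
  \<open>\<sigma>\<close> and the bound \<open>g + 1\<close>. If \<open>T\<^sub>c\<^sub>+\<^sub>1(G)\<close> is nonempty, the same isomorphism shows that \<open>G\<close> is a
  Schur\<open>+1\<close> group, so \<open>Meas(G)\<close> vanishes otherwise.\<close>

section \<open>The lower \<open>p\<close>-central series\<close>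

text \<open>The inverted elements of a subgroup form no subgroup, so no exact sequence counts them.
  Odd order replaces it: square roots are powers, a coset of W on which \<sigma> is inversion modulo
  W contains \<open>r r\<close> with \<open>r\<close> inverted, and n \<mapsto> r n r carries the
  inverted elements of W onto those of the coset. Write X for sets of inverted elements. Then |X(N)|
  / |X(W)| = |N : W| when \<sigma> inverts N modulo W, and |G| = y(G) |X(G)|, the source of
  y(G)/|G|. There are |X(G)|^g \<eta>_g equivariant surjections, and |X(F_m)| = p^g |X_m| yields
  p^(g(g+1)). Only the dimension of the relation module is left. At level c transgression is merely
  shown injective. Every central extension of G by Z/p has class at most c+1, so it receives a map
  from F_{c+1}; hence at level c+1 transgression is onto H^2(G) and the dimension is r(G). The same
  level makes relations visible: for n > c, P_{c+1}(F_n) lies in \<open>pstar\<close> of the kernel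
  of F_n \<rightarrow> G, so a tuple found in F_{c+1} already presents G over the free pro-p
  group.\<close>

definition pstar :: "nat \<Rightarrow> ('a, 'b) monoid_scheme \<Rightarrow> 'a set \<Rightarrow> 'a set" where
  "pstar p G N = generate G
     ({x \<otimes>\<^bsub>G\<^esub> y \<otimes>\<^bsub>G\<^esub> inv\<^bsub>G\<^esub> x \<otimes>\<^bsub>G\<^esub> inv\<^bsub>G\<^esub> y | x y. x \<in> carrier G \<and> y \<in> N} \<union> {y [^]\<^bsub>G\<^esub> p | y. y \<in> N})"

text \<open>The series without any topology: \<open>plcs_discrete\<close> identifies it with
  \<open>plcs\<close> for discrete groups, and in a topological group the closures are put outside
  \<open>pstar\<close>, see \<open>plcs_Suc\<close>.\<close>

primrec lpc :: "nat \<Rightarrow> ('a, 'b) monoid_scheme \<Rightarrow> nat \<Rightarrow> 'a set" where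
  "lpc p G 0 = carrier G"
| "lpc p G (Suc n) = pstar p G (lpc p G n)"

context group
begin

text \<open>Together with \<open>m_assoc\<close> and \<open>inv_mult_group\<close> these rules let
  simp reduce words in a group, which is how the commutator identities are verified.\<close>

lemma inv_cancel [simp]:
  assumes "x \<in> carrier G" "y \<in> carrier G"
  shows "x \<otimes> (inv x \<otimes> y) = y" "inv x \<otimes> (x \<otimes> y) = y"
  using assms by (simp_all add: m_assoc[symmetric])

lemma comm_in_pstar: "x \<in> carrier G \<Longrightarrow> y \<in> N \<Longrightarrow> x \<otimes> y \<otimes> inv x \<otimes> inv y \<in> pstar p G N"
  unfolding pstar_def by (rule generate.incl) blast

lemma pow_in_pstar: "y \<in> N \<Longrightarrow> y [^] (p::nat) \<in> pstar p G N"
  unfolding pstar_def by (rule generate.incl) blast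

lemma pstar_least:
  assumes "subgroup W G" "\<And>x y. x \<in> carrier G \<Longrightarrow> y \<in> N \<Longrightarrow> x \<otimes> y \<otimes> inv x \<otimes> inv y \<in> W"
    "\<And>y. y \<in> N \<Longrightarrow> y [^] p \<in> W"
  shows "pstar p G N \<subseteq> W"
  unfolding pstar_def using assms by (intro generate_subgroup_incl) auto

lemma pstar_subgroup: "N \<subseteq> carrier G \<Longrightarrow> subgroup (pstar p G N) G"
  unfolding pstar_def by (intro generate_is_subgroup) auto

lemma pstar_mono: "N \<subseteq> M \<Longrightarrow> M \<subseteq> carrier G \<Longrightarrow> pstar p G N \<subseteq> pstar p G M"
  unfolding pstar_def by (intro mono_generate) auto

lemma pow_conj:
  assumes "g \<in> carrier G" "y \<in> carrier G"
  shows "(g \<otimes> y \<otimes> inv g) [^] (n::nat) = g \<otimes> y [^] n \<otimes> inv g"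
  using assms by (induction n) (simp_all add: m_assoc)

lemma pstar_normal:
  assumes "N \<lhd> G" shows "pstar p G N \<lhd> G"
proof -
  interpret N: normal N G by fact
  have *: "g \<otimes> (x \<otimes> y \<otimes> inv x \<otimes> inv y) \<otimes> inv g =
     (g \<otimes> x \<otimes> inv g) \<otimes> (g \<otimes> y \<otimes> inv g) \<otimes> inv (g \<otimes> x \<otimes> inv g) \<otimes> inv (g \<otimes> y \<otimes> inv g)"
    if "g \<in> carrier G" "x \<in> carrier G" "y \<in> carrier G" for g x y
    using that by (simp add: m_assoc inv_mult_group)
  show ?thesis unfolding pstar_def
  proof (rule normal_generateI, safe, goal_cases)
    case (3 h g x y)
    show ?case using 3 * N.inv_op_closed2 by (metis N.mem_carrier inv_closed m_closed)
  next
    case (4 h g y)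
    then show ?case using pow_conj N.inv_op_closed2 N.mem_carrier by metis
  qed auto
qed

lemma pstar_subset: "N \<lhd> G \<Longrightarrow> pstar p G N \<subseteq> N"
proof (rule pstar_least)
  assume "N \<lhd> G"
  then interpret N: normal N G .
  show "subgroup N G" by (rule N.subgroup_axioms)
  show "x \<otimes> y \<otimes> inv x \<otimes> inv y \<in> N" if "x \<in> carrier G" "y \<in> N" for x y
    using that N.inv_op_closed2 by simp
  show "y [^] p \<in> N" if "y \<in> N" for y
    using that by (induction p) auto
qed

text \<open>Conjugation acts trivially on N modulo \<open>pstar p G N\<close>, because x h x^-1 =
  [x,h] h. So subgroups in between can be enlarged one element at a time without passing to normal
  closures.\<close>

lemma between_normal:
  assumes "subgroup W G" "pstar p G N \<subseteq> W" "W \<subseteq> N"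
  shows "W \<lhd> G"
proof -
  interpret W: subgroup W G by fact
  have "x \<otimes> h \<otimes> inv x \<in> W" if "x \<in> carrier G" "h \<in> W" for x h
  proof -
    have "x \<otimes> h \<otimes> inv x \<otimes> inv h \<in> W"
      using comm_in_pstar[of x h N p] that assms by blast
    then have "x \<otimes> h \<otimes> inv x \<otimes> inv h \<otimes> h \<in> W" using that by blast
    then show ?thesis using that by (simp add: m_assoc)
  qed
  then show ?thesis by (simp add: normal_inv_iff assms)
qed

lemma lpc_normal: "lpc p G n \<lhd> G"
  by (induction n) (simp_all add: pstar_normal normal_self)

lemma lpc_subgroup: "subgroup (lpc p G n) G"
  using lpc_normal normal_imp_subgroup by blast

lemma lpc_carrier: "lpc p G n \<subseteq> carrier G"
  using lpc_subgroup subgroup.subset by blast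

lemma lpc_Suc_subset: "lpc p G (Suc n) \<subseteq> lpc p G n"
  using pstar_subset[OF lpc_normal] by simp

lemma lpc_antimono: "m \<le> n \<Longrightarrow> lpc p G n \<subseteq> lpc p G m"
  by (rule lift_Suc_antimono_le[of "lpc p G"]) (use lpc_Suc_subset in auto)

lemma lpc_pow: "x \<in> carrier G \<Longrightarrow> x [^] (p ^ n) \<in> lpc p G n"
proof (induction n)
  case (Suc n)
  then have "(x [^] (p ^ n)) [^] p \<in> lpc p G (Suc n)" by (simp add: pow_in_pstar)
  then show ?case using Suc.prems by (simp add: nat_pow_pow mult.commute)
qed simp

lemma plcs_discrete: "plcs p G (discrete_topology (carrier G)) n = lpc p G n"
proof (induction n)
  case (Suc n)
  have "pstar p G (lpc p G n) \<subseteq> carrier G"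
    using pstar_subgroup[OF lpc_carrier] subgroup.subset by blast
  then show ?case using Suc by (simp add: pstar_def discrete_topology_closure_of inf_absorb2)
qed simp

end

lemma (in group_hom) pstar_img_subset:
  assumes "N \<subseteq> carrier G" "h ` N \<subseteq> M" "M \<subseteq> carrier H"
  shows "h ` pstar p G N \<subseteq> pstar p H M"
proof -
  have "h ` pstar p G N = generate H (h ` ({x \<otimes> y \<otimes> inv x \<otimes> inv y | x y. x \<in> carrier G \<and> y \<in> N} \<union> {y [^] p | y. y \<in> N}))"
    unfolding pstar_def using assms(1) by (intro generate_img[symmetric]) auto
  also have "\<dots> \<subseteq> pstar p H M"
    unfolding pstar_def
  proof (rule H.mono_generate, safe, goal_cases)
    case (1 _ _ x y)
    then have "y \<in> carrier G" "h y \<in> M" using assms by auto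
    then show ?case using 1 by (intro exI[of _ "h x"] exI[of _ "h y"]) auto
  next
    case (2 _ _ y)
    then have "y \<in> carrier G" "h y \<in> M" using assms by auto
    then have "h (y [^] p) = h y [^]\<^bsub>H\<^esub> p" by (simp add: hom_nat_pow)
    with 2 \<open>h y \<in> M\<close> show ?case by blast
  qed
  finally show ?thesis .
qed

lemma (in group_hom) pstar_img:
  assumes "N \<subseteq> carrier G" "h ` carrier G = carrier H"
  shows "h ` pstar p G N = pstar p H (h ` N)"
proof
  show "h ` pstar p G N \<subseteq> pstar p H (h ` N)" using assms by (intro pstar_img_subset) auto
  show "pstar p H (h ` N) \<subseteq> h ` pstar p G N"
  proof (rule H.pstar_least)
    show "subgroup (h ` pstar p G N) H"
      by (rule subgroup_img_is_subgroup[OF G.pstar_subgroup[OF assms(1)]])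
  next
    fix x y assume "x \<in> carrier H" "y \<in> h ` N"
    then obtain a b where "a \<in> carrier G" "x = h a" "b \<in> N" "y = h b" using assms by (metis imageE)
    moreover from this have "b \<in> carrier G" using assms by auto
    ultimately have "x \<otimes>\<^bsub>H\<^esub> y \<otimes>\<^bsub>H\<^esub> inv\<^bsub>H\<^esub> x \<otimes>\<^bsub>H\<^esub> inv\<^bsub>H\<^esub> y = h (a \<otimes> b \<otimes> inv a \<otimes> inv b)" by simp
    then show "x \<otimes>\<^bsub>H\<^esub> y \<otimes>\<^bsub>H\<^esub> inv\<^bsub>H\<^esub> x \<otimes>\<^bsub>H\<^esub> inv\<^bsub>H\<^esub> y \<in> h ` pstar p G N"
      using G.comm_in_pstar \<open>a \<in> carrier G\<close> \<open>b \<in> N\<close> by blast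
  next
    fix y assume "y \<in> h ` N"
    then obtain b where "b \<in> N" "y = h b" by auto
    moreover from this have "b \<in> carrier G" using assms by auto
    ultimately have "y [^]\<^bsub>H\<^esub> p = h (b [^] p)" by (simp add: hom_nat_pow)
    then show "y [^]\<^bsub>H\<^esub> p \<in> h ` pstar p G N" using G.pow_in_pstar \<open>b \<in> N\<close> by blast
  qed
qed

lemma (in group_hom) lpc_img_subset: "h ` lpc p G n \<subseteq> lpc p H n"
proof (induction n)
  case (Suc n)
  then show ?case using pstar_img_subset[OF G.lpc_carrier Suc H.lpc_carrier] by simp
qed auto

lemma (in group_hom) lpc_img: "h ` carrier G = carrier H \<Longrightarrow> h ` lpc p G n = lpc p H n"
  by (induction n) (simp_all add: pstar_img[OF G.lpc_carrier])

section \<open>Powers, cyclic extensions and the Frattini argument\<close>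

context group
begin

text \<open>By Bezout the exponent 1 is an integer combination of \<open>a\<close> and
  \<open>b\<close>.\<close>

lemma pow_coprime_mem:
  assumes "subgroup W G" "x \<in> carrier G" "x [^] (a::nat) \<in> W" "x [^] (b::nat) \<in> W" "coprime a b"
  shows "x \<in> W"
proof -
  obtain u v where uv: "u * int a + v * int b = 1"
    using bezout_int[of "int a" "int b"] assms(5) by auto
  have "x [^] (int a * u) \<in> W" "x [^] (int b * v) \<in> W"
    using subgroup_int_pow_closed[OF assms(1), of _ u] subgroup_int_pow_closed[OF assms(1), of _ v] assms
    by (metis int_pow_pow int_pow_int)+
  then have "x [^] (int a * u) \<otimes> x [^] (int b * v) \<in> W"
    using assms(1) by (simp add: subgroup.m_closed)
  then have "x [^] (int a * u + int b * v) \<in> W" using assms(2) by (simp add: int_pow_mult)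
  then show ?thesis using uv assms(2) by (simp add: mult.commute)
qed

lemma subgroup_nat_pow_closed: "subgroup W G \<Longrightarrow> x \<in> W \<Longrightarrow> x [^] (n::nat) \<in> W"
  by (metis int_pow_int subgroup_int_pow_closed)

lemma pow_mod_normal:
  assumes "L \<lhd> G" "m \<in> L" "u \<in> carrier G"
  shows "\<exists>l\<in>L. (m \<otimes> u) [^] (n::nat) = l \<otimes> u [^] n"
proof (induction n)
  case 0
  interpret L: normal L G by fact
  show ?case by (auto intro!: bexI[of _ \<one>])
next
  case (Suc n)
  interpret L: normal L G by fact
  obtain l where l: "l \<in> L" "(m \<otimes> u) [^] n = l \<otimes> u [^] n" using Suc by blast
  have "l \<otimes> (u [^] n \<otimes> m \<otimes> inv (u [^] n)) \<in> L"
    using l assms L.inv_op_closed2[of "u [^] n" m] by simp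
  moreover have "(m \<otimes> u) [^] Suc n = l \<otimes> (u [^] n \<otimes> m \<otimes> inv (u [^] n)) \<otimes> u [^] Suc n"
    using l assms by (simp add: m_assoc)
  ultimately show ?case by blast
qed

lemma pow_split_mem:
  assumes "subgroup W G" "x \<in> carrier G" "x [^] (p::nat) \<in> W"
  shows "\<exists>w\<in>W. x [^] (n::nat) = w \<otimes> x [^] (n mod p)"
proof (intro bexI)
  show "x [^] n = (x [^] p) [^] (n div p) \<otimes> x [^] (n mod p)"
    using assms(2) by (simp add: nat_pow_pow nat_pow_mult)
  show "(x [^] p) [^] (n div p) \<in> W" by (rule subgroup_nat_pow_closed) fact+
qed

text \<open>A coincidence with i < j would put x^(j-i) into W; as j-i is prime to p and x^p lies in
  W, so would x.\<close>

lemma pow_inj_mod: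
  assumes "subgroup W G" "x \<in> carrier G" "x \<notin> W" "x [^] p \<in> W" "prime (p::nat)"
    "w \<in> W" "v \<in> W" "i < p" "j < p" "w \<otimes> x [^] i = v \<otimes> x [^] j"
  shows "i = j \<and> w = v"
proof -
  have lt: False if "i < j" "j < p" "w \<in> W" "v \<in> W" "w \<otimes> x [^] i = v \<otimes> x [^] j" for i j w v
  proof -
    interpret W: subgroup W G by fact
    have "x [^] j = x [^] (j - i) \<otimes> x [^] i" using that assms(2) by (simp add: nat_pow_mult)
    then have "w \<otimes> x [^] i = v \<otimes> x [^] (j - i) \<otimes> x [^] i"
      using that assms(2) by (simp add: m_assoc)
    then have "w = v \<otimes> x [^] (j - i)" using that assms(2) by simp
    then have "x [^] (j - i) = inv v \<otimes> w" using that assms(2) by simp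
    then have "x [^] (j - i) \<in> W" using that by simp
    moreover have "coprime p (j - i)" using assms(5) that
      by (metis coprime_commute diff_is_0_eq dvd_imp_le less_imp_diff_less linorder_not_less neq0_conv prime_imp_coprime)
    ultimately have "x \<in> W" using pow_coprime_mem assms by blast
    then show False using assms by blast
  qed
  have "i = j" using lt[of i j w v] lt[of j i v w] assms by (metis linorder_neqE_nat)
  moreover have "w = v" using assms \<open>i = j\<close> subgroup.mem_carrier[OF assms(1)] by simp
  ultimately show ?thesis by blast
qed

lemma generate_insert_normal:
  assumes "W \<lhd> G" "x \<in> carrier G" "x [^] (p::nat) \<in> W" "p > 0"
  shows "generate G (insert x W) = (\<lambda>(w, j). w \<otimes> x [^] j) ` (W \<times> {..<p})" (is "_ = ?D")
proof
  interpret W: normal W G by fact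
  have D_iff: "w \<otimes> x [^] (n::nat) \<in> ?D" if "w \<in> W" for w n
  proof -
    obtain v where v: "v \<in> W" "x [^] n = v \<otimes> x [^] (n mod p)"
      using pow_split_mem[OF W.subgroup_axioms assms(2,3)] by blast
    have "w \<otimes> x [^] n = (w \<otimes> v) \<otimes> x [^] (n mod p)" using v that assms by (simp add: m_assoc)
    moreover have "(w \<otimes> v, n mod p) \<in> W \<times> {..<p}" using v that assms by auto
    ultimately show ?thesis by force
  qed
  have sub: "subgroup ?D G"
  proof (rule subgroupI)
    show "?D \<subseteq> carrier G" using assms by auto
    show "?D \<noteq> {}" using assms W.one_closed by force
  next
    fix a assume "a \<in> ?D"
    then obtain w j where wj: "w \<in> W" "j < p" "a = w \<otimes> x [^] j" by auto
    \<comment> \<open>A natural exponent for the inverse of \<open>x [^] j\<close> modulo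
      \<open>W\<close>: the sum (p-1)j + j is the multiple pj of p.\<close>
    let ?k = "(p - 1) * j"
    have "(p - 1) * j + j = p * j" using assms(4) by (cases p) auto
    then have "x [^] ?k \<otimes> x [^] j = (x [^] p) [^] j"
      using assms(2) by (simp add: nat_pow_mult nat_pow_pow)
    then have q: "x [^] ?k \<otimes> x [^] j \<in> W"
      using subgroup_nat_pow_closed[OF W.subgroup_axioms assms(3)] by simp
    let ?z = "inv (x [^] ?k \<otimes> x [^] j)"
    have e: "inv a = ?z \<otimes> (x [^] ?k \<otimes> inv w \<otimes> inv (x [^] ?k)) \<otimes> x [^] ?k"
      using wj assms(2) by (simp add: m_assoc inv_mult_group)
    have "x [^] ?k \<otimes> inv w \<otimes> inv (x [^] ?k) \<in> W"
      using wj assms(2) W.inv_op_closed2[of "x [^] ?k" "inv w"] by simp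
    with q have "?z \<otimes> (x [^] ?k \<otimes> inv w \<otimes> inv (x [^] ?k)) \<in> W" by (rule W.m_closed[OF W.m_inv_closed])
    from D_iff[OF this, of ?k] show "inv a \<in> ?D" unfolding e .
  next
    fix a b assume "a \<in> ?D" "b \<in> ?D"
    then obtain w j v i where wj: "w \<in> W" "j < p" "a = w \<otimes> x [^] j" "v \<in> W" "i < p" "b = v \<otimes> x [^] i" by auto
    have e: "a \<otimes> b = (w \<otimes> (x [^] j \<otimes> v \<otimes> inv (x [^] j))) \<otimes> x [^] (j + i)"
      using wj assms(2) by (simp add: m_assoc nat_pow_mult[symmetric])
    have "w \<otimes> (x [^] j \<otimes> v \<otimes> inv (x [^] j)) \<in> W"
      using wj assms(2) W.inv_op_closed2[of "x [^] j" v] by simp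
    from D_iff[OF this] show "a \<otimes> b \<in> ?D" unfolding e .
  qed
  have "w \<in> ?D" if "w \<in> W" for w using D_iff[OF that, of 0] that by simp
  moreover have "x \<in> ?D" using D_iff[OF W.one_closed, of 1] assms(2) by simp
  ultimately show "generate G (insert x W) \<subseteq> ?D"
    by (intro generate_subgroup_incl[OF _ sub]) blast
  have S: "subgroup (generate G (insert x W)) G" using assms by (intro generate_is_subgroup) auto
  have "w \<otimes> x [^] j \<in> generate G (insert x W)" if "w \<in> W" for w and j :: nat
    by (intro subgroup.m_closed[OF S] subgroup_nat_pow_closed[OF S] generate.incl) (use that in auto)
  then show "?D \<subseteq> generate G (insert x W)" by auto
qed

lemma inj_on_coset_powers:
  assumes "subgroup W G" "x \<in> carrier G" "x \<notin> W" "x [^] p \<in> W" "prime (p::nat)"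
  shows "inj_on (\<lambda>(w, j). w \<otimes> x [^] j) (W \<times> {..<p})"
  using pow_inj_mod[OF assms] by (auto simp: inj_on_def)

lemma card_generate_insert_normal:
  assumes "W \<lhd> G" "x \<in> carrier G" "x [^] p \<in> W" "prime (p::nat)" "x \<notin> W"
  shows "card (generate G (insert x W)) = p * card W"
proof -
  have "p > 0" using assms(4) prime_gt_0_nat by blast
  then show ?thesis
    using generate_insert_normal[OF assms(1-3)] inj_on_coset_powers[OF normal_imp_subgroup[OF assms(1)] assms(2,5,3,4)]
    by (simp add: card_image card_cartesian_product)
qed

text \<open>The elements of \<open>pstar p G N\<close> are non-generators of N because the series
  reaches 1. Let L be maximal among the admissible proper subgroups of N above M, and let V be the
  last intersection of N with a term P_j that is not inside L. Then LV = N, while commutators and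
  p-th powers of V fall into N \<inter> P_{j+1}, hence into L. So L contains
  \<open>pstar p G N\<close>, against \<open>gen\<close>.\<close>

lemma frattini_argument:
  assumes fin: "finite (carrier G)" and c: "lpc p G c = {\<one>}" and N: "N \<lhd> G"
    and M: "subgroup M G" "M \<subseteq> N" "M \<lhd> G \<or> N = carrier G"
    and gen: "N \<subseteq> generate G (M \<union> pstar p G N)"
  shows "M = N"
proof (rule ccontr)
  assume "M \<noteq> N"
  interpret N: normal N G by fact
  \<comment> \<open>The disjunction covers both uses: for a proper N the maximum is taken among
    normal subgroups; for N = G it is taken among all subgroups, and normality of L is derived
    afterwards from G = LV.\<close>
  define P where "P L \<longleftrightarrow> subgroup L G \<and> M \<subseteq> L \<and> L \<subset> N \<and> (L \<lhd> G \<or> N = carrier G)" for L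
  have "P M" using M \<open>M \<noteq> N\<close> by (auto simp: P_def)
  moreover have "card L < Suc (card N)" if "P L" for L
    using that fin N.subset by (metis P_def less_SucI psubset_card_mono rev_finite_subset)
  ultimately obtain L where L: "P L" and L_max: "\<And>L'. P L' \<Longrightarrow> card L' \<le> card L"
    using ex_has_greatest_nat[of P M card] by (metis less_Suc_eq_le less_imp_le_nat)
  interpret L: subgroup L G using L by (simp add: P_def)
  have finN: "finite N" using fin N.subset finite_subset by blast
  have "N \<inter> lpc p G c \<subseteq> L" using c by auto
  then have ex: "\<exists>i. N \<inter> lpc p G i \<subseteq> L" by blast
  define i where "i = (LEAST i. N \<inter> lpc p G i \<subseteq> L)"
  have i: "N \<inter> lpc p G i \<subseteq> L" using LeastI_ex[OF ex] by (simp add: i_def)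
  have "i \<noteq> 0" using i L N.subset by (auto simp: P_def)
  then obtain j where j: "i = Suc j" using not0_implies_Suc by blast
  have nj: "\<not> N \<inter> lpc p G j \<subseteq> L" using not_less_Least[of j "\<lambda>i. N \<inter> lpc p G i \<subseteq> L"] j i_def by simp
  define V where "V = N \<inter> lpc p G j"
  have V: "V \<lhd> G" unfolding V_def using N lpc_normal by (intro normal_subgroup_intersect) auto
  interpret V: normal V G by fact
  have VN: "V \<subseteq> N" by (auto simp: V_def)
  have LV: "subgroup (L <#> V) G"
    using commut_normal[OF L.subgroup_axioms V] mult_norm_subgroup[OF V L.subgroup_axioms] by simp
  have LVsub: "L \<subseteq> L <#> V" "V \<subseteq> L <#> V"
  proof (safe)
    show "l \<in> L <#> V" if "l \<in> L" for l
      unfolding set_mult_def by (rule UN_I[OF that], rule UN_I[OF V.one_closed]) (simp add: that)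
    show "v \<in> L <#> V" if "v \<in> V" for v
      unfolding set_mult_def by (rule UN_I[OF L.one_closed], rule UN_I[OF that]) (simp add: that)
  qed
  have LVN: "L <#> V \<subseteq> N" using L VN unfolding P_def set_mult_def by blast
  have "L <#> V = N"
  proof (rule ccontr)
    assume ne: "L <#> V \<noteq> N"
    have "L <#> V \<lhd> G" if "L \<lhd> G"
      using that V by (simp add: mult_norm_subgroup normal_subgroup_set_mult_closed)
    then have "P (L <#> V)" using ne LVN LVsub LV L unfolding P_def by blast
    moreover have "L \<subset> L <#> V" using LVsub nj V_def by blast
    then have "card L < card (L <#> V)" using LVN finN by (meson finite_subset psubset_card_mono)
    ultimately show False using L_max by fastforce
  qed
  then have dec: "\<exists>m\<in>L. \<exists>u\<in>V. x = m \<otimes> u" if "x \<in> N" for x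
    using that unfolding set_mult_def by blast
  have comm: "x \<otimes> u \<otimes> inv x \<otimes> inv u \<in> L" if "x \<in> carrier G" "u \<in> V" for x u
  proof -
    have "x \<otimes> u \<otimes> inv x \<otimes> inv u \<in> lpc p G i"
      using that comm_in_pstar j by (auto simp: V_def)
    moreover have "x \<otimes> u \<otimes> inv x \<otimes> inv u \<in> N"
      using that VN N.inv_op_closed2 by blast
    ultimately show ?thesis using i by blast
  qed
  have pw: "u [^] p \<in> L" if "u \<in> V" for u
  proof -
    have "u [^] p \<in> lpc p G i" using that pow_in_pstar j by (auto simp: V_def)
    moreover have "u [^] p \<in> N" using that VN subgroup_nat_pow_closed N.subgroup_axioms by blast
    ultimately show ?thesis using i by blast
  qed
  \<comment> \<open>If G = LV, conjugation by \<open>u\<close> in V multiplies \<open>l\<close> by a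
    commutator that lies in L, and conjugation by \<open>m\<close> in L stays in L.\<close>
  have Ln: "L \<lhd> G"
  proof (cases "L \<lhd> G")
    case False
    then have Nc: "N = carrier G" using L by (simp add: P_def)
    have "g \<otimes> l \<otimes> inv g \<in> L" if g: "g \<in> carrier G" and l: "l \<in> L" for g l
    proof -
      obtain m u where mu: "m \<in> L" "u \<in> V" "g = m \<otimes> u" using dec g Nc by blast
      have "m \<otimes> (inv (l \<otimes> u \<otimes> inv l \<otimes> inv u) \<otimes> l) \<otimes> inv m \<in> L"
        using comm[OF L.mem_carrier[OF l] mu(2)] mu(1) l by simp
      moreover have "m \<otimes> (inv (l \<otimes> u \<otimes> inv l \<otimes> inv u) \<otimes> l) \<otimes> inv m = g \<otimes> l \<otimes> inv g"
        using mu l by (simp add: m_assoc inv_mult_group)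
      ultimately show ?thesis by simp
    qed
    then show ?thesis by (simp add: normal_inv_iff L.subgroup_axioms)
  qed
  interpret L: normal L G by (fact Ln)
  have "pstar p G N \<subseteq> L"
  proof (rule pstar_least[OF L.subgroup_axioms])
    fix x y assume x: "x \<in> carrier G" and y: "y \<in> N"
    obtain m u where mu: "m \<in> L" "u \<in> V" "y = m \<otimes> u" using dec y by blast
    have "(x \<otimes> m \<otimes> inv x) \<otimes> (x \<otimes> u \<otimes> inv x \<otimes> inv u) \<otimes> inv m \<in> L"
      using comm[OF x mu(2)] L.inv_op_closed2[OF x mu(1)] mu(1) by simp
    moreover have "(x \<otimes> m \<otimes> inv x) \<otimes> (x \<otimes> u \<otimes> inv x \<otimes> inv u) \<otimes> inv m = x \<otimes> y \<otimes> inv x \<otimes> inv y"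
      using mu x by (simp add: m_assoc inv_mult_group)
    ultimately show "x \<otimes> y \<otimes> inv x \<otimes> inv y \<in> L" by simp
  next
    fix y assume y: "y \<in> N"
    obtain m u where mu: "m \<in> L" "u \<in> V" "y = m \<otimes> u" using dec y by blast
    show "y [^] p \<in> L"
      using pow_mod_normal[OF Ln mu(1), of u p] mu pw[of u] by auto
  qed
  moreover have "M \<subseteq> L" using L by (simp add: P_def)
  ultimately have "generate G (M \<union> pstar p G N) \<subseteq> L"
    by (intro generate_subgroup_incl L.subgroup_axioms) auto
  then show False using gen L unfolding P_def by blast
qed

end

section \<open>Characters of elementary abelian sections\<close>

text \<open>The homomorphisms from U to F_p that vanish on W. Values are representatives in {0..<p}
  and functions are extensional, so distinct functionals are distinct functions and the set can be
  counted.\<close>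

definition chars :: "nat \<Rightarrow> ('a, 'b) monoid_scheme \<Rightarrow> 'a set \<Rightarrow> 'a set \<Rightarrow> ('a \<Rightarrow> int) set" where
  "chars p G U W = {\<phi> \<in> U \<rightarrow>\<^sub>E {0..<int p}.
     (\<forall>a\<in>U. \<forall>b\<in>U. (\<phi> (a \<otimes>\<^bsub>G\<^esub> b) - (\<phi> a + \<phi> b)) mod int p = 0) \<and> (\<forall>w\<in>W. \<phi> w = 0)}"


context group
begin

lemma char_one:
  assumes "\<phi> \<in> chars p G U W" "subgroup U G"
  shows "\<phi> \<one> = 0"
proof -
  interpret U: subgroup U G by fact
  have "\<phi> \<one> \<in> {0..<int p}" "(\<phi> (\<one> \<otimes> \<one>) - (\<phi> \<one> + \<phi> \<one>)) mod int p = 0"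
    using assms U.one_closed unfolding chars_def by blast+
  then have "- \<phi> \<one> mod int p = 0" "0 \<le> \<phi> \<one>" "\<phi> \<one> < int p" by auto
  then show ?thesis by (metis mod_pos_pos_trivial mod_0_imp_dvd dvd_minus_iff dvd_imp_mod_0)
qed

lemma char_mult:
  assumes "\<phi> \<in> chars p G U W" "a \<in> U" "b \<in> U" "subgroup U G"
  shows "\<phi> (a \<otimes> b) = (\<phi> a + \<phi> b) mod int p"
proof -
  interpret U: subgroup U G by fact
  have "\<phi> (a \<otimes> b) \<in> {0..<int p}" "(\<phi> (a \<otimes> b) - (\<phi> a + \<phi> b)) mod int p = 0"
    using assms U.m_closed unfolding chars_def by blast+
  then show ?thesis by (metis atLeastLessThan_iff mod_eq_dvd_iff mod_eq_0_iff_dvd mod_pos_pos_trivial)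
qed

lemma char_range: "\<phi> \<in> chars p G U W \<Longrightarrow> a \<in> U \<Longrightarrow> \<phi> a \<in> {0..<int p}"
  unfolding chars_def by blast

lemma char_mod: "\<phi> \<in> chars p G U W \<Longrightarrow> a \<in> U \<Longrightarrow> \<phi> a mod int p = \<phi> a"
  using char_range by fastforce

lemma char_pow:
  assumes "\<phi> \<in> chars p G U W" "a \<in> U" "subgroup U G"
  shows "\<phi> (a [^] (n::nat)) = (int n * \<phi> a) mod int p"
proof (induction n)
  case 0
  then show ?case using char_one assms by simp
next
  case (Suc n)
  have "a [^] n \<in> U" using subgroup_nat_pow_closed assms by blast
  then show ?case using Suc char_mult[OF assms(1) _ assms(2,3)] by (simp add: algebra_simps mod_simps)
qed

lemma char_inv:
  assumes "\<phi> \<in> chars p G U W" "a \<in> U" "subgroup U G"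
  shows "\<phi> (inv a) = (- \<phi> a) mod int p"
proof -
  interpret U: subgroup U G by fact
  have "(\<phi> a + \<phi> (inv a)) mod int p = 0"
    using char_mult[OF assms(1,2) _ assms(3), of "inv a"] char_one[OF assms(1,3)] assms(2) by simp
  then have "\<phi> (inv a) mod int p = (- \<phi> a) mod int p"
    by (metis add.commute add_eq_0_iff mod_0_imp_dvd mod_eq_dvd_iff diff_minus_eq_add)
  then show ?thesis using char_mod[OF assms(1)] assms(2) by simp
qed

text \<open>A character of \<open>V\<close> extends to \<open>\<langle>x, V\<rangle>\<close> with any prescribed value at \<open>x\<close>,
  because \<open>x\<^sup>p\<close> and all commutators lie in \<open>W\<close>.\<close>

lemma char_extend:
  assumes p: "prime p" and N: "N \<lhd> G" and V: "subgroup V G" and W: "subgroup W G"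
    and WV: "pstar p G N \<subseteq> W" "W \<subseteq> V" "V \<subseteq> N" and x: "x \<in> N" "x \<notin> V"
    and \<phi>: "\<phi> \<in> chars p G V W" and e: "e \<in> {0..<int p}"
  shows "\<exists>\<psi> \<in> chars p G (generate G (insert x V)) W. (\<forall>v\<in>V. \<psi> v = \<phi> v) \<and> \<psi> x = e"
proof -
  interpret N: normal N G by fact
  interpret V: subgroup V G by fact
  interpret W: subgroup W G by fact
  have p0: "p > 0" "p > 1" using p prime_gt_0_nat prime_gt_1_nat by auto
  have xc: "x \<in> carrier G" using x by simp
  have xp: "x [^] p \<in> W" using pow_in_pstar[OF x(1)] WV by blast
  have Vn: "V \<lhd> G" using between_normal[OF V _ WV(3)] WV by blast
  define U where "U = generate G (insert x V)"
  have U: "U = (\<lambda>(w, j). w \<otimes> x [^] j) ` (V \<times> {..<p})"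
    unfolding U_def using generate_insert_normal[OF Vn xc _ p0(1)] xp WV by blast
  have inj: "inj_on (\<lambda>(w, j). w \<otimes> x [^] j) (V \<times> {..<p})"
    using inj_on_coset_powers[OF V xc x(2) _ p] xp WV by blast
  define dec where "dec = inv_into (V \<times> {..<p}) (\<lambda>(w, j). w \<otimes> x [^] (j::nat))"
  define \<psi> where "\<psi> = restrict (\<lambda>y. (\<phi> (fst (dec y)) + int (snd (dec y)) * e) mod int p) U"
  have \<psi>0: "\<psi> (v \<otimes> x [^] j) = (\<phi> v + int j * e) mod int p" if "v \<in> V" "j < p" for v j
  proof -
    have "dec (v \<otimes> x [^] j) = (v, j)"
      unfolding dec_def using inv_into_f_f[OF inj, of "(v, j)"] that by auto
    moreover have "v \<otimes> x [^] j \<in> U" using that U by force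
    ultimately show ?thesis by (simp add: \<psi>_def)
  qed
  \<comment> \<open>The formula persists for all exponents, since x^p lies in \<open>W\<close>,
    where \<phi> vanishes.\<close>
  have \<psi>1: "\<psi> (v \<otimes> x [^] j) = (\<phi> v + int j * e) mod int p" if "v \<in> V" for v and j :: nat
  proof -
    obtain w where w: "w \<in> W" "x [^] j = w \<otimes> x [^] (j mod p)"
      using pow_split_mem[OF W xc xp] by blast
    have "\<phi> (v \<otimes> w) = \<phi> v"
      using char_mult[OF \<phi> that _ V, of w] w WV \<phi> char_mod[OF \<phi> that] by (auto simp: chars_def)
    moreover have "\<psi> ((v \<otimes> w) \<otimes> x [^] (j mod p)) = (\<phi> (v \<otimes> w) + int (j mod p) * e) mod int p"
      using w WV that p0 by (intro \<psi>0) auto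
    moreover have "(v \<otimes> w) \<otimes> x [^] (j mod p) = v \<otimes> x [^] j"
      using w that xc WV by (simp add: m_assoc)
    ultimately show ?thesis by (metis mod_add_right_eq mod_mult_left_eq of_nat_mod)
  qed
  have "\<psi> \<in> chars p G U W"
    unfolding chars_def
  proof (intro CollectI conjI ballI)
    show "\<psi> \<in> U \<rightarrow>\<^sub>E {0..<int p}" using p0 by (auto simp: \<psi>_def)
    show "\<psi> w = 0" if "w \<in> W" for w
      using \<psi>1[of w 0] that WV \<phi> by (auto simp: chars_def)
  next
    fix a b assume "a \<in> U" "b \<in> U"
    then obtain v i w j where ab: "v \<in> V" "a = v \<otimes> x [^] (i::nat)" "w \<in> V" "b = w \<otimes> x [^] (j::nat)"
      unfolding U by auto
    \<comment> \<open>Moving x^i past \<open>w\<close> costs this commutator, which lies in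
      \<open>W\<close> and is invisible to \<phi>.\<close>
    let ?k = "x [^] i \<otimes> w \<otimes> inv (x [^] i) \<otimes> inv w"
    have k: "?k \<in> W" using comm_in_pstar[of "x [^] i" w N p] ab WV xc by blast
    have "a \<otimes> b = (v \<otimes> (?k \<otimes> w)) \<otimes> x [^] (i + j)"
      using ab xc by (simp add: m_assoc nat_pow_mult[symmetric])
    moreover have "\<phi> (?k \<otimes> w) = \<phi> w"
      using char_mult[OF \<phi> _ _ V, of ?k w] k ab WV \<phi> char_mod[OF \<phi>] by (auto simp: chars_def)
    moreover have "?k \<otimes> w \<in> V" using k ab WV by blast
    ultimately have "\<psi> (a \<otimes> b) = ((\<phi> v + \<phi> w) + int (i + j) * e) mod int p"
      using \<psi>1[of "v \<otimes> (?k \<otimes> w)" "i + j"] char_mult[OF \<phi> _ _ V, of v "?k \<otimes> w"] ab by (simp add: mod_simps)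
    moreover have "\<psi> a = (\<phi> v + int i * e) mod int p" "\<psi> b = (\<phi> w + int j * e) mod int p"
      using \<psi>1 ab by auto
    ultimately have "\<psi> (a \<otimes> b) mod int p = (\<psi> a + \<psi> b) mod int p"
      by (simp add: mod_add_eq algebra_simps)
    then show "(\<psi> (a \<otimes> b) - (\<psi> a + \<psi> b)) mod int p = 0"
      by (simp add: mod_eq_dvd_iff)
  qed
  moreover have "\<psi> v = \<phi> v" if "v \<in> V" for v
    using \<psi>1[of v 0] that char_mod[OF \<phi>] by auto
  moreover have "\<psi> x = e"
    using \<psi>1[of \<one> 1] xc char_one[OF \<phi> V] e by auto
  ultimately show ?thesis unfolding U_def by blast
qed

lemma char_determined:
  assumes "\<psi> \<in> chars p G (generate G (insert x V)) W" "\<psi>' \<in> chars p G (generate G (insert x V)) W"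
    and "subgroup V G" "x \<in> carrier G" "\<And>v. v \<in> V \<Longrightarrow> \<psi> v = \<psi>' v" "\<psi> x = \<psi>' x"
  shows "\<psi> = \<psi>'"
proof -
  have S: "insert x V \<subseteq> carrier G" using assms subgroup.subset by blast
  have U: "subgroup (generate G (insert x V)) G" using S by (rule generate_is_subgroup)
  have "\<psi> y = \<psi>' y" if "y \<in> generate G (insert x V)" for y
    using that
  proof (induction rule: generate.induct)
    case one
    then show ?case using char_one U assms by metis
  next
    case (incl h)
    then show ?case using assms by auto
  next
    case (inv h)
    then have "h \<in> generate G (insert x V)" "\<psi> h = \<psi>' h" using assms by (auto intro: generate.incl)
    then show ?case using char_inv U assms by metis
  next
    case (eng h1 h2)
    then show ?case using char_mult U assms by metis
  qed
  then show ?thesis using assms(1,2) unfolding chars_def by (auto intro: PiE_ext)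
qed

text \<open>Duality by counting. Take V maximal below U. Then U is generated by V and one element x,
  and a character of U is freely given by its restriction to V and its value at x, so both sides
  gain a factor p.\<close>

lemma card_chars:
  assumes p: "prime p" and fin: "finite N" and N: "N \<lhd> G" and W: "subgroup W G" and SW: "pstar p G N \<subseteq> W"
    and "subgroup U G" "W \<subseteq> U" "U \<subseteq> N"
  shows "finite (chars p G U W) \<and> card (chars p G U W) * card W = card U"
  using assms(6-8)
proof (induction "card U" arbitrary: U rule: less_induct)
  case less
  interpret N: normal N G by fact
  interpret W: subgroup W G by fact
  interpret U: subgroup U G by fact
  have finU: "finite U" using less fin finite_subset by blast
  have p0: "p > 0" "p > 1" using p prime_gt_0_nat prime_gt_1_nat by auto
  show ?case
  proof (cases "U = W")
    case True
    have "chars p G W W = {\<lambda>w\<in>W. 0}"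
      using p0 by (auto simp: chars_def PiE_iff intro!: extensionalityI[of _ W] W.m_closed)
    then show ?thesis using True by simp
  next
    case False
    define P where "P V \<longleftrightarrow> subgroup V G \<and> W \<subseteq> V \<and> V \<subset> U" for V
    have "P W" using False less W by (auto simp: P_def)
    moreover have "card V < Suc (card U)" if "P V" for V
      using that finU by (metis P_def less_SucI psubset_card_mono)
    ultimately obtain V where V: "P V" and V_max: "\<And>L. P L \<Longrightarrow> card L \<le> card V"
      using ex_has_greatest_nat[of P W card] by (metis less_Suc_eq_le less_imp_le_nat)
    interpret V: subgroup V G using V by (simp add: P_def)
    obtain x where x: "x \<in> U" "x \<notin> V" using V by (auto simp: P_def)
    let ?U = "generate G (insert x V)"
    have "?U \<subseteq> U" using V x by (intro generate_subgroup_incl) (auto simp: P_def U.subgroup_axioms)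
    moreover have S: "subgroup ?U G" using V.subset x by (intro generate_is_subgroup) auto
    moreover have VU: "insert x V \<subseteq> ?U" by (auto intro: generate.incl)
    moreover have "card V < card ?U"
      using VU x finite_subset[OF \<open>?U \<subseteq> U\<close> finU] by (intro psubset_card_mono) auto
    ultimately have U_eq: "?U = U" using V_max[of ?U] V unfolding P_def by fastforce
    have xN: "x \<in> N" using x less by blast
    have xp: "x [^] p \<in> V" using pow_in_pstar[OF xN] SW V unfolding P_def by blast
    have Vn: "V \<lhd> G" using V SW less.prems unfolding P_def by (intro between_normal[OF V.subgroup_axioms, of p N]) auto
    have cU: "card U = p * card V"
      using card_generate_insert_normal[OF Vn _ xp p x(2)] x U_eq by simp
    have IH: "finite (chars p G V W)" "card (chars p G V W) * card W = card V"
      using less.hyps[of V] V less finU psubset_card_mono unfolding P_def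
      by (meson order.trans psubset_imp_subset)+
    have VN: "V \<subseteq> N" "W \<subseteq> V" using V less unfolding P_def by auto
    have "bij_betw (\<lambda>\<psi>. (restrict \<psi> V, \<psi> x)) (chars p G U W) (chars p G V W \<times> {0..<int p})"
      unfolding bij_betw_def
    proof
      show "inj_on (\<lambda>\<psi>. (restrict \<psi> V, \<psi> x)) (chars p G U W)"
      proof (rule inj_onI)
        fix \<psi> \<psi>' assume *: "\<psi> \<in> chars p G U W" "\<psi>' \<in> chars p G U W" "(restrict \<psi> V, \<psi> x) = (restrict \<psi>' V, \<psi>' x)"
        have "\<psi> v = \<psi>' v" if "v \<in> V" for v
          using *(3) that by (metis Pair_inject restrict_apply')
        then show "\<psi> = \<psi>'"
          using char_determined[OF _ _ V.subgroup_axioms, of \<psi> p x W \<psi>'] * x by (simp add: U_eq)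
      qed
      show "(\<lambda>\<psi>. (restrict \<psi> V, \<psi> x)) ` chars p G U W = chars p G V W \<times> {0..<int p}"
      proof (intro equalityI subsetI)
        fix z assume "z \<in> (\<lambda>\<psi>. (restrict \<psi> V, \<psi> x)) ` chars p G U W"
        then obtain \<psi> where \<psi>: "\<psi> \<in> chars p G U W" "z = (restrict \<psi> V, \<psi> x)" by blast
        have "restrict \<psi> V \<in> chars p G V W"
          using \<psi>(1) V VN unfolding P_def chars_def by (auto simp: Pi_iff PiE_iff subset_iff)
        then show "z \<in> chars p G V W \<times> {0..<int p}" using \<psi> char_range[OF \<psi>(1) x(1)] by auto
      next
        fix z assume "z \<in> chars p G V W \<times> {0..<int p}"
        then obtain \<phi> e where z: "z = (\<phi>, e)" "\<phi> \<in> chars p G V W" "e \<in> {0..<int p}" by blast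
        obtain \<psi> where \<psi>: "\<psi> \<in> chars p G U W" "\<And>v. v \<in> V \<Longrightarrow> \<psi> v = \<phi> v" "\<psi> x = e"
          using char_extend[OF p N V.subgroup_axioms W SW VN(2,1) xN x(2) z(2,3)] U_eq by metis
        have "restrict \<psi> V = \<phi>"
          using \<psi>(2) z(2) unfolding chars_def by (auto simp: PiE_iff intro!: extensionalityI[of _ V])
        then show "z \<in> (\<lambda>\<psi>. (restrict \<psi> V, \<psi> x)) ` chars p G U W" using \<psi> z by auto
      qed
    qed
    then show ?thesis
      using IH cU bij_betw_finite bij_betw_same_card by (fastforce simp: card_cartesian_product)
  qed
qed

text \<open>If every character vanished at x, all of them would vanish on the subgroup generated by
  x and W, which has p |W| elements; \<open>card_chars\<close> leaves too few of those.\<close>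

lemma char_separates:
  assumes p: "prime p" and fin: "finite N" and N: "N \<lhd> G" and W: "subgroup W G" and SW: "pstar p G N \<subseteq> W"
    and WN: "W \<subseteq> N" and x: "x \<in> N" "x \<notin> W"
  shows "\<exists>\<phi> \<in> chars p G N W. \<phi> x \<noteq> 0"
proof (rule ccontr)
  assume neg: "\<not> ?thesis"
  interpret N: normal N G by fact
  interpret W: subgroup W G by fact
  let ?U = "generate G (insert x W)"
  have p0: "p > 1" using p prime_gt_1_nat by auto
  have UN: "?U \<subseteq> N" using x WN by (intro generate_subgroup_incl N.subgroup_axioms) auto
  have U: "subgroup ?U G" using x by (intro generate_is_subgroup) auto
  have WU: "W \<subseteq> ?U" by (auto intro: generate.incl)
  have "chars p G N W \<subseteq> chars p G N ?U"
  proof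
    fix \<phi> assume \<phi>: "\<phi> \<in> chars p G N W"
    have "\<phi> y = 0" if "y \<in> ?U" for y
      using that
    proof (induction rule: generate.induct)
      case one
      then show ?case using char_one[OF \<phi> N.subgroup_axioms] .
    next
      case (incl h)
      then show ?case using \<phi> neg unfolding chars_def by blast
    next
      case (inv h)
      then have "h \<in> N" "\<phi> h = 0" using \<phi> neg x WN unfolding chars_def by blast+
      then show ?case using char_inv[OF \<phi> _ N.subgroup_axioms] by simp
    next
      case (eng h1 h2)
      then have "h1 \<in> N" "h2 \<in> N" using UN by auto
      then show ?case using eng char_mult[OF \<phi> _ _ N.subgroup_axioms] by simp
    qed
    then show "\<phi> \<in> chars p G N ?U" using \<phi> unfolding chars_def by blast
  qed
  then have "card (chars p G N W) \<le> card (chars p G N ?U)"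
    using card_chars[OF p fin N U _ N.subgroup_axioms UN] SW WU by (meson card_mono order.trans order_refl)
  moreover have "card (chars p G N W) * card W = card N"
    using card_chars[OF p fin N W SW N.subgroup_axioms WN] by simp
  moreover have "card (chars p G N ?U) * card ?U = card N"
    using card_chars[OF p fin N U _ N.subgroup_axioms UN] SW WU by (meson order.trans order_refl)
  moreover have "card ?U = p * card W"
  proof (rule card_generate_insert_normal[OF _ _ _ p x(2)])
    show "W \<lhd> G" using between_normal[OF W SW WN] .
    show "x [^] p \<in> W" using pow_in_pstar[OF x(1)] SW by blast
  qed (use x in auto)
  moreover have "card W > 0" "card N > 0"
    using fin WN W.one_closed N.one_closed by (metis card_gt_0_iff empty_iff finite_subset)+
  ultimately have "card (chars p G N ?U) * (p * card W) \<le> card (chars p G N ?U) * card W" "card (chars p G N ?U) > 0"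
    by (metis mult_le_mono1, metis gr0I mult_0 not_less0)
  then show False using p0 \<open>card W > 0\<close> by simp
qed

end

section \<open>Involutions of groups of odd order\<close>

text \<open>In general not closed under products. For N the Frattini subgroup of F_m it is X_m, see
  \<open>Xc_alt\<close>.\<close>

definition inverted :: "('a, 'b) monoid_scheme \<Rightarrow> ('a \<Rightarrow> 'a) \<Rightarrow> 'a set \<Rightarrow> 'a set" where
  "inverted G \<sigma> N = {s \<in> N. \<sigma> s = inv\<^bsub>G\<^esub> s}"

lemma card_eq_fibres:
  assumes "finite A" "finite B" "\<And>a. a \<in> A \<Longrightarrow> f a \<in> B" "\<And>b. b \<in> B \<Longrightarrow> card {a \<in> A. f a = b} = k"
  shows "card A = card B * k"
proof -
  have "card A = (\<Sum>b\<in>B. \<Sum>a\<in>{a \<in> A. f a = b}. 1)"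
    using assms(1-3) by (subst sum.group) auto
  then show ?thesis using assms(4) by simp
qed

locale involution_group = group G for G (structure) +
  fixes \<sigma> :: "'a \<Rightarrow> 'a"
  assumes fin: "finite (carrier G)" and odd_card: "odd (card (carrier G))"
    and sig_hom: "\<sigma> \<in> hom G G" and sig_sig: "x \<in> carrier G \<Longrightarrow> \<sigma> (\<sigma> x) = x"
begin

sublocale sig: group_hom G G \<sigma>
  by unfold_locales (rule sig_hom)

text \<open>The square root in a group of odd order. As a power of \<open>x\<close> it lies in every
  subgroup that contains \<open>x\<close>, and homomorphisms respect it.\<close>

definition rt :: "'a \<Rightarrow> 'a" where
  "rt x = x [^] ((card (carrier G) + 1) div 2)"

lemma pow_Suc_card: "x \<in> carrier G \<Longrightarrow> x [^] (card (carrier G) + 1) = x"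
  using pow_order_eq_1[of x] by (simp add: order_def)

lemma two_half: "2 * ((card (carrier G) + 1) div 2) = card (carrier G) + 1"
  using odd_card by simp

lemma rt_closed [simp]: "x \<in> carrier G \<Longrightarrow> rt x \<in> carrier G"
  by (simp add: rt_def)

lemma rt_rt: "x \<in> carrier G \<Longrightarrow> rt x \<otimes> rt x = x"
  using pow_Suc_card[of x] two_half by (simp add: rt_def nat_pow_mult mult_2[symmetric] del: nat_pow_Suc)

lemma rt_square: "x \<in> carrier G \<Longrightarrow> rt (x \<otimes> x) = x"
proof -
  assume x: "x \<in> carrier G"
  have "x \<otimes> x = x [^] (2::nat)" using x by (simp add: numeral_2_eq_2)
  then show ?thesis using x pow_Suc_card[OF x] two_half by (simp add: rt_def nat_pow_pow del: nat_pow_Suc)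
qed

lemma rt_mem: "subgroup W G \<Longrightarrow> x \<in> W \<Longrightarrow> rt x \<in> W"
  by (simp add: rt_def subgroup_nat_pow_closed)

lemma rt_inverted: "x \<in> carrier G \<Longrightarrow> \<sigma> x = inv x \<Longrightarrow> \<sigma> (rt x) = inv (rt x)"
  by (simp add: rt_def sig.hom_nat_pow nat_pow_inv)

text \<open>As \<sigma> x is inverse to x modulo W, the element a = x \<sigma>(x)^-1 is inverted and
  congruent to x x. Its square root is then congruent to x, and the square root \<open>r\<close> of
  that one is still inverted.\<close>

lemma square_root_in_coset:
  assumes W: "W \<lhd> G" and x: "x \<in> carrier G" "\<sigma> x \<otimes> x \<in> W"
  shows "\<exists>r w. r \<in> carrier G \<and> w \<in> W \<and> \<sigma> r = inv r \<and> r \<otimes> r = w \<otimes> x"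
proof -
  interpret W: normal W G by fact
  define a where "a = x \<otimes> inv (\<sigma> x)"
  have a: "a \<in> carrier G" "\<sigma> a = inv a" using x by (simp_all add: a_def sig_sig inv_mult_group)
  define w where "w = x \<otimes> inv (x \<otimes> (\<sigma> x \<otimes> x) \<otimes> inv x) \<otimes> inv x"
  have "x \<otimes> (\<sigma> x \<otimes> x) \<otimes> inv x \<in> W" using W.inv_op_closed2[OF x] .
  then have w: "w \<in> W" unfolding w_def by (rule W.inv_op_closed2[OF x(1) W.m_inv_closed])
  have aw: "a = w \<otimes> (x \<otimes> x)" using x by (simp add: a_def w_def m_assoc inv_mult_group)
  obtain v where v: "v \<in> W" "rt a = v \<otimes> rt (x \<otimes> x)"
    unfolding rt_def aw using pow_mod_normal[OF W w, of "x \<otimes> x"] x by auto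
  show ?thesis
  proof (intro exI conjI)
    show "rt (rt a) \<in> carrier G" using a by simp
    show "v \<in> W" by fact
    show "\<sigma> (rt (rt a)) = inv (rt (rt a))" using a by (intro rt_inverted) auto
    show "rt (rt a) \<otimes> rt (rt a) = v \<otimes> x" using v a x by (simp add: rt_rt rt_square)
  qed
qed

text \<open>Unlike a translation, n \<mapsto> r n r preserves inverted elements; and r n r = (r n
  r^-1) r r lies in W x.\<close>

lemma card_inverted_coset:
  assumes W: "W \<lhd> G" and x: "x \<in> carrier G" "\<sigma> x \<otimes> x \<in> W"
  shows "card {s \<in> inverted G \<sigma> (carrier G). s \<in> W #> x} = card (inverted G \<sigma> W)"
proof -
  interpret W: normal W G by fact
  obtain r w where r: "r \<in> carrier G" "w \<in> W" "\<sigma> r = inv r" "r \<otimes> r = w \<otimes> x"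
    using square_root_in_coset[OF assms] by blast
  have "bij_betw (\<lambda>n. r \<otimes> n \<otimes> r) (inverted G \<sigma> W) {s \<in> inverted G \<sigma> (carrier G). s \<in> W #> x}"
    unfolding bij_betw_def
  proof
    show "inj_on (\<lambda>n. r \<otimes> n \<otimes> r) (inverted G \<sigma> W)"
      using r by (auto simp: inj_on_def inverted_def)
    show "(\<lambda>n. r \<otimes> n \<otimes> r) ` inverted G \<sigma> W = {s \<in> inverted G \<sigma> (carrier G). s \<in> W #> x}"
    proof (intro equalityI subsetI)
      fix s assume "s \<in> (\<lambda>n. r \<otimes> n \<otimes> r) ` inverted G \<sigma> W"
      then obtain n where n: "n \<in> W" "\<sigma> n = inv n" "s = r \<otimes> n \<otimes> r" by (auto simp: inverted_def)
      have "\<sigma> s = inv s" using n r by (simp add: inv_mult_group m_assoc)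
      moreover have "s = ((r \<otimes> n \<otimes> inv r) \<otimes> w) \<otimes> x"
      proof -
        have "((r \<otimes> n \<otimes> inv r) \<otimes> w) \<otimes> x = (r \<otimes> n \<otimes> inv r) \<otimes> (r \<otimes> r)"
          unfolding r(4) using n r(1,2) x by (simp add: m_assoc)
        then show ?thesis using n r(1) by (simp add: m_assoc)
      qed
      moreover have "(r \<otimes> n \<otimes> inv r) \<otimes> w \<in> W" using W.inv_op_closed2[OF r(1) n(1)] r by simp
      ultimately show "s \<in> {s \<in> inverted G \<sigma> (carrier G). s \<in> W #> x}"
        using n(1,2) r(1-3) x(1) by (auto simp: inverted_def r_coset_def)
    next
      fix s assume "s \<in> {s \<in> inverted G \<sigma> (carrier G). s \<in> W #> x}"
      then obtain v where s: "s \<in> carrier G" "\<sigma> s = inv s" "v \<in> W" "s = v \<otimes> x"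
        by (auto simp: inverted_def r_coset_def)
      have "x = inv w \<otimes> (r \<otimes> r)" using r x by simp
      then have "s = v \<otimes> (inv w \<otimes> (r \<otimes> r))" using s(4) by metis
      then have "inv r \<otimes> s \<otimes> inv r = inv r \<otimes> (v \<otimes> inv w) \<otimes> r"
        using s(3) r(1,2) by (simp add: m_assoc)
      then have "inv r \<otimes> s \<otimes> inv r \<in> W"
        using W.inv_op_closed1[OF r(1), of "v \<otimes> inv w"] s r by simp
      moreover have "\<sigma> (inv r \<otimes> s \<otimes> inv r) = inv (inv r \<otimes> s \<otimes> inv r)"
        using s r by (simp add: inv_mult_group m_assoc)
      moreover have "s = r \<otimes> (inv r \<otimes> s \<otimes> inv r) \<otimes> r" using s r by (simp add: m_assoc)
      ultimately show "s \<in> (\<lambda>n. r \<otimes> n \<otimes> r) ` inverted G \<sigma> W"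
        by (intro image_eqI[of _ _ "inv r \<otimes> s \<otimes> inv r"]) (auto simp: inverted_def)
    qed
  qed
  from bij_betw_same_card[OF this] show ?thesis by simp
qed

lemma finite_inverted: "N \<subseteq> carrier G \<Longrightarrow> finite (inverted G \<sigma> N)"
  using fin finite_subset unfolding inverted_def by (metis (no_types, lifting) mem_Collect_eq subsetI)

text \<open>Each of the |N : W| cosets of W in N holds as many inverted elements as W
  itself.\<close>

lemma card_inverted_index:
  assumes N: "subgroup N G" and W: "W \<lhd> G" and WN: "W \<subseteq> N"
    and inv: "\<And>x. x \<in> N \<Longrightarrow> \<sigma> x \<otimes> x \<in> W"
  shows "card (inverted G \<sigma> N) * card W = card N * card (inverted G \<sigma> W)"
proof -
  interpret N: subgroup N G by fact
  interpret W: normal W G by fact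
  have finN: "finite N" using fin N.subset finite_subset by blast
  let ?B = "(\<lambda>x. W #> x) ` N"
  have eq: "W #> s = W #> x \<longleftrightarrow> s \<in> W #> x" if "s \<in> carrier G" "x \<in> carrier G" for s x
    using that repr_independence[OF _ that(2) W.subgroup_axioms] rcos_self[OF that(1) W.subgroup_axioms] by auto
  have cosN: "s \<in> N" if "x \<in> N" "s \<in> W #> x" for s x
    using that WN by (auto simp: r_coset_def)
  have "card (inverted G \<sigma> N) = card ?B * card (inverted G \<sigma> W)"
  proof (rule card_eq_fibres[where f = "\<lambda>x. W #> x"])
    fix b assume "b \<in> ?B"
    then obtain x where x: "x \<in> N" "b = W #> x" by blast
    have "{s \<in> inverted G \<sigma> N. W #> s = b} = {s \<in> inverted G \<sigma> (carrier G). s \<in> W #> x}"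
      unfolding inverted_def x(2) using cosN[OF x(1)] eq[OF _ N.mem_carrier[OF x(1)]] N.subset by blast
    then show "card {s \<in> inverted G \<sigma> N. W #> s = b} = card (inverted G \<sigma> W)"
      using card_inverted_coset[OF W, of x] x inv by simp
  qed (use finN finite_inverted[OF N.subset] in \<open>auto simp: inverted_def\<close>)
  moreover have "card N = card ?B * card W"
  proof (rule card_eq_fibres[where f = "\<lambda>x. W #> x"])
    fix b assume "b \<in> ?B"
    then obtain x where x: "x \<in> N" "b = W #> x" by blast
    have "{s \<in> N. W #> s = b} = W #> x"
      unfolding x(2) using cosN[OF x(1)] eq[OF _ N.mem_carrier[OF x(1)]] N.subset by blast
    then show "card {s \<in> N. W #> s = b} = card W"
      using card_cosets_equal[of "W #> x" W] x rcosetsI[OF W.subset, of x] W.subset bij_betw_same_card by (metis N.mem_carrier)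
  qed (use finN in auto)
  ultimately show ?thesis by simp
qed

text \<open>The map x \<mapsto> x \<sigma>(x)^-1 has inverted values, and its fibre over b consists
  of the fixed points translated by the square root of b.\<close>

lemma card_carrier_inverted:
  "card (carrier G) = card {s \<in> carrier G. \<sigma> s = s} * card (inverted G \<sigma> (carrier G))"
proof -
  have "card (carrier G) = card (inverted G \<sigma> (carrier G)) * card {s \<in> carrier G. \<sigma> s = s}"
  proof (rule card_eq_fibres[where f = "\<lambda>x. x \<otimes> inv (\<sigma> x)"])
    show "finite (inverted G \<sigma> (carrier G))" by (simp add: finite_inverted)
  next
    fix a assume "a \<in> carrier G"
    then show "a \<otimes> inv (\<sigma> a) \<in> inverted G \<sigma> (carrier G)" by (simp add: inverted_def sig_sig inv_mult_group)
  next
    fix b assume b: "b \<in> inverted G \<sigma> (carrier G)"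
    define r where "r = rt b"
    have r: "r \<in> carrier G" "\<sigma> r = inv r" "r \<otimes> r = b"
      using b by (simp_all add: r_def inverted_def rt_inverted rt_rt)
    have "bij_betw (\<lambda>y. r \<otimes> y) {s \<in> carrier G. \<sigma> s = s} {a \<in> carrier G. a \<otimes> inv (\<sigma> a) = b}"
      unfolding bij_betw_def
    proof
      show "inj_on (\<lambda>y. r \<otimes> y) {s \<in> carrier G. \<sigma> s = s}" using r by (auto simp: inj_on_def)
      show "(\<lambda>y. r \<otimes> y) ` {s \<in> carrier G. \<sigma> s = s} = {a \<in> carrier G. a \<otimes> inv (\<sigma> a) = b}"
      proof (intro equalityI subsetI)
        fix a assume "a \<in> (\<lambda>y. r \<otimes> y) ` {s \<in> carrier G. \<sigma> s = s}"
        then show "a \<in> {a \<in> carrier G. a \<otimes> inv (\<sigma> a) = b}"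
          using r by (auto simp: inv_mult_group m_assoc)
      next
        fix a assume "a \<in> {a \<in> carrier G. a \<otimes> inv (\<sigma> a) = b}"
        then have a: "a \<in> carrier G" "a \<otimes> inv (\<sigma> a) = r \<otimes> r" using r by auto
        then have "a = r \<otimes> r \<otimes> \<sigma> a" using r by (metis inv_solve_right' sig.hom_closed m_closed)
        moreover have "inv r \<otimes> (r \<otimes> r \<otimes> \<sigma> a) = r \<otimes> \<sigma> a" using a(1) r(1) by (simp add: m_assoc)
        ultimately have "inv r \<otimes> a = r \<otimes> \<sigma> a" by metis
        then have "\<sigma> (inv r \<otimes> a) = inv r \<otimes> a" using a(1) r by (simp add: sig_sig)
        moreover have "a = r \<otimes> (inv r \<otimes> a)" using a r by simp
        ultimately show "a \<in> (\<lambda>y. r \<otimes> y) ` {s \<in> carrier G. \<sigma> s = s}"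
          using a(1) r by (intro image_eqI[of _ _ "inv r \<otimes> a"]) auto
      qed
    qed
    from bij_betw_same_card[OF this]
    show "card {a \<in> carrier G. a \<otimes> inv (\<sigma> a) = b} = card {s \<in> carrier G. \<sigma> s = s}" by simp
  qed (use fin in auto)
  then show ?thesis by simp
qed

text \<open>For a prime power q both sides count the (n+1)-tuples spanning F_q^(h+1), split by
  whether the first vector is zero. If it is not, the other n vectors must span the quotient of
  dimension h, and each vector there has q lifts.\<close>

lemma generating_product_step:
  fixes q :: real and n h :: nat
  shows "(\<Prod>i<Suc h. q ^ n - q ^ i) + (q ^ Suc h - 1) * q ^ n * (\<Prod>i<h. q ^ n - q ^ i) = (\<Prod>i<Suc h. q ^ Suc n - q ^ i)"
proof -
  have "(\<Prod>i<Suc h. q ^ Suc n - q ^ i) = (q ^ Suc n - 1) * (\<Prod>i<h. q ^ Suc n - q ^ Suc i)"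
    by (simp only: prod.lessThan_Suc_shift power_0)
  also have "(\<Prod>i<h. q ^ Suc n - q ^ Suc i) = (\<Prod>i<h. q * (q ^ n - q ^ i))"
    by (simp add: algebra_simps)
  also have "\<dots> = q ^ h * (\<Prod>i<h. q ^ n - q ^ i)" by (simp add: prod.distrib)
  finally show ?thesis by (simp add: algebra_simps)
qed

text \<open>Condition on the first entry of the tuple: either it lies in \<open>W\<close> and the remaining
  entries must generate \<open>N\<close> modulo \<open>W\<close>, or it enlarges \<open>W\<close> by a factor \<open>p\<close>.\<close>

lemma card_generating_tuples:
  assumes p: "prime p" and N: "N \<lhd> G" and SN: "\<And>x. x \<in> N \<Longrightarrow> \<sigma> x \<otimes> x \<in> pstar p G N"
    and "finite I" and "subgroup W G" "pstar p G N \<subseteq> W" "W \<subseteq> N" "card N = p ^ h * card W"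
  shows "real (card {t \<in> I \<rightarrow>\<^sub>E inverted G \<sigma> N. generate G (t ` I \<union> W) = N}) =
    real (card (inverted G \<sigma> W)) ^ card I * (\<Prod>i<h. real p ^ card I - real p ^ i)"
  using assms(4-8)
proof (induction I arbitrary: W h rule: finite_induct)
  case empty
  interpret W: subgroup W G by fact
  interpret N: normal N G by fact
  have finN: "finite N" using fin N.subset finite_subset by blast
  have "generate G W = W"
    using generate_subgroup_incl[OF order_refl W.subgroup_axioms] by (auto intro: generate.incl)
  then have *: "{t \<in> {} \<rightarrow>\<^sub>E inverted G \<sigma> N. generate G (t ` {} \<union> W) = N} = (if W = N then {\<lambda>x. undefined} else {})"
    by auto
  show ?case
  proof (cases h)
    case 0
    then have "W = N" using empty finN by (intro card_subset_eq) auto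
    then show ?thesis unfolding * using 0 by simp
  next
    case (Suc k)
    have "card W > 0" using finN empty W.one_closed by (metis card_gt_0_iff empty_iff finite_subset)
    moreover have "p ^ h > 1" using Suc prime_gt_1_nat[OF p] by (metis one_less_power zero_less_Suc)
    ultimately have "W \<noteq> N" using empty by auto
    \<comment> \<open>The factor i = 0 is p^0 - p^0, as the index set is empty.\<close>
    moreover have "(\<Prod>i<h. real p ^ card {} - real p ^ i) = 0" using Suc by (intro prod_zero) (auto intro!: bexI[of _ 0])
    ultimately show ?thesis using * by simp
  qed
next
  case (insert j I)
  interpret W: subgroup W G by fact
  interpret N: normal N G by fact
  have finN: "finite N" using fin N.subset finite_subset by blast
  have p0: "p > 0" using p prime_gt_0_nat by auto
  let ?X = "inverted G \<sigma>"
  have Wn: "V \<lhd> G" if "subgroup V G" "pstar p G N \<subseteq> V" "V \<subseteq> N" for V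
    using between_normal[OF that] .
  let ?gen = "\<lambda>V. real (card {t \<in> I \<rightarrow>\<^sub>E ?X N. generate G (t ` I \<union> V) = N})"
  let ?W = "\<lambda>y. generate G (insert y W)"
  have finX: "finite (?X N)" using finite_inverted N.subset by blast
  have gen_eq: "generate G ((g(j := y)) ` insert j I \<union> W) = generate G (g ` I \<union> ?W y)"
    if "g \<in> I \<rightarrow>\<^sub>E ?X N" "y \<in> ?X N" for g y
  proof -
    have c: "g ` I \<subseteq> carrier G" "y \<in> carrier G" using that by (auto simp: inverted_def PiE_iff)
    have im: "(g(j := y)) ` insert j I = insert y (g ` I)" using insert.hyps by auto
    have c2: "?W y \<subseteq> carrier G" using c W.subset by (intro generate_incl) auto
    show ?thesis unfolding im
    proof
      have "insert y W \<subseteq> generate G (g ` I \<union> ?W y)" by (auto intro: generate.incl)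
      then show "generate G (insert y (g ` I) \<union> W) \<subseteq> generate G (g ` I \<union> ?W y)"
        using c c2 by (intro generate_subgroup_incl generate_is_subgroup) (auto intro: generate.incl)
      have S: "subgroup (generate G (insert y (g ` I) \<union> W)) G"
        using c W.subset by (intro generate_is_subgroup) auto
      have "?W y \<subseteq> generate G (insert y (g ` I) \<union> W)"
        using S by (intro generate_subgroup_incl) (auto intro: generate.incl)
      then show "generate G (g ` I \<union> ?W y) \<subseteq> generate G (insert y (g ` I) \<union> W)"
        by (intro generate_subgroup_incl S) (auto intro: generate.incl)
    qed
  qed
  have "{t \<in> insert j I \<rightarrow>\<^sub>E ?X N. generate G (t ` insert j I \<union> W) = N} =
      (\<lambda>(y, g). g(j := y)) ` (SIGMA y:?X N. {g \<in> I \<rightarrow>\<^sub>E ?X N. generate G (g ` I \<union> ?W y) = N})"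
    (is "?L = ?R")
  proof (intro equalityI subsetI)
    fix t assume t: "t \<in> ?L"
    then have "t \<in> (\<lambda>(y, g). g(j := y)) ` (?X N \<times> (I \<rightarrow>\<^sub>E ?X N))" unfolding PiE_insert_eq by blast
    then obtain y g where yg: "y \<in> ?X N" "g \<in> I \<rightarrow>\<^sub>E ?X N" "t = g(j := y)" by auto
    then have "generate G (g ` I \<union> ?W y) = N" using t gen_eq[OF yg(2,1)] by blast
    with yg show "t \<in> ?R" by (intro image_eqI[of _ _ "(y, g)"]) simp_all
  next
    fix t assume "t \<in> ?R"
    then obtain y g where yg: "y \<in> ?X N" "g \<in> I \<rightarrow>\<^sub>E ?X N" "generate G (g ` I \<union> ?W y) = N" "t = g(j := y)" by auto
    then have "t \<in> (\<lambda>(y, g). g(j := y)) ` (?X N \<times> (I \<rightarrow>\<^sub>E ?X N))"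
      by (intro image_eqI[of _ _ "(y, g)"]) simp_all
    then have "t \<in> insert j I \<rightarrow>\<^sub>E ?X N" unfolding PiE_insert_eq .
    moreover have "generate G (t ` insert j I \<union> W) = N" using gen_eq[OF yg(2,1)] yg(3,4) by metis
    ultimately show "t \<in> ?L" by blast
  qed
  moreover have "inj_on (\<lambda>(y, g). g(j := y)) (SIGMA y:?X N. {g \<in> I \<rightarrow>\<^sub>E ?X N. generate G (g ` I \<union> ?W y) = N})"
    by (rule inj_on_subset[OF inj_combinator[OF insert.hyps(2), of "\<lambda>_. ?X N"]]) auto
  ultimately have "real (card {t \<in> insert j I \<rightarrow>\<^sub>E ?X N. generate G (t ` insert j I \<union> W) = N}) = (\<Sum>y\<in>?X N. ?gen (?W y))"
    using finX insert.hyps by (simp add: card_image finite_PiE)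
  also have "\<dots> = (\<Sum>y\<in>?X W. ?gen (?W y)) + (\<Sum>y\<in>?X N - ?X W. ?gen (?W y))"
  proof -
    have "?X W \<subseteq> ?X N" using insert.prems by (auto simp: inverted_def)
    then show ?thesis using finX by (simp add: sum.subset_diff add.commute)
  qed
  also have "(\<Sum>y\<in>?X W. ?gen (?W y)) = (\<Sum>y\<in>?X W. ?gen W)"
  proof (rule sum.cong)
    fix y assume "y \<in> ?X W"
    then have "insert y W = W" by (auto simp: inverted_def)
    moreover have "generate G W = W"
      using generate_subgroup_incl[OF order_refl W.subgroup_axioms] by (auto intro: generate.incl)
    ultimately show "?gen (?W y) = ?gen W" by simp
  qed simp
  also have "\<dots> = real (card (?X W)) * (real (card (?X W)) ^ card I * (\<Prod>i<h. real p ^ card I - real p ^ i))"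
    using insert.IH[OF insert.prems] by simp
  finally have *: "real (card {t \<in> insert j I \<rightarrow>\<^sub>E ?X N. generate G (t ` insert j I \<union> W) = N}) =
     real (card (?X W)) * (real (card (?X W)) ^ card I * (\<Prod>i<h. real p ^ card I - real p ^ i)) + (\<Sum>y\<in>?X N - ?X W. ?gen (?W y))" .
  have cX: "card (?X N) * card V = card N * card (?X V)" if "subgroup V G" "pstar p G N \<subseteq> V" "V \<subseteq> N" for V
    using card_inverted_index[OF N.subgroup_axioms Wn[OF that] that(3)] SN that by blast
  show ?case
  proof (cases h)
    case 0
    then have "W = N" using insert.prems finN by (intro card_subset_eq) auto
    then show ?thesis using * 0 insert.hyps by simp
  next
    case (Suc k)
    have cW: "card W > 0" using finN insert.prems W.one_closed by (metis card_gt_0_iff empty_iff finite_subset)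
    have XNW: "card (?X N) = p ^ h * card (?X W)"
      using cX[OF insert.prems(1-3)] insert.prems(4) cW by simp
    \<comment> \<open>Besides the drop of the dimension to \<open>k\<close>, the inverted part of
      the enlarged subgroup grows by the factor \<open>p\<close>, which accounts for the power q^n
      in \<open>generating_product_step\<close>.\<close>
    have "?gen (?W y) = real (p * card (?X W)) ^ card I * (\<Prod>i<k. real p ^ card I - real p ^ i)"
      if y: "y \<in> ?X N - ?X W" for y
    proof -
      have yN: "y \<in> N" "y \<notin> W" using y by (auto simp: inverted_def)
      have S: "subgroup (?W y) G" using yN W.subset by (intro generate_is_subgroup) auto
      have sub: "pstar p G N \<subseteq> ?W y" "?W y \<subseteq> N"
      proof -
        have "W \<subseteq> ?W y" by (auto intro: generate.incl)
        then show "pstar p G N \<subseteq> ?W y" using insert.prems by blast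
        show "?W y \<subseteq> N" using insert.prems yN by (intro generate_subgroup_incl N.subgroup_axioms) auto
      qed
      have c: "card (?W y) = p * card W"
        using insert.prems yN p pow_in_pstar[of y N p]
        by (intro card_generate_insert_normal Wn) auto
      then have cN: "card N = p ^ k * card (?W y)" using insert.prems(4) Suc by simp
      have "p ^ h * card (?X W) * (p * card W) = p ^ h * card W * card (?X (?W y))"
        using cX[OF S sub] XNW c insert.prems(4) by simp
      then have "card (?X (?W y)) = p * card (?X W)" using cW p0 by (simp add: mult.commute)
      then show ?thesis using insert.IH[OF S sub cN] by simp
    qed
    then have "(\<Sum>y\<in>?X N - ?X W. ?gen (?W y)) =
        real (card (?X N - ?X W)) * (real (p * card (?X W)) ^ card I * (\<Prod>i<k. real p ^ card I - real p ^ i))"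
      by simp
    moreover have "real (card (?X N - ?X W)) = (real p ^ h - 1) * real (card (?X W))"
    proof -
      have "?X W \<subseteq> ?X N" using insert.prems by (auto simp: inverted_def)
      then have "card (?X N - ?X W) = card (?X N) - card (?X W)" "card (?X W) \<le> card (?X N)"
        using finX by (auto intro: card_Diff_subset card_mono finite_subset)
      then show ?thesis using XNW by (simp add: of_nat_diff algebra_simps)
    qed
    ultimately have S: "(\<Sum>y\<in>?X N - ?X W. ?gen (?W y)) =
        real (card (?X W)) ^ Suc (card I) * ((real p ^ Suc k - 1) * real p ^ card I * (\<Prod>i<k. real p ^ card I - real p ^ i))"
      using Suc by (simp add: power_mult_distrib mult_ac)
    have c: "card (insert j I) = Suc (card I)" using insert.hyps by simp
    show ?thesis
      unfolding * S c Suc generating_product_step[of "real p" "card I" k, symmetric]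
      by (simp add: distrib_left mult.assoc del: prod.lessThan_Suc)
  qed
qed

end

text \<open>The fibre is a coset of the kernel, and equivariance together with \<tau> y = y^-1 says
  that \<sigma> inverts this coset modulo the kernel.\<close>

lemma (in group_hom) card_inverted_fibre:
  assumes "involution_group G \<sigma>" and eq: "\<And>x. x \<in> carrier G \<Longrightarrow> h (\<sigma> x) = \<tau> (h x)"
    and y: "y \<in> inverted H \<tau> (carrier H)" "y \<in> h ` carrier G"
  shows "card {s \<in> inverted G \<sigma> (carrier G). h s = y} = card (inverted G \<sigma> (kernel G H h))"
proof -
  interpret involution_group G \<sigma> by fact
  obtain x where x: "x \<in> carrier G" "y = h x" using y by blast
  have "\<sigma> x \<otimes> x \<in> kernel G H h" using x y eq by (auto simp: kernel_def inverted_def)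
  moreover have "{s \<in> inverted G \<sigma> (carrier G). h s = y} = {s \<in> inverted G \<sigma> (carrier G). s \<in> kernel G H h #> x}"
  proof -
    have "h s = h x \<longleftrightarrow> s \<in> kernel G H h #> x" if "s \<in> carrier G" for s
    proof
      assume "h s = h x"
      then have "s \<otimes> inv x \<in> kernel G H h" "s = s \<otimes> inv x \<otimes> x"
        using that x by (auto simp: kernel_def G.m_assoc)
      then show "s \<in> kernel G H h #> x" unfolding r_coset_def by blast
    qed (use x in \<open>auto simp: r_coset_def kernel_def\<close>)
    then show ?thesis using x by (auto simp: inverted_def)
  qed
  ultimately show ?thesis using card_inverted_coset[OF normal_kernel x(1)] by simp
qed

text \<open>Inverted elements go to inverted elements, and by \<open>card_inverted_fibre\<close> all
  their fibres have the same size; surjectivity makes none of them empty.\<close>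

lemma (in group_hom) card_inverted_image:
  assumes "involution_group G \<sigma>" and eq: "\<And>x. x \<in> carrier G \<Longrightarrow> h (\<sigma> x) = \<tau> (h x)"
    and surj: "h ` carrier G = carrier H"
  shows "card (inverted G \<sigma> (carrier G)) = card (inverted H \<tau> (carrier H)) * card (inverted G \<sigma> (kernel G H h))"
proof (rule card_eq_fibres[where f = h])
  interpret involution_group G \<sigma> by fact
  show "finite (inverted G \<sigma> (carrier G))" by (simp add: finite_inverted)
  have "finite (carrier H)" using fin surj by (metis finite_imageI)
  then show "finite (inverted H \<tau> (carrier H))" unfolding inverted_def by simp
  show "h a \<in> inverted H \<tau> (carrier H)" if "a \<in> inverted G \<sigma> (carrier G)" for a
    using that eq[of a] by (auto simp: inverted_def)
  show "card {a \<in> inverted G \<sigma> (carrier G). h a = b} = card (inverted G \<sigma> (kernel G H h))"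
    if "b \<in> inverted H \<tau> (carrier H)" for b
    using card_inverted_fibre[OF assms(1) eq that] that surj by (auto simp: inverted_def)
qed

text \<open>The product \<open>\<pi> = \<sigma>\<tau>\<close> acts trivially modulo \<open>D\<close>. It has odd order, since an involution acting
  trivially modulo \<open>D\<close> has a fixed point in every coset of \<open>D\<close>, so its fixed points generate.
  The square root of \<open>\<pi>\<close> in the group generated by \<open>\<pi>\<close> conjugates \<open>\<tau>\<close> to \<open>\<sigma>\<close>.\<close>

lemma involutions_conjugate:
  assumes "involution_group G \<sigma>" "involution_group G \<tau>"
    and D: "D \<lhd> G" "\<And>M. subgroup M G \<Longrightarrow> carrier G \<subseteq> generate G (M \<union> D) \<Longrightarrow> M = carrier G"
    and s: "\<And>x. x \<in> carrier G \<Longrightarrow> \<sigma> x \<otimes>\<^bsub>G\<^esub> x \<in> D" and t: "\<And>x. x \<in> carrier G \<Longrightarrow> \<tau> x \<otimes>\<^bsub>G\<^esub> x \<in> D"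
  shows "\<exists>\<alpha>\<in>iso G G. \<forall>x\<in>carrier G. \<alpha> (\<tau> x) = \<sigma> (\<alpha> x)"
proof -
  interpret S: involution_group G \<sigma> by fact
  interpret T: involution_group G \<tau> by fact
  interpret D: normal D G by fact
  \<comment> \<open>The identity outside the carrier makes \<pi> a permutation of the whole type,
    some power of which is \<open>id\<close>.\<close>
  define \<pi> where "\<pi> x = (if x \<in> carrier G then \<sigma> (\<tau> x) else x)" for x
  have \<pi>c: "\<pi> x \<in> carrier G" if "x \<in> carrier G" for x using that by (simp add: \<pi>_def)
  have pc: "(\<pi> ^^ n) x \<in> carrier G" if "x \<in> carrier G" for x n
    by (induction n) (use that \<pi>c in auto)
  have pi_hom: "(\<pi> ^^ n) (x \<otimes>\<^bsub>G\<^esub> y) = (\<pi> ^^ n) x \<otimes>\<^bsub>G\<^esub> (\<pi> ^^ n) y" if "x \<in> carrier G" "y \<in> carrier G" for n x y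
  proof (induction n)
    case (Suc n)
    have "\<pi> ((\<pi> ^^ n) x \<otimes>\<^bsub>G\<^esub> (\<pi> ^^ n) y) = \<pi> ((\<pi> ^^ n) x) \<otimes>\<^bsub>G\<^esub> \<pi> ((\<pi> ^^ n) y)"
      using pc[OF that(1)] pc[OF that(2)] by (simp add: \<pi>_def)
    then show ?case using Suc by simp
  qed simp
  have homn: "\<pi> ^^ n \<in> hom G G" for n using pc pi_hom by (auto simp: hom_def)
  have "\<pi> permutes carrier G"
  proof (rule bij_imp_permutes)
    have "inj_on \<pi> (carrier G)"
      by (rule inj_onI) (metis \<pi>_def S.sig_sig T.sig.hom_closed T.sig_sig)
    then show "bij_betw \<pi> (carrier G) (carrier G)"
      using \<pi>c S.fin by (simp add: bij_betw_def endo_inj_surj image_subsetI)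
  qed (simp add: \<pi>_def)
  then have perm: "permutation \<pi>" using S.fin permutation_permutes by blast
  then have ex: "\<exists>m. m > 0 \<and> \<pi> ^^ m = id" using permutation_is_nilpotent by metis
  define m where "m = (LEAST m. m > 0 \<and> \<pi> ^^ m = id)"
  have m: "m > 0" "\<pi> ^^ m = id" using LeastI_ex[OF ex] by (auto simp: m_def)
  have m_least: "\<pi> ^^ k \<noteq> id" if "k > 0" "k < m" for k
    using not_less_Least[of k "\<lambda>m. m > 0 \<and> \<pi> ^^ m = id"] that by (auto simp: m_def)
  have triv: "inv\<^bsub>G\<^esub> x \<otimes>\<^bsub>G\<^esub> \<pi> x \<in> D" if x: "x \<in> carrier G" for x
  proof -
    have "inv\<^bsub>G\<^esub> (\<tau> x \<otimes>\<^bsub>G\<^esub> x) \<in> D" using t x by blast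
    moreover have "\<tau> x \<otimes>\<^bsub>G\<^esub> (\<sigma> (\<tau> x) \<otimes>\<^bsub>G\<^esub> \<tau> x) \<otimes>\<^bsub>G\<^esub> inv\<^bsub>G\<^esub> \<tau> x \<in> D"
      using D.inv_op_closed2[OF _ s] x by simp
    ultimately have "inv\<^bsub>G\<^esub> (\<tau> x \<otimes>\<^bsub>G\<^esub> x) \<otimes>\<^bsub>G\<^esub> (\<tau> x \<otimes>\<^bsub>G\<^esub> (\<sigma> (\<tau> x) \<otimes>\<^bsub>G\<^esub> \<tau> x) \<otimes>\<^bsub>G\<^esub> inv\<^bsub>G\<^esub> \<tau> x) \<in> D"
      by (rule D.m_closed)
    then show ?thesis using x by (simp add: \<pi>_def S.m_assoc S.inv_mult_group)
  qed
  have trivn: "inv\<^bsub>G\<^esub> x \<otimes>\<^bsub>G\<^esub> (\<pi> ^^ n) x \<in> D" if x: "x \<in> carrier G" for x n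
  proof (induction n)
    case (Suc n)
    have "(inv\<^bsub>G\<^esub> x \<otimes>\<^bsub>G\<^esub> (\<pi> ^^ n) x) \<otimes>\<^bsub>G\<^esub> (inv\<^bsub>G\<^esub> ((\<pi> ^^ n) x) \<otimes>\<^bsub>G\<^esub> \<pi> ((\<pi> ^^ n) x)) \<in> D"
      using Suc triv[OF pc[OF x]] by (rule D.m_closed)
    then show ?case using x pc[OF x, of n] \<pi>c[OF pc[OF x, of n]] by (simp add: S.m_assoc)
  qed (use x in simp)
  have "odd m"
  proof
    assume "even m"
    then obtain k where k: "m = 2 * k" by blast
    define \<iota> where "\<iota> = \<pi> ^^ k"
    have "\<iota> \<circ> \<iota> = id" using m(2) k by (simp add: \<iota>_def funpow_add[symmetric] mult_2)
    then have inv: "\<iota> (\<iota> x) = x" for x by (metis comp_apply id_apply)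
    interpret i: group_hom G G \<iota> by unfold_locales (use homn \<iota>_def in simp)
    interpret I: involution_group G \<iota>
      using inv homn \<iota>_def S.fin S.odd_card by unfold_locales auto
    let ?Y = "{x \<in> carrier G. \<iota> x = x}"
    have "subgroup ?Y G" by (rule S.subgroupI) (auto intro: exI[of _ "\<one>\<^bsub>G\<^esub>"])
    moreover have "x \<in> generate G (?Y \<union> D)" if x: "x \<in> carrier G" for x
    proof -
      \<comment> \<open>\<iota> inverts \<open>d\<close> and therefore its root \<open>?e\<close>,
        so it sends x ?e to x d ?e^-1 = x ?e.\<close>
      define d where "d = inv\<^bsub>G\<^esub> x \<otimes>\<^bsub>G\<^esub> \<iota> x"
      have d: "d \<in> D" using trivn[OF x] by (simp add: d_def \<iota>_def)
      have id: "\<iota> d = inv\<^bsub>G\<^esub> d" using x by (simp add: d_def inv S.inv_mult_group)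
      have dc: "d \<in> carrier G" using d by simp
      let ?e = "I.rt d"
      have e: "?e \<in> D" "?e \<in> carrier G" "\<iota> ?e = inv\<^bsub>G\<^esub> ?e" "?e \<otimes>\<^bsub>G\<^esub> ?e = d"
        using d dc id I.rt_mem[OF D.subgroup_axioms] I.rt_inverted I.rt_rt by auto
      have "\<iota> x = x \<otimes>\<^bsub>G\<^esub> d" using x by (simp add: d_def)
      then have "\<iota> (x \<otimes>\<^bsub>G\<^esub> ?e) = x \<otimes>\<^bsub>G\<^esub> (?e \<otimes>\<^bsub>G\<^esub> ?e) \<otimes>\<^bsub>G\<^esub> inv\<^bsub>G\<^esub> ?e" using x e by simp
      also have "\<dots> = x \<otimes>\<^bsub>G\<^esub> ?e" using x e(2) by (simp add: S.m_assoc)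
      finally have "x \<otimes>\<^bsub>G\<^esub> ?e \<in> ?Y" using x e by simp
      then have "(x \<otimes>\<^bsub>G\<^esub> ?e) \<otimes>\<^bsub>G\<^esub> inv\<^bsub>G\<^esub> ?e \<in> generate G (?Y \<union> D)"
        by (intro generate.eng generate.incl) (use e D.m_inv_closed in auto)
      then show ?thesis using x e(2) by (simp add: S.m_assoc)
    qed
    ultimately have "?Y = carrier G" using D(2) by blast
    then have "\<iota> x = x" if "x \<in> carrier G" for x using that by blast
    moreover have "(\<pi> ^^ n) x = x" if "x \<notin> carrier G" for x n
      by (induction n) (use that in \<open>auto simp: \<pi>_def\<close>)
    ultimately have "\<iota> = id" unfolding \<iota>_def by (metis eq_id_iff)
    then show False using m_least[of k] k m(1) by (simp add: \<iota>_def)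
  qed
  then obtain k where k: "m = 2 * k + 1" by (elim oddE)
  \<comment> \<open>As m = 2k+1, the square of \<alpha> is \<pi>^(m+1) = \<pi>.\<close>
  define \<alpha> where "\<alpha> = \<pi> ^^ (k + 1)"
  have "\<alpha> \<circ> \<alpha> = \<pi> ^^ ((k + 1) + (k + 1))" by (simp only: \<alpha>_def funpow_add)
  also have "(k + 1) + (k + 1) = Suc m" using k by simp
  also have "\<pi> ^^ Suc m = \<pi>" using m(2) by simp
  finally have sq: "\<alpha> (\<alpha> x) = \<pi> x" for x by (metis comp_apply)
  have mk: "m = (k + 1) + k" "m = k + (k + 1)" using k by simp_all
  have "\<pi> ^^ m = \<alpha> \<circ> \<pi> ^^ k" unfolding mk(1) by (simp only: \<alpha>_def funpow_add)
  moreover have "\<pi> ^^ m = \<pi> ^^ k \<circ> \<alpha>" unfolding mk(2) by (simp only: \<alpha>_def funpow_add)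
  ultimately have "\<alpha> ((\<pi> ^^ k) x) = x" "(\<pi> ^^ k) (\<alpha> x) = x" for x using m(2) by (metis comp_apply id_apply)+
  then have "bij_betw \<alpha> (carrier G) (carrier G)"
    by (intro bij_betwI[of _ _ _ "\<pi> ^^ k"]) (auto simp: \<alpha>_def pc simp del: funpow.simps)
  then have "\<alpha> \<in> iso G G" using homn[of "k + 1"] by (auto simp: iso_def \<alpha>_def simp del: funpow.simps)
  \<comment> \<open>Conjugation by \<sigma> turns \<pi> = \<sigma>\<tau> into \<tau>\<sigma>, its
    inverse. Since \<tau> = \<sigma>\<pi> = \<sigma>\<alpha>\<alpha>, the case
    \<alpha>\<sigma>\<alpha> = \<sigma> yields \<alpha>\<tau> = \<sigma>\<alpha>.\<close>
  have flip: "(\<pi> ^^ n) (\<sigma> ((\<pi> ^^ n) x)) = \<sigma> x" if x: "x \<in> carrier G" for x n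
  proof (induction n)
    case (Suc n)
    have c: "(\<pi> ^^ n) x \<in> carrier G" using pc[OF x] .
    have "(\<pi> ^^ Suc n) (\<sigma> ((\<pi> ^^ Suc n) x)) = (\<pi> ^^ n) (\<pi> (\<sigma> (\<pi> ((\<pi> ^^ n) x))))"
      by (simp add: funpow_swap1)
    also have "\<pi> (\<sigma> (\<pi> ((\<pi> ^^ n) x))) = \<sigma> ((\<pi> ^^ n) x)"
      using c by (simp add: \<pi>_def S.sig_sig T.sig_sig)
    finally show ?case using Suc by simp
  qed simp
  have "\<alpha> (\<tau> x) = \<sigma> (\<alpha> x)" if x: "x \<in> carrier G" for x
  proof -
    have ax: "\<alpha> x \<in> carrier G" using pc[OF x] by (simp add: \<alpha>_def del: funpow.simps)
    have "\<tau> x = \<sigma> (\<alpha> (\<alpha> x))" using x by (simp add: sq \<pi>_def S.sig_sig)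
    then show ?thesis using flip[OF ax, of "k + 1"] by (simp add: \<alpha>_def del: funpow.simps)
  qed
  then show ?thesis using \<open>\<alpha> \<in> iso G G\<close> by blast
qed

section \<open>Free groups\<close>

definition flip :: "nat \<times> bool \<Rightarrow> nat \<times> bool" where
  "flip x = (fst x, \<not> snd x)"

lemma flip_flip [simp]: "flip (flip x) = x"
  by (simp add: flip_def)

text \<open>The index-based definition of reducedness in recursive form, for induction over
  lists.\<close>

lemma reduced_word_simps [simp]:
  "reduced_word []" "reduced_word [x]"
  "reduced_word (x # y # w) \<longleftrightarrow> y \<noteq> flip x \<and> reduced_word (y # w)"
proof -
  have "reduced_word (x # y # w) \<longleftrightarrow> \<not> (fst x = fst y \<and> snd x \<noteq> snd y) \<and> reduced_word (y # w)"
    unfolding reduced_word_def by (subst All_less_Suc2[symmetric, simplified] | auto simp: nth_Cons split: nat.splits)+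
  then show "reduced_word (x # y # w) \<longleftrightarrow> y \<noteq> flip x \<and> reduced_word (y # w)"
    by (auto simp: flip_def prod_eq_iff)
qed (auto simp: reduced_word_def)

lemma cancel_letter_Cons: "cancel_letter x (y # ys) = (if y = flip x then ys else x # y # ys)"
  by (auto simp: flip_def prod_eq_iff)

declare cancel_letter.simps(2) [simp del]

lemma reduced_word_tl: "reduced_word (x # w) \<Longrightarrow> reduced_word w"
  by (cases w) auto

lemma reduced_cancel_letter: "reduced_word w \<Longrightarrow> reduced_word (cancel_letter x w)"
  by (cases w) (auto simp: cancel_letter_Cons dest: reduced_word_tl)

lemma cancel_letter_reduced: "reduced_word (x # w) \<Longrightarrow> cancel_letter x w = x # w"
  by (cases w) (auto simp: cancel_letter_Cons)

text \<open>Van der Waerden's method: each letter acts on the reduced words by a permutation whose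
  inverse belongs to the flipped letter. Left multiplication by a word composes these permutations,
  so associativity of \<open>free_grp\<close> comes from composition of functions.\<close>

lemma cancel_flip: "reduced_word w \<Longrightarrow> cancel_letter x (cancel_letter (flip x) w) = w"
  by (cases w) (auto simp: cancel_letter_Cons cancel_letter_reduced)

lemma cancel_flip': "reduced_word w \<Longrightarrow> cancel_letter (flip x) (cancel_letter x w) = w"
  using cancel_flip[of w "flip x"] by simp

lemma reduced_foldr: "reduced_word v \<Longrightarrow> reduced_word (foldr cancel_letter u v)"
  by (induction u) (simp_all add: reduced_cancel_letter)

lemma foldr_cancel_letter:
  "reduced_word v \<Longrightarrow> foldr cancel_letter (cancel_letter x w) v = cancel_letter x (foldr cancel_letter w v)"
  by (cases w) (auto simp: cancel_letter_Cons cancel_flip reduced_foldr)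

lemma foldr_reduce_word: "reduced_word v \<Longrightarrow> foldr cancel_letter (reduce_word u) v = foldr cancel_letter u v"
  by (induction u) (simp_all add: reduce_word_def foldr_cancel_letter)

lemma reduce_word_reduced: "reduced_word w \<Longrightarrow> reduce_word w = w"
proof (induction w)
  case (Cons x w)
  then have "foldr cancel_letter w [] = w" using reduced_word_tl by (auto simp: reduce_word_def)
  then show ?case using cancel_letter_reduced[OF Cons.prems] by (simp add: reduce_word_def)
qed (simp add: reduce_word_def)

lemma reduced_reduce_word: "reduced_word (reduce_word w)"
  by (simp add: reduce_word_def reduced_foldr)

lemma reduce_word_append: "reduced_word v \<Longrightarrow> reduce_word (u @ v) = foldr cancel_letter u v"
  using reduce_word_reduced[of v] by (simp add: reduce_word_def)

lemma set_cancel_letter: "set (cancel_letter x w) \<subseteq> insert x (set w)"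
  by (cases w) (auto simp: cancel_letter_Cons)

lemma set_reduce_word: "set (reduce_word w) \<subseteq> set w"
  by (induction w) (use set_cancel_letter in \<open>fastforce simp: reduce_word_def\<close>)+

lemma foldr_inverse_word:
  "reduced_word v \<Longrightarrow> foldr cancel_letter (rev (map flip w)) (foldr cancel_letter w v) = v"
  by (induction w) (simp_all add: cancel_flip' reduced_foldr)

lemma fst_flip [simp]: "fst (flip x) = fst x" and snd_flip [simp]: "snd (flip x) = (\<not> snd x)"
  by (simp_all add: flip_def)

lemma free_grp_carrier: "w \<in> carrier (free_grp g) \<longleftrightarrow> reduced_word w \<and> (\<forall>x\<in>set w. fst x < g)"
  by (simp add: free_grp_def)

lemma free_grp_mult: "reduced_word v \<Longrightarrow> u \<otimes>\<^bsub>free_grp g\<^esub> v = foldr cancel_letter u v"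
  by (simp add: free_grp_def reduce_word_append)

lemma free_grp_one [simp]: "\<one>\<^bsub>free_grp g\<^esub> = []"
  by (simp add: free_grp_def)

lemma group_free_grp: "group (free_grp g)"
proof (rule groupI)
  fix u v assume "u \<in> carrier (free_grp g)" "v \<in> carrier (free_grp g)"
  then show "u \<otimes>\<^bsub>free_grp g\<^esub> v \<in> carrier (free_grp g)"
    using set_reduce_word[of "u @ v"] reduced_reduce_word by (auto simp: free_grp_def)
next
  fix u v w assume *: "u \<in> carrier (free_grp g)" "v \<in> carrier (free_grp g)" "w \<in> carrier (free_grp g)"
  then have "u \<otimes>\<^bsub>free_grp g\<^esub> v = reduce_word (u @ v)" by (simp add: free_grp_def)
  then have "u \<otimes>\<^bsub>free_grp g\<^esub> v \<otimes>\<^bsub>free_grp g\<^esub> w = foldr cancel_letter (u @ v) w"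
    using * by (simp add: free_grp_mult free_grp_carrier foldr_reduce_word del: foldr_append)
  then show "u \<otimes>\<^bsub>free_grp g\<^esub> v \<otimes>\<^bsub>free_grp g\<^esub> w = u \<otimes>\<^bsub>free_grp g\<^esub> (v \<otimes>\<^bsub>free_grp g\<^esub> w)"
    using * by (simp add: free_grp_mult free_grp_carrier reduced_foldr)
next
  fix u assume *: "u \<in> carrier (free_grp g)"
  show "\<one>\<^bsub>free_grp g\<^esub> \<otimes>\<^bsub>free_grp g\<^esub> u = u" using * by (simp add: free_grp_mult free_grp_carrier)
  let ?v = "reduce_word (rev (map flip u))"
  have "?v \<in> carrier (free_grp g)"
    using * set_reduce_word[of "rev (map flip u)"] reduced_reduce_word
    by (fastforce simp: free_grp_carrier)
  moreover have "?v \<otimes>\<^bsub>free_grp g\<^esub> u = []"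
  proof -
    have "u = foldr cancel_letter u []"
      using * reduce_word_reduced[of u] by (simp add: free_grp_carrier reduce_word_def)
    then show ?thesis
      using * foldr_inverse_word[of "[]" u] by (simp add: free_grp_mult free_grp_carrier foldr_reduce_word)
  qed
  ultimately show "\<exists>y\<in>carrier (free_grp g). y \<otimes>\<^bsub>free_grp g\<^esub> u = \<one>\<^bsub>free_grp g\<^esub>" by auto
qed (simp add: free_grp_def)

section \<open>Evaluation of words in a group\<close>

definition letter_val :: "('a, 'b) monoid_scheme \<Rightarrow> (nat \<Rightarrow> 'a) \<Rightarrow> nat \<times> bool \<Rightarrow> 'a" where
  "letter_val E e x = (if snd x then e (fst x) else inv\<^bsub>E\<^esub> e (fst x))"

definition word_val :: "('a, 'b) monoid_scheme \<Rightarrow> (nat \<Rightarrow> 'a) \<Rightarrow> (nat \<times> bool) list \<Rightarrow> 'a" where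
  "word_val E e w = foldr (\<lambda>x a. letter_val E e x \<otimes>\<^bsub>E\<^esub> a) w \<one>\<^bsub>E\<^esub>"

context group
begin

lemma letter_val_closed: "e \<in> {..<g} \<rightarrow> carrier G \<Longrightarrow> fst x < g \<Longrightarrow> letter_val G e x \<in> carrier G"
  by (auto simp: letter_val_def)

lemma word_val_closed: "e \<in> {..<g} \<rightarrow> carrier G \<Longrightarrow> \<forall>x\<in>set w. fst x < g \<Longrightarrow> word_val G e w \<in> carrier G"
  by (induction w) (simp_all add: word_val_def letter_val_closed)

lemma letter_val_flip: "e \<in> {..<g} \<rightarrow> carrier G \<Longrightarrow> fst x < g \<Longrightarrow> letter_val G e (flip x) = inv (letter_val G e x)"
  by (auto simp: letter_val_def PiE_iff Pi_iff)

lemma word_val_Cons: "word_val G e (x # w) = letter_val G e x \<otimes> word_val G e w"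
  by (simp add: word_val_def)

lemma word_val_cancel_letter:
  assumes "e \<in> {..<g} \<rightarrow> carrier G" "fst x < g" "\<forall>x\<in>set w. fst x < g"
  shows "word_val G e (cancel_letter x w) = letter_val G e x \<otimes> word_val G e w"
proof (cases w)
  case (Cons y ys)
  have c: "letter_val G e x \<in> carrier G" "word_val G e ys \<in> carrier G"
    using letter_val_closed[OF assms(1,2)] word_val_closed[OF assms(1), of ys] assms(3) Cons by auto
  show ?thesis
  proof (cases "y = flip x")
    case True
    then show ?thesis using Cons c letter_val_flip[OF assms(1,2)] by (simp add: cancel_letter_Cons word_val_Cons)
  next
    case False
    then show ?thesis using Cons by (simp add: cancel_letter_Cons word_val_Cons)
  qed
qed (simp add: word_val_Cons)

lemma word_val_foldr:
  assumes "e \<in> {..<g} \<rightarrow> carrier G" "\<forall>x\<in>set u. fst x < g" "\<forall>x\<in>set v. fst x < g"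
  shows "word_val G e (foldr cancel_letter u v) = word_val G e u \<otimes> word_val G e v \<and>
    (\<forall>x\<in>set (foldr cancel_letter u v). fst x < g)"
  using assms(2)
proof (induction u)
  case Nil
  then show ?case using assms word_val_closed[OF assms(1,3)] by (simp add: word_val_def)
next
  case (Cons x u)
  have "word_val G e (foldr cancel_letter (x # u) v) = letter_val G e x \<otimes> (word_val G e u \<otimes> word_val G e v)"
    using Cons word_val_cancel_letter[OF assms(1)] by simp
  moreover have "\<forall>y\<in>set (foldr cancel_letter (x # u) v). fst y < g"
    using Cons set_cancel_letter[of x "foldr cancel_letter u v"] by auto
  moreover have "letter_val G e x \<in> carrier G" "word_val G e u \<in> carrier G" "word_val G e v \<in> carrier G"
    using letter_val_closed[OF assms(1)] word_val_closed[OF assms(1)] assms(3) Cons.prems by auto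
  ultimately show ?case by (simp add: word_val_Cons m_assoc)
qed

lemma word_val_hom:
  assumes "e \<in> {..<g} \<rightarrow> carrier G" shows "word_val G e \<in> hom (free_grp g) G"
proof (rule homI)
  show "word_val G e w \<in> carrier G" if "w \<in> carrier (free_grp g)" for w
    using that word_val_closed[OF assms] by (simp add: free_grp_carrier)
  show "word_val G e (u \<otimes>\<^bsub>free_grp g\<^esub> v) = word_val G e u \<otimes> word_val G e v"
    if "u \<in> carrier (free_grp g)" "v \<in> carrier (free_grp g)" for u v
    using that word_val_foldr[OF assms] by (simp add: free_grp_carrier free_grp_mult)
qed

lemma word_val_gen: "e \<in> {..<g} \<rightarrow> carrier G \<Longrightarrow> i < g \<Longrightarrow> word_val G e [(i, True)] = e i"
  by (auto simp: word_val_def letter_val_def Pi_iff)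

end

lemma gen_in_free_grp: "i < g \<Longrightarrow> [(i, b)] \<in> carrier (free_grp g)"
  by (simp add: free_grp_carrier)

lemma inv_gen_free_grp: "i < g \<Longrightarrow> inv\<^bsub>free_grp g\<^esub> [(i, True)] = [(i, False)]"
  by (rule group.inv_equality[OF group_free_grp])
    (simp_all add: gen_in_free_grp free_grp_mult cancel_letter_Cons flip_def)

lemma free_grp_generated:
  "carrier (free_grp g) = generate (free_grp g) ((\<lambda>i. [(i, True)]) ` {..<g})" (is "_ = ?H")
proof
  interpret F: group "free_grp g" by (rule group_free_grp)
  show "?H \<subseteq> carrier (free_grp g)" by (rule F.generate_incl) (auto simp: gen_in_free_grp)
  have "w \<in> ?H" if "reduced_word w" "\<forall>x\<in>set w. fst x < g" for w
    using that
  proof (induction w)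
    case Nil
    then show ?case using generate.one[of "free_grp g"] by simp
  next
    case (Cons x w)
    obtain i b where x: "x = (i, b)" by fastforce
    then have "i < g" using Cons by simp
    have "[x] \<in> ?H"
    proof (cases b)
      case True
      then show ?thesis using x \<open>i < g\<close> by (auto intro: generate.incl)
    next
      case False
      then have "[x] = inv\<^bsub>free_grp g\<^esub> [(i, True)]" using x inv_gen_free_grp[OF \<open>i < g\<close>] by simp
      moreover have "inv\<^bsub>free_grp g\<^esub> [(i, True)] \<in> ?H" using \<open>i < g\<close> by (intro generate.inv) auto
      ultimately show ?thesis by simp
    qed
    moreover have "w \<in> ?H" using Cons reduced_word_tl by auto
    ultimately have "[x] \<otimes>\<^bsub>free_grp g\<^esub> w \<in> ?H" by (rule generate.eng)
    then show ?case
      using Cons.prems reduced_word_tl[OF Cons.prems(1)] by (simp add: free_grp_mult cancel_letter_reduced)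
  qed
  then show "carrier (free_grp g) \<subseteq> ?H" by (auto simp: free_grp_carrier)
qed

lemma sigma_word_flip: "sigma_word w = map flip w"
  by (simp add: sigma_word_def flip_def)

lemma flip_eq_iff: "flip x = flip y \<longleftrightarrow> x = y"
  by (metis flip_flip)

lemma sigma_cancel_letter: "sigma_word (cancel_letter x w) = cancel_letter (flip x) (sigma_word w)"
  by (cases w) (auto simp: sigma_word_flip cancel_letter_Cons flip_eq_iff)

lemma sigma_foldr: "sigma_word (foldr cancel_letter u v) = foldr cancel_letter (sigma_word u) (sigma_word v)"
  by (induction u) (simp_all add: sigma_cancel_letter, simp_all add: sigma_word_flip)

lemma reduced_sigma_word: "reduced_word w \<Longrightarrow> reduced_word (sigma_word w)"
proof (induction w)
  case (Cons x w)
  then show ?case by (cases w) (auto simp: sigma_word_flip flip_eq_iff)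
qed (simp add: sigma_word_flip)

lemma sigma_sigma_word: "sigma_word (sigma_word w) = w"
  by (simp add: sigma_word_flip map_idI)

lemma sigma_word_closed: "w \<in> carrier (free_grp g) \<Longrightarrow> sigma_word w \<in> carrier (free_grp g)"
  using reduced_sigma_word by (force simp: free_grp_carrier sigma_word_def)

lemma sigma_word_hom: "sigma_word \<in> hom (free_grp g) (free_grp g)"
  by (rule homI) (auto simp: sigma_word_closed free_grp_mult reduced_sigma_word sigma_foldr dest!: free_grp_carrier[THEN iffD1])

lemma (in group_hom) hom_eq_on_generate:
  assumes "k \<in> hom G H" "S \<subseteq> carrier G" "\<And>s. s \<in> S \<Longrightarrow> h s = k s" "x \<in> generate G S"
  shows "h x = k x"
proof -
  interpret k: group_hom G H k by unfold_locales fact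
  show ?thesis using assms(4)
  proof (induction rule: generate.induct)
    case (inv s)
    then show ?case using assms(2,3) by auto
  next
    case (eng a b)
    then have "a \<in> carrier G" "b \<in> carrier G" using G.generate_in_carrier[OF assms(2)] by auto
    then show ?case using eng by simp
  qed (use assms in auto)
qed

section \<open>Finite index, prime power order and the Frattini subgroup\<close>

context group
begin

text \<open>Phrased by a finite covering set, which may meet a coset repeatedly: only finiteness is
  handed from one term of the series to the next, and covering sets are easily multiplied.\<close>

definition finite_index :: "'a set \<Rightarrow> bool" where
  "finite_index W \<longleftrightarrow> (\<exists>T. finite T \<and> T \<subseteq> carrier G \<and> (\<forall>x\<in>carrier G. \<exists>w\<in>W. \<exists>t\<in>T. x = w \<otimes> t))"

text \<open>Schreier's argument: the elements \<open>t x s(tx)\<inverse>\<close> generate a subgroup \<open>C\<close> of finite index;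
  then the finitely many generators of \<open>C\<close> modulo \<open>N\<^sup>*\<close> are removed one at a time.\<close>

lemma finite_index_pstar:
  assumes S: "finite S" "S \<subseteq> carrier G" "carrier G = generate G S"
    and N: "N \<lhd> G" "finite_index N" and p: "p > 0"
  shows "finite_index (pstar p G N)"
proof -
  interpret N: normal N G by fact
  obtain T where T: "finite T" "T \<subseteq> carrier G" "\<And>x. x \<in> carrier G \<Longrightarrow> \<exists>w\<in>N. \<exists>t\<in>T. x = w \<otimes> t"
    using N(2) unfolding finite_index_def by blast
  \<comment> \<open>The representative in \<open>T\<close> of the coset of \<open>N\<close> through
    \<open>x\<close>.\<close>
  define s where "s x = (SOME t. t \<in> T \<and> x \<otimes> inv t \<in> N)" for x
  have s: "s x \<in> T" "x \<otimes> inv (s x) \<in> N" "s x \<in> carrier G" if x: "x \<in> carrier G" for x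
  proof -
    obtain w t where "w \<in> N" "t \<in> T" "x = w \<otimes> t" using T(3)[OF x] by blast
    then have "\<exists>t. t \<in> T \<and> x \<otimes> inv t \<in> N" using T(2) by (auto simp: m_assoc intro!: exI[of _ t])
    then have "s x \<in> T \<and> x \<otimes> inv (s x) \<in> N" unfolding s_def by (rule someI_ex)
    then show "s x \<in> T" "x \<otimes> inv (s x) \<in> N" "s x \<in> carrier G" using T(2) by auto
  qed
  define B where "B = (\<lambda>(t, x). t \<otimes> x \<otimes> inv (s (t \<otimes> x))) ` (T \<times> (S \<union> m_inv G ` S))"
  have finB: "finite B" unfolding B_def using T S by auto
  have BN: "B \<subseteq> N" unfolding B_def using T(2) S(2) by (auto intro!: s(2))
  let ?C = "\<lambda>B. generate G (B \<union> pstar p G N)"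
  have pc: "pstar p G N \<subseteq> N" using pstar_subset[OF N(1)] .
  have C: "subgroup (?C B') G" "pstar p G N \<subseteq> ?C B'" "?C B' \<subseteq> N" if "B' \<subseteq> N" for B'
  proof -
    show "subgroup (?C B') G" using that pc N.subset by (intro generate_is_subgroup) auto
    show "pstar p G N \<subseteq> ?C B'" by (auto intro: generate.incl)
    show "?C B' \<subseteq> N" using that pc by (intro generate_subgroup_incl N.subgroup_axioms) auto
  qed
  interpret C: subgroup "?C B" G using C(1)[OF BN] .
  \<comment> \<open>The product CT is stable under right multiplication by the generators and their
    inverses, hence by all of G, so it exhausts G and C has finite index.\<close>
  define Z where "Z = {c \<otimes> t | c t. c \<in> ?C B \<and> t \<in> T}"
  have Zc: "Z \<subseteq> carrier G" unfolding Z_def using T(2) by auto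
  have step: "z \<otimes> x \<in> Z" if z: "z \<in> Z" and x: "x \<in> S \<union> m_inv G ` S" for z x
  proof -
    obtain c t where ct: "c \<in> ?C B" "t \<in> T" "z = c \<otimes> t" using z Z_def by blast
    have xc: "x \<in> carrier G" "t \<in> carrier G" using x S(2) ct(2) T(2) by auto
    have "t \<otimes> x \<otimes> inv (s (t \<otimes> x)) \<in> ?C B" using ct x by (intro generate.incl) (auto simp: B_def)
    then have "c \<otimes> (t \<otimes> x \<otimes> inv (s (t \<otimes> x))) \<in> ?C B" using ct(1) by simp
    moreover have "z \<otimes> x = c \<otimes> (t \<otimes> x \<otimes> inv (s (t \<otimes> x))) \<otimes> s (t \<otimes> x)"
      using ct xc s(3)[of "t \<otimes> x"] by (simp add: m_assoc)
    ultimately show ?thesis unfolding Z_def using s(1)[of "t \<otimes> x"] xc by blast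
  qed
  have stepn: "\<forall>z\<in>Z. z \<otimes> x \<in> Z" if "x \<in> generate G S" for x
    using that
  proof (induction rule: generate.induct)
    case one
    then show ?case using Zc by auto
  next
    case (eng a b)
    have "a \<in> carrier G" "b \<in> carrier G" using eng generate_in_carrier[OF S(2)] by auto
    then show ?case using eng Zc by (metis m_assoc subsetD)
  qed (use step in auto)
  have fi: "finite_index (?C B)"
    unfolding finite_index_def
  proof (intro exI[of _ T] conjI ballI)
    fix x assume x: "x \<in> carrier G"
    obtain t where t: "t \<in> T" using s(1)[OF x] by blast
    have tc: "t \<in> carrier G" using t T by auto
    have "\<one> \<otimes> t \<in> Z" unfolding Z_def using t C.one_closed by blast
    moreover have "inv t \<otimes> x \<in> generate G S" using S(3) x tc by auto
    ultimately have "\<one> \<otimes> t \<otimes> (inv t \<otimes> x) \<in> Z" using stepn by blast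
    then have "x \<in> Z" using x tc by simp
    then show "\<exists>w\<in>?C B. \<exists>t\<in>T. x = w \<otimes> t" unfolding Z_def by blast
  qed (use T in auto)
  have "finite_index (?C B) \<Longrightarrow> finite_index (?C {})" using finB BN
  proof (induction B rule: finite_induct)
    case (insert b B)
    have bN: "b \<in> N" "B \<subseteq> N" using insert by auto
    have bc: "b \<in> carrier G" using bN by simp
    have CB: "?C B \<lhd> G" using between_normal C[OF bN(2)] by blast
    have bp: "b [^] p \<in> ?C B" using pow_in_pstar[OF bN(1)] C(2)[OF bN(2)] by blast
    have sub: "?C (insert b B) \<subseteq> generate G (insert b (?C B))"
    proof (rule generate_subgroup_incl)
      show "insert b B \<union> pstar p G N \<subseteq> generate G (insert b (?C B))"
        by (auto intro!: generate.incl)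
      show "subgroup (generate G (insert b (?C B))) G"
        using bc C(3)[OF bN(2)] N.subset by (intro generate_is_subgroup) auto
    qed
    obtain T where T: "finite T" "T \<subseteq> carrier G" "\<And>x. x \<in> carrier G \<Longrightarrow> \<exists>w\<in>?C (insert b B). \<exists>t\<in>T. x = w \<otimes> t"
      using insert.prems(1) unfolding finite_index_def by blast
    \<comment> \<open>Dropping \<open>b\<close> splits each coset into at most p pieces, so the
      covering set becomes the set of products b^j t with j < p.\<close>
    have "finite_index (?C B)"
      unfolding finite_index_def
    proof (intro exI[of _ "(\<lambda>(j, t). b [^] (j::nat) \<otimes> t) ` ({..<p} \<times> T)"] conjI ballI)
      fix x assume "x \<in> carrier G"
      then obtain w t where wt: "w \<in> ?C (insert b B)" "t \<in> T" "x = w \<otimes> t" using T(3) by blast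
      then have "w \<in> (\<lambda>(w, j). w \<otimes> b [^] j) ` (?C B \<times> {..<p})"
        using sub generate_insert_normal[OF CB bc bp p] by blast
      then obtain v j where vj: "v \<in> ?C B" "j < p" "w = v \<otimes> b [^] j" by auto
      have "v \<in> carrier G" "t \<in> carrier G" using wt(2) vj(1) T(2) C(3)[OF bN(2)] N.subset by auto
      then have "x = v \<otimes> (b [^] j \<otimes> t)" using wt(3) vj(3) bc by (simp add: m_assoc)
      then show "\<exists>w\<in>?C B. \<exists>t\<in>(\<lambda>(j, t). b [^] (j::nat) \<otimes> t) ` ({..<p} \<times> T). x = w \<otimes> t"
        using vj wt by (intro bexI[of _ v] bexI[of _ "b [^] j \<otimes> t"]) auto
    qed (use T bc in auto)
    then show ?case using insert by auto
  qed simp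
  moreover have "?C {} = pstar p G N"
    using generate_subgroup_incl[OF order_refl pstar_subgroup[OF N.subset]] by (auto intro: generate.incl)
  ultimately show ?thesis using fi by simp
qed

lemma finite_index_lpc:
  assumes "finite S" "S \<subseteq> carrier G" "carrier G = generate G S" "p > 0"
  shows "finite_index (lpc p G n)"
proof (induction n)
  case 0
  show ?case unfolding finite_index_def by (intro exI[of _ "{\<one>}"]) auto
next
  case (Suc n)
  then show ?case using finite_index_pstar[OF assms(1-3) lpc_normal Suc assms(4)] by simp
qed

text \<open>A further prime q in the order would by Sylow's theorem give a subgroup of order q; a
  nontrivial element of it would be killed by the coprime exponents q and p^k.\<close>

lemma card_exponent_prime_power:
  assumes fin: "finite (carrier G)" and p: "prime (p::nat)"
    and ex: "\<And>x. x \<in> carrier G \<Longrightarrow> x [^] (p ^ k) = \<one>"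
  shows "\<exists>n. card (carrier G) = p ^ n"
proof -
  let ?N = "card (carrier G)"
  have N0: "?N \<noteq> 0" using fin by auto
  have "\<not> is_unit p" using p by auto
  then obtain r where r: "?N = p ^ multiplicity p ?N * r" "\<not> p dvd r"
    using multiplicity_decompose'[OF N0] by metis
  have "r = 1"
  proof (rule ccontr)
    assume "r \<noteq> 1"
    then obtain q where q: "prime q" "q dvd r" using prime_factor_nat by blast
    then obtain u where "r = q * u" by blast
    then have "order G = q ^ 1 * (p ^ multiplicity p ?N * u)" using r by (simp add: order_def mult.left_commute)
    then obtain H where H: "subgroup H G" "card H = q"
      using sylow_thm[OF q(1) group_axioms _ fin] by (metis power_one_right)
    interpret H: subgroup H G by fact
    have "q > 1" using q prime_gt_1_nat by blast
    have "H \<noteq> {\<one>}" using H(2) \<open>q > 1\<close> by auto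
    then obtain x where x: "x \<in> H" "x \<noteq> \<one>" using H.one_closed by blast
    interpret GH: group "G\<lparr>carrier := H\<rparr>" by (rule H.subgroup_is_group[OF group_axioms])
    have "x [^] q = \<one>"
      using GH.pow_order_eq_1[of x] x H(2) by (simp add: order_def nat_pow_consistent[symmetric])
    moreover have "coprime q (p ^ k)"
      using p q r(2) by (metis coprime_power_right_iff primes_coprime)
    ultimately have "x \<in> {\<one>}"
      using pow_coprime_mem[OF triv_subgroup, of x q "p ^ k"] ex x by simp
    then show False using x by simp
  qed
  then show ?thesis using r by auto
qed

lemma card_prime_power:
  assumes "finite (carrier G)" "prime p" "lpc p G c = {\<one>}"
  shows "\<exists>n. card (carrier G) = p ^ n"
  using card_exponent_prime_power[OF assms(1,2), of c] lpc_pow[of _ p c] assms(3) by auto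

text \<open>P_1 consists of non-generators and so lies in every maximal subgroup. Conversely, an
  element outside P_1 is detected by a character, and the kernel of that character is a maximal
  subgroup avoiding it.\<close>

lemma frattini_eq_lpc:
  assumes fin: "finite (carrier G)" and p: "prime p" and c: "lpc p G c = {\<one>}"
  shows "frattini G = lpc p G 1"
proof (intro equalityI subsetI)
  fix x assume x: "x \<in> lpc p G 1"
  have "x \<in> H" if H: "subgroup H G" "H \<noteq> carrier G"
    and max: "\<forall>K. subgroup K G \<and> H \<subseteq> K \<longrightarrow> K = H \<or> K = carrier G" for H
  proof -
    let ?K = "generate G (H \<union> lpc p G 1)"
    have Hc: "H \<subseteq> carrier G" using H subgroup.subset by blast
    have K: "subgroup ?K G" using Hc lpc_carrier by (intro generate_is_subgroup) blast
    moreover have sub: "H \<subseteq> ?K" "lpc p G 1 \<subseteq> ?K" by (auto intro: generate.incl)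
    ultimately have "?K = H \<or> ?K = carrier G" using max by blast
    moreover have "?K \<noteq> carrier G"
    proof
      assume "?K = carrier G"
      then have "H = carrier G"
        using frattini_argument[OF fin c normal_self H(1) Hc] by simp
      then show False using H by simp
    qed
    ultimately show ?thesis using sub x by blast
  qed
  then show "x \<in> frattini G" using x lpc_carrier unfolding frattini_def by blast
next
  fix x assume x: "x \<in> frattini G"
  show "x \<in> lpc p G 1"
  proof (rule ccontr)
    assume nx: "x \<notin> lpc p G 1"
    have xc: "x \<in> carrier G" using x by (simp add: frattini_def)
    obtain \<phi> where \<phi>: "\<phi> \<in> chars p G (carrier G) (lpc p G 1)" "\<phi> x \<noteq> 0"
      using char_separates[OF p fin normal_self lpc_subgroup[of p 1] _ lpc_carrier xc nx] by auto
    define H where "H = {y \<in> carrier G. \<phi> y = 0}"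
    have H: "subgroup H G"
      by (rule subgroupI)
        (auto simp: H_def char_inv[OF \<phi>(1) _ subgroup_self] char_mult[OF \<phi>(1) _ _ subgroup_self]
          intro!: exI[of _ \<one>] char_one[OF \<phi>(1) subgroup_self])
    have "K = H \<or> K = carrier G" if K: "subgroup K G" "H \<subseteq> K" for K
    proof (cases "K = H")
      case False
      interpret K: subgroup K G by fact
      obtain y where y: "y \<in> K" "y \<notin> H" using False K by blast
      have y0: "\<phi> y \<noteq> 0" "\<phi> y \<in> {0..<int p}" using y char_range[OF \<phi>(1)] by (auto simp: H_def)
      then have "\<not> int p dvd \<phi> y" by (auto dest: zdvd_imp_le)
      then have "gcd (\<phi> y) (int p) = 1"
        using p by (metis coprime_commute coprime_imp_gcd_eq_1 prime_imp_coprime prime_nat_int_transfer)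
      then obtain v v' where v: "v * \<phi> y + v' * int p = 1" using bezout_int by metis
      \<comment> \<open>\<open>v\<close> inverts \<phi>(y) modulo p, so y^n with n = v \<phi>(z) has
        the same character value as z and differs from it by an element of H.\<close>
      have "z \<in> K" if z: "z \<in> carrier G" for z
      proof -
        define n where "n = nat ((v * \<phi> z) mod int p)"
        have "int n = (v * \<phi> z) mod int p" using p prime_gt_0_nat by (simp add: n_def)
        then have "int n * \<phi> y mod int p = (v * \<phi> z) * \<phi> y mod int p" by (simp add: mod_mult_left_eq)
        also have "(v * \<phi> z) * \<phi> y = \<phi> z * (v * \<phi> y)" by simp
        also have "\<dots> = \<phi> z * (1 - v' * int p)" using v by (metis add_diff_cancel_right')
        also have "\<dots> = \<phi> z + int p * (- (\<phi> z * v'))" by (simp add: algebra_simps)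
        also have "\<dots> mod int p = \<phi> z mod int p" by (rule mod_mult_self2)
        finally have e: "\<phi> (y [^] n) = \<phi> z"
          using char_pow[OF \<phi>(1) _ subgroup_self] y char_mod[OF \<phi>(1)] z by simp
        have "\<phi> (z \<otimes> inv (y [^] n)) = 0"
          using char_mult[OF \<phi>(1) z _ subgroup_self, of "inv (y [^] n)"] char_inv[OF \<phi>(1) _ subgroup_self, of "y [^] n"] e y
          by (simp add: mod_simps)
        then have "z \<otimes> inv (y [^] n) \<in> K" using K(2) z y by (auto simp: H_def)
        moreover have "y [^] n \<in> K" using subgroup_nat_pow_closed[OF K(1) y(1)] .
        ultimately have "z \<otimes> inv (y [^] n) \<otimes> y [^] n \<in> K" by simp
        then show ?thesis using z y by (simp add: m_assoc)
      qed
      then show ?thesis using K.subset by blast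
    qed simp
    moreover have "H \<noteq> carrier G" using \<phi>(2) xc by (auto simp: H_def)
    ultimately have "x \<in> H" using x H unfolding frattini_def by blast
    then show False using \<phi>(2) by (simp add: H_def)
  qed
qed

end

section \<open>Relatively free groups of bounded \<open>p\<close>-class\<close>

definition Fproj :: "nat \<Rightarrow> nat \<Rightarrow> nat \<Rightarrow> (nat \<times> bool) list \<Rightarrow> (nat \<times> bool) list set" where
  "Fproj p g m w = lpc p (free_grp g) m #>\<^bsub>free_grp g\<^esub> w"

definition Fgen :: "nat \<Rightarrow> nat \<Rightarrow> nat \<Rightarrow> nat \<Rightarrow> (nat \<times> bool) list set" where
  "Fgen p g m i = Fproj p g m [(i, True)]"

lemma Fc_alt: "Fc p g m = free_grp g Mod lpc p (free_grp g) m"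
  by (simp add: Fc_def group.plcs_discrete[OF group_free_grp])

lemma group_Fc: "group (Fc p g m)"
  unfolding Fc_alt by (rule normal.factorgroup_is_group[OF group.lpc_normal[OF group_free_grp]])

lemma Fproj_hom: "Fproj p g m \<in> hom (free_grp g) (Fc p g m)"
  unfolding Fc_alt Fproj_def[abs_def] by (rule normal.r_coset_hom_Mod[OF group.lpc_normal[OF group_free_grp]])

lemma group_hom_Fproj: "group_hom (free_grp g) (Fc p g m) (Fproj p g m)"
  by (simp add: group_hom_def group_hom_axioms_def group_free_grp group_Fc Fproj_hom)

lemma Fproj_surj: "Fproj p g m ` carrier (free_grp g) = carrier (Fc p g m)"
  by (simp add: Fc_alt carrier_FactGroup Fproj_def[abs_def])

lemma Fproj_eq_one_iff:
  assumes "w \<in> carrier (free_grp g)"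
  shows "Fproj p g m w = \<one>\<^bsub>Fc p g m\<^esub> \<longleftrightarrow> w \<in> lpc p (free_grp g) m"
proof -
  interpret F: group "free_grp g" by (rule group_free_grp)
  show ?thesis
    unfolding Fproj_def Fc_alt one_FactGroup
    using F.coset_join1[OF _ assms F.lpc_subgroup] F.coset_join2[OF assms F.lpc_subgroup] by metis
qed

lemma Fproj_eq_iff_mem:
  assumes "w \<in> carrier (free_grp g)" "v \<in> carrier (free_grp g)"
  shows "Fproj p g m w = Fproj p g m v \<longleftrightarrow> w \<in> Fproj p g m v"
proof -
  interpret F: group "free_grp g" by (rule group_free_grp)
  show ?thesis
    unfolding Fproj_def
    using F.repr_independence[OF _ assms(2) F.lpc_subgroup] F.rcos_self[OF assms(1) F.lpc_subgroup] by blast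
qed

lemma lpc_Fc: "lpc p (Fc p g m) m = {\<one>\<^bsub>Fc p g m\<^esub>}"
proof -
  interpret P: group_hom "free_grp g" "Fc p g m" "Fproj p g m" by (rule group_hom_Fproj)
  have "lpc p (Fc p g m) m = Fproj p g m ` lpc p (free_grp g) m"
    using P.lpc_img[OF Fproj_surj] by simp
  also have "\<dots> = {\<one>\<^bsub>Fc p g m\<^esub>}"
    using Fproj_eq_one_iff[of _ g p m] P.G.lpc_carrier subgroup.one_closed[OF P.G.lpc_subgroup] by blast
  finally show ?thesis .
qed

lemma Fgen_closed: "i < g \<Longrightarrow> Fgen p g m i \<in> carrier (Fc p g m)"
  unfolding Fgen_def using Fproj_surj gen_in_free_grp by blast

lemma Fc_generated: "generate (Fc p g m) (Fgen p g m ` {..<g}) = carrier (Fc p g m)"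
proof -
  interpret P: group_hom "free_grp g" "Fc p g m" "Fproj p g m" by (rule group_hom_Fproj)
  have "Fgen p g m ` {..<g} = Fproj p g m ` (\<lambda>i. [(i, True)]) ` {..<g}" by (auto simp: Fgen_def)
  moreover have "(\<lambda>i. [(i, True)]) ` {..<g} \<subseteq> carrier (free_grp g)" by (auto simp: gen_in_free_grp)
  ultimately show ?thesis
    using P.generate_img[symmetric, of "(\<lambda>i. [(i, True)]) ` {..<g}"] free_grp_generated[of g] Fproj_surj[of p g m]
    by metis
qed

lemma Fc_hom_unique:
  assumes "\<psi> \<in> hom (Fc p g m) E" "\<psi>' \<in> hom (Fc p g m) E" "group E"
    "\<And>i. i < g \<Longrightarrow> \<psi> (Fgen p g m i) = \<psi>' (Fgen p g m i)" "x \<in> carrier (Fc p g m)"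
  shows "\<psi> x = \<psi>' x"
proof -
  interpret group_hom "Fc p g m" E \<psi>
    using assms by (simp add: group_hom_def group_hom_axioms_def group_Fc)
  show ?thesis
  proof (rule hom_eq_on_generate[OF assms(2)])
    show "x \<in> generate (Fc p g m) (Fgen p g m ` {..<g})" using assms(5) Fc_generated by simp
  qed (use assms(4) Fgen_closed in auto)
qed

lemma Fc_lift_hom:
  assumes E: "group E" and \<rho>: "\<rho> \<in> hom (free_grp g) E" and m: "\<rho> ` lpc p (free_grp g) m \<subseteq> {\<one>\<^bsub>E\<^esub>}"
  shows "\<exists>\<psi> \<in> hom (Fc p g m) E. \<forall>w \<in> carrier (free_grp g). \<psi> (Fproj p g m w) = \<rho> w"
proof -
  interpret R: group_hom "free_grp g" E \<rho>
    using assms by (simp add: group_hom_def group_hom_axioms_def group_free_grp)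
  have "lpc p (free_grp g) m \<subseteq> kernel (free_grp g) E \<rho>"
    using m R.G.lpc_carrier by (auto simp: kernel_def)
  from R.FactGroup_universal_kernel[OF R.G.lpc_normal this]
  show ?thesis unfolding Fc_alt Fproj_def by metis
qed

text \<open>Freeness among groups of class at most m: a homomorphism from the free group maps P_m
  into P_m(E) = 1.\<close>

lemma Fc_universal:
  assumes E: "group E" and m: "lpc p E m = {\<one>\<^bsub>E\<^esub>}" and e: "e \<in> {..<g} \<rightarrow> carrier E"
  shows "\<exists>\<psi> \<in> hom (Fc p g m) E. \<forall>i<g. \<psi> (Fgen p g m i) = e i"
proof -
  interpret E: group E by fact
  have \<rho>: "word_val E e \<in> hom (free_grp g) E" by (rule E.word_val_hom[OF e])
  interpret R: group_hom "free_grp g" E "word_val E e"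
    using E \<rho> by (simp add: group_hom_def group_hom_axioms_def group_free_grp)
  have "word_val E e ` lpc p (free_grp g) m \<subseteq> {\<one>\<^bsub>E\<^esub>}" using R.lpc_img_subset[of p m] m by simp
  from Fc_lift_hom[OF E \<rho> this] obtain \<psi> where
    "\<psi> \<in> hom (Fc p g m) E" "\<forall>w \<in> carrier (free_grp g). \<psi> (Fproj p g m w) = word_val E e w" by blast
  then show ?thesis using E.word_val_gen[OF e] gen_in_free_grp by (auto simp: Fgen_def intro!: bexI[of _ \<psi>])
qed

lemma finite_Fc:
  assumes "p > 0" shows "finite (carrier (Fc p g m))"
proof -
  interpret F: group "free_grp g" by (rule group_free_grp)
  have "F.finite_index (lpc p (free_grp g) m)"
    by (rule F.finite_index_lpc[OF _ _ free_grp_generated assms]) (auto simp: gen_in_free_grp)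
  then obtain T where T: "finite T" "T \<subseteq> carrier (free_grp g)"
    "\<And>x. x \<in> carrier (free_grp g) \<Longrightarrow> \<exists>w\<in>lpc p (free_grp g) m. \<exists>t\<in>T. x = w \<otimes>\<^bsub>free_grp g\<^esub> t"
    unfolding F.finite_index_def by blast
  have "carrier (Fc p g m) \<subseteq> Fproj p g m ` T"
  proof
    fix C assume "C \<in> carrier (Fc p g m)"
    then obtain x where x: "x \<in> carrier (free_grp g)" "C = Fproj p g m x" using Fproj_surj by blast
    then obtain w t where "w \<in> lpc p (free_grp g) m" "t \<in> T" "x = w \<otimes>\<^bsub>free_grp g\<^esub> t" using T(3) by blast
    then have "x \<in> Fproj p g m t" "t \<in> carrier (free_grp g)" using T(2) by (auto simp: Fproj_def r_coset_def)
    then have "C = Fproj p g m t" using Fproj_eq_iff_mem x by blast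
    then show "C \<in> Fproj p g m ` T" using \<open>t \<in> T\<close> by blast
  qed
  then show ?thesis using T(1) finite_subset by blast
qed

text \<open>\<open>sigma_word\<close> is onto, so it maps P_m onto itself and cosets onto
  cosets.\<close>

lemma sigma_Fc_Fproj:
  assumes w: "w \<in> carrier (free_grp g)"
  shows "sigma_Fc (Fproj p g m w) = Fproj p g m (sigma_word w)"
proof -
  interpret S: group_hom "free_grp g" "free_grp g" sigma_word
    by (simp add: group_hom_def group_hom_axioms_def group_free_grp sigma_word_hom)
  have "sigma_word ` carrier (free_grp g) = carrier (free_grp g)"
    using sigma_word_closed sigma_sigma_word by (metis (no_types, lifting) image_subsetI image_eqI subsetI subset_antisym)
  then have L: "sigma_word ` lpc p (free_grp g) m = lpc p (free_grp g) m"
    using S.lpc_img by blast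
  have hm: "sigma_word (h \<otimes>\<^bsub>free_grp g\<^esub> w) = sigma_word h \<otimes>\<^bsub>free_grp g\<^esub> sigma_word w"
    if "h \<in> lpc p (free_grp g) m" for h
    using that w subsetD[OF S.G.lpc_carrier] by simp
  have "sigma_Fc (Fproj p g m w) = (\<lambda>h. h \<otimes>\<^bsub>free_grp g\<^esub> sigma_word w) ` sigma_word ` lpc p (free_grp g) m"
    unfolding sigma_Fc_def Fproj_def r_coset_def using hm by (auto simp: image_iff)
  then show ?thesis unfolding L Fproj_def r_coset_def by auto
qed

lemma sigma_Fc_hom: "sigma_Fc \<in> hom (Fc p g m) (Fc p g m)"
proof (rule homI)
  interpret P: group_hom "free_grp g" "Fc p g m" "Fproj p g m" by (rule group_hom_Fproj)
  fix C D assume "C \<in> carrier (Fc p g m)" "D \<in> carrier (Fc p g m)"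
  then obtain u v where uv: "u \<in> carrier (free_grp g)" "v \<in> carrier (free_grp g)" "C = Fproj p g m u" "D = Fproj p g m v"
    unfolding Fproj_surj[symmetric] by blast
  then show "sigma_Fc C \<in> carrier (Fc p g m)" by (simp add: sigma_Fc_Fproj sigma_word_closed)
  have "sigma_Fc (C \<otimes>\<^bsub>Fc p g m\<^esub> D) = sigma_Fc (Fproj p g m (u \<otimes>\<^bsub>free_grp g\<^esub> v))" using uv by simp
  also have "\<dots> = Fproj p g m (sigma_word u \<otimes>\<^bsub>free_grp g\<^esub> sigma_word v)"
    by (simp only: sigma_Fc_Fproj[OF P.G.m_closed[OF uv(1,2)]] hom_mult[OF sigma_word_hom uv(1,2)])
  finally show "sigma_Fc (C \<otimes>\<^bsub>Fc p g m\<^esub> D) = sigma_Fc C \<otimes>\<^bsub>Fc p g m\<^esub> sigma_Fc D"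
    using uv by (simp add: sigma_Fc_Fproj sigma_word_closed)
qed

lemma sigma_sigma_Fc: "sigma_Fc (sigma_Fc C) = C"
  by (simp add: sigma_Fc_def image_image sigma_sigma_word)

lemma sigma_Fc_gen: "i < g \<Longrightarrow> sigma_Fc (Fgen p g m i) = inv\<^bsub>Fc p g m\<^esub> Fgen p g m i"
proof -
  interpret P: group_hom "free_grp g" "Fc p g m" "Fproj p g m" by (rule group_hom_Fproj)
  assume i: "i < g"
  have "sigma_word [(i, True)] = inv\<^bsub>free_grp g\<^esub> [(i, True)]"
    using inv_gen_free_grp[OF i] by (simp add: sigma_word_def)
  then show ?thesis
    using gen_in_free_grp[OF i] by (simp add: Fgen_def sigma_Fc_Fproj)
qed

lemma card_Fc: "prime p \<Longrightarrow> \<exists>n. card (carrier (Fc p g m)) = p ^ n"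
  using group.card_prime_power[OF group_Fc finite_Fc _ lpc_Fc] prime_gt_0_nat by blast

lemma involution_group_Fc:
  assumes "prime p" "odd p" shows "involution_group (Fc p g m) sigma_Fc"
proof -
  have "odd (card (carrier (Fc p g m)))" using card_Fc[OF assms(1), of g m] assms(2) by auto
  then show ?thesis
    using finite_Fc[of p g m] assms prime_gt_0_nat[of p]
    by (simp add: involution_group_def involution_group_axioms_def group_Fc sigma_Fc_hom sigma_sigma_Fc)
qed

lemma Xc_alt:
  assumes "prime p" shows "Xc p g m = inverted (Fc p g m) sigma_Fc (lpc p (Fc p g m) 1)"
  using group.frattini_eq_lpc[OF group_Fc finite_Fc assms lpc_Fc] prime_gt_0_nat[OF assms]
  by (simp add: Xc_def inverted_def)

text \<open>\<open>lpc p G 1\<close> stands for the Frattini subgroup from here on and has to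
  survive simplification, which rewrites 1 to \<open>Suc 0\<close>.\<close>

declare lpc.simps(2) [simp del]

lemma lpc_1: "lpc p G (Suc 0) = pstar p G (carrier G)"
  by (simp add: lpc.simps)

section \<open>Normal closures and generation modulo the Frattini subgroup\<close>

context group
begin

lemma cl_ncl_discrete:
  assumes "S \<subseteq> carrier G"
  shows "cl_ncl G (discrete_topology (carrier G)) S = generate G {x \<otimes> s \<otimes> inv x | x s. x \<in> carrier G \<and> s \<in> S}"
proof -
  have "generate G {x \<otimes> s \<otimes> inv x | x s. x \<in> carrier G \<and> s \<in> S} \<subseteq> carrier G"
    using assms by (intro generate_incl) auto
  then show ?thesis by (simp add: cl_ncl_def discrete_topology_closure_of inf_absorb2)
qed

lemma ncl_normal:
  assumes "S \<subseteq> carrier G"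
  shows "generate G {x \<otimes> s \<otimes> inv x | x s. x \<in> carrier G \<and> s \<in> S} \<lhd> G"
proof (rule normal_generateI)
  show "{x \<otimes> s \<otimes> inv x | x s. x \<in> carrier G \<and> s \<in> S} \<subseteq> carrier G" using assms by auto
next
  fix h y assume "h \<in> {x \<otimes> s \<otimes> inv x | x s. x \<in> carrier G \<and> s \<in> S}" and y: "y \<in> carrier G"
  then obtain x s where h: "x \<in> carrier G" "s \<in> S" "h = x \<otimes> s \<otimes> inv x" by blast
  then have "y \<otimes> h \<otimes> inv y = (y \<otimes> x) \<otimes> s \<otimes> inv (y \<otimes> x)"
    using assms y by (auto simp: m_assoc inv_mult_group subset_iff)
  then show "y \<otimes> h \<otimes> inv y \<in> {x \<otimes> s \<otimes> inv x | x s. x \<in> carrier G \<and> s \<in> S}"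
    using h y by blast
qed

lemma ncl_incl:
  assumes "S \<subseteq> carrier G" "s \<in> S"
  shows "s \<in> generate G {x \<otimes> s \<otimes> inv x | x s. x \<in> carrier G \<and> s \<in> S}"
proof (rule generate.incl)
  have "s = \<one> \<otimes> s \<otimes> inv \<one>" using assms by auto
  then show "s \<in> {x \<otimes> s \<otimes> inv x | x s. x \<in> carrier G \<and> s \<in> S}" using assms(2) by blast
qed

lemma ncl_least:
  assumes "M \<lhd> G" "S \<subseteq> M"
  shows "generate G {x \<otimes> s \<otimes> inv x | x s. x \<in> carrier G \<and> s \<in> S} \<subseteq> M"
proof (rule generate_subgroup_incl)
  interpret M: normal M G by fact
  show "{x \<otimes> s \<otimes> inv x | x s. x \<in> carrier G \<and> s \<in> S} \<subseteq> M"
    using assms(2) M.inv_op_closed2 by blast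
  show "subgroup M G" by (rule M.subgroup_axioms)
qed

text \<open>This turns normal generation into linear algebra: conjugate elements of N agree modulo
  \<open>pstar p G N\<close>, and \<open>frattini_argument\<close> lifts generation modulo that
  subgroup back to N.\<close>

lemma ncl_eq_iff:
  assumes fin: "finite (carrier G)" and c: "lpc p G c = {\<one>}" and N: "N \<lhd> G" and S: "S \<subseteq> N"
  shows "generate G {x \<otimes> s \<otimes> inv x | x s. x \<in> carrier G \<and> s \<in> S} = N \<longleftrightarrow>
    generate G (S \<union> pstar p G N) = N"
proof -
  interpret N: normal N G by fact
  let ?M = "generate G {x \<otimes> s \<otimes> inv x | x s. x \<in> carrier G \<and> s \<in> S}"
  let ?L = "generate G (S \<union> pstar p G N)"
  have Sc: "S \<subseteq> carrier G" using S N.subset by blast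
  have pN: "pstar p G N \<subseteq> N" by (rule pstar_subset[OF N])
  have L: "subgroup ?L G" using Sc pN N.subset by (intro generate_is_subgroup) blast
  have LN: "?L \<subseteq> N" using S pN by (intro generate_subgroup_incl N.subgroup_axioms) auto
  have "?L \<lhd> G" using between_normal[OF L _ LN] by (auto intro: generate.incl)
  then have "?M \<subseteq> ?L" by (rule ncl_least) (auto intro: generate.incl)
  moreover have "?M = N" if "?L = N"
  proof (rule frattini_argument[OF fin c N])
    show "subgroup ?M G" using ncl_normal[OF Sc] normal_imp_subgroup by blast
    show "?M \<lhd> G \<or> N = carrier G" using ncl_normal[OF Sc] by blast
    show "?M \<subseteq> N" by (rule ncl_least[OF N S])
    have "S \<union> pstar p G N \<subseteq> ?M \<union> pstar p G N" using ncl_incl[OF Sc] by blast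
    then have "?L \<subseteq> generate G (?M \<union> pstar p G N)"
      using \<open>?M \<subseteq> N\<close> pN N.subset by (intro mono_generate) auto
    then show "N \<subseteq> generate G (?M \<union> pstar p G N)" using that by simp
  qed
  ultimately show ?thesis using LN by blast
qed

text \<open>The quotient by D is abelian, so x \<mapsto> \<sigma>(x) x is multiplicative modulo D
  and it suffices to know it on generators.\<close>

lemma inverts_mod_of_generators:
  assumes "\<sigma> \<in> hom G G" and D: "D \<lhd> G" "\<And>x y. x \<in> carrier G \<Longrightarrow> y \<in> carrier G \<Longrightarrow> x \<otimes> y \<otimes> inv x \<otimes> inv y \<in> D"
    and S: "S \<subseteq> carrier G" "carrier G = generate G S" "\<And>s. s \<in> S \<Longrightarrow> \<sigma> s = inv s" and x: "x \<in> carrier G"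
  shows "\<sigma> x \<otimes> x \<in> D"
proof -
  interpret s: group_hom G G \<sigma> by unfold_locales fact
  interpret D: normal D G by fact
  have "x \<in> generate G S" using x S(2) by simp
  then show ?thesis
  proof (induction rule: generate.induct)
    case (incl h)
    then have "\<sigma> h \<otimes> h = \<one>" using S(1) S(3)[of h] by auto
    then show ?case by simp
  next
    case (inv h)
    then have "\<sigma> (inv h) \<otimes> inv h = \<one>" using S(1) S(3)[of h] by auto
    then show ?case by simp
  next
    case (eng a b)
    then have c: "a \<in> carrier G" "b \<in> carrier G" using generate_in_carrier[OF S(1)] by auto
    have "(\<sigma> a \<otimes> (\<sigma> b \<otimes> a \<otimes> inv (\<sigma> b) \<otimes> inv a) \<otimes> inv (\<sigma> a)) \<otimes> (\<sigma> a \<otimes> a) \<otimes> (\<sigma> b \<otimes> b) \<in> D"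
      using eng D.inv_op_closed2[OF _ D(2), of "\<sigma> a" "\<sigma> b" a] c by simp
    then show ?case using c by (simp add: m_assoc)
  qed simp
qed

text \<open>Starting from P_1, each further generator enlarges the subgroup by a factor of at most
  p.\<close>

lemma card_le_generated:
  assumes p: "prime p" and fin: "finite (carrier G)" and gen: "generate G (x ` {..<n}) = carrier G" and x: "x \<in> {..<n} \<rightarrow> carrier G"
  shows "card (carrier G) \<le> p ^ n * card (lpc p G 1)"
proof -
  let ?D = "lpc p G 1"
  have sub: "subgroup (generate G (x ` {..<k} \<union> ?D)) G" if "k \<le> n" for k
    using x that lpc_carrier[of p 1] by (intro generate_is_subgroup Un_least) (auto simp: Pi_iff)
  have "card (generate G (x ` {..<k} \<union> ?D)) \<le> p ^ k * card ?D" if "k \<le> n" for k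
    using that
  proof (induction k)
    case 0
    have "generate G ?D = ?D"
      using generate_subgroup_incl[OF order_refl lpc_subgroup[of p 1]] by (auto intro: generate.incl)
    then show ?case by simp
  next
    case (Suc k)
    let ?W = "generate G (x ` {..<k} \<union> ?D)"
    have W: "subgroup ?W G" using sub Suc by simp
    have Wn: "?W \<lhd> G"
      using between_normal[OF W, of p "carrier G"] subgroup.subset[OF W] by (auto simp: lpc_1 intro: generate.incl)
    have xk: "x k \<in> carrier G" using x Suc by auto
    have "x k [^] p \<in> ?D" using pow_in_pstar[OF xk] by (simp add: lpc_1)
    then have xp: "x k [^] p \<in> ?W" by (auto intro: generate.incl)
    have sub2: "generate G (x ` {..<Suc k} \<union> ?D) \<subseteq> generate G (insert (x k) ?W)"
    proof (rule generate_subgroup_incl)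
      show "subgroup (generate G (insert (x k) ?W)) G"
        using xk subgroup.subset[OF W] by (intro generate_is_subgroup) auto
      show "x ` {..<Suc k} \<union> ?D \<subseteq> generate G (insert (x k) ?W)"
        by (auto simp: lessThan_Suc intro!: generate.incl)
    qed
    have "generate G (insert (x k) ?W) \<subseteq> carrier G" using xk subgroup.subset[OF W] by (intro generate_incl) auto
    then have "card (generate G (x ` {..<Suc k} \<union> ?D)) \<le> card (generate G (insert (x k) ?W))"
      using sub2 fin by (meson card_mono finite_subset)
    also have "\<dots> \<le> p * card ?W"
    proof (cases "x k \<in> ?W")
      case True
      then have "generate G (insert (x k) ?W) = ?W"
        using generate_subgroup_incl[OF _ W, of "insert (x k) ?W"] by (auto intro: generate.incl)
      then show ?thesis using prime_gt_0_nat[OF p] by simp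
    next
      case False
      then show ?thesis using card_generate_insert_normal[OF Wn xk xp p] by simp
    qed
    also have "\<dots> \<le> p * (p ^ k * card ?D)" using Suc by simp
    finally show ?case by (simp add: mult.assoc)
  qed
  from this[OF order_refl] have "card (generate G (x ` {..<n} \<union> ?D)) \<le> p ^ n * card ?D" .
  moreover have "carrier G \<subseteq> generate G (x ` {..<n} \<union> ?D)"
    using gen x lpc_carrier mono_generate[of "x ` {..<n}" "x ` {..<n} \<union> ?D"] by (auto simp: Pi_iff)
  moreover have "generate G (x ` {..<n} \<union> ?D) \<subseteq> carrier G" using sub[OF order_refl] subgroup.subset by blast
  ultimately show ?thesis by (metis subset_antisym)
qed

end

lemma (in group_hom) hom_factor:
  assumes surj: "h ` carrier G = carrier H" and r: "\<rho> \<in> hom G E" and E: "group E"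
    and ker: "kernel G H h \<subseteq> kernel G E \<rho>"
  shows "\<exists>\<theta>\<in>hom H E. \<forall>x\<in>carrier G. \<theta> (h x) = \<rho> x"
proof -
  interpret R: group_hom G E \<rho> using E r by (simp add: group_hom_def group_hom_axioms_def)
  define \<theta> where "\<theta> y = \<rho> (SOME x. x \<in> carrier G \<and> h x = y)" for y
  have \<theta>: "\<theta> (h x) = \<rho> x" if x: "x \<in> carrier G" for x
  proof -
    define z where "z = (SOME z. z \<in> carrier G \<and> h z = h x)"
    have z: "z \<in> carrier G" "h z = h x" using someI[of "\<lambda>z. z \<in> carrier G \<and> h z = h x" x] x by (auto simp: z_def)
    then have "z \<otimes> inv x \<in> kernel G H h" using x by (auto simp: kernel_def)
    then have "\<rho> (z \<otimes> inv x) = \<one>\<^bsub>E\<^esub>" using ker unfolding kernel_def by blast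
    then have "\<rho> z \<otimes>\<^bsub>E\<^esub> inv\<^bsub>E\<^esub> \<rho> x = \<one>\<^bsub>E\<^esub>" using x z by simp
    then have "\<rho> z = \<rho> x" using x z R.H.inv_equality[of "\<rho> z" "inv\<^bsub>E\<^esub> \<rho> x"] by simp
    then show ?thesis by (simp add: \<theta>_def z_def)
  qed
  have "\<theta> \<in> hom H E"
  proof (rule homI)
    show "\<theta> y \<in> carrier E" if "y \<in> carrier H" for y using that surj \<theta> by (metis R.hom_closed imageE)
    fix y z assume "y \<in> carrier H" "z \<in> carrier H"
    then obtain a b where ab: "a \<in> carrier G" "b \<in> carrier G" "y = h a" "z = h b" using surj by (metis imageE)
    then have "\<theta> (y \<otimes>\<^bsub>H\<^esub> z) = \<theta> (h (a \<otimes> b))" by simp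
    also have "\<dots> = \<rho> (a \<otimes> b)" using ab by (intro \<theta>) auto
    finally show "\<theta> (y \<otimes>\<^bsub>H\<^esub> z) = \<theta> y \<otimes>\<^bsub>E\<^esub> \<theta> z" using ab \<theta> by simp
  qed
  then show ?thesis using \<theta> by blast
qed

section \<open>Products of the factors 1 - p^(-k)\<close>

lemma eta_pos: "p > 1 \<Longrightarrow> eta n p > 0"
  unfolding eta_def by (intro prod_pos) (auto simp: field_simps)

text \<open>Write p^n - p^i = p^n (1 - p^(-(n-i))); the exponents n-i run from n-h+1 to n, which
  leaves a quotient of two values of \<open>eta\<close>.\<close>

lemma prod_diff_powers:
  fixes p :: nat
  assumes "p > 1" "h \<le> n"
  shows "(\<Prod>i<h. real p ^ n - real p ^ i) = real p ^ (n * h) * (eta n p / eta (n - h) p)"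
  using assms(2)
proof (induction h)
  case 0
  then show ?case using eta_pos[OF assms(1), of n] by simp
next
  case (Suc h)
  have "Suc (n - Suc h) = n - h" using Suc by simp
  then have "eta (n - h) p = eta (n - Suc h) p * (1 - 1 / real p ^ (n - h))"
    unfolding eta_def by (metis prod.atLeast1_atMost_eq prod.lessThan_Suc prod.nat_ivl_Suc' One_nat_def le_add1 plus_1_eq_Suc mult.commute)
  moreover have "eta (n - h) p > 0" "eta (n - Suc h) p > 0" using eta_pos[OF assms(1)] by auto
  ultimately have e1: "1 / eta (n - Suc h) p = (1 - 1 / real p ^ (n - h)) / eta (n - h) p" by (simp add: field_simps)
  have e2: "real p ^ n * (1 - 1 / real p ^ (n - h)) = real p ^ n - real p ^ h"
    using Suc.prems assms(1) by (simp add: right_diff_distrib power_diff)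
  have "real p ^ n * (eta n p / eta (n - Suc h) p) = real p ^ n * eta n p * (1 / eta (n - Suc h) p)" by simp
  also have "\<dots> = (real p ^ n * (1 - 1 / real p ^ (n - h))) * (eta n p / eta (n - h) p)" unfolding e1 by simp
  also have "\<dots> = (real p ^ n - real p ^ h) * (eta n p / eta (n - h) p)" unfolding e2 ..
  finally have "real p ^ n * (eta n p / eta (n - Suc h) p) = (real p ^ n - real p ^ h) * (eta n p / eta (n - h) p)" .
  moreover have "real p ^ (n * Suc h) = real p ^ (n * h) * real p ^ n" by (simp add: power_add mult.commute)
  moreover have "(\<Prod>i<Suc h. real p ^ n - real p ^ i) =
      real p ^ (n * h) * ((real p ^ n - real p ^ h) * (eta n p / eta (n - h) p))"
    using Suc by simp
  ultimately show ?case by (metis mult.assoc)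
qed

section \<open>Counting presentations\<close>

text \<open>\<open>m\<close> is any level with P_m(G) = 1; it is used with m = c and m = c+1.
  \<open>rank\<close> says that G modulo its Frattini subgroup has dimension g. \<open>gi\<close>
  records inversion modulo the Frattini subgroup, the form in which it is inherited by involutions
  induced from F_m.\<close>

locale rank_group = involution_group G \<sigma> for G (structure) and \<sigma> +
  fixes p g m :: nat
  assumes prime_p: "prime p" and odd_p: "odd p" and lpc_m: "lpc p G m = {\<one>}"
    and gi: "x \<in> carrier G \<Longrightarrow> \<sigma> x \<otimes> x \<in> lpc p G 1"
    and rank: "card (carrier G) = p ^ g * card (lpc p G 1)"
begin

abbreviation "F \<equiv> Fc p g m"

sublocale F: involution_group F sigma_Fc
  by (rule involution_group_Fc[OF prime_p odd_p])

lemma p_gt_1: "p > 1"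
  using prime_gt_1_nat[OF prime_p] .

lemma frattini_cover: "subgroup M G \<Longrightarrow> carrier G \<subseteq> generate G (M \<union> lpc p G 1) \<Longrightarrow> M = carrier G"
  using frattini_argument[OF fin lpc_m normal_self, of M] subgroup.subset[of M G] by (simp add: lpc_1)

text \<open>Codes the equivariant surjections F_m \<rightarrow> G by the images of the generators.
  As \<sigma> inverts the generators of F_m, equivariance means that the images are
  inverted.\<close>

definition Etup :: "(nat \<Rightarrow> 'a) set" where
  "Etup = {s \<in> {..<g} \<rightarrow>\<^sub>E inverted G \<sigma> (carrier G). generate G (s ` {..<g}) = carrier G}"

definition lift :: "(nat \<Rightarrow> 'a) \<Rightarrow> (nat \<times> bool) list set \<Rightarrow> 'a" where
  "lift s = (SOME \<psi>. \<psi> \<in> hom F G \<and> (\<forall>i<g. \<psi> (Fgen p g m i) = s i))"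

lemma lift:
  assumes "s \<in> {..<g} \<rightarrow> carrier G"
  shows lift_hom: "lift s \<in> hom F G" and lift_gen: "i < g \<Longrightarrow> lift s (Fgen p g m i) = s i"
proof -
  have "\<exists>\<psi>. \<psi> \<in> hom F G \<and> (\<forall>i<g. \<psi> (Fgen p g m i) = s i)"
    using Fc_universal[OF group_axioms lpc_m assms] by blast
  from someI_ex[OF this, folded lift_def]
  show "lift s \<in> hom F G" "i < g \<Longrightarrow> lift s (Fgen p g m i) = s i" by auto
qed

lemma Etup_closed: "s \<in> Etup \<Longrightarrow> s \<in> {..<g} \<rightarrow> carrier G"
  by (auto simp: Etup_def inverted_def PiE_iff)

lemma lift_group_hom: "s \<in> {..<g} \<rightarrow> carrier G \<Longrightarrow> group_hom F G (lift s)"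
  using lift_hom by (simp add: group_hom_def group_hom_axioms_def group_Fc)

lemma lift_surj:
  assumes "s \<in> Etup" shows "lift s ` carrier F = carrier G"
proof -
  interpret L: group_hom F G "lift s" using lift_group_hom[OF Etup_closed[OF assms]] .
  have "lift s ` (Fgen p g m ` {..<g}) = s ` {..<g}"
    using lift_gen[OF Etup_closed[OF assms]] by (force simp: image_image)
  moreover have "Fgen p g m ` {..<g} \<subseteq> carrier F" using Fgen_closed by auto
  ultimately have "lift s ` carrier F = generate G (s ` {..<g})"
    using L.generate_img[symmetric, of "Fgen p g m ` {..<g}"] by (simp add: Fc_generated)
  then show ?thesis using assms by (simp add: Etup_def)
qed

lemma equivariant_of_gens:
  assumes h: "\<psi> \<in> hom F G" and "\<And>i. i < g \<Longrightarrow> \<sigma> (\<psi> (Fgen p g m i)) = inv \<psi> (Fgen p g m i)" and x: "x \<in> carrier F"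
  shows "\<psi> (sigma_Fc x) = \<sigma> (\<psi> x)"
proof -
  interpret L: group_hom F G \<psi> using h by (simp add: group_hom_def group_hom_axioms_def group_Fc)
  have "(\<psi> \<circ> sigma_Fc) x = (\<sigma> \<circ> \<psi>) x"
  proof (rule Fc_hom_unique[OF _ _ group_axioms _ x])
    show "\<psi> \<circ> sigma_Fc \<in> hom F G" by (rule Group.hom_compose[OF sigma_Fc_hom h])
    show "\<sigma> \<circ> \<psi> \<in> hom F G" by (rule Group.hom_compose[OF h sig_hom])
    show "(\<psi> \<circ> sigma_Fc) (Fgen p g m i) = (\<sigma> \<circ> \<psi>) (Fgen p g m i)" if "i < g" for i
      using assms(2)[OF that] that by (simp add: sigma_Fc_gen Fgen_closed)
  qed
  then show ?thesis by simp
qed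

lemma lift_equivariant:
  assumes "s \<in> Etup" "x \<in> carrier F" shows "lift s (sigma_Fc x) = \<sigma> (lift s x)"
  using assms lift_gen[OF Etup_closed[OF assms(1)]]
  by (intro equivariant_of_gens lift_hom Etup_closed) (auto simp: Etup_def inverted_def PiE_iff)

lemma lift_unique:
  assumes "\<psi> \<in> hom F G" "s \<in> {..<g} \<rightarrow> carrier G" "\<And>i. i < g \<Longrightarrow> \<psi> (Fgen p g m i) = s i" "x \<in> carrier F"
  shows "\<psi> x = lift s x"
  using Fc_hom_unique[OF assms(1) lift_hom[OF assms(2)] group_axioms _ assms(4)] assms(3) lift_gen[OF assms(2)] by auto

lemma card_le_Fc: "card (carrier F) \<le> p ^ g * card (lpc p F 1)"
  using F.card_le_generated[OF prime_p F.fin Fc_generated] Fgen_closed by auto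

text \<open>The Frattini quotient of F_m has order at most p^g, having g generators, while that of G
  has order exactly p^g. So the Frattini subgroup of F_m is the full preimage of that of G, and this
  contains the kernel.\<close>

lemma surj_index:
  assumes h: "\<psi> \<in> hom F G" and surj: "\<psi> ` carrier F = carrier G"
  shows "card (carrier F) = p ^ g * card (lpc p F 1)" "kernel F G \<psi> \<subseteq> lpc p F 1"
proof -
  interpret L: group_hom F G \<psi> using h by (simp add: group_hom_def group_hom_axioms_def group_Fc)
  let ?P = "{x \<in> carrier F. \<psi> x \<in> lpc p G 1}"
  have fibre: "card {a \<in> carrier F. \<psi> a = y} = card (kernel F G \<psi>)" if "y \<in> carrier G" for y
  proof -
    from that obtain x where x: "x \<in> carrier F" "y = \<psi> x" unfolding surj[symmetric] by blast
    have "bij_betw (\<lambda>k. k \<otimes>\<^bsub>F\<^esub> x) (kernel F G \<psi>) {a \<in> carrier F. \<psi> a = y}"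
      using x by (intro bij_betwI[of _ _ _ "\<lambda>a. a \<otimes>\<^bsub>F\<^esub> inv\<^bsub>F\<^esub> x"]) (auto simp: kernel_def F.m_assoc)
    from bij_betw_same_card[OF this] show ?thesis by simp
  qed
  have cF: "card (carrier F) = card (carrier G) * card (kernel F G \<psi>)"
    by (rule card_eq_fibres[where f = \<psi>, OF F.fin fin]) (auto simp: fibre)
  have Pc: "card ?P = card (lpc p G 1) * card (kernel F G \<psi>)"
  proof (rule card_eq_fibres[where f = \<psi>])
    show "finite ?P" using F.fin by simp
    show "finite (lpc p G 1)" using lpc_carrier fin finite_subset by blast
    show "card {a \<in> ?P. \<psi> a = b} = card (kernel F G \<psi>)" if "b \<in> lpc p G 1" for b
    proof -
      have "{a \<in> ?P. \<psi> a = b} = {a \<in> carrier F. \<psi> a = b}" using that by auto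
      then show ?thesis using fibre[of b] that lpc_carrier by auto
    qed
  qed auto
  have sub: "lpc p F 1 \<subseteq> ?P" using L.lpc_img_subset[of p 1] F.lpc_carrier by blast
  have eq: "card (carrier F) = p ^ g * card ?P" using cF Pc rank by simp
  have "card (lpc p F 1) \<le> card ?P" using sub F.fin by (intro card_mono) auto
  moreover have "card ?P \<le> card (lpc p F 1)" using card_le_Fc eq p_gt_1 by simp
  ultimately have "lpc p F 1 = ?P" using sub F.fin by (intro card_subset_eq) auto
  then show "card (carrier F) = p ^ g * card (lpc p F 1)" using eq by simp
  have "kernel F G \<psi> \<subseteq> ?P" using subgroup.one_closed[OF lpc_subgroup] by (auto simp: kernel_def)
  then show "kernel F G \<psi> \<subseteq> lpc p F 1" using \<open>lpc p F 1 = ?P\<close> by simp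
qed

lemma sigma_Fc_inverts: "x \<in> carrier F \<Longrightarrow> sigma_Fc x \<otimes>\<^bsub>F\<^esub> x \<in> lpc p F 1"
proof (rule F.inverts_mod_of_generators[OF sigma_Fc_hom F.lpc_normal _ _ Fc_generated[symmetric]])
  show "x \<otimes>\<^bsub>F\<^esub> y \<otimes>\<^bsub>F\<^esub> inv\<^bsub>F\<^esub> x \<otimes>\<^bsub>F\<^esub> inv\<^bsub>F\<^esub> y \<in> lpc p F 1" if "x \<in> carrier F" "y \<in> carrier F" for x y
    using F.comm_in_pstar[OF that] by (simp add: lpc_1)
  show "Fgen p g m ` {..<g} \<subseteq> carrier F" using Fgen_closed by auto
qed (auto simp: sigma_Fc_gen)

text \<open>X_m is the inverted part of the Frattini subgroup, modulo which \<sigma> inverts F_m. A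
  surjection onto G pins the index of that subgroup to p^g.\<close>

lemma card_Xc:
  assumes "Etup \<noteq> {}"
  shows "card (inverted F sigma_Fc (carrier F)) = p ^ g * card (Xc p g m)"
proof -
  obtain s where s: "s \<in> Etup" using assms by blast
  have c: "card (carrier F) = p ^ g * card (lpc p F 1)"
    using surj_index(1)[OF lift_hom[OF Etup_closed[OF s]] lift_surj[OF s]] .
  have "card (lpc p F 1) > 0"
    using F.lpc_carrier F.fin subgroup.one_closed[OF F.lpc_subgroup] by (metis card_gt_0_iff empty_iff finite_subset)
  moreover have "card (inverted F sigma_Fc (carrier F)) * card (lpc p F 1) = card (carrier F) * card (inverted F sigma_Fc (lpc p F 1))"
    by (rule F.card_inverted_index[OF F.subgroup_self F.lpc_normal F.lpc_carrier sigma_Fc_inverts])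
  ultimately show ?thesis unfolding Xc_alt[OF prime_p] c by simp
qed

lemma card_inverted_frattini: "card (inverted G \<sigma> (carrier G)) = p ^ g * card (inverted G \<sigma> (lpc p G 1))"
proof -
  have "card (lpc p G 1) > 0"
    using lpc_carrier fin subgroup.one_closed[OF lpc_subgroup] by (metis card_gt_0_iff empty_iff finite_subset)
  moreover have "card (inverted G \<sigma> (carrier G)) * card (lpc p G 1) = card (carrier G) * card (inverted G \<sigma> (lpc p G 1))"
    by (rule card_inverted_index[OF subgroup_self lpc_normal lpc_carrier gi])
  ultimately show ?thesis unfolding rank by simp
qed

text \<open>By \<open>frattini_cover\<close> a tuple generates G iff it does so modulo the Frattini
  subgroup, where it has to span a space of dimension g.\<close>

lemma card_Etup:
  "real (card Etup) = real (card (inverted G \<sigma> (lpc p G 1))) ^ g * (\<Prod>i<g. real p ^ g - real p ^ i)"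
proof -
  have "Etup = {t \<in> {..<g} \<rightarrow>\<^sub>E inverted G \<sigma> (carrier G). generate G (t ` {..<g} \<union> lpc p G 1) = carrier G}"
  proof -
    have "generate G (t ` {..<g}) = carrier G \<longleftrightarrow> generate G (t ` {..<g} \<union> lpc p G 1) = carrier G"
      if t: "t \<in> {..<g} \<rightarrow>\<^sub>E inverted G \<sigma> (carrier G)" for t
    proof -
      have tc: "t ` {..<g} \<subseteq> carrier G" using t by (auto simp: inverted_def PiE_iff)
      have sub: "generate G (t ` {..<g} \<union> lpc p G 1) \<subseteq> carrier G"
        using tc lpc_carrier by (intro generate_incl) blast
      have "generate G (t ` {..<g}) \<subseteq> generate G (t ` {..<g} \<union> lpc p G 1)"
        using tc lpc_carrier by (intro mono_generate) blast+
      moreover have "generate G (t ` {..<g} \<union> lpc p G 1) \<subseteq> generate G (generate G (t ` {..<g}) \<union> lpc p G 1)"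
        using tc lpc_carrier generate_incl[OF tc] by (intro mono_generate) (auto intro: generate.incl)
      ultimately show ?thesis
        using sub frattini_cover[OF generate_is_subgroup[OF tc]] by blast
    qed
    then show ?thesis unfolding Etup_def by blast
  qed
  then show ?thesis
    using card_generating_tuples[OF prime_p normal_self, of "{..<g}" "lpc p G 1" g] gi lpc_subgroup[of p 1] lpc_carrier[of p 1] rank
    by (simp add: lpc_1)
qed

text \<open>Two surjections with the same kernel differ by a unique automorphism of G, which
  commutes with \<sigma> as both surjections are equivariant.\<close>

lemma Aut_sigma_fibre:
  assumes s0: "s0 \<in> Etup"
  shows "card {s \<in> Etup. kernel F G (lift s) = kernel F G (lift s0)} = card (Aut_sigma G \<sigma>)"
proof -
  have s0c: "s0 \<in> {..<g} \<rightarrow> carrier G" by (rule Etup_closed[OF s0])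
  interpret L0: group_hom F G "lift s0" using lift_group_hom[OF s0c] .
  have gen0: "generate G (s0 ` {..<g}) = carrier G" using s0 by (simp add: Etup_def)
  let ?S = "{s \<in> Etup. kernel F G (lift s) = kernel F G (lift s0)}"
  have "bij_betw (\<lambda>\<alpha>. restrict (\<alpha> \<circ> s0) {..<g}) (Aut_sigma G \<sigma>) ?S"
    unfolding bij_betw_def
  proof
    show "inj_on (\<lambda>\<alpha>. restrict (\<alpha> \<circ> s0) {..<g}) (Aut_sigma G \<sigma>)"
    proof (rule inj_onI)
      fix \<alpha> \<beta> assume ab: "\<alpha> \<in> Aut_sigma G \<sigma>" "\<beta> \<in> Aut_sigma G \<sigma>" "restrict (\<alpha> \<circ> s0) {..<g} = restrict (\<beta> \<circ> s0) {..<g}"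
      have hom: "\<alpha> \<in> hom G G" "\<beta> \<in> hom G G" using ab by (auto simp: Aut_sigma_def iso_def)
      interpret A: group_hom G G \<alpha> by unfold_locales fact
      have "\<alpha> (s0 i) = \<beta> (s0 i)" if "i < g" for i
        using fun_cong[OF ab(3), of i] that by simp
      then have "\<alpha> x = \<beta> x" if "x \<in> carrier G" for x
        using A.hom_eq_on_generate[OF hom(2), of "s0 ` {..<g}" x] s0c gen0 that by auto
      then show "\<alpha> = \<beta>" using ab by (auto simp: Aut_sigma_def intro: extensionalityI)
    qed
    show "(\<lambda>\<alpha>. restrict (\<alpha> \<circ> s0) {..<g}) ` Aut_sigma G \<sigma> = ?S"
    proof (intro equalityI subsetI)
      fix s assume "s \<in> (\<lambda>\<alpha>. restrict (\<alpha> \<circ> s0) {..<g}) ` Aut_sigma G \<sigma>"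
      then obtain \<alpha> where a: "\<alpha> \<in> Aut_sigma G \<sigma>" "s = restrict (\<alpha> \<circ> s0) {..<g}" by blast
      have ah: "\<alpha> \<in> hom G G" "bij_betw \<alpha> (carrier G) (carrier G)" "\<And>x. x \<in> carrier G \<Longrightarrow> \<alpha> (\<sigma> x) = \<sigma> (\<alpha> x)"
        using a by (auto simp: Aut_sigma_def iso_def)
      interpret A: group_hom G G \<alpha> by unfold_locales fact
      have si: "s i = \<alpha> (s0 i)" if "i < g" for i using a that by simp
      have inv0: "\<sigma> (s0 i) = inv (s0 i)" "s0 i \<in> carrier G" if "i < g" for i
        using s0 that by (auto simp: Etup_def inverted_def PiE_iff)
      have "s \<in> {..<g} \<rightarrow>\<^sub>E inverted G \<sigma> (carrier G)"
        using a inv0 ah(3)[symmetric] by (auto simp: inverted_def)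
      moreover have "s ` {..<g} = \<alpha> ` (s0 ` {..<g})" using si by (force simp: image_image)
      then have "generate G (s ` {..<g}) = carrier G"
        using A.generate_img[symmetric, of "s0 ` {..<g}"] gen0 s0c ah(2) by (auto simp: bij_betw_def)
      ultimately have sE: "s \<in> Etup" by (simp add: Etup_def)
      have "(\<alpha> \<circ> lift s0) x = lift s x" if "x \<in> carrier F" for x
        by (rule lift_unique[OF Group.hom_compose[OF lift_hom[OF s0c] ah(1)] Etup_closed[OF sE] _ that])
          (simp add: si lift_gen[OF s0c])
      moreover have "\<alpha> y = \<one> \<longleftrightarrow> y = \<one>" if "y \<in> carrier G" for y
        using that ah(2) A.hom_one by (metis bij_betw_def inj_on_def one_closed)
      ultimately have "kernel F G (lift s) = kernel F G (lift s0)" by (force simp: kernel_def)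
      then show "s \<in> ?S" using sE by simp
    next
      fix s assume s: "s \<in> ?S"
      then have sE: "s \<in> Etup" and ker: "kernel F G (lift s) = kernel F G (lift s0)" by auto
      have sc: "s \<in> {..<g} \<rightarrow> carrier G" by (rule Etup_closed[OF sE])
      interpret L: group_hom F G "lift s" using lift_group_hom[OF sc] .
      obtain \<theta> where \<theta>: "\<theta> \<in> hom G G" "\<And>x. x \<in> carrier F \<Longrightarrow> \<theta> (lift s0 x) = lift s x"
        using L0.hom_factor[OF lift_surj[OF s0] lift_hom[OF sc] group_axioms] ker by auto
      interpret T: group_hom G G \<theta> by unfold_locales fact
      have surj: "\<theta> ` carrier G = carrier G"
        using lift_surj[OF sE] lift_surj[OF s0] \<theta>(2) by (metis (no_types, lifting) image_cong image_image)
      then have bij: "bij_betw \<theta> (carrier G) (carrier G)" using fin by (simp add: bij_betw_def eq_card_imp_inj_on)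
      define \<alpha> where "\<alpha> = restrict \<theta> (carrier G)"
      have "\<alpha> \<in> hom G G" using \<theta>(1) by (auto simp: \<alpha>_def hom_def)
      moreover have "bij_betw \<alpha> (carrier G) (carrier G)" using bij by (simp add: \<alpha>_def cong: bij_betw_cong)
      moreover have "\<alpha> (\<sigma> x) = \<sigma> (\<alpha> x)" if "x \<in> carrier G" for x
      proof -
        from that obtain a where a: "a \<in> carrier F" "x = lift s0 a" unfolding lift_surj[OF s0, symmetric] by blast
        have "\<theta> (\<sigma> x) = \<theta> (lift s0 (sigma_Fc a))" using a lift_equivariant[OF s0] by simp
        also have "\<dots> = \<sigma> (\<theta> x)" using a lift_equivariant[OF sE] \<theta>(2) by simp
        finally show ?thesis using that by (simp add: \<alpha>_def)
      qed
      ultimately have aA: "\<alpha> \<in> Aut_sigma G \<sigma>" by (auto simp: Aut_sigma_def iso_def \<alpha>_def)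
      have "\<alpha> (s0 i) = s i" if "i < g" for i
        using \<theta>(2)[OF Fgen_closed[OF that]] lift_gen[OF sc that] lift_gen[OF s0c that] s0c that
        by (auto simp: \<alpha>_def)
      then have "s = restrict (\<alpha> \<circ> s0) {..<g}"
        using sE by (intro extensionalityI[of _ "{..<g}"]) (auto simp: Etup_def PiE_iff)
      then show "s \<in> (\<lambda>\<alpha>. restrict (\<alpha> \<circ> s0) {..<g}) ` Aut_sigma G \<sigma>" using aA by blast
    qed
  qed
  from bij_betw_same_card[OF this] show ?thesis by simp
qed

lemma Xc_closed: "t \<in> {0..g} \<rightarrow>\<^sub>E Xc p g m \<Longrightarrow> t ` {0..g} \<subseteq> carrier F"
  using F.lpc_carrier by (auto simp: Xc_alt[OF prime_p] inverted_def PiE_iff)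

lemma ncl_tuple_alt:
  assumes "t ` {0..g} \<subseteq> carrier F"
  shows "ncl_tuple p g m t = generate F {x \<otimes>\<^bsub>F\<^esub> s \<otimes>\<^bsub>F\<^esub> inv\<^bsub>F\<^esub> x | x s. x \<in> carrier F \<and> s \<in> t ` {0..g}}"
  unfolding ncl_tuple_def by (rule F.cl_ncl_discrete[OF assms])

text \<open>The isomorphism in \<open>Tc\<close> ignores \<sigma>. It carries the action of \<sigma>
  on the quotient of F_m to some involution \<tau> of G, and an automorphism conjugating \<tau> into
  \<sigma> makes the surjection equivariant.\<close>

lemma Tc_kernel:
  assumes t: "t \<in> Tc p g m G"
  shows "\<exists>s\<in>Etup. kernel F G (lift s) = ncl_tuple p g m t"
proof -
  have tX: "t \<in> {0..g} \<rightarrow>\<^sub>E Xc p g m" using t by (simp add: Tc_def)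
  note tc = Xc_closed[OF tX]
  define M where "M = ncl_tuple p g m t"
  note M_alt = M_def[unfolded ncl_tuple_alt[OF tc]]
  have Mn: "M \<lhd> F" unfolding M_alt by (rule F.ncl_normal[OF tc])
  interpret M: normal M F by fact
  obtain \<beta> where \<beta>: "\<beta> \<in> iso (F Mod M) G" using t unfolding Tc_def M_def is_iso_def by auto
  define \<psi> where "\<psi> = \<beta> \<circ> (\<lambda>x. M #>\<^bsub>F\<^esub> x)"
  have \<beta>h: "\<beta> \<in> hom (F Mod M) G" "bij_betw \<beta> (carrier (F Mod M)) (carrier G)" using \<beta> by (auto simp: iso_def)
  have \<psi>h: "\<psi> \<in> hom F G" unfolding \<psi>_def by (rule Group.hom_compose[OF M.r_coset_hom_Mod \<beta>h(1)])
  interpret L: group_hom F G \<psi> using \<psi>h by (simp add: group_hom_def group_hom_axioms_def group_Fc)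
  interpret B: group_hom "F Mod M" G \<beta>
    using \<beta>h(1) M.factorgroup_is_group by (simp add: group_hom_def group_hom_axioms_def)
  have surj: "\<psi> ` carrier F = carrier G"
    using \<beta>h(2) by (simp add: \<psi>_def bij_betw_def carrier_FactGroup image_image)
  have ker: "kernel F G \<psi> = M"
  proof -
    have "\<psi> x = \<one> \<longleftrightarrow> x \<in> M" if x: "x \<in> carrier F" for x
    proof -
      have "M #>\<^bsub>F\<^esub> x \<in> carrier (F Mod M)" using x by (simp add: carrier_FactGroup)
      then have "\<psi> x = \<one> \<longleftrightarrow> M #>\<^bsub>F\<^esub> x = M"
        using \<beta>h(2) B.hom_one B.G.one_closed unfolding \<psi>_def bij_betw_def inj_on_def by (metis comp_apply one_FactGroup)
      also have "\<dots> \<longleftrightarrow> x \<in> M" using F.coset_join1[OF _ x M.subgroup_axioms] F.coset_join2[OF x M.subgroup_axioms] by blast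
      finally show ?thesis .
    qed
    then show ?thesis unfolding kernel_def using M.subset by blast
  qed
  \<comment> \<open>\<sigma> sends a conjugate of t_i to a conjugate of its inverse.\<close>
  have "sigma_Fc ` M \<subseteq> M"
  proof -
    have "sigma_Fc ` M = generate F (sigma_Fc ` {x \<otimes>\<^bsub>F\<^esub> s \<otimes>\<^bsub>F\<^esub> inv\<^bsub>F\<^esub> x | x s. x \<in> carrier F \<and> s \<in> t ` {0..g}})"
      unfolding M_alt using tc by (intro F.sig.generate_img[symmetric]) auto
    also have "\<dots> \<subseteq> M"
    proof (rule F.generate_subgroup_incl[OF _ M.subgroup_axioms], safe)
      fix x i assume x: "x \<in> carrier F" and i: "i \<in> {0..g}"
      have ti: "t i \<in> M" unfolding M_alt by (rule F.ncl_incl[OF tc]) (use i in auto)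
      have "sigma_Fc (t i) = inv\<^bsub>F\<^esub> t i" using tX i by (auto simp: Xc_def)
      then have "sigma_Fc (x \<otimes>\<^bsub>F\<^esub> t i \<otimes>\<^bsub>F\<^esub> inv\<^bsub>F\<^esub> x) = sigma_Fc x \<otimes>\<^bsub>F\<^esub> inv\<^bsub>F\<^esub> t i \<otimes>\<^bsub>F\<^esub> inv\<^bsub>F\<^esub> sigma_Fc x"
        using x ti by simp
      moreover have "sigma_Fc x \<otimes>\<^bsub>F\<^esub> inv\<^bsub>F\<^esub> t i \<otimes>\<^bsub>F\<^esub> inv\<^bsub>F\<^esub> sigma_Fc x \<in> M"
        using M.inv_op_closed2[of "sigma_Fc x" "inv\<^bsub>F\<^esub> t i"] x ti by simp
      ultimately show "sigma_Fc (x \<otimes>\<^bsub>F\<^esub> t i \<otimes>\<^bsub>F\<^esub> inv\<^bsub>F\<^esub> x) \<in> M" by simp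
    qed
    finally show ?thesis .
  qed
  then have "kernel F G \<psi> \<subseteq> kernel F G (\<psi> \<circ> sigma_Fc)" using ker unfolding kernel_def by auto
  then obtain \<tau> where \<tau>: "\<tau> \<in> hom G G" "\<And>x. x \<in> carrier F \<Longrightarrow> \<tau> (\<psi> x) = \<psi> (sigma_Fc x)"
    using L.hom_factor[OF surj Group.hom_compose[OF sigma_Fc_hom \<psi>h] group_axioms] by auto
  have \<tau>\<tau>: "\<tau> (\<tau> x) = x" if "x \<in> carrier G" for x
  proof -
    from that obtain a where a: "a \<in> carrier F" "x = \<psi> a" unfolding surj[symmetric] by blast
    then show ?thesis using \<tau>(2)[OF a(1)] \<tau>(2)[of "sigma_Fc a"] by (simp add: sigma_sigma_Fc)
  qed
  have "involution_group G \<tau>"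
    using \<tau>(1) \<tau>\<tau> fin odd_card by unfold_locales auto
  moreover have "\<tau> x \<otimes> x \<in> lpc p G 1" if "x \<in> carrier G" for x
  proof -
    from that obtain a where a: "a \<in> carrier F" "x = \<psi> a" unfolding surj[symmetric] by blast
    have "\<tau> x \<otimes> x = \<psi> (sigma_Fc a \<otimes>\<^bsub>F\<^esub> a)" using a \<tau>(2) by simp
    then show ?thesis using sigma_Fc_inverts[OF a(1)] L.lpc_img_subset[of p 1] by blast
  qed
  ultimately have "\<exists>\<alpha>\<in>iso G G. \<forall>x\<in>carrier G. \<alpha> (\<tau> x) = \<sigma> (\<alpha> x)"
    by (intro involutions_conjugate[OF involution_group_axioms _ lpc_normal frattini_cover gi])
  then obtain \<alpha> where \<alpha>: "\<alpha> \<in> iso G G" "\<And>x. x \<in> carrier G \<Longrightarrow> \<alpha> (\<tau> x) = \<sigma> (\<alpha> x)" by blast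
  have \<alpha>h: "\<alpha> \<in> hom G G" "bij_betw \<alpha> (carrier G) (carrier G)" using \<alpha>(1) by (auto simp: iso_def)
  interpret A: group_hom G G \<alpha> by unfold_locales fact
  have \<phi>h: "\<alpha> \<circ> \<psi> \<in> hom F G" by (rule Group.hom_compose[OF \<psi>h \<alpha>h(1)])
  interpret P: group_hom F G "\<alpha> \<circ> \<psi>" using \<phi>h by (simp add: group_hom_def group_hom_axioms_def group_Fc)
  define s where "s = restrict (\<lambda>i. (\<alpha> \<circ> \<psi>) (Fgen p g m i)) {..<g}"
  have "\<sigma> (\<alpha> (\<psi> (Fgen p g m i))) = inv (\<alpha> (\<psi> (Fgen p g m i)))" if "i < g" for i
    using \<alpha>(2)[of "\<psi> (Fgen p g m i)", symmetric] \<tau>(2)[OF Fgen_closed[OF that]] Fgen_closed[OF that]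
    by (simp add: sigma_Fc_gen[OF that])
  then have sX: "s \<in> {..<g} \<rightarrow>\<^sub>E inverted G \<sigma> (carrier G)"
    using Fgen_closed by (auto simp: s_def inverted_def)
  have "s ` {..<g} = (\<alpha> \<circ> \<psi>) ` (Fgen p g m ` {..<g})" by (force simp: s_def)
  then have "generate G (s ` {..<g}) = (\<alpha> \<circ> \<psi>) ` carrier F"
    using P.generate_img[symmetric, of "Fgen p g m ` {..<g}"] Fc_generated Fgen_closed by (auto simp: image_subset_iff)
  moreover have "(\<alpha> \<circ> \<psi>) ` carrier F = carrier G"
    using \<alpha>h(2) unfolding image_comp[symmetric] surj bij_betw_def by blast
  ultimately have "generate G (s ` {..<g}) = carrier G" by simp
  with sX have sE: "s \<in> Etup" by (simp add: Etup_def)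
  have "(\<alpha> \<circ> \<psi>) x = lift s x" if "x \<in> carrier F" for x
    by (rule lift_unique[OF \<phi>h Etup_closed[OF sE] _ that]) (simp add: s_def)
  moreover have "\<alpha> y = \<one> \<longleftrightarrow> y = \<one>" if "y \<in> carrier G" for y
    using that \<alpha>h(2) A.hom_one by (metis bij_betw_def inj_on_def one_closed)
  ultimately have "kernel F G (lift s) = kernel F G \<psi>" by (force simp: kernel_def)
  then show ?thesis using sE ker M_def by blast
qed

text \<open>N lies in the Frattini subgroup, so its inverted elements all belong to X_m, and
  \<open>ncl_eq_iff\<close> leaves a count of generating tuples modulo \<open>pstar p F N\<close>.
  The quotient |X(N)| / p^h is the number of inverted elements of
  \<open>pstar p F N\<close>.\<close>

lemma card_kernel_tuples:
  assumes s: "s \<in> Etup" and N: "N = kernel F G (lift s)"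
    and inv: "\<And>x. x \<in> N \<Longrightarrow> sigma_Fc x \<otimes>\<^bsub>F\<^esub> x \<in> pstar p F N"
    and h: "card N = p ^ h * card (pstar p F N)"
  shows "real (card {t \<in> Tc p g m G. ncl_tuple p g m t = N}) =
    (real (card (inverted F sigma_Fc N)) / real p ^ h) ^ (g + 1) * (\<Prod>i<h. real p ^ (g + 1) - real p ^ i)"
proof -
  interpret L: group_hom F G "lift s" using lift_group_hom[OF Etup_closed[OF s]] .
  have Nn: "N \<lhd> F" unfolding N by (rule L.normal_kernel)
  interpret N: normal N F by fact
  have NP: "N \<subseteq> lpc p F 1"
    unfolding N by (rule surj_index(2)[OF lift_hom[OF Etup_closed[OF s]] lift_surj[OF s]])
  have "{t \<in> Tc p g m G. ncl_tuple p g m t = N} =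
      {t \<in> {0..g} \<rightarrow>\<^sub>E inverted F sigma_Fc N. generate F (t ` {0..g} \<union> pstar p F N) = N}" (is "?L = ?R")
  proof (intro equalityI subsetI)
    fix t assume t: "t \<in> ?L"
    then have tX: "t \<in> {0..g} \<rightarrow>\<^sub>E Xc p g m" and e: "ncl_tuple p g m t = N" by (auto simp: Tc_def)
    have tN: "t ` {0..g} \<subseteq> N"
      using F.ncl_incl[OF Xc_closed[OF tX]] e ncl_tuple_alt[OF Xc_closed[OF tX]] by blast
    then have "t \<in> {0..g} \<rightarrow>\<^sub>E inverted F sigma_Fc N"
      using tX by (auto simp: inverted_def Xc_def PiE_iff image_subset_iff)
    moreover have "generate F (t ` {0..g} \<union> pstar p F N) = N"
      using F.ncl_eq_iff[OF F.fin lpc_Fc Nn tN] e ncl_tuple_alt[OF Xc_closed[OF tX]] by metis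
    ultimately show "t \<in> ?R" by blast
  next
    fix t assume t: "t \<in> ?R"
    then have tN: "t ` {0..g} \<subseteq> N" by (auto simp: inverted_def PiE_iff)
    have "t \<in> {0..g} \<rightarrow>\<^sub>E Xc p g m"
      using t NP by (auto simp: Xc_alt[OF prime_p] inverted_def PiE_iff)
    moreover from this have e: "ncl_tuple p g m t = N"
      using F.ncl_eq_iff[OF F.fin lpc_Fc Nn tN] t ncl_tuple_alt[OF Xc_closed] by blast
    moreover have "F Mod N \<cong> G"
      using L.FactGroup_iso_set[OF lift_surj[OF s]] N unfolding is_iso_def by blast
    ultimately show "t \<in> ?L" by (simp add: Tc_def)
  qed
  moreover have "real (card {t \<in> {0..g} \<rightarrow>\<^sub>E inverted F sigma_Fc N. generate F (t ` {0..g} \<union> pstar p F N) = N}) =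
      real (card (inverted F sigma_Fc (pstar p F N))) ^ (g + 1) * (\<Prod>i<h. real p ^ (g + 1) - real p ^ i)"
    using F.card_generating_tuples[OF prime_p Nn inv, of "{0..g}" "pstar p F N" h] h
      F.pstar_subgroup[OF N.subset] F.pstar_subset[OF Nn] by simp
  moreover have "real (card (inverted F sigma_Fc N)) / real p ^ h = real (card (inverted F sigma_Fc (pstar p F N)))"
  proof -
    have "card (inverted F sigma_Fc N) * card (pstar p F N) = card N * card (inverted F sigma_Fc (pstar p F N))"
      by (rule F.card_inverted_index[OF N.subgroup_axioms F.pstar_normal[OF Nn] F.pstar_subset[OF Nn] inv])
    moreover have "card (pstar p F N) > 0"
      using F.pstar_subgroup[OF N.subset] F.fin
      by (metis card_gt_0_iff empty_iff finite_subset subgroup.one_closed subgroup.subset)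
    ultimately have "card (inverted F sigma_Fc N) = p ^ h * card (inverted F sigma_Fc (pstar p F N))" using h by simp
    then show ?thesis using p_gt_1 by simp
  qed
  ultimately show ?thesis by simp
qed

lemma card_sum_fibres:
  assumes "finite A" "finite B" "\<And>a. a \<in> A \<Longrightarrow> card {b \<in> B. R a b} = k"
  shows "card A * k = (\<Sum>b\<in>B. card {a \<in> A. R a b})"
proof -
  have "card A * k = (\<Sum>a\<in>A. card {b \<in> B. R a b})" using assms(3) by simp
  also have "\<dots> = (\<Sum>a\<in>A. \<Sum>b\<in>B. if R a b then 1 else 0)"
    using assms(2) by (intro sum.cong) (simp_all add: sum.If_cases Int_def)
  also have "\<dots> = (\<Sum>b\<in>B. \<Sum>a\<in>A. if R a b then 1 else 0)" by (rule sum.swap)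
  also have "\<dots> = (\<Sum>b\<in>B. card {a \<in> A. R a b})"
    using assms(1) by (intro sum.cong) (simp_all add: sum.If_cases Int_def)
  finally show ?thesis .
qed

text \<open>Count the pairs \<open>(t, s)\<close> where \<open>s\<close> is an equivariant surjection onto \<open>G\<close>
  whose kernel is the normal subgroup generated by \<open>t\<close>.\<close>

lemma Meas_formula:
  assumes ker: "\<And>s x. s \<in> Etup \<Longrightarrow> x \<in> kernel F G (lift s) \<Longrightarrow>
      sigma_Fc x \<otimes>\<^bsub>F\<^esub> x \<in> pstar p F (kernel F G (lift s))"
    and h: "\<And>s. s \<in> Etup \<Longrightarrow> card (kernel F G (lift s)) = p ^ h * card (pstar p F (kernel F G (lift s)))"
    and hg: "h \<le> g + 1"
  shows "Meas p g m G = real (y_inv G \<sigma>) / (real (card (Aut_sigma G \<sigma>)) * real (card (carrier G)))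
     * real p ^ (g * (g + 1)) * (eta g p * eta (g + 1) p / eta (g + 1 - h) p)"
proof -
  let ?T = "Tc p g m G" and ?A = "card (Aut_sigma G \<sigma>)"
  let ?XF = "real (card (inverted F sigma_Fc (carrier F)))" and ?XG = "real (card (inverted G \<sigma> (carrier G)))"
  let ?q = "real p"
  have q0: "?q > 0" "?q \<noteq> 0" using p_gt_1 by auto
  have XG: "?XG = ?q ^ g * real (card (inverted G \<sigma> (lpc p G 1)))" using card_inverted_frattini by simp
  have one_inv: "\<one> \<in> inverted G \<sigma> (lpc p G 1)"
    using subgroup.one_closed[OF lpc_subgroup[of p 1]] by (simp add: inverted_def)
  then have "card (inverted G \<sigma> (lpc p G 1)) > 0"
    using finite_inverted[OF lpc_carrier[of p 1]] card_gt_0_iff by blast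
  then have XG0: "?XG > 0" unfolding XG using q0 by simp
  have finT: "finite ?T"
    unfolding Tc_def using F.finite_inverted[OF F.lpc_carrier]
    by (intro finite_subset[OF _ finite_PiE[of "{0..g}" "\<lambda>_. Xc p g m"]]) (auto simp: Xc_alt[OF prime_p])
  have finE: "finite Etup"
    unfolding Etup_def using finite_inverted[of "carrier G"]
    by (intro finite_subset[OF _ finite_PiE[of "{..<g}" "\<lambda>_. inverted G \<sigma> (carrier G)"]]) auto
  have cE: "real (card Etup) = (?XG / ?q ^ g) ^ g * (?q ^ (g * g) * eta g p)"
    using card_Etup prod_diff_powers[OF p_gt_1, of g g] XG q0 by (simp add: eta_def)
  have Epos: "real (card Etup) > 0" unfolding cE using XG0 q0 eta_pos[OF p_gt_1] by simp
  then have Ene: "Etup \<noteq> {}" by auto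
  have XF: "?XF = ?q ^ g * real (card (Xc p g m))" using card_Xc[OF Ene] by simp
  have pairs: "card ?T * ?A = (\<Sum>s\<in>Etup. card {t \<in> ?T. kernel F G (lift s) = ncl_tuple p g m t})"
  proof (rule card_sum_fibres[OF finT finE])
    fix t assume "t \<in> ?T"
    then obtain s0 where "s0 \<in> Etup" "kernel F G (lift s0) = ncl_tuple p g m t" using Tc_kernel by blast
    then show "card {s \<in> Etup. kernel F G (lift s) = ncl_tuple p g m t} = ?A"
      using Aut_sigma_fibre[of s0] by simp
  qed
  have "real (card ?T) * real ?A = (\<Sum>s\<in>Etup. real (card {t \<in> ?T. kernel F G (lift s) = ncl_tuple p g m t}))"
    using arg_cong[OF pairs, of real] by simp
  also have "\<dots> = (\<Sum>s\<in>Etup. (?XF / ?XG / ?q ^ h) ^ (g + 1) * (\<Prod>i<h. ?q ^ (g + 1) - ?q ^ i))"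
  proof (rule sum.cong)
    fix s assume s: "s \<in> Etup"
    interpret L: group_hom F G "lift s" using lift_group_hom[OF Etup_closed[OF s]] .
    have "card (inverted F sigma_Fc (carrier F)) = card (inverted G \<sigma> (carrier G)) * card (inverted F sigma_Fc (kernel F G (lift s)))"
      by (rule L.card_inverted_image[OF F.involution_group_axioms lift_equivariant[OF s] lift_surj[OF s]])
    then have "real (card (inverted F sigma_Fc (kernel F G (lift s)))) = ?XF / ?XG" using XG0 by simp
    moreover have "{t \<in> ?T. kernel F G (lift s) = ncl_tuple p g m t} = {t \<in> ?T. ncl_tuple p g m t = kernel F G (lift s)}" by auto
    ultimately show "real (card {t \<in> ?T. kernel F G (lift s) = ncl_tuple p g m t}) =
       (?XF / ?XG / ?q ^ h) ^ (g + 1) * (\<Prod>i<h. ?q ^ (g + 1) - ?q ^ i)"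
      using card_kernel_tuples[OF s refl ker[OF s] h[OF s]] by simp
  qed simp
  also have "\<dots> = real (card Etup) * ((?XF / ?XG / ?q ^ h) ^ (g + 1) * (?q ^ ((g + 1) * h) * (eta (g + 1) p / eta (g + 1 - h) p)))"
    using prod_diff_powers[OF p_gt_1 hg] by simp
  \<comment> \<open>The dimension h cancels from the powers of p and survives only in the index of
    \<open>eta\<close>.\<close>
  also have "(?XF / ?XG / ?q ^ h) ^ (g + 1) * (?q ^ ((g + 1) * h) * (eta (g + 1) p / eta (g + 1 - h) p)) =
      (?XF / ?XG) ^ (g + 1) * (eta (g + 1) p / eta (g + 1 - h) p)"
  proof -
    have "(?XF / ?XG / ?q ^ h) ^ (g + 1) = (?XF / ?XG) ^ (g + 1) / ?q ^ ((g + 1) * h)"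
      by (simp only: power_divide[of "?XF / ?XG"] power_mult[symmetric] mult.commute[of h])
    then show ?thesis using q0 by simp
  qed
  also have "real (card Etup) = ?XG ^ g * eta g p"
    unfolding cE using q0 by (simp add: power_divide power_mult[symmetric])
  finally have main: "real (card ?T) * real ?A = ?XG ^ g * eta g p * ((?XF / ?XG) ^ (g + 1) * (eta (g + 1) p / eta (g + 1 - h) p))" .
  have "?A > 0"
  proof -
    obtain s where s: "s \<in> Etup" using Ene by blast
    have "{s' \<in> Etup. kernel F G (lift s') = kernel F G (lift s)} \<noteq> {}" using s by blast
    then show ?thesis using Aut_sigma_fibre[OF s] finE by (metis (no_types, lifting) card_gt_0_iff finite_subset mem_Collect_eq subsetI)
  qed
  have XFp: "card (Xc p g m) > 0"
  proof -
    have "\<one>\<^bsub>F\<^esub> \<in> Xc p g m"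
      using subgroup.one_closed[OF F.lpc_subgroup[of p 1]] by (simp add: Xc_alt[OF prime_p] inverted_def)
    then show ?thesis
      using F.finite_inverted[OF F.lpc_carrier] by (auto simp: Xc_alt[OF prime_p] card_gt_0_iff)
  qed
  have y: "real (card (carrier G)) = real (y_inv G \<sigma>) * ?XG"
    using card_carrier_inverted by (simp add: y_inv_def)
  have y0: "real (y_inv G \<sigma>) > 0" using y fin by (metis card_gt_0_iff carrier_not_empty mult_zero_left of_nat_0 of_nat_0_eq_iff of_nat_0_less_iff neq0_conv)
  have "Meas p g m G = real (card ?T) * real ?A / (real ?A * real (card (Xc p g m)) ^ (g + 1))"
    using \<open>?A > 0\<close> by (simp add: Meas_def)
  also have "\<dots> = ?XG ^ g * eta g p * ((?q ^ g * real (card (Xc p g m)) / ?XG) ^ (g + 1) * (eta (g + 1) p / eta (g + 1 - h) p))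
      / (real ?A * real (card (Xc p g m)) ^ (g + 1))"
    unfolding main XF ..
  \<comment> \<open>|X(G)|^g against |X(G)|^(g+1) leaves 1/|X(G)|, and the g+1 entries contribute
    p^g each through \<open>card_Xc\<close>.\<close>
  also have "\<dots> = 1 / (real ?A * ?XG) * ?q ^ (g * (g + 1)) * (eta g p * eta (g + 1) p / eta (g + 1 - h) p)"
    using XG0 XFp \<open>?A > 0\<close> eta_pos[OF p_gt_1, of "g + 1 - h"]
    by (simp add: power_mult_distrib power_divide power_mult power_add field_simps)
  also have "1 / (real ?A * ?XG) = real (y_inv G \<sigma>) / (real ?A * real (card (carrier G)))"
    unfolding y using y0 by simp
  finally show ?thesis .
qed

end

lemma (in group) char_conj:
  assumes "\<phi> \<in> chars p G N W" "pstar p G N \<subseteq> W" "N \<lhd> G" "x \<in> carrier G" "n \<in> N"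
  shows "\<phi> (x \<otimes> n \<otimes> inv x) = \<phi> n"
proof -
  interpret N: normal N G by fact
  let ?k = "x \<otimes> n \<otimes> inv x \<otimes> inv n"
  have k: "?k \<in> W" using comm_in_pstar[OF assms(4,5)] assms(2) by blast
  have kN: "?k \<in> N" using comm_in_pstar[OF assms(4,5)] pstar_subset[OF assms(3)] by blast
  have "x \<otimes> n \<otimes> inv x = ?k \<otimes> n" using assms by (simp add: m_assoc)
  then show ?thesis
    using char_mult[OF assms(1) kN assms(5) N.subgroup_axioms] k assms(1) char_mod[OF assms(1,5)]
    by (simp add: chars_def)
qed

text \<open>Continuity into discrete sets is expressed throughout by open fibres; with this rule
  anything computed from two locally constant functions is locally constant.\<close>

lemma openin_combine:
  assumes "\<And>k. openin tau {x \<in> C. u x = k}" "\<And>k. openin tau {x \<in> C. v x = k}"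
  shows "openin tau {x \<in> C. P (u x) (v x)}"
proof -
  have "{x \<in> C. P (u x) (v x)} = \<Union> {{x \<in> C. u x = i} \<inter> {x \<in> C. v x = j} | i j. P i j}" by blast
  then show ?thesis using assms by (auto intro!: openin_Union openin_Int)
qed

section \<open>Transgression\<close>

text \<open>\<open>B2\<close> up to congruence: integer values are unrestricted and no
  extensionality is imposed, so cocycles can be added and subtracted freely. For discrete groups
  \<open>discrete_coboundary_B2\<close> leads back.\<close>

definition coboundary :: "nat \<Rightarrow> ('a, 'b) monoid_scheme \<Rightarrow> 'a topology \<Rightarrow> ('a \<Rightarrow> 'a \<Rightarrow> int) \<Rightarrow> bool" where
  "coboundary p G tau f \<longleftrightarrow> (\<exists>u. (\<forall>k. openin tau {x \<in> carrier G. u x = k}) \<and>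
     (\<forall>a\<in>carrier G. \<forall>b\<in>carrier G. [f a b = u b - u (a \<otimes>\<^bsub>G\<^esub> b) + u a] (mod int p)))"

lemma coboundary_add:
  assumes "coboundary p G tau f" "coboundary p G tau f'"
  shows "coboundary p G tau (\<lambda>a b. f a b + f' a b)"
proof -
  obtain u v where u: "\<And>k. openin tau {x \<in> carrier G. u x = k}"
      "\<And>a b. a \<in> carrier G \<Longrightarrow> b \<in> carrier G \<Longrightarrow> [f a b = u b - u (a \<otimes>\<^bsub>G\<^esub> b) + u a] (mod int p)"
    and v: "\<And>k. openin tau {x \<in> carrier G. v x = k}"
      "\<And>a b. a \<in> carrier G \<Longrightarrow> b \<in> carrier G \<Longrightarrow> [f' a b = v b - v (a \<otimes>\<^bsub>G\<^esub> b) + v a] (mod int p)"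
    using assms unfolding coboundary_def by blast
  show ?thesis
    unfolding coboundary_def
  proof (intro exI[of _ "\<lambda>x. u x + v x"] conjI allI ballI)
    show "openin tau {x \<in> carrier G. u x + v x = k}" for k
      by (rule openin_combine[of tau "carrier G" u v "\<lambda>i j. i + j = k", OF u(1) v(1)])
    show "[f a b + f' a b = u b + v b - (u (a \<otimes>\<^bsub>G\<^esub> b) + v (a \<otimes>\<^bsub>G\<^esub> b)) + (u a + v a)] (mod int p)"
      if "a \<in> carrier G" "b \<in> carrier G" for a b
      using cong_add[OF u(2)[OF that] v(2)[OF that]] by (simp add: algebra_simps)
  qed
qed

lemma coboundary_minus:
  assumes "coboundary p G tau f"
  shows "coboundary p G tau (\<lambda>a b. - f a b)"
proof -
  obtain u where u: "\<And>k. openin tau {x \<in> carrier G. u x = k}"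
      "\<And>a b. a \<in> carrier G \<Longrightarrow> b \<in> carrier G \<Longrightarrow> [f a b = u b - u (a \<otimes>\<^bsub>G\<^esub> b) + u a] (mod int p)"
    using assms unfolding coboundary_def by blast
  show ?thesis
    unfolding coboundary_def
  proof (intro exI[of _ "\<lambda>x. - u x"] conjI allI ballI)
    show "openin tau {x \<in> carrier G. - u x = k}" for k
      by (rule openin_combine[of tau "carrier G" u u "\<lambda>i j. - i = k", OF u(1) u(1)])
    show "[- f a b = - u b - - u (a \<otimes>\<^bsub>G\<^esub> b) + - u a] (mod int p)" if "a \<in> carrier G" "b \<in> carrier G" for a b
      using cong_minus_minus_iff[of "f a b"] u(2)[OF that] by (metis (no_types, lifting) add_diff_cancel_left' diff_minus_eq_add minus_add_distrib minus_diff_eq add.commute diff_conv_add_uminus)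
  qed
qed

lemma coboundary_cong:
  assumes "coboundary p G tau f" "\<And>a b. a \<in> carrier G \<Longrightarrow> b \<in> carrier G \<Longrightarrow> [f' a b = f a b] (mod int p)"
  shows "coboundary p G tau f'"
  using assms unfolding coboundary_def by (meson cong_trans)

lemma coboundary_diff:
  assumes "coboundary p G tau f" "coboundary p G tau f'"
  shows "coboundary p G tau (\<lambda>a b. f a b - f' a b)"
  using coboundary_add[OF assms(1) coboundary_minus[OF assms(2)]] by simp

lemma B2_coboundary:
  assumes "b \<in> B2 p G tau" shows "coboundary p G tau (\<lambda>x y. b (x, y))"
proof -
  obtain u where "u \<in> cochain1 p G tau"
    "\<forall>a \<in> carrier G. \<forall>c \<in> carrier G. (b (a, c) - (u c - u (a \<otimes>\<^bsub>G\<^esub> c) + u a)) mod int p = 0"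
    using assms unfolding B2_def by blast
  then show ?thesis
    unfolding coboundary_def cochain1_def
    by (intro exI[of _ u]) (simp add: cong_iff_dvd_diff dvd_eq_mod_eq_0)
qed

lemma cohomologous_coboundary:
  assumes "cohomologous p G tau f f'" shows "coboundary p G tau (\<lambda>a b. f (a, b) - f' (a, b))"
proof -
  obtain b where b: "b \<in> B2 p G tau" "\<forall>z \<in> carrier G \<times> carrier G. (f z - f' z - b z) mod int p = 0"
    using assms unfolding cohomologous_def by blast
  show ?thesis
    by (rule coboundary_cong[OF B2_coboundary[OF b(1)]]) (use b(2) in \<open>auto simp: cong_iff_dvd_diff dvd_eq_mod_eq_0\<close>)
qed

lemma openin_discrete_prod:
  "S \<subseteq> A \<times> A \<Longrightarrow> openin (prod_topology (discrete_topology A) (discrete_topology A)) S"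
  by (simp add: prod_topology_discrete_topology[symmetric])

lemma discrete_coboundary_B2:
  assumes "group G" "p > 0" "coboundary p G (discrete_topology (carrier G)) f"
  shows "restrict (\<lambda>(a, b). f a b mod int p) (carrier G \<times> carrier G) \<in> B2 p G (discrete_topology (carrier G))"
proof -
  interpret group G by fact
  obtain u where u: "\<And>a b. a \<in> carrier G \<Longrightarrow> b \<in> carrier G \<Longrightarrow> [f a b = u b - u (a \<otimes>\<^bsub>G\<^esub> b) + u a] (mod int p)"
    using assms(3) unfolding coboundary_def by blast
  define v where "v = restrict (\<lambda>x. u x mod int p) (carrier G)"
  have v: "v \<in> cochain1 p G (discrete_topology (carrier G))"
    using assms(2) by (auto simp: cochain1_def v_def)
  have "(f a b mod int p - (v b - v (a \<otimes>\<^bsub>G\<^esub> b) + v a)) mod int p = 0" if "a \<in> carrier G" "b \<in> carrier G" for a b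
  proof -
    have "[v b - v (a \<otimes>\<^bsub>G\<^esub> b) + v a = u b - u (a \<otimes>\<^bsub>G\<^esub> b) + u a] (mod int p)"
      using that by (intro cong_add cong_diff) (auto simp: v_def cong_def)
    then have "[f a b mod int p = v b - v (a \<otimes>\<^bsub>G\<^esub> b) + v a] (mod int p)"
      using u[OF that] by (simp add: cong_def)
    then show ?thesis by (simp add: cong_iff_dvd_diff dvd_eq_mod_eq_0)
  qed
  then show ?thesis
    unfolding B2_def cochain2_def using v assms(2)
    by (auto intro!: openin_discrete_prod bexI[of _ v])
qed

lemma zero_B2:
  assumes "group G" "topspace tau = carrier G" "p > 0"
  shows "(\<lambda>z\<in>carrier G \<times> carrier G. 0) \<in> B2 p G tau"
proof -
  interpret group G by fact
  have o: "openin tau {x \<in> carrier G. (0::int) = k}" for k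
    using assms(2) openin_topspace[of tau] by (cases "k = 0") auto
  have "openin (prod_topology tau tau) {z \<in> carrier G \<times> carrier G. (0::int) = k}" for k
    using assms(2) openin_topspace[of "prod_topology tau tau"] by (cases "k = 0") auto
  then have "(\<lambda>z\<in>carrier G \<times> carrier G. 0) \<in> cochain2 p G tau"
    using assms(3) unfolding cochain2_def by (auto cong: conj_cong)
  moreover have "(\<lambda>z\<in>carrier G. 0) \<in> cochain1 p G tau"
    using assms(3) o unfolding cochain1_def by (auto cong: conj_cong)
  ultimately show ?thesis unfolding B2_def by (auto intro!: bexI[of _ "\<lambda>z\<in>carrier G. 0"])
qed

text \<open>The closures in \<open>plcs\<close> leave no trace in the image: fibres are open, so a
  closure point shares its value with a point of the set itself.\<close>

lemma (in group_hom) plcs_img_discrete: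
  assumes "topspace tau = carrier G" "\<And>q. openin tau {a \<in> carrier G. h a = q}"
  shows "h ` plcs p G tau n \<subseteq> lpc p H n"
proof (induction n)
  case (Suc n)
  let ?S = "{x \<otimes> y \<otimes> inv x \<otimes> inv y | x y. x \<in> carrier G \<and> y \<in> plcs p G tau n} \<union> {y [^] p | y. y \<in> plcs p G tau n}"
  have c: "plcs p G tau n \<subseteq> carrier G"
    using closure_of_subset_topspace[of tau] assms(1) by (cases n) auto
  have Sc: "?S \<subseteq> carrier G" using c by auto
  have "h ` generate G ?S = generate H (h ` ?S)" by (rule generate_img[OF Sc, symmetric])
  also have "\<dots> \<subseteq> lpc p H (Suc n)"
  proof (rule H.generate_subgroup_incl[OF _ H.lpc_subgroup], safe)
    fix x y assume xy: "x \<in> carrier G" "y \<in> plcs p G tau n"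
    then have "h (x \<otimes> y \<otimes> inv x \<otimes> inv y) = h x \<otimes>\<^bsub>H\<^esub> h y \<otimes>\<^bsub>H\<^esub> inv\<^bsub>H\<^esub> h x \<otimes>\<^bsub>H\<^esub> inv\<^bsub>H\<^esub> h y"
      using c by auto
    then show "h (x \<otimes> y \<otimes> inv x \<otimes> inv y) \<in> lpc p H (Suc n)"
      using H.comm_in_pstar[of "h x" "h y" "lpc p H n" p] xy Suc by (auto simp: lpc.simps)
  next
    fix y assume y: "y \<in> plcs p G tau n"
    then have "h (y [^] p) = h y [^]\<^bsub>H\<^esub> p" using c by (auto simp: hom_nat_pow)
    then show "h (y [^] p) \<in> lpc p H (Suc n)"
      using H.pow_in_pstar[of "h y" "lpc p H n" p] y Suc by (auto simp: lpc.simps)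
  qed
  finally have gen: "h ` generate G ?S \<subseteq> lpc p H (Suc n)" .
  show ?case
  proof
    fix q assume "q \<in> h ` plcs p G tau (Suc n)"
    then obtain x where x: "x \<in> tau closure_of generate G ?S" "q = h x" by auto
    have "x \<in> carrier G" using x(1) closure_of_subset_topspace[of tau] assms(1) by blast
    then have "x \<in> {a \<in> carrier G. h a = h x}" by simp
    then have "\<exists>y. y \<in> generate G ?S \<and> y \<in> {a \<in> carrier G. h a = h x}"
      using x(1) assms(2)[of "h x"] unfolding in_closure_of
      by (elim conjE allE[of _ "{a \<in> carrier G. h a = h x}"]) simp
    then obtain a where "a \<in> generate G ?S" "h a = h x" by blast
    then show "q \<in> lpc p H (Suc n)" using gen x(2) by auto
  qed
qed auto

text \<open>K plays the part of F_m, presenting G at level m, and H is a group over G such that the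
  kernel of \<kappa> lies in P_m(H). There are two uses: H a Schur+1 group above G, and H = G with
  \<kappa> the identity.\<close>

locale transgression = psi: group_hom K G \<psi> + kap: group_hom H G \<kappa>
  for K :: "('k, 'kk) monoid_scheme" and G :: "('g, 'gg) monoid_scheme" and H :: "('h, 'hh) monoid_scheme"
    and \<psi> \<kappa> +
  fixes p m :: nat and tau :: "'h topology"
  assumes prime_p: "prime p" and finK: "finite (carrier K)" and lpcK: "lpc p K m = {\<one>\<^bsub>K\<^esub>}"
    and psi_surj: "\<psi> ` carrier K = carrier G" and ker_psi: "kernel K G \<psi> \<subseteq> lpc p K 1"
    and kap_surj: "\<kappa> ` carrier H = carrier G" and topH: "topspace tau = carrier H"
    and kap_open: "openin tau {x \<in> carrier H. \<kappa> x = a}"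
    and ker_kap: "kernel H G \<kappa> \<subseteq> plcs p H tau m"
begin

definition "N = kernel K G \<psi>"
definition "Chars = chars p K N (pstar p K N)"
definition "sec a = (SOME k. k \<in> carrier K \<and> \<psi> k = a)"
definition "cocyc a b = sec a \<otimes>\<^bsub>K\<^esub> sec b \<otimes>\<^bsub>K\<^esub> inv\<^bsub>K\<^esub> sec (a \<otimes>\<^bsub>G\<^esub> b)"
text \<open>\<open>cocyc\<close> is the factor set of K as an extension of G by N;
  \<open>pull\<close> pushes it along the character \<phi> and inflates it to H. Up to sign its
  class is the transgression of \<phi>.\<close>

definition "pull \<phi> = (\<lambda>(a, b)\<in>carrier H \<times> carrier H. \<phi> (cocyc (\<kappa> a) (\<kappa> b)))"

lemma N_normal: "N \<lhd> K"
  unfolding N_def by (rule psi.normal_kernel)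

sublocale N: normal N K by (rule N_normal)

lemma p0: "p > 0" "p > 1"
  using prime_p prime_gt_0_nat prime_gt_1_nat by auto

lemma sec [simp]: "a \<in> carrier G \<Longrightarrow> sec a \<in> carrier K" "a \<in> carrier G \<Longrightarrow> \<psi> (sec a) = a"
proof -
  assume "a \<in> carrier G"
  then have "\<exists>k. k \<in> carrier K \<and> \<psi> k = a" unfolding psi_surj[symmetric] by blast
  from someI_ex[OF this, folded sec_def] show "sec a \<in> carrier K" "\<psi> (sec a) = a" by auto
qed

lemma N_I: "k \<in> carrier K \<Longrightarrow> \<psi> k = \<one>\<^bsub>G\<^esub> \<Longrightarrow> k \<in> N"
  unfolding N_def kernel_def by simp

lemma N_D: "k \<in> N \<Longrightarrow> \<psi> k = \<one>\<^bsub>G\<^esub>"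
  unfolding N_def kernel_def by simp

lemma cocyc_N [simp]: "a \<in> carrier G \<Longrightarrow> b \<in> carrier G \<Longrightarrow> cocyc a b \<in> N"
  by (rule N_I) (simp_all add: cocyc_def)

lemma Chars_mult: "\<phi> \<in> Chars \<Longrightarrow> a \<in> N \<Longrightarrow> b \<in> N \<Longrightarrow> [\<phi> (a \<otimes>\<^bsub>K\<^esub> b) = \<phi> a + \<phi> b] (mod int p)"
  unfolding Chars_def using psi.G.char_mult[of \<phi> p N "pstar p K N" a b, OF _ _ _ N.subgroup_axioms] by (simp add: cong_def)

lemma Chars_inv: "\<phi> \<in> Chars \<Longrightarrow> a \<in> N \<Longrightarrow> [\<phi> (inv\<^bsub>K\<^esub> a) = - \<phi> a] (mod int p)"
  unfolding Chars_def using psi.G.char_inv[of \<phi> p N "pstar p K N" a, OF _ _ N.subgroup_axioms] by (simp add: cong_def)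

lemma Chars_conj: "\<phi> \<in> Chars \<Longrightarrow> x \<in> carrier K \<Longrightarrow> n \<in> N \<Longrightarrow> \<phi> (x \<otimes>\<^bsub>K\<^esub> n \<otimes>\<^bsub>K\<^esub> inv\<^bsub>K\<^esub> x) = \<phi> n"
  unfolding Chars_def using psi.G.char_conj[OF _ order_refl N_normal] .

lemma Chars_range: "\<phi> \<in> Chars \<Longrightarrow> n \<in> N \<Longrightarrow> \<phi> n \<in> {0..<int p}"
  unfolding Chars_def by (rule psi.G.char_range)

text \<open>Replacing a section \<open>s'\<close> by \<open>s = d s'\<close> changes the associated cocycle by the coboundary of \<open>\<phi> \<circ> d\<close>.\<close>

lemma change_section:
  assumes \<phi>: "\<phi> \<in> Chars" and "s x \<in> carrier K" "s y \<in> carrier K" "s z \<in> carrier K"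
    and d: "d x \<in> N" "d y \<in> N" "d z \<in> N"
    and s: "s' x = d x \<otimes>\<^bsub>K\<^esub> s x" "s' y = d y \<otimes>\<^bsub>K\<^esub> s y" "s' z = d z \<otimes>\<^bsub>K\<^esub> s z"
    and c: "s x \<otimes>\<^bsub>K\<^esub> s y \<otimes>\<^bsub>K\<^esub> inv\<^bsub>K\<^esub> s z \<in> N"
  shows "[\<phi> (s' x \<otimes>\<^bsub>K\<^esub> s' y \<otimes>\<^bsub>K\<^esub> inv\<^bsub>K\<^esub> s' z) = \<phi> (s x \<otimes>\<^bsub>K\<^esub> s y \<otimes>\<^bsub>K\<^esub> inv\<^bsub>K\<^esub> s z) + (\<phi> (d y) - \<phi> (d z) + \<phi> (d x))] (mod int p)"
proof -
  let ?c = "s x \<otimes>\<^bsub>K\<^esub> s y \<otimes>\<^bsub>K\<^esub> inv\<^bsub>K\<^esub> s z" and ?e = "s x \<otimes>\<^bsub>K\<^esub> d y \<otimes>\<^bsub>K\<^esub> inv\<^bsub>K\<^esub> s x"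
  have dK: "d x \<in> carrier K" "d y \<in> carrier K" "d z \<in> carrier K" using d by auto
  have e: "?e \<in> N" using N.inv_op_closed2[OF assms(2) d(2)] .
  have eq: "s' x \<otimes>\<^bsub>K\<^esub> s' y \<otimes>\<^bsub>K\<^esub> inv\<^bsub>K\<^esub> s' z = d x \<otimes>\<^bsub>K\<^esub> (?e \<otimes>\<^bsub>K\<^esub> (?c \<otimes>\<^bsub>K\<^esub> inv\<^bsub>K\<^esub> d z))"
    unfolding s using assms(2-4) dK by (simp add: psi.G.m_assoc psi.G.inv_mult_group)
  have "[\<phi> (d x \<otimes>\<^bsub>K\<^esub> (?e \<otimes>\<^bsub>K\<^esub> (?c \<otimes>\<^bsub>K\<^esub> inv\<^bsub>K\<^esub> d z))) = \<phi> (d x) + (\<phi> ?e + (\<phi> ?c + - \<phi> (d z)))] (mod int p)"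
    by (intro cong_trans[OF Chars_mult[OF \<phi>]] cong_add cong_refl Chars_inv[OF \<phi>] N.m_closed N.m_inv_closed d e c)
  then show ?thesis unfolding eq Chars_conj[OF \<phi> assms(2) d(2)] by (simp add: algebra_simps)
qed

text \<open>Associativity in K, applied to three chosen lifts. The conjugation by
  \<open>sec a\<close> disappears because characters are invariant under conjugation.\<close>

lemma cocyc_identity:
  assumes \<phi>: "\<phi> \<in> Chars" and a: "a \<in> carrier G" and b: "b \<in> carrier G" and c: "c \<in> carrier G"
  shows "[\<phi> (cocyc b c) - \<phi> (cocyc (a \<otimes>\<^bsub>G\<^esub> b) c) + \<phi> (cocyc a (b \<otimes>\<^bsub>G\<^esub> c)) - \<phi> (cocyc a b) = 0] (mod int p)"
proof -
  have e: "cocyc a b \<otimes>\<^bsub>K\<^esub> cocyc (a \<otimes>\<^bsub>G\<^esub> b) c = (sec a \<otimes>\<^bsub>K\<^esub> cocyc b c \<otimes>\<^bsub>K\<^esub> inv\<^bsub>K\<^esub> sec a) \<otimes>\<^bsub>K\<^esub> cocyc a (b \<otimes>\<^bsub>G\<^esub> c)"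
    using a b c unfolding cocyc_def by (simp add: psi.G.m_assoc psi.G.inv_mult_group psi.H.m_assoc)
  have c1: "[\<phi> (cocyc a b \<otimes>\<^bsub>K\<^esub> cocyc (a \<otimes>\<^bsub>G\<^esub> b) c) = \<phi> (cocyc a b) + \<phi> (cocyc (a \<otimes>\<^bsub>G\<^esub> b) c)] (mod int p)"
    using a b c by (intro Chars_mult[OF \<phi>]) auto
  have c2: "[\<phi> ((sec a \<otimes>\<^bsub>K\<^esub> cocyc b c \<otimes>\<^bsub>K\<^esub> inv\<^bsub>K\<^esub> sec a) \<otimes>\<^bsub>K\<^esub> cocyc a (b \<otimes>\<^bsub>G\<^esub> c)) = \<phi> (cocyc b c) + \<phi> (cocyc a (b \<otimes>\<^bsub>G\<^esub> c))] (mod int p)"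
    using Chars_mult[OF \<phi> N.inv_op_closed2[of "sec a" "cocyc b c"], of "cocyc a (b \<otimes>\<^bsub>G\<^esub> c)"] a b c Chars_conj[OF \<phi>] by simp
  have "[\<phi> (cocyc b c) + \<phi> (cocyc a (b \<otimes>\<^bsub>G\<^esub> c)) = \<phi> (cocyc a b) + \<phi> (cocyc (a \<otimes>\<^bsub>G\<^esub> b) c)] (mod int p)"
    by (rule cong_trans[OF cong_sym[OF c2[folded e]] c1])
  then show ?thesis by (simp add: cong_iff_dvd_diff algebra_simps)
qed

lemma pull_Z2:
  assumes \<phi>: "\<phi> \<in> Chars" shows "pull \<phi> \<in> Z2 p H tau"
proof -
  have open2: "openin (prod_topology tau tau) {z \<in> carrier H \<times> carrier H. pull \<phi> z = k}" for k
  proof -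
    have "{z \<in> carrier H \<times> carrier H. pull \<phi> z = k} =
      \<Union> {{x \<in> carrier H. \<kappa> x = a} \<times> {x \<in> carrier H. \<kappa> x = b} | a b. \<phi> (cocyc a b) = k}"
      by (auto simp: pull_def)
    then show ?thesis using kap_open by (auto intro!: openin_Union simp: openin_prod_Times_iff)
  qed
  have "pull \<phi> \<in> (carrier H \<times> carrier H) \<rightarrow>\<^sub>E {0..<int p}"
    using Chars_range[OF \<phi>] cocyc_N kap.hom_closed by (auto simp: pull_def)
  moreover have "(pull \<phi> (b, c) - pull \<phi> (a \<otimes>\<^bsub>H\<^esub> b, c) + pull \<phi> (a, b \<otimes>\<^bsub>H\<^esub> c) - pull \<phi> (a, b)) mod int p = 0"
    if "a \<in> carrier H" "b \<in> carrier H" "c \<in> carrier H" for a b c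
    using cocyc_identity[OF \<phi>, of "\<kappa> a" "\<kappa> b" "\<kappa> c"] that by (simp add: pull_def cong_def)
  ultimately show ?thesis using open2 unfolding Z2_def cochain2_def by blast
qed

lemma Chars_combine:
  assumes "\<phi> \<in> Chars" "\<phi>' \<in> Chars" "\<And>n. n \<in> N \<Longrightarrow> [\<eta>' n = c * \<phi> n + c' * \<phi>' n] (mod int p)"
    "\<eta>' \<in> N \<rightarrow>\<^sub>E {0..<int p}"
  shows "\<eta>' \<in> Chars"
proof -
  have "[\<eta>' (a \<otimes>\<^bsub>K\<^esub> b) = \<eta>' a + \<eta>' b] (mod int p)" if "a \<in> N" "b \<in> N" for a b
  proof -
    have "[\<eta>' (a \<otimes>\<^bsub>K\<^esub> b) = c * (\<phi> a + \<phi> b) + c' * (\<phi>' a + \<phi>' b)] (mod int p)"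
      using that assms(1,2) by (intro cong_trans[OF assms(3)] cong_add cong_mult cong_refl Chars_mult) auto
    also have "c * (\<phi> a + \<phi> b) + c' * (\<phi>' a + \<phi>' b) = (c * \<phi> a + c' * \<phi>' a) + (c * \<phi> b + c' * \<phi>' b)"
      by (simp add: algebra_simps)
    also have "[\<dots> = \<eta>' a + \<eta>' b] (mod int p)" using that by (intro cong_add cong_sym[OF assms(3)])
    finally show ?thesis .
  qed
  moreover have "\<eta>' w = 0" if "w \<in> pstar p K N" for w
  proof -
    have w: "w \<in> N" using that psi.G.pstar_subset[OF N_normal] by blast
    have "\<phi> w = 0" "\<phi>' w = 0" using that assms(1,2) by (auto simp: Chars_def chars_def)
    then have "[\<eta>' w = 0] (mod int p)" using assms(3)[OF w] by simp
    moreover have "\<eta>' w \<in> {0..<int p}" using assms(4) w by auto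
    ultimately show ?thesis by (simp add: cong_def)
  qed
  ultimately show ?thesis
    using assms(4) unfolding Chars_def chars_def by (auto simp: cong_iff_dvd_diff dvd_eq_mod_eq_0)
qed

lemma generator_power:
  assumes \<phi>: "\<phi> \<in> Chars" and z: "z \<in> N" "\<phi> z = 1" and n: "n \<in> N"
  shows "\<phi> (n \<otimes>\<^bsub>K\<^esub> inv\<^bsub>K\<^esub> (z [^]\<^bsub>K\<^esub> nat (\<phi> n))) = 0"
proof -
  let ?w = "z [^]\<^bsub>K\<^esub> nat (\<phi> n)"
  have w: "?w \<in> N" using psi.G.subgroup_nat_pow_closed[OF N.subgroup_axioms z(1)] .
  have "\<phi> ?w = \<phi> n"
    using psi.G.char_pow[OF \<phi>[unfolded Chars_def] z(1) N.subgroup_axioms, of "nat (\<phi> n)"] Chars_range[OF \<phi> n] z(2) by simp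
  have "[\<phi> (n \<otimes>\<^bsub>K\<^esub> inv\<^bsub>K\<^esub> ?w) = \<phi> n + - \<phi> ?w] (mod int p)"
    by (intro cong_trans[OF Chars_mult[OF \<phi> n]] cong_add cong_refl Chars_inv[OF \<phi>] N.m_inv_closed w)
  then have "[\<phi> (n \<otimes>\<^bsub>K\<^esub> inv\<^bsub>K\<^esub> ?w) = 0] (mod int p)" using \<open>\<phi> ?w = \<phi> n\<close> by simp
  moreover have "\<phi> (n \<otimes>\<^bsub>K\<^esub> inv\<^bsub>K\<^esub> ?w) \<in> {0..<int p}" using Chars_range[OF \<phi>] n w by simp
  ultimately show ?thesis by (simp add: cong_def)
qed

text \<open>If the class of \<open>\<phi> \<noteq> 0\<close> died in \<open>H\<^sup>2(H)\<close>, then \<open>\<kappa>\<close> would lift to a homomorphism \<open>\<theta>\<close> into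
  \<open>K / ker \<phi>\<close>, which has class at most \<open>m\<close>, so \<open>\<theta>\<close> factors through \<open>G\<close>.
  As \<open>N\<close> consists of non-generators, \<open>\<theta>\<close> is onto, which contradicts \<open>ker \<phi> \<noteq> N\<close>.\<close>

lemma pull_coboundary_zero:
  assumes \<phi>: "\<phi> \<in> Chars" and cob: "coboundary p H tau (\<lambda>a b. pull \<phi> (a, b))" and n: "n \<in> N"
  shows "\<phi> n = 0"
proof (rule ccontr)
  assume n0: "\<phi> n \<noteq> 0"
  have nr: "\<phi> n \<in> {0..<int p}" using Chars_range[OF \<phi> n] .
  then have "\<not> int p dvd \<phi> n" using n0 by (auto dest: zdvd_imp_le)
  then have "coprime (\<phi> n) (int p)"
    using prime_p by (metis coprime_commute prime_imp_coprime prime_nat_int_transfer)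
  \<comment> \<open>A suitable power \<open>z\<close> of \<open>n\<close> has \<phi>(z) = 1, so that
    \<phi> itself gives the exponents with respect to the image \<open>Z\<close> of
    \<open>z\<close>.\<close>
  then obtain v where v: "[\<phi> n * v = 1] (mod int p)" using cong_solve_coprime_int by blast
  define z where "z = n [^]\<^bsub>K\<^esub> nat (v mod int p)"
  have z: "z \<in> N" unfolding z_def using psi.G.subgroup_nat_pow_closed[OF N.subgroup_axioms n] .
  have z1: "\<phi> z = 1"
  proof -
    have "\<phi> z = ((v mod int p) * \<phi> n) mod int p"
      using psi.G.char_pow[OF \<phi>[unfolded Chars_def] n N.subgroup_axioms, of "nat (v mod int p)"] p0 by (simp add: z_def)
    also have "\<dots> = (\<phi> n * v) mod int p" by (metis mod_mult_left_eq mult.commute)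
    also have "\<dots> = 1" using v p0 by (simp add: cong_def)
    finally show ?thesis .
  qed
  define L where "L = {k \<in> N. \<phi> k = 0}"
  have LN: "L \<subseteq> N" by (auto simp: L_def)
  have L: "subgroup L K"
  proof (rule psi.G.subgroupI)
    have "\<one>\<^bsub>K\<^esub> \<in> L" using psi.G.char_one[OF \<phi>[unfolded Chars_def] N.subgroup_axioms] by (simp add: L_def)
    then show "L \<noteq> {}" by blast
    show "inv\<^bsub>K\<^esub> a \<in> L" if "a \<in> L" for a
      using that psi.G.char_inv[OF \<phi>[unfolded Chars_def] _ N.subgroup_axioms] by (simp add: L_def)
    show "a \<otimes>\<^bsub>K\<^esub> b \<in> L" if "a \<in> L" "b \<in> L" for a b
      using that psi.G.char_mult[OF \<phi>[unfolded Chars_def] _ _ N.subgroup_axioms] by (simp add: L_def)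
  qed (auto simp: L_def)
  have pL: "pstar p K N \<subseteq> L"
    using \<phi> psi.G.pstar_subset[OF N_normal] by (auto simp: L_def Chars_def chars_def)
  have Ln: "L \<lhd> K" by (rule psi.G.between_normal[OF L pL LN])
  interpret L: normal L K by (rule Ln)
  define Q where "Q = K Mod L"
  interpret Q: group Q unfolding Q_def by (rule L.factorgroup_is_group)
  define q where "q k = L #>\<^bsub>K\<^esub> k" for k
  have qh: "q \<in> hom K Q" unfolding Q_def q_def[abs_def] by (rule L.r_coset_hom_Mod)
  interpret q: group_hom K Q q using qh by (simp add: group_hom_def group_hom_axioms_def)
  have q_surj: "q ` carrier K = carrier Q" by (simp add: Q_def carrier_FactGroup q_def[abs_def])
  have q1: "q k = \<one>\<^bsub>Q\<^esub> \<longleftrightarrow> k \<in> L" if "k \<in> carrier K" for k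
    unfolding q_def Q_def one_FactGroup
    using psi.G.coset_join1[OF _ that L] psi.G.coset_join2[OF that L] by blast
  have lpcQ: "lpc p Q m = {\<one>\<^bsub>Q\<^esub>}"
    using q.lpc_img[OF q_surj, of p m] lpcK by simp
  define Z where "Z = q z"
  have ZQ: "Z \<in> carrier Q" using z by (simp add: Z_def)
  have Zcent: "Z \<otimes>\<^bsub>Q\<^esub> x = x \<otimes>\<^bsub>Q\<^esub> Z" if "x \<in> carrier Q" for x
  proof -
    from that obtain k where k: "k \<in> carrier K" "x = q k" unfolding q_surj[symmetric] by blast
    have "k \<otimes>\<^bsub>K\<^esub> z \<otimes>\<^bsub>K\<^esub> inv\<^bsub>K\<^esub> k \<otimes>\<^bsub>K\<^esub> inv\<^bsub>K\<^esub> z \<in> L" using psi.G.comm_in_pstar[OF k(1) z] pL by blast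
    then have "x \<otimes>\<^bsub>Q\<^esub> Z \<otimes>\<^bsub>Q\<^esub> inv\<^bsub>Q\<^esub> x \<otimes>\<^bsub>Q\<^esub> inv\<^bsub>Q\<^esub> Z = \<one>\<^bsub>Q\<^esub>"
      using q1[of "k \<otimes>\<^bsub>K\<^esub> z \<otimes>\<^bsub>K\<^esub> inv\<^bsub>K\<^esub> k \<otimes>\<^bsub>K\<^esub> inv\<^bsub>K\<^esub> z"] k z by (simp add: Z_def)
    then have "x \<otimes>\<^bsub>Q\<^esub> Z = inv\<^bsub>Q\<^esub> (inv\<^bsub>Q\<^esub> x \<otimes>\<^bsub>Q\<^esub> inv\<^bsub>Q\<^esub> Z)"
      using that ZQ Q.inv_equality[of "x \<otimes>\<^bsub>Q\<^esub> Z" "inv\<^bsub>Q\<^esub> x \<otimes>\<^bsub>Q\<^esub> inv\<^bsub>Q\<^esub> Z"] by (simp add: Q.m_assoc)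
    then show ?thesis using that ZQ by (simp add: Q.inv_mult_group)
  qed
  have Zp: "Z [^]\<^bsub>Q\<^esub> p = \<one>\<^bsub>Q\<^esub>"
    using psi.G.pow_in_pstar[OF z, of p] pL q1[of "z [^]\<^bsub>K\<^esub> p"] z q.hom_nat_pow[of z p] by (auto simp: Z_def)
  have Zcong: "Z [^]\<^bsub>Q\<^esub> i = Z [^]\<^bsub>Q\<^esub> j" if "[i = j] (mod int p)" for i j :: int
  proof -
    from cong_sym[OF that] obtain k where "i = j + int p * k" unfolding cong_iff_lin by blast
    then have "Z [^]\<^bsub>Q\<^esub> i = Z [^]\<^bsub>Q\<^esub> j \<otimes>\<^bsub>Q\<^esub> (Z [^]\<^bsub>Q\<^esub> int p) [^]\<^bsub>Q\<^esub> k"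
      using ZQ by (simp add: Q.int_pow_mult Q.int_pow_pow)
    then show ?thesis using Zp ZQ by (simp add: int_pow_int)
  qed
  have Zcent': "Z [^]\<^bsub>Q\<^esub> i \<otimes>\<^bsub>Q\<^esub> x = x \<otimes>\<^bsub>Q\<^esub> Z [^]\<^bsub>Q\<^esub> i" if "x \<in> carrier Q" for x and i :: int
  proof -
    have "Z [^]\<^bsub>Q\<^esub> i = Z [^]\<^bsub>Q\<^esub> (i mod int p)" by (rule Zcong) (simp add: cong_def)
    also have "\<dots> = Z [^]\<^bsub>Q\<^esub> nat (i mod int p)"
      using p0 by (metis int_nat_eq int_pow_int of_nat_0_less_iff pos_mod_sign)
    finally show ?thesis
      using Q.group_commutes_pow[OF Zcent[OF that] ZQ that, of "nat (i mod int p)"] by simp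
  qed
  have qN: "q k = Z [^]\<^bsub>Q\<^esub> \<phi> k" if k: "k \<in> N" for k
  proof -
    have w: "z [^]\<^bsub>K\<^esub> nat (\<phi> k) \<in> N" using psi.G.subgroup_nat_pow_closed[OF N.subgroup_axioms z] .
    have "q (k \<otimes>\<^bsub>K\<^esub> inv\<^bsub>K\<^esub> (z [^]\<^bsub>K\<^esub> nat (\<phi> k))) = \<one>\<^bsub>Q\<^esub>"
      using q1[of "k \<otimes>\<^bsub>K\<^esub> inv\<^bsub>K\<^esub> (z [^]\<^bsub>K\<^esub> nat (\<phi> k))"] generator_power[OF \<phi> z z1 k] k w by (simp add: L_def)
    then have "q k \<otimes>\<^bsub>Q\<^esub> inv\<^bsub>Q\<^esub> (Z [^]\<^bsub>Q\<^esub> nat (\<phi> k)) = \<one>\<^bsub>Q\<^esub>"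
      using k z q.hom_nat_pow[of z "nat (\<phi> k)"] by (simp add: Z_def)
    then have "q k = Z [^]\<^bsub>Q\<^esub> nat (\<phi> k)"
      using k ZQ Q.inv_equality[of "q k" "inv\<^bsub>Q\<^esub> (Z [^]\<^bsub>Q\<^esub> nat (\<phi> k))"] by simp
    then show ?thesis using Chars_range[OF \<phi> k] by (metis atLeastLessThan_iff int_pow_int nat_0_le)
  qed
  obtain u where u_open: "\<And>k. openin tau {x \<in> carrier H. u x = k}"
    and u: "\<And>a b. a \<in> carrier H \<Longrightarrow> b \<in> carrier H \<Longrightarrow> [pull \<phi> (a, b) = u b - u (a \<otimes>\<^bsub>H\<^esub> b) + u a] (mod int p)"
    using cob unfolding coboundary_def by blast
  \<comment> \<open>The map q \<circ> sec \<circ> \<kappa> is multiplicative up to \<open>Z\<close>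
    raised to the cocycle value; the cochain \<open>u\<close> cancels exactly this defect.\<close>
  define \<theta> where "\<theta> a = q (sec (\<kappa> a)) \<otimes>\<^bsub>Q\<^esub> Z [^]\<^bsub>Q\<^esub> (- u a)" for a
  have \<theta>h: "\<theta> \<in> hom H Q"
  proof (rule homI)
    show "\<theta> a \<in> carrier Q" if "a \<in> carrier H" for a using that ZQ by (simp add: \<theta>_def)
    fix a b assume a: "a \<in> carrier H" and b: "b \<in> carrier H"
    let ?x = "\<kappa> a" and ?y = "\<kappa> b"
    have c: "cocyc ?x ?y \<in> N" using a b by simp
    have "sec ?x \<otimes>\<^bsub>K\<^esub> sec ?y = cocyc ?x ?y \<otimes>\<^bsub>K\<^esub> sec (?x \<otimes>\<^bsub>G\<^esub> ?y)"
      using a b by (simp add: cocyc_def psi.G.m_assoc)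
    then have "q (sec ?x) \<otimes>\<^bsub>Q\<^esub> q (sec ?y) = q (cocyc ?x ?y) \<otimes>\<^bsub>Q\<^esub> q (sec (\<kappa> (a \<otimes>\<^bsub>H\<^esub> b)))"
      using a b c by (metis N.mem_carrier kap.hom_closed kap.hom_mult psi.H.m_closed q.hom_mult sec(1))
    then have e1: "q (sec ?x) \<otimes>\<^bsub>Q\<^esub> q (sec ?y) = q (sec (\<kappa> (a \<otimes>\<^bsub>H\<^esub> b))) \<otimes>\<^bsub>Q\<^esub> Z [^]\<^bsub>Q\<^esub> \<phi> (cocyc ?x ?y)"
      using qN[OF c] Zcent'[of "q (sec (\<kappa> (a \<otimes>\<^bsub>H\<^esub> b)))"] a b by simp
    have "\<theta> a \<otimes>\<^bsub>Q\<^esub> \<theta> b = q (sec ?x) \<otimes>\<^bsub>Q\<^esub> (Z [^]\<^bsub>Q\<^esub> (- u a) \<otimes>\<^bsub>Q\<^esub> q (sec ?y)) \<otimes>\<^bsub>Q\<^esub> Z [^]\<^bsub>Q\<^esub> (- u b)"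
      using a b ZQ by (simp add: \<theta>_def Q.m_assoc)
    also have "\<dots> = (q (sec ?x) \<otimes>\<^bsub>Q\<^esub> q (sec ?y)) \<otimes>\<^bsub>Q\<^esub> (Z [^]\<^bsub>Q\<^esub> (- u a) \<otimes>\<^bsub>Q\<^esub> Z [^]\<^bsub>Q\<^esub> (- u b))"
      using Zcent'[of "q (sec ?y)" "- u a"] a b ZQ by (simp add: Q.m_assoc)
    also have "\<dots> = q (sec (\<kappa> (a \<otimes>\<^bsub>H\<^esub> b))) \<otimes>\<^bsub>Q\<^esub> Z [^]\<^bsub>Q\<^esub> (\<phi> (cocyc ?x ?y) + (- u a + - u b))"
      unfolding e1 Q.int_pow_mult[OF ZQ] using a b ZQ by (simp add: Q.m_assoc)
    also have "Z [^]\<^bsub>Q\<^esub> (\<phi> (cocyc ?x ?y) + (- u a + - u b)) = Z [^]\<^bsub>Q\<^esub> (- u (a \<otimes>\<^bsub>H\<^esub> b))"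
    proof (rule Zcong)
      have "[\<phi> (cocyc ?x ?y) = u b - u (a \<otimes>\<^bsub>H\<^esub> b) + u a] (mod int p)"
        using u[OF a b] a b by (simp add: pull_def)
      from cong_add[OF this cong_refl[of "- u a + - u b"]]
      show "[\<phi> (cocyc ?x ?y) + (- u a + - u b) = - u (a \<otimes>\<^bsub>H\<^esub> b)] (mod int p)" by simp
    qed
    finally show "\<theta> (a \<otimes>\<^bsub>H\<^esub> b) = \<theta> a \<otimes>\<^bsub>Q\<^esub> \<theta> b" by (simp add: \<theta>_def)
  qed
  interpret T: group_hom H Q \<theta> using \<theta>h by (simp add: group_hom_def group_hom_axioms_def)
  have T_open: "openin tau {a \<in> carrier H. \<theta> a = x}" for x
    unfolding \<theta>_def by (rule openin_combine[of tau "carrier H" \<kappa> u "\<lambda>g k. q (sec g) \<otimes>\<^bsub>Q\<^esub> Z [^]\<^bsub>Q\<^esub> (- k) = x", OF kap_open u_open])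
  \<comment> \<open>P_m(Q) = 1 because P_m(K) = 1, so \<theta> kills P_m(H) and with it the kernel
    of \<kappa>.\<close>
  have T_ker: "\<theta> a = \<one>\<^bsub>Q\<^esub>" if "a \<in> carrier H" "\<kappa> a = \<one>\<^bsub>G\<^esub>" for a
    using T.plcs_img_discrete[OF topH T_open, of p m] lpcQ ker_kap that by (auto simp: kernel_def)
  \<comment> \<open>The preimage of the image of \<theta>. It maps onto G, so M N = K, and N lies in
    the Frattini subgroup of K.\<close>
  define M where "M = {k \<in> carrier K. q k \<in> \<theta> ` carrier H}"
  have Msub: "subgroup M K"
  proof -
    have I: "subgroup (\<theta> ` carrier H) Q" by (rule T.img_is_subgroup)
    show ?thesis
      by (rule psi.G.subgroupI)
        (auto simp: M_def subgroup.m_inv_closed[OF I] subgroup.m_closed[OF I] intro!: exI[of _ "\<one>\<^bsub>K\<^esub>"] subgroup.one_closed[OF I])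
  qed
  have Zrep: "\<exists>w\<in>N. Z [^]\<^bsub>Q\<^esub> i = q w" for i :: int
  proof -
    have "z [^]\<^bsub>K\<^esub> i \<in> N" using psi.G.subgroup_int_pow_closed[OF N.subgroup_axioms z] .
    moreover have "Z [^]\<^bsub>Q\<^esub> i = q (z [^]\<^bsub>K\<^esub> i)" using z q.hom_int_pow by (simp add: Z_def)
    ultimately show ?thesis by blast
  qed
  have "carrier K \<subseteq> generate K (M \<union> pstar p K (carrier K))"
  proof
    fix k assume k: "k \<in> carrier K"
    have "\<psi> k \<in> \<kappa> ` carrier H" using k kap_surj by simp
    then obtain a where a: "a \<in> carrier H" "\<kappa> a = \<psi> k" by auto
    obtain w where w: "w \<in> N" "Z [^]\<^bsub>Q\<^esub> (- u a) = q w" using Zrep by blast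
    have "q (sec (\<kappa> a) \<otimes>\<^bsub>K\<^esub> w) = \<theta> a" using a(1) w by (simp add: \<theta>_def)
    then have x: "sec (\<kappa> a) \<otimes>\<^bsub>K\<^esub> w \<in> M" unfolding M_def using a(1) w by auto
    have "inv\<^bsub>K\<^esub> (sec (\<kappa> a) \<otimes>\<^bsub>K\<^esub> w) \<otimes>\<^bsub>K\<^esub> k \<in> N"
      by (rule N_I) (use a k w N_D[OF w(1)] in auto)
    then have y: "inv\<^bsub>K\<^esub> (sec (\<kappa> a) \<otimes>\<^bsub>K\<^esub> w) \<otimes>\<^bsub>K\<^esub> k \<in> pstar p K (carrier K)"
      using ker_psi by (auto simp: N_def lpc_1)
    have "k = (sec (\<kappa> a) \<otimes>\<^bsub>K\<^esub> w) \<otimes>\<^bsub>K\<^esub> (inv\<^bsub>K\<^esub> (sec (\<kappa> a) \<otimes>\<^bsub>K\<^esub> w) \<otimes>\<^bsub>K\<^esub> k)"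
      using a k w by simp
    moreover have "(sec (\<kappa> a) \<otimes>\<^bsub>K\<^esub> w) \<otimes>\<^bsub>K\<^esub> (inv\<^bsub>K\<^esub> (sec (\<kappa> a) \<otimes>\<^bsub>K\<^esub> w) \<otimes>\<^bsub>K\<^esub> k) \<in> generate K (M \<union> pstar p K (carrier K))"
      by (intro generate.eng generate.incl) (use x y in auto)
    ultimately show "k \<in> generate K (M \<union> pstar p K (carrier K))" by simp
  qed
  then have "M = carrier K"
    by (intro psi.G.frattini_argument[OF finK lpcK psi.G.normal_self Msub]) (use subgroup.subset[OF Msub] in auto)
  then have "z \<in> M" using N.mem_carrier[OF z] by simp
  then have "q z \<in> \<theta> ` carrier H" unfolding M_def by simp
  then obtain a where a: "a \<in> carrier H" "q z = \<theta> a" by (elim imageE)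
  obtain w where w: "w \<in> N" "Z [^]\<^bsub>Q\<^esub> (- u a) = q w" using Zrep by blast
  \<comment> \<open>Comparing images in G gives \<kappa> a = 1, as \<open>z\<close> and
    \<open>w\<close> lie in N; then \<theta> a is trivial although q z is not.\<close>
  have "q (sec (\<kappa> a) \<otimes>\<^bsub>K\<^esub> w) = q z" using a w by (simp add: \<theta>_def)
  then have "q (sec (\<kappa> a) \<otimes>\<^bsub>K\<^esub> w \<otimes>\<^bsub>K\<^esub> inv\<^bsub>K\<^esub> z) = \<one>\<^bsub>Q\<^esub>" using a(1) w z by simp
  moreover have "sec (\<kappa> a) \<otimes>\<^bsub>K\<^esub> w \<otimes>\<^bsub>K\<^esub> inv\<^bsub>K\<^esub> z \<in> carrier K" using a(1) w z by simp
  ultimately have "sec (\<kappa> a) \<otimes>\<^bsub>K\<^esub> w \<otimes>\<^bsub>K\<^esub> inv\<^bsub>K\<^esub> z \<in> N" using q1 LN by blast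
  from N_D[OF this] have "\<kappa> a = \<one>\<^bsub>G\<^esub>" using a(1) w z N_D[OF w(1)] N_D[OF z] by simp
  then have "q z = \<one>\<^bsub>Q\<^esub>" using T_ker a by simp
  then show False using q1[of z] z z1 by (simp add: L_def)
qed

text \<open>Transgression is linear, so the difference of the two characters can be put into
  \<open>pull_coboundary_zero\<close>.\<close>

lemma pull_inj:
  assumes \<phi>: "\<phi> \<in> Chars" "\<phi>' \<in> Chars" and c: "coboundary p H tau (\<lambda>a b. pull \<phi> (a, b) - pull \<phi>' (a, b))"
  shows "\<phi> = \<phi>'"
proof -
  define \<delta> where "\<delta> = restrict (\<lambda>n. (\<phi> n - \<phi>' n) mod int p) N"
  have \<delta>: "\<delta> \<in> Chars"
    by (rule Chars_combine[OF \<phi>, of _ 1 "- 1"]) (use p0 in \<open>auto simp: \<delta>_def cong_def mod_simps\<close>)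
  have "coboundary p H tau (\<lambda>a b. pull \<delta> (a, b))"
    by (rule coboundary_cong[OF c]) (simp add: pull_def \<delta>_def cong_def)
  then have "\<delta> n = 0" if "n \<in> N" for n using pull_coboundary_zero[OF \<delta>] that by blast
  then have "[\<phi> n = \<phi>' n] (mod int p)" if "n \<in> N" for n
    using that by (simp add: \<delta>_def cong_iff_dvd_diff dvd_eq_mod_eq_0)
  then have "\<phi> n = \<phi>' n" if "n \<in> N" for n
    using Chars_range[OF \<phi>(1) that] Chars_range[OF \<phi>(2) that] that
    by (metis atLeastLessThan_iff cong_def mod_pos_pos_trivial)
  then show ?thesis using \<phi> unfolding Chars_def chars_def by (auto intro: PiE_ext)
qed

definition "cls f = {(f, f'). f \<in> Z2 p H tau \<and> f' \<in> Z2 p H tau \<and> cohomologous p H tau f f'} `` {f}"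

lemma H2_alt: "H2 p H tau = cls ` Z2 p H tau"
  by (auto simp: H2_def quotient_def cls_def)

lemma cls_mem: "f' \<in> cls f \<longleftrightarrow> f \<in> Z2 p H tau \<and> f' \<in> Z2 p H tau \<and> cohomologous p H tau f f'"
  by (auto simp: cls_def)

lemma cls_inj: "inj_on (\<lambda>\<phi>. cls (pull \<phi>)) Chars"
proof (rule inj_onI)
  fix \<phi> \<phi>' assume \<phi>: "\<phi> \<in> Chars" "\<phi>' \<in> Chars" "cls (pull \<phi>) = cls (pull \<phi>')"
  have "cohomologous p H tau (pull \<phi>') (pull \<phi>')"
    unfolding cohomologous_def by (rule bexI[OF _ zero_B2[OF kap.G.group_axioms topH p0(1)]]) simp
  then have "pull \<phi>' \<in> cls (pull \<phi>)" using \<phi> pull_Z2 by (simp add: cls_mem)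
  then have "cohomologous p H tau (pull \<phi>) (pull \<phi>')" by (simp add: cls_mem)
  then show "\<phi> = \<phi>'" using pull_inj[OF \<phi>(1,2)] cohomologous_coboundary by blast
qed

lemma card_Chars: "finite Chars" "card Chars * card (pstar p K N) = card N"
  using psi.G.card_chars[OF prime_p finite_subset[OF N.subset finK] N_normal psi.G.pstar_subgroup[OF N.subset] order_refl
      N.subgroup_axioms psi.G.pstar_subset[OF N_normal] order_refl]
  by (auto simp: Chars_def)

lemma card_Chars_le_H2:
  assumes "finite (H2 p H tau)" shows "card Chars \<le> card (H2 p H tau)"
  by (rule card_inj_on_le[OF cls_inj _ assms]) (auto simp: H2_alt pull_Z2)

text \<open>How far the section is from commuting with the involutions. For equivariant \<psi> the
  value lies in N.\<close>

definition "dev \<sigma>K \<sigma>G x = \<sigma>K (sec x) \<otimes>\<^bsub>K\<^esub> inv\<^bsub>K\<^esub> sec (\<sigma>G x)"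

text \<open>\<sigma>K(sec x) and sec(\<sigma>G x) both lift \<sigma>G x and differ by
  \<open>dev\<close>, so \<open>change_section\<close> compares their factor sets.\<close>

lemma sigma_cocyc:
  assumes \<phi>: "\<phi> \<in> Chars"
    and s: "\<sigma>K \<in> hom K K" "\<And>k. k \<in> carrier K \<Longrightarrow> \<psi> (\<sigma>K k) = \<sigma>G (\<psi> k)" "\<sigma>G \<in> hom G G"
    and x: "x \<in> carrier G" and y: "y \<in> carrier G"
  shows "[\<phi> (\<sigma>K (cocyc x y)) = \<phi> (cocyc (\<sigma>G x) (\<sigma>G y)) +
    (\<phi> (dev \<sigma>K \<sigma>G y) - \<phi> (dev \<sigma>K \<sigma>G (x \<otimes>\<^bsub>G\<^esub> y)) + \<phi> (dev \<sigma>K \<sigma>G x))] (mod int p)"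
proof -
  interpret sK: group_hom K K \<sigma>K by unfold_locales fact
  interpret sG: group_hom G G \<sigma>G by unfold_locales fact
  have dN: "dev \<sigma>K \<sigma>G x \<in> N" if "x \<in> carrier G" for x
    unfolding dev_def by (rule N_I) (use that s(2) in auto)
  have dd: "\<sigma>K (sec x) = dev \<sigma>K \<sigma>G x \<otimes>\<^bsub>K\<^esub> sec (\<sigma>G x)" if "x \<in> carrier G" for x
    using that by (simp add: dev_def psi.G.m_assoc)
  have e1: "\<sigma>K (cocyc x y) = \<sigma>K (sec x) \<otimes>\<^bsub>K\<^esub> \<sigma>K (sec y) \<otimes>\<^bsub>K\<^esub> inv\<^bsub>K\<^esub> \<sigma>K (sec (x \<otimes>\<^bsub>G\<^esub> y))"
    using x y by (simp add: cocyc_def)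
  have e2: "cocyc (\<sigma>G x) (\<sigma>G y) = sec (\<sigma>G x) \<otimes>\<^bsub>K\<^esub> sec (\<sigma>G y) \<otimes>\<^bsub>K\<^esub> inv\<^bsub>K\<^esub> sec (\<sigma>G (x \<otimes>\<^bsub>G\<^esub> y))"
    using x y by (simp add: cocyc_def)
  show ?thesis
    unfolding e1 e2
    by (rule change_section[OF \<phi>, where s = "\<lambda>x. sec (\<sigma>G x)" and s' = "\<lambda>x. \<sigma>K (sec x)"])
      (use x y dN dd cocyc_N[of "\<sigma>G x" "\<sigma>G y"] e2 in auto)
qed

text \<open>Transgression is equivariant up to a coboundary. If H^2(H) is inverted, the character
  \<phi> \<circ> \<sigma> + \<phi> therefore has trivial class and vanishes by injectivity; since
  characters separate points of N modulo \<open>pstar p K N\<close>, the involution inverts that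
  quotient.\<close>

lemma sigma_Chars:
  assumes "inverts_H2 p H tau \<sigma>H"
    and s: "\<sigma>K \<in> hom K K" "\<And>k. k \<in> carrier K \<Longrightarrow> \<psi> (\<sigma>K k) = \<sigma>G (\<psi> k)"
      "\<And>x. x \<in> carrier H \<Longrightarrow> \<sigma>H x \<in> carrier H" "\<And>x. x \<in> carrier H \<Longrightarrow> \<kappa> (\<sigma>H x) = \<sigma>G (\<kappa> x)"
      "\<sigma>G \<in> hom G G"
    and n: "n \<in> N"
  shows "\<sigma>K n \<otimes>\<^bsub>K\<^esub> n \<in> pstar p K N"
proof -
  interpret sK: group_hom K K \<sigma>K by unfold_locales fact
  interpret sG: group_hom G G \<sigma>G by unfold_locales fact
  have sN: "\<sigma>K n \<in> N" if "n \<in> N" for n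
    by (rule N_I) (use that s(2)[of n] N_D in auto)
  have main: "\<phi> (\<sigma>K n \<otimes>\<^bsub>K\<^esub> n) = 0" if \<phi>: "\<phi> \<in> Chars" for \<phi>
  proof -
    define \<phi>s where "\<phi>s = restrict (\<lambda>n. \<phi> (\<sigma>K n)) N"
    have \<phi>s: "\<phi>s \<in> Chars"
      unfolding Chars_def chars_def
    proof (intro CollectI conjI ballI)
      show "\<phi>s \<in> N \<rightarrow>\<^sub>E {0..<int p}" using Chars_range[OF \<phi>] sN by (auto simp: \<phi>s_def)
      show "(\<phi>s (a \<otimes>\<^bsub>K\<^esub> b) - (\<phi>s a + \<phi>s b)) mod int p = 0" if "a \<in> N" "b \<in> N" for a b
        using Chars_mult[OF \<phi> sN[OF that(1)] sN[OF that(2)]] that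
        by (simp add: \<phi>s_def cong_iff_dvd_diff dvd_eq_mod_eq_0)
      show "\<phi>s w = 0" if "w \<in> pstar p K N" for w
      proof -
        have "\<sigma>K w \<in> pstar p K N" using sK.pstar_img_subset[of N N p] sN that N.subset by auto
        then show ?thesis
          using \<phi> that psi.G.pstar_subset[OF N_normal] by (auto simp: \<phi>s_def Chars_def chars_def)
      qed
    qed
    define \<delta> where "\<delta> = restrict (\<lambda>n. (\<phi>s n + \<phi> n) mod int p) N"
    have \<delta>: "\<delta> \<in> Chars"
      by (rule Chars_combine[OF \<phi>s \<phi>, of _ 1 1]) (use p0 in \<open>auto simp: \<delta>_def cong_def\<close>)
    obtain b where b: "b \<in> B2 p H tau"
      "\<And>a c. a \<in> carrier H \<Longrightarrow> c \<in> carrier H \<Longrightarrow> (pull \<phi> (\<sigma>H a, \<sigma>H c) + pull \<phi> (a, c) - b (a, c)) mod int p = 0"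
      using assms(1) pull_Z2[OF \<phi>] unfolding inverts_H2_def by blast
    have c1: "coboundary p H tau (\<lambda>a c. pull \<phi> (\<sigma>H a, \<sigma>H c) + pull \<phi> (a, c))"
      by (rule coboundary_cong[OF B2_coboundary[OF b(1)]]) (use b(2) in \<open>auto simp: cong_iff_dvd_diff dvd_eq_mod_eq_0\<close>)
    define d where "d = dev \<sigma>K \<sigma>G"
    \<comment> \<open>\<open>dev\<close> is evaluated at \<kappa> a, so the cochain is locally
      constant on H.\<close>
    have c2: "coboundary p H tau (\<lambda>a c. \<phi> (d (\<kappa> c)) - \<phi> (d (\<kappa> (a \<otimes>\<^bsub>H\<^esub> c))) + \<phi> (d (\<kappa> a)))"
      unfolding coboundary_def
    proof (intro exI[of _ "\<lambda>a. \<phi> (d (\<kappa> a))"] conjI allI ballI cong_refl)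
      show "openin tau {x \<in> carrier H. \<phi> (d (\<kappa> x)) = k}" for k
        by (rule openin_combine[of tau "carrier H" \<kappa> \<kappa> "\<lambda>i j. \<phi> (d i) = k", OF kap_open kap_open])
    qed
    have "coboundary p H tau (\<lambda>a c. pull \<delta> (a, c))"
    proof (rule coboundary_cong[OF coboundary_add[OF c1 c2]])
      fix a c assume ac: "a \<in> carrier H" "c \<in> carrier H"
      let ?x = "\<kappa> a" and ?y = "\<kappa> c"
      have xy: "?x \<in> carrier G" "?y \<in> carrier G" using ac by auto
      have "[\<phi> (\<sigma>K (cocyc ?x ?y)) = \<phi> (cocyc (\<sigma>G ?x) (\<sigma>G ?y)) + (\<phi> (d ?y) - \<phi> (d (?x \<otimes>\<^bsub>G\<^esub> ?y)) + \<phi> (d ?x))] (mod int p)"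
        unfolding d_def by (rule sigma_cocyc[OF \<phi> s(1,2,5) xy])
      then have "[\<phi> (\<sigma>K (cocyc ?x ?y)) + \<phi> (cocyc ?x ?y) = \<phi> (cocyc (\<sigma>G ?x) (\<sigma>G ?y)) + (\<phi> (d ?y) - \<phi> (d (?x \<otimes>\<^bsub>G\<^esub> ?y)) + \<phi> (d ?x)) + \<phi> (cocyc ?x ?y)] (mod int p)"
        by (intro cong_add cong_refl)
      then show "[pull \<delta> (a, c) = pull \<phi> (\<sigma>H a, \<sigma>H c) + pull \<phi> (a, c) + (\<phi> (d (\<kappa> c)) - \<phi> (d (\<kappa> (a \<otimes>\<^bsub>H\<^esub> c))) + \<phi> (d (\<kappa> a)))] (mod int p)"
        using ac xy s(3,4) by (simp add: pull_def \<delta>_def \<phi>s_def cong_def algebra_simps)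
    qed
    then have "\<delta> n = 0" using pull_coboundary_zero[OF \<delta>] n by blast
    then have "[\<phi> (\<sigma>K n) + \<phi> n = 0] (mod int p)" using n by (simp add: \<delta>_def \<phi>s_def cong_def)
    then have "[\<phi> (\<sigma>K n \<otimes>\<^bsub>K\<^esub> n) = 0] (mod int p)" using Chars_mult[OF \<phi> sN[OF n] n] cong_trans by blast
    moreover have "\<phi> (\<sigma>K n \<otimes>\<^bsub>K\<^esub> n) \<in> {0..<int p}" using Chars_range[OF \<phi>] sN[OF n] n by simp
    ultimately show ?thesis by (simp add: cong_def)
  qed
  show ?thesis
  proof (rule ccontr)
    assume "\<sigma>K n \<otimes>\<^bsub>K\<^esub> n \<notin> pstar p K N"
    then obtain \<phi> where "\<phi> \<in> Chars" "\<phi> (\<sigma>K n \<otimes>\<^bsub>K\<^esub> n) \<noteq> 0"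
      using psi.G.char_separates[OF prime_p finite_subset[OF N.subset finK] N_normal psi.G.pstar_subgroup[OF N.subset] order_refl
          psi.G.pstar_subset[OF N_normal], of "\<sigma>K n \<otimes>\<^bsub>K\<^esub> n"] sN[OF n] n unfolding Chars_def by auto
    then show False using main by blast
  qed
qed

end

section \<open>Central extensions\<close>

text \<open>The extension of G by Z/p with factor set f. As f is not normalised, the identity
  carries the correction -f(1,1), which returns as the constant \<epsilon> below.\<close>

definition extgrp :: "nat \<Rightarrow> ('a, 'b) monoid_scheme \<Rightarrow> ('a \<times> 'a \<Rightarrow> int) \<Rightarrow> (int \<times> 'a) monoid" where
  "extgrp p G f = \<lparr>carrier = {0..<int p} \<times> carrier G,
     mult = (\<lambda>x y. ((fst x + fst y + f (snd x, snd y)) mod int p, snd x \<otimes>\<^bsub>G\<^esub> snd y)),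
     one = ((- f (\<one>\<^bsub>G\<^esub>, \<one>\<^bsub>G\<^esub>)) mod int p, \<one>\<^bsub>G\<^esub>)\<rparr>"

locale two_cocycle = group G for G (structure) +
  fixes p :: nat and f :: "'a \<times> 'a \<Rightarrow> int"
  assumes p0: "p > 0"
    and cocycle: "a \<in> carrier G \<Longrightarrow> b \<in> carrier G \<Longrightarrow> c \<in> carrier G \<Longrightarrow>
      [f (b, c) + f (a, b \<otimes> c) = f (a \<otimes> b, c) + f (a, b)] (mod int p)"
begin

abbreviation "E \<equiv> extgrp p G f"
abbreviation "\<epsilon> \<equiv> f (\<one>, \<one>)"

lemma cocycle_one:
  assumes "b \<in> carrier G" shows "[f (\<one>, b) = \<epsilon>] (mod int p)" "[f (b, \<one>) = \<epsilon>] (mod int p)"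
proof -
  show "[f (\<one>, b) = \<epsilon>] (mod int p)"
  proof -
    have "[f (\<one>, b) + f (\<one>, b) = f (\<one>, b) + \<epsilon>] (mod int p)"
      using cocycle[OF one_closed one_closed assms] by (simp only: l_one[OF assms] l_one[OF one_closed])
    then show ?thesis unfolding cong_add_lcancel .
  qed
  show "[f (b, \<one>) = \<epsilon>] (mod int p)"
  proof -
    have "[\<epsilon> + f (b, \<one>) = f (b, \<one>) + f (b, \<one>)] (mod int p)"
      using cocycle[OF assms one_closed one_closed] by (simp only: r_one[OF assms] l_one[OF one_closed])
    then show ?thesis unfolding cong_add_rcancel by (rule cong_sym)
  qed
qed

lemma ext_carrier: "x \<in> carrier E \<longleftrightarrow> fst x \<in> {0..<int p} \<and> snd x \<in> carrier G"
  by (cases x) (simp add: extgrp_def)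

lemma ext_mult: "x \<otimes>\<^bsub>E\<^esub> y = ((fst x + fst y + f (snd x, snd y)) mod int p, snd x \<otimes> snd y)"
  by (simp add: extgrp_def)

lemma ext_one: "\<one>\<^bsub>E\<^esub> = ((- \<epsilon>) mod int p, \<one>)"
  by (simp add: extgrp_def)

lemma mod_add_first: "(a mod n + b + c) mod n = (a + b + c) mod (n::int)"
  by (metis add.assoc mod_add_left_eq)

lemma mod_add_second: "(a + b mod n + c) mod n = (a + b + c) mod (n::int)"
  by (metis add.assoc add.commute mod_add_left_eq)

lemma ext_group: "group E"
proof (rule groupI)
  fix x y assume xy: "x \<in> carrier E" "y \<in> carrier E"
  show "x \<otimes>\<^bsub>E\<^esub> y \<in> carrier E" using xy p0 by (simp add: ext_carrier ext_mult)
next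
  show "\<one>\<^bsub>E\<^esub> \<in> carrier E" using p0 by (simp add: ext_carrier ext_one)
next
  fix x y z assume "x \<in> carrier E" "y \<in> carrier E" "z \<in> carrier E"
  then have c: "snd x \<in> carrier G" "snd y \<in> carrier G" "snd z \<in> carrier G" by (auto simp: ext_carrier)
  have "[fst x + fst y + f (snd x, snd y) + fst z + f (snd x \<otimes> snd y, snd z) =
      fst x + (fst y + fst z + f (snd y, snd z)) + f (snd x, snd y \<otimes> snd z)] (mod int p)"
    using cong_add[OF cong_refl[of "fst x + fst y + fst z"] cong_sym[OF cocycle[OF c]]]
    by (simp add: algebra_simps)
  then show "x \<otimes>\<^bsub>E\<^esub> y \<otimes>\<^bsub>E\<^esub> z = x \<otimes>\<^bsub>E\<^esub> (y \<otimes>\<^bsub>E\<^esub> z)"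
    using c by (simp add: ext_mult m_assoc cong_def mod_add_first mod_add_second)
next
  fix x assume x: "x \<in> carrier E"
  then have c: "snd x \<in> carrier G" "fst x mod int p = fst x" by (auto simp: ext_carrier)
  have "[- \<epsilon> + fst x + f (\<one>, snd x) = - \<epsilon> + fst x + \<epsilon>] (mod int p)"
    by (intro cong_add cong_refl cocycle_one c)
  then have "((- \<epsilon>) mod int p + fst x + f (\<one>, snd x)) mod int p = fst x"
    using c(2) unfolding mod_add_first by (simp add: cong_def)
  then show "\<one>\<^bsub>E\<^esub> \<otimes>\<^bsub>E\<^esub> x = x" using c by (simp add: ext_mult ext_one prod_eq_iff)
  let ?y = "((- fst x - f (inv snd x, snd x) - \<epsilon>) mod int p, inv snd x)"
  have "((- fst x - f (inv snd x, snd x) - \<epsilon>) mod int p + fst x + f (inv snd x, snd x)) mod int p =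
      ((- fst x - f (inv snd x, snd x) - \<epsilon>) + (fst x + f (inv snd x, snd x))) mod int p"
    by (simp only: add.assoc mod_add_left_eq)
  then have "?y \<otimes>\<^bsub>E\<^esub> x = \<one>\<^bsub>E\<^esub>" using c by (simp add: ext_mult ext_one)
  moreover have "?y \<in> carrier E" using c p0 by (simp add: ext_carrier)
  ultimately show "\<exists>y\<in>carrier E. y \<otimes>\<^bsub>E\<^esub> x = \<one>\<^bsub>E\<^esub>" by blast
qed

lemma ext_snd_hom: "group_hom E G snd"
  using ext_group by (auto simp: group_hom_def group_hom_axioms_def group_axioms hom_def ext_carrier ext_mult)

lemma ext_central:
  assumes "x \<in> carrier E" "snd x = \<one>" "y \<in> carrier E"
  shows "x \<otimes>\<^bsub>E\<^esub> y = y \<otimes>\<^bsub>E\<^esub> x"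
proof -
  have c: "snd y \<in> carrier G" using assms by (simp add: ext_carrier)
  have "[fst x + fst y + f (\<one>, snd y) = fst x + fst y + f (snd y, \<one>)] (mod int p)"
    by (intro cong_add cong_refl cong_trans[OF cocycle_one(1)[OF c] cong_sym[OF cocycle_one(2)[OF c]]])
  then show ?thesis using assms c by (simp add: ext_mult cong_def add_ac)
qed

lemma ext_exponent:
  assumes "x \<in> carrier E" "snd x = \<one>" shows "x [^]\<^bsub>E\<^esub> p = \<one>\<^bsub>E\<^esub>"
proof -
  have "x [^]\<^bsub>E\<^esub> n = ((int n * (fst x + \<epsilon>) - \<epsilon>) mod int p, \<one>)" for n
  proof (induction n)
    case (Suc n)
    have "((int n * (fst x + \<epsilon>) - \<epsilon>) mod int p + fst x + \<epsilon>) mod int p = (int (Suc n) * (fst x + \<epsilon>) - \<epsilon>) mod int p"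
      unfolding add.assoc mod_add_left_eq by (simp add: algebra_simps)
    then show ?case using Suc assms(2) by (simp add: ext_mult)
  qed (simp add: ext_one)
  then show ?thesis using mod_mult_self2[of "- \<epsilon>" "int p" "fst x + \<epsilon>"] by (simp add: ext_one algebra_simps)
qed

lemma ext_pstar: "pstar p E {x \<in> carrier E. snd x = \<one>} \<subseteq> {\<one>\<^bsub>E\<^esub>}"
proof -
  interpret X: group E by (rule ext_group)
  show ?thesis
  proof (rule X.pstar_least[OF X.triv_subgroup])
    fix x y assume "x \<in> carrier E" "y \<in> {x \<in> carrier E. snd x = \<one>}"
    then have xy: "x \<in> carrier E" "y \<in> carrier E" "x \<otimes>\<^bsub>E\<^esub> y = y \<otimes>\<^bsub>E\<^esub> x" using ext_central[of y x] by auto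
    show "x \<otimes>\<^bsub>E\<^esub> y \<otimes>\<^bsub>E\<^esub> inv\<^bsub>E\<^esub> x \<otimes>\<^bsub>E\<^esub> inv\<^bsub>E\<^esub> y \<in> {\<one>\<^bsub>E\<^esub>}"
      unfolding xy(3) using xy(1,2) by (simp add: X.m_assoc)
  qed (use ext_exponent in auto)
qed

text \<open>P_c(E) lies in the kernel of E \<rightarrow> G, which is central of exponent p, so one
  more step kills it.\<close>

lemma ext_lpc:
  assumes "lpc p G c = {\<one>}" shows "lpc p E (Suc c) = {\<one>\<^bsub>E\<^esub>}"
proof -
  interpret X: group_hom E G snd by (rule ext_snd_hom)
  have "lpc p E c \<subseteq> {x \<in> carrier E. snd x = \<one>}"
  proof
    fix x assume x: "x \<in> lpc p E c"
    then have "snd x \<in> lpc p G c" using X.lpc_img_subset[of p c] by blast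
    then show "x \<in> {x \<in> carrier E. snd x = \<one>}" using assms subsetD[OF X.G.lpc_carrier x] by simp
  qed
  then have "lpc p E (Suc c) \<subseteq> {\<one>\<^bsub>E\<^esub>}"
    using X.G.pstar_mono[of "lpc p E c" "{x \<in> carrier E. snd x = \<one>}" p] ext_pstar by (auto simp: lpc.simps)
  then show ?thesis using subgroup.one_closed[OF X.G.lpc_subgroup[of p "Suc c"]] by blast
qed

end

section \<open>Second cohomology of G from the relations at level c+1\<close>

lemma Z2_two_cocycle:
  assumes "group G" "p > 0" "f \<in> Z2 p G tau" shows "two_cocycle G p f"
proof -
  have "[f (b, c) + f (a, b \<otimes>\<^bsub>G\<^esub> c) = f (a \<otimes>\<^bsub>G\<^esub> b, c) + f (a, b)] (mod int p)"
    if "a \<in> carrier G" "b \<in> carrier G" "c \<in> carrier G" for a b c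
  proof -
    have "(f (b, c) - f (a \<otimes>\<^bsub>G\<^esub> b, c) + f (a, b \<otimes>\<^bsub>G\<^esub> c) - f (a, b)) mod int p = 0"
      using assms(3) that unfolding Z2_def by blast
    moreover have "f (b, c) - f (a \<otimes>\<^bsub>G\<^esub> b, c) + f (a, b \<otimes>\<^bsub>G\<^esub> c) - f (a, b) =
      f (b, c) + f (a, b \<otimes>\<^bsub>G\<^esub> c) - (f (a \<otimes>\<^bsub>G\<^esub> b, c) + f (a, b))" by simp
    ultimately show ?thesis by (simp add: cong_iff_dvd_diff dvd_eq_mod_eq_0)
  qed
  then show ?thesis using assms by (simp add: two_cocycle_def two_cocycle_axioms_def)
qed

text \<open>The level is one above a level with P_c(G) = 1, so that F_m maps to every central
  extension of G by Z/p.\<close>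

locale rank_group_Suc = rank_group G \<sigma> p g m for G (structure) and \<sigma> p g m +
  fixes c s
  assumes m: "m = Suc c" and lpc_c: "lpc p G c = {\<one>}" and s: "s \<in> Etup"
begin

sublocale tr: transgression F G G "lift s" "id" p m "discrete_topology (carrier G)"
proof -
  interpret L: group_hom F G "lift s" using lift_group_hom[OF Etup_closed[OF s]] .
  show "transgression F G G (lift s) id p m (discrete_topology (carrier G))"
  proof
    show "kernel F G (lift s) \<subseteq> lpc p F 1"
      using surj_index(2)[OF lift_hom[OF Etup_closed[OF s]] lift_surj[OF s]] .
    show "kernel G G id \<subseteq> plcs p G (discrete_topology (carrier G)) m"
      using lpc_m by (auto simp: kernel_def plcs_discrete)
  qed (use prime_p F.fin lpc_Fc lift_surj[OF s] in \<open>auto simp: hom_def\<close>)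
qed

text \<open>Surjectivity of transgression. The map F_m \<rightarrow> G lifts to the extension E
  given by f. On N the lift takes values in the central Z/p and yields a character; on the section
  it yields the cochain that compares f with the factor set of F_m.\<close>

lemma class_from_char:
  assumes f: "f \<in> Z2 p G (discrete_topology (carrier G))"
  shows "\<exists>\<phi>\<in>tr.Chars. coboundary p G (discrete_topology (carrier G)) (\<lambda>a b. f (a, b) - tr.pull \<phi> (a, b))"
proof -
  interpret X: two_cocycle G p f using Z2_two_cocycle[OF group_axioms tr.p0(1) f] .
  interpret S: group_hom X.E G snd by (rule X.ext_snd_hom)
  have "lpc p X.E m = {\<one>\<^bsub>X.E\<^esub>}" unfolding m by (rule X.ext_lpc[OF lpc_c])
  \<comment> \<open>Any lifts of the \<open>s i\<close> extend to a homomorphism, by freeness at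
    level m; the first coordinate 0 is a convenient choice.\<close>
  moreover have "(\<lambda>i. (0, s i)) \<in> {..<g} \<rightarrow> carrier X.E"
    using Etup_closed[OF s] tr.p0 by (auto simp: X.ext_carrier)
  ultimately obtain \<Psi> where \<Psi>: "\<Psi> \<in> hom F X.E" "\<And>i. i < g \<Longrightarrow> \<Psi> (Fgen p g m i) = (0, s i)"
    using Fc_universal[OF X.ext_group] by blast
  interpret P: group_hom F X.E \<Psi> using \<Psi>(1) by (simp add: group_hom_def group_hom_axioms_def group_Fc X.ext_group)
  have snd\<Psi>: "snd (\<Psi> x) = lift s x" if "x \<in> carrier F" for x
    using lift_unique[OF Group.hom_compose[OF \<Psi>(1) S.homh] Etup_closed[OF s] _ that] \<Psi>(2) by simp
  define w where "w x = fst (\<Psi> x)" for x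
  have w_mult: "[w (x \<otimes>\<^bsub>F\<^esub> y) = w x + w y + f (lift s x, lift s y)] (mod int p)"
    if "x \<in> carrier F" "y \<in> carrier F" for x y
    using arg_cong[OF P.hom_mult[OF that], of fst] snd\<Psi>[OF that(1)] snd\<Psi>[OF that(2)]
    by (simp add: w_def X.ext_mult cong_def)
  \<comment> \<open>The shift by \<epsilon> moves the first coordinate of the identity of E to
    0.\<close>
  define \<phi> where "\<phi> = restrict (\<lambda>n. (w n + X.\<epsilon>) mod int p) tr.N"
  have \<phi>: "\<phi> \<in> tr.Chars"
    unfolding tr.Chars_def chars_def
  proof (intro CollectI conjI ballI)
    show "\<phi> \<in> tr.N \<rightarrow>\<^sub>E {0..<int p}" using tr.p0 by (auto simp: \<phi>_def)
    show "(\<phi> (a \<otimes>\<^bsub>F\<^esub> b) - (\<phi> a + \<phi> b)) mod int p = 0" if "a \<in> tr.N" "b \<in> tr.N" for a b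
    proof -
      have "[\<phi> (a \<otimes>\<^bsub>F\<^esub> b) = w (a \<otimes>\<^bsub>F\<^esub> b) + X.\<epsilon>] (mod int p)" using that by (simp add: \<phi>_def cong_def)
      also have "[w (a \<otimes>\<^bsub>F\<^esub> b) + X.\<epsilon> = w a + w b + X.\<epsilon> + X.\<epsilon>] (mod int p)"
        using w_mult[of a b] that tr.N_D by (intro cong_add cong_refl) auto
      also have "w a + w b + X.\<epsilon> + X.\<epsilon> = (w a + X.\<epsilon>) + (w b + X.\<epsilon>)" by simp
      also have "[\<dots> = \<phi> a + \<phi> b] (mod int p)" using that by (intro cong_add) (auto simp: \<phi>_def cong_def)
      finally show ?thesis by (simp add: cong_iff_dvd_diff dvd_eq_mod_eq_0)
    qed
    show "\<phi> n = 0" if n: "n \<in> pstar p F tr.N" for n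
    proof -
      have "\<Psi> ` tr.N \<subseteq> {x \<in> carrier X.E. snd x = \<one>}"
        using snd\<Psi> tr.N_D by auto
      then have "\<Psi> ` pstar p F tr.N \<subseteq> {\<one>\<^bsub>X.E\<^esub>}"
        using P.pstar_img_subset[OF tr.N.subset, of "{x \<in> carrier X.E. snd x = \<one>}" p] X.ext_pstar by blast
      then have "\<Psi> n = \<one>\<^bsub>X.E\<^esub>" using n by blast
      then have "w n = (- X.\<epsilon>) mod int p" by (simp add: w_def X.ext_one)
      moreover have "n \<in> tr.N" using n F.pstar_subset[OF tr.N_normal] by blast
      ultimately show ?thesis by (simp add: \<phi>_def mod_simps)
    qed
  qed
  have "coboundary p G (discrete_topology (carrier G)) (\<lambda>a b. f (a, b) - tr.pull \<phi> (a, b))"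
    unfolding coboundary_def
  proof (intro exI[of _ "\<lambda>a. - w (tr.sec a)"] conjI allI ballI)
    fix a b assume ab: "a \<in> carrier G" "b \<in> carrier G"
    let ?c = "tr.cocyc a b"
    have c: "?c \<in> tr.N" "?c \<in> carrier F" using ab tr.cocyc_N tr.N.mem_carrier by auto
    have "tr.sec a \<otimes>\<^bsub>F\<^esub> tr.sec b = ?c \<otimes>\<^bsub>F\<^esub> tr.sec (a \<otimes> b)"
      using ab by (simp add: tr.cocyc_def F.m_assoc)
    then have "[w (tr.sec a) + w (tr.sec b) + f (a, b) = w ?c + w (tr.sec (a \<otimes> b)) + f (\<one>, a \<otimes> b)] (mod int p)"
      using w_mult[of "tr.sec a" "tr.sec b"] w_mult[of ?c "tr.sec (a \<otimes> b)"] ab c tr.N_D[OF c(1)]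
      by (simp add: cong_def)
    also have "[w ?c + w (tr.sec (a \<otimes> b)) + f (\<one>, a \<otimes> b) = w ?c + w (tr.sec (a \<otimes> b)) + X.\<epsilon>] (mod int p)"
      by (intro cong_add cong_refl X.cocycle_one) (use ab in auto)
    also have "w ?c + w (tr.sec (a \<otimes> b)) + X.\<epsilon> = (w ?c + X.\<epsilon>) + w (tr.sec (a \<otimes> b))" by simp
    also have "[\<dots> = tr.pull \<phi> (a, b) + w (tr.sec (a \<otimes> b))] (mod int p)"
      using ab c by (intro cong_add cong_refl) (simp add: tr.pull_def \<phi>_def cong_def)
    finally show "[f (a, b) - tr.pull \<phi> (a, b) = - w (tr.sec b) - - w (tr.sec (a \<otimes> b)) + - w (tr.sec a)] (mod int p)"
      by (simp add: cong_iff_dvd_diff algebra_simps)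
  qed auto
  then show ?thesis using \<phi> by blast
qed

lemma cohomologous_of_coboundary:
  assumes "coboundary p G (discrete_topology (carrier G)) (\<lambda>a b. f (a, b) - f' (a, b))"
  shows "cohomologous p G (discrete_topology (carrier G)) f f'"
  unfolding cohomologous_def
  by (rule bexI[OF _ discrete_coboundary_B2[OF group_axioms tr.p0(1) assms]]) (auto simp: mod_simps)

text \<open>\<open>class_from_char\<close> makes every class a transgression and
  \<open>tr.cls_inj\<close> makes its character unique; the characters in turn are as many as the
  elements of the relation module.\<close>

lemma card_H2: "card (H2 p G (discrete_topology (carrier G))) * card (pstar p F tr.N) = card tr.N"
proof -
  have "H2 p G (discrete_topology (carrier G)) = (\<lambda>\<phi>. tr.cls (tr.pull \<phi>)) ` tr.Chars"
    unfolding tr.H2_alt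
  proof (intro equalityI subsetI)
    fix A assume "A \<in> tr.cls ` Z2 p G (discrete_topology (carrier G))"
    then obtain f where f: "f \<in> Z2 p G (discrete_topology (carrier G))" "A = tr.cls f" by blast
    obtain \<phi> where \<phi>: "\<phi> \<in> tr.Chars"
      "coboundary p G (discrete_topology (carrier G)) (\<lambda>a b. f (a, b) - tr.pull \<phi> (a, b))"
      using class_from_char[OF f(1)] by blast
    have "tr.cls f = tr.cls (tr.pull \<phi>)"
    proof (intro equalityI subsetI)
      fix x assume "x \<in> tr.cls f"
      then have x: "x \<in> Z2 p G (discrete_topology (carrier G))" "cohomologous p G (discrete_topology (carrier G)) f x"
        by (auto simp: tr.cls_mem)
      have "coboundary p G (discrete_topology (carrier G)) (\<lambda>a b. tr.pull \<phi> (a, b) - x (a, b))"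
        using coboundary_diff[OF cohomologous_coboundary[OF x(2)] \<phi>(2)] by simp
      then show "x \<in> tr.cls (tr.pull \<phi>)" using x tr.pull_Z2[OF \<phi>(1)] cohomologous_of_coboundary by (simp add: tr.cls_mem)
    next
      fix x assume "x \<in> tr.cls (tr.pull \<phi>)"
      then have x: "x \<in> Z2 p G (discrete_topology (carrier G))" "cohomologous p G (discrete_topology (carrier G)) (tr.pull \<phi>) x"
        by (auto simp: tr.cls_mem)
      have "coboundary p G (discrete_topology (carrier G)) (\<lambda>a b. f (a, b) - x (a, b))"
        using coboundary_add[OF cohomologous_coboundary[OF x(2)] \<phi>(2)] by (simp add: add.commute)
      then show "x \<in> tr.cls f" using x f(1) cohomologous_of_coboundary by (simp add: tr.cls_mem)
    qed
    then show "A \<in> (\<lambda>\<phi>. tr.cls (tr.pull \<phi>)) ` tr.Chars" using f(2) \<phi>(1) by blast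
  qed (use tr.pull_Z2 in auto)
  then have "card (H2 p G (discrete_topology (carrier G))) = card tr.Chars"
    using card_image[OF tr.cls_inj] by simp
  then show ?thesis using tr.card_Chars by simp
qed

text \<open>The converse of \<open>tr.sigma_Chars\<close> at this level: every class comes from a
  character, and these are inverted by \<sigma>.\<close>

lemma inverts_H2_of_kernel:
  assumes inv: "\<And>n. n \<in> tr.N \<Longrightarrow> sigma_Fc n \<otimes>\<^bsub>F\<^esub> n \<in> pstar p F tr.N"
  shows "inverts_H2 p G (discrete_topology (carrier G)) \<sigma>"
  unfolding inverts_H2_def
proof
  let ?t = "discrete_topology (carrier G)"
  fix f assume f: "f \<in> Z2 p G ?t"
  obtain \<phi> where \<phi>: "\<phi> \<in> tr.Chars" "coboundary p G ?t (\<lambda>a b. f (a, b) - tr.pull \<phi> (a, b))"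
    using class_from_char[OF f] by blast
  then obtain v where v: "\<And>a b. a \<in> carrier G \<Longrightarrow> b \<in> carrier G \<Longrightarrow>
      [f (a, b) - tr.pull \<phi> (a, b) = v b - v (a \<otimes> b) + v a] (mod int p)"
    unfolding coboundary_def by blast
  have sN: "sigma_Fc n \<in> tr.N" if "n \<in> tr.N" for n
  proof (rule tr.N_I)
    have "n \<in> carrier F" by (rule tr.N.mem_carrier[OF that])
    then show "sigma_Fc n \<in> carrier F" "lift s (sigma_Fc n) = \<one>"
      using lift_equivariant[OF s] tr.N_D[OF that] by simp_all
  qed
  have neg: "[\<phi> (sigma_Fc n) = - \<phi> n] (mod int p)" if "n \<in> tr.N" for n
  proof -
    have "\<phi> (sigma_Fc n \<otimes>\<^bsub>F\<^esub> n) = 0"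
      using inv[OF that] \<phi>(1) by (auto simp: tr.Chars_def chars_def)
    then have "[\<phi> (sigma_Fc n) + \<phi> n = 0] (mod int p)"
      using tr.Chars_mult[OF \<phi>(1) sN[OF that] that] by (simp add: cong_sym_eq)
    then show ?thesis by (simp add: cong_iff_dvd_diff)
  qed
  define d where "d x = \<phi> (tr.dev sigma_Fc \<sigma> x)" for x
  \<comment> \<open>The cochain \<open>v\<close> enters at a and at \<sigma> a, once for each copy
    of f, and \<open>d\<close> accounts for the section not being equivariant.\<close>
  have "coboundary p G ?t (\<lambda>a b. f (\<sigma> a, \<sigma> b) + f (a, b))"
    unfolding coboundary_def
  proof (intro exI[of _ "\<lambda>a. v (\<sigma> a) + v a - d a"] conjI allI ballI)
    fix a b assume ab: "a \<in> carrier G" "b \<in> carrier G"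
    have sab: "\<sigma> a \<in> carrier G" "\<sigma> b \<in> carrier G" using ab by auto
    have e1: "[f (\<sigma> a, \<sigma> b) - \<phi> (tr.cocyc (\<sigma> a) (\<sigma> b)) = v (\<sigma> b) - v (\<sigma> (a \<otimes> b)) + v (\<sigma> a)] (mod int p)"
      using v[OF sab] sab ab by (simp add: tr.pull_def)
    have e2: "[f (a, b) - \<phi> (tr.cocyc a b) = v b - v (a \<otimes> b) + v a] (mod int p)"
      using v[OF ab] ab by (simp add: tr.pull_def)
    have e3: "[- \<phi> (tr.cocyc a b) = \<phi> (tr.cocyc (\<sigma> a) (\<sigma> b)) + (d b - d (a \<otimes> b) + d a)] (mod int p)"
      unfolding d_def
      using cong_trans[OF cong_sym[OF neg[OF tr.cocyc_N[OF ab]]]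
        tr.sigma_cocyc[OF \<phi>(1) sigma_Fc_hom lift_equivariant[OF s] sig_hom ab]] .
    have "[f (\<sigma> a, \<sigma> b) - \<phi> (tr.cocyc (\<sigma> a) (\<sigma> b)) + (f (a, b) - \<phi> (tr.cocyc a b)) - - \<phi> (tr.cocyc a b) =
       (v (\<sigma> b) - v (\<sigma> (a \<otimes> b)) + v (\<sigma> a)) + (v b - v (a \<otimes> b) + v a) - (\<phi> (tr.cocyc (\<sigma> a) (\<sigma> b)) + (d b - d (a \<otimes> b) + d a))] (mod int p)"
      by (intro cong_diff cong_add e1 e2 e3)
    from cong_add[OF this cong_refl[of "\<phi> (tr.cocyc (\<sigma> a) (\<sigma> b))"]]
    show "[f (\<sigma> a, \<sigma> b) + f (a, b) = (v (\<sigma> b) + v b - d b) - (v (\<sigma> (a \<otimes> b)) + v (a \<otimes> b) - d (a \<otimes> b)) + (v (\<sigma> a) + v a - d a)] (mod int p)"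
      by (simp add: algebra_simps)
  qed auto
  from discrete_coboundary_B2[OF group_axioms tr.p0(1) this]
  show "\<exists>b\<in>B2 p G ?t. \<forall>a\<in>carrier G. \<forall>c\<in>carrier G. (f (\<sigma> a, \<sigma> c) + f (a, c) - b (a, c)) mod int p = 0"
    by (rule bexI[rotated]) (auto simp: mod_simps)
qed

end

section \<open>Free pro-\<open>p\<close> groups\<close>

locale topgroup = group G for G (structure) +
  fixes tau :: "'a topology"
  assumes topsp: "topspace tau = carrier G"
    and cont_mult: "continuous_map (prod_topology tau tau) tau (\<lambda>z. fst z \<otimes> snd z)"
    and cont_inv: "continuous_map tau tau (\<lambda>x. inv x)"
begin

lemma continuous_mult:
  assumes "continuous_map X tau f" "continuous_map X tau h"
  shows "continuous_map X tau (\<lambda>x. f x \<otimes> h x)"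
proof -
  have "continuous_map X (prod_topology tau tau) (\<lambda>x. (f x, h x))"
    using assms by (simp add: continuous_map_paired)
  from continuous_map_compose[OF this cont_mult] show ?thesis by (simp add: comp_def)
qed

lemma continuous_const: "a \<in> carrier G \<Longrightarrow> continuous_map X tau (\<lambda>x. a)"
  using topsp by simp

lemma closure_carrier: "tau closure_of S \<subseteq> carrier G"
  using closure_of_subset_topspace topsp by metis

lemma closure_incl: "S \<subseteq> carrier G \<Longrightarrow> S \<subseteq> tau closure_of S"
  using closure_of_subset topsp by metis

lemma closure_subgroup:
  assumes S: "subgroup S G" shows "subgroup (tau closure_of S) G"
proof (rule subgroupI)
  interpret S: subgroup S G by fact
  show "tau closure_of S \<subseteq> carrier G" by (rule closure_carrier)
  show "tau closure_of S \<noteq> {}" using closure_incl[OF S.subset] S.one_closed by blast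
  show "inv a \<in> tau closure_of S" if "a \<in> tau closure_of S" for a
  proof -
    have "m_inv G ` (tau closure_of S) \<subseteq> tau closure_of (m_inv G ` S)"
      by (rule continuous_map_image_closure_subset[OF cont_inv])
    moreover have "m_inv G ` S \<subseteq> S" by auto
    ultimately show ?thesis using that closure_of_mono by blast
  qed
  show "a \<otimes> b \<in> tau closure_of S" if "a \<in> tau closure_of S" "b \<in> tau closure_of S" for a b
  proof -
    have "(\<lambda>z. fst z \<otimes> snd z) ` (prod_topology tau tau closure_of (S \<times> S)) \<subseteq> tau closure_of ((\<lambda>z. fst z \<otimes> snd z) ` (S \<times> S))"
      by (rule continuous_map_image_closure_subset[OF cont_mult])
    moreover have "(\<lambda>z. fst z \<otimes> snd z) ` (S \<times> S) \<subseteq> S" by auto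
    ultimately have "(\<lambda>z. fst z \<otimes> snd z) ` ((tau closure_of S) \<times> (tau closure_of S)) \<subseteq> tau closure_of S"
      unfolding closure_of_Times using closure_of_mono by blast
    then show ?thesis using that by fastforce
  qed
qed

lemma closure_normal:
  assumes S: "S \<lhd> G" shows "tau closure_of S \<lhd> G"
proof -
  interpret S: normal S G by fact
  have "x \<otimes> h \<otimes> inv x \<in> tau closure_of S" if x: "x \<in> carrier G" and h: "h \<in> tau closure_of S" for x h
  proof -
    have "continuous_map tau tau (\<lambda>h. x \<otimes> h \<otimes> inv x)"
      using x by (intro continuous_mult continuous_const) auto
    from continuous_map_image_closure_subset[OF this]
    have "(\<lambda>h. x \<otimes> h \<otimes> inv x) ` (tau closure_of S) \<subseteq> tau closure_of ((\<lambda>h. x \<otimes> h \<otimes> inv x) ` S)" .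
    moreover have "(\<lambda>h. x \<otimes> h \<otimes> inv x) ` S \<subseteq> S" using S.inv_op_closed2[OF x] by auto
    ultimately show ?thesis using h closure_of_mono by blast
  qed
  then show ?thesis using closure_subgroup[OF S.subgroup_axioms] by (simp add: normal_inv_iff)
qed

lemma plcs_Suc: "plcs p G tau (Suc n) = tau closure_of (pstar p G (plcs p G tau n))"
  by (simp add: pstar_def)

lemma plcs_normal: "plcs p G tau n \<lhd> G"
proof (induction n)
  case (Suc n)
  then show ?case unfolding plcs_Suc by (intro closure_normal pstar_normal)
qed (simp add: normal_self)

lemma plcs_carrier: "plcs p G tau n \<subseteq> carrier G"
  using subgroup.subset[OF normal_imp_subgroup[OF plcs_normal]] .

lemma plcs_closed: "closedin tau (plcs p G tau n)"
  by (cases n) (auto simp: topsp[symmetric])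

lemma plcs_antimono: "m \<le> n \<Longrightarrow> plcs p G tau n \<subseteq> plcs p G tau m"
proof (rule lift_Suc_antimono_le[of "plcs p G tau"])
  show "plcs p G tau (Suc n) \<subseteq> plcs p G tau n" for n
    unfolding plcs_Suc by (rule closure_of_minimal[OF pstar_subset[OF plcs_normal] plcs_closed])
qed

lemma plcs_continuous_endo:
  assumes f: "f \<in> hom G G" and c: "continuous_map tau tau f"
  shows "f ` plcs p G tau n \<subseteq> plcs p G tau n"
proof (induction n)
  case 0
  then show ?case using f by (auto simp: hom_def)
next
  case (Suc n)
  interpret f: group_hom G G f by unfold_locales fact
  have "f ` pstar p G (plcs p G tau n) \<subseteq> pstar p G (plcs p G tau n)"
    by (rule f.pstar_img_subset[OF plcs_carrier Suc plcs_carrier])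
  then show ?case
    unfolding plcs_Suc using continuous_map_image_closure_subset[OF c] closure_of_mono by blast
qed

lemma closedin_coset:
  assumes "closedin tau P" "P \<subseteq> carrier G" "x \<in> carrier G" shows "closedin tau (P #> x)"
proof -
  have "continuous_map tau tau (\<lambda>y. y \<otimes> inv x)"
    using assms(3) by (intro continuous_mult continuous_const) auto
  from closedin_continuous_map_preimage[OF this assms(1)]
  have "closedin tau {y \<in> carrier G. y \<otimes> inv x \<in> P}" unfolding topsp .
  moreover have "{y \<in> carrier G. y \<otimes> inv x \<in> P} = P #> x"
  proof (intro equalityI subsetI)
    fix y assume "y \<in> {y \<in> carrier G. y \<otimes> inv x \<in> P}"
    then have "y = (y \<otimes> inv x) \<otimes> x" "y \<otimes> inv x \<in> P" using assms(3) by (auto simp: m_assoc)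
    then show "y \<in> P #> x" unfolding r_coset_def by blast
  next
    fix y assume "y \<in> P #> x"
    then obtain a where "a \<in> P" "y = a \<otimes> x" by (auto simp: r_coset_def)
    then show "y \<in> {y \<in> carrier G. y \<otimes> inv x \<in> P}" using assms(2,3) by (auto simp: m_assoc)
  qed
  ultimately show ?thesis by simp
qed

text \<open>The complement is a finite union of closed cosets.\<close>

lemma openin_coset:
  assumes P: "subgroup P G" "closedin tau P" and fin: "finite (rcosets P)" and A: "A \<in> rcosets P"
  shows "openin tau A"
proof -
  have "closedin tau B" if "B \<in> rcosets P" for B
    using that closedin_coset[OF P(2) subgroup.subset[OF P(1)]] by (auto simp: RCOSETS_def)
  then have "closedin tau (\<Union> (rcosets P - {A}))" using fin by (intro closedin_Union) auto
  moreover have "carrier G - \<Union> (rcosets P - {A}) = A"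
  proof -
    have "disjnt A B" if "B \<in> rcosets P - {A}" for B
      using that A rcos_disjoint[OF P(1)] by (auto simp: pairwise_def)
    then show ?thesis
      using rcosets_part_G[OF P(1)] A unfolding disjnt_def by blast
  qed
  ultimately show ?thesis unfolding closedin_def topsp
    by (metis (no_types, lifting) openin_closedin_eq closedin_def topsp \<open>closedin tau (\<Union> (rcosets P - {A}))\<close>)
qed

end

lemma pro_p_topgroup: "pro_p_group p G tau \<Longrightarrow> topgroup G tau"
  by (simp add: pro_p_group_def topgroup_def topgroup_axioms_def)

text \<open>The counterpart of \<open>plcs_img_discrete\<close>: here the source has no topology,
  and closures occur in the target only.\<close>

lemma (in group_hom) lpc_img_plcs:
  assumes "topgroup H tau" shows "h ` lpc p G n \<subseteq> plcs p H tau n"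
proof (induction n)
  case (Suc n)
  interpret T: topgroup H tau by fact
  have "h ` pstar p G (lpc p G n) \<subseteq> pstar p H (plcs p H tau n)"
    by (rule pstar_img_subset[OF G.lpc_carrier Suc T.plcs_carrier])
  moreover have "pstar p H (plcs p H tau n) \<subseteq> carrier H"
    using subgroup.subset[OF H.pstar_subgroup[OF T.plcs_carrier]] .
  ultimately show ?case using T.closure_incl unfolding T.plcs_Suc lpc.simps by blast
qed auto

lemma Fproj_mono:
  assumes "m \<le> n" "w \<in> carrier (free_grp g)" "v \<in> carrier (free_grp g)" "Fproj p g n w = Fproj p g n v"
  shows "Fproj p g m w = Fproj p g m v"
proof -
  interpret F: group "free_grp g" by (rule group_free_grp)
  have "w \<in> Fproj p g n v" using Fproj_eq_iff_mem assms by blast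
  then have "w \<in> Fproj p g m v" using F.lpc_antimono[OF assms(1), of p] by (auto simp: Fproj_def r_coset_def)
  then show ?thesis using Fproj_eq_iff_mem assms by blast
qed

text \<open>Cosets shrink along a coherent sequence, so a word representing coordinate n represents
  all lower ones. Statements about the inverse limit thereby reduce to the free group.\<close>

lemma free_prop_iff:
  "a \<in> carrier (free_prop p g) \<longleftrightarrow> (\<forall>n. \<exists>w\<in>carrier (free_grp g). \<forall>m\<le>n. a m = Fproj p g m w)"
proof
  interpret F: group "free_grp g" by (rule group_free_grp)
  assume a: "a \<in> carrier (free_prop p g)"
  then have c: "a n \<in> carrier (Fc p g n)" "a (Suc n) \<subseteq> a n" for n by (auto simp: free_prop_def)
  show "\<forall>n. \<exists>w\<in>carrier (free_grp g). \<forall>m\<le>n. a m = Fproj p g m w"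
  proof
    fix n
    have "a n \<in> Fproj p g n ` carrier (free_grp g)" using c(1) by (simp add: Fproj_surj)
    then obtain w where w: "w \<in> carrier (free_grp g)" "a n = Fproj p g n w" by blast
    have wn: "w \<in> a n" using w Fproj_eq_iff_mem[of w g w] by blast
    have "a m = Fproj p g m w" if "m \<le> n" for m
    proof -
      have "a n \<subseteq> a m" by (rule lift_Suc_antimono_le[of a, OF c(2) that])
      moreover have "a m \<in> Fproj p g m ` carrier (free_grp g)" using c(1) by (simp add: Fproj_surj)
      then obtain v where v: "v \<in> carrier (free_grp g)" "a m = Fproj p g m v" by blast
      ultimately show ?thesis using wn w(1) Fproj_eq_iff_mem by blast
    qed
    then show "\<exists>w\<in>carrier (free_grp g). \<forall>m\<le>n. a m = Fproj p g m w" using w(1) by blast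
  qed
next
  interpret F: group "free_grp g" by (rule group_free_grp)
  assume r: "\<forall>n. \<exists>w\<in>carrier (free_grp g). \<forall>m\<le>n. a m = Fproj p g m w"
  have "a n \<in> carrier (Fc p g n) \<and> a (Suc n) \<subseteq> a n" for n
  proof -
    obtain w where w: "w \<in> carrier (free_grp g)" "\<forall>m\<le>Suc n. a m = Fproj p g m w" using r by blast
    then have "a n = Fproj p g n w" "a (Suc n) = Fproj p g (Suc n) w" by auto
    moreover have "Fproj p g n w \<in> carrier (Fc p g n)" using w(1) Fproj_surj by blast
    moreover have "Fproj p g (Suc n) w \<subseteq> Fproj p g n w"
      using F.lpc_Suc_subset[of p n] by (auto simp: Fproj_def r_coset_def)
    ultimately show ?thesis by simp
  qed
  then show "a \<in> carrier (free_prop p g)" by (simp add: free_prop_def)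
qed

definition "word_seq p g w = (\<lambda>n. Fproj p g n w)"

lemma word_seq_closed: "w \<in> carrier (free_grp g) \<Longrightarrow> word_seq p g w \<in> carrier (free_prop p g)"
  unfolding free_prop_iff word_seq_def by blast

lemma free_prop_mult: "a \<otimes>\<^bsub>free_prop p g\<^esub> b = (\<lambda>n. a n \<otimes>\<^bsub>Fc p g n\<^esub> b n)"
  by (simp add: free_prop_def)

lemma free_prop_one: "\<one>\<^bsub>free_prop p g\<^esub> = (\<lambda>n. \<one>\<^bsub>Fc p g n\<^esub>)"
  by (simp add: free_prop_def)

lemma free_prop_closed: "a \<in> carrier (free_prop p g) \<Longrightarrow> a n \<in> carrier (Fc p g n)"
  by (simp add: free_prop_def)

lemma group_free_prop: "group (free_prop p g)"
proof (rule groupI)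
  fix a b assume a: "a \<in> carrier (free_prop p g)" and b: "b \<in> carrier (free_prop p g)"
  show "a \<otimes>\<^bsub>free_prop p g\<^esub> b \<in> carrier (free_prop p g)"
    unfolding free_prop_iff
  proof
    fix n
    obtain w v where w: "w \<in> carrier (free_grp g)" "\<And>m. m \<le> n \<Longrightarrow> a m = Fproj p g m w"
      and v: "v \<in> carrier (free_grp g)" "\<And>m. m \<le> n \<Longrightarrow> b m = Fproj p g m v"
      using a b unfolding free_prop_iff by metis
    have "(a \<otimes>\<^bsub>free_prop p g\<^esub> b) m = Fproj p g m (w \<otimes>\<^bsub>free_grp g\<^esub> v)" if "m \<le> n" for m
      using w v that by (simp add: free_prop_mult group_hom.hom_mult[OF group_hom_Fproj])
    moreover have "w \<otimes>\<^bsub>free_grp g\<^esub> v \<in> carrier (free_grp g)" using w v by (simp add: group.is_monoid group_free_grp monoid.m_closed)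
    ultimately show "\<exists>w\<in>carrier (free_grp g). \<forall>m\<le>n. (a \<otimes>\<^bsub>free_prop p g\<^esub> b) m = Fproj p g m w" by blast
  qed
next
  show "\<one>\<^bsub>free_prop p g\<^esub> \<in> carrier (free_prop p g)"
  proof -
    interpret F: group "free_grp g" by (rule group_free_grp)
    have "\<one>\<^bsub>free_prop p g\<^esub> = word_seq p g \<one>\<^bsub>free_grp g\<^esub>"
      using group_hom.hom_one[OF group_hom_Fproj] by (simp add: word_seq_def free_prop_one)
    then show ?thesis using word_seq_closed[OF F.one_closed] by metis
  qed
next
  fix a b c assume "a \<in> carrier (free_prop p g)" "b \<in> carrier (free_prop p g)" "c \<in> carrier (free_prop p g)"
  then show "a \<otimes>\<^bsub>free_prop p g\<^esub> b \<otimes>\<^bsub>free_prop p g\<^esub> c = a \<otimes>\<^bsub>free_prop p g\<^esub> (b \<otimes>\<^bsub>free_prop p g\<^esub> c)"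
    using group_Fc by (simp add: free_prop_mult free_prop_closed monoid.m_assoc group.is_monoid)
next
  fix a assume a: "a \<in> carrier (free_prop p g)"
  show "\<one>\<^bsub>free_prop p g\<^esub> \<otimes>\<^bsub>free_prop p g\<^esub> a = a"
    using a group_Fc by (simp add: free_prop_mult free_prop_one free_prop_closed monoid.l_one group.is_monoid)
  let ?b = "\<lambda>n. inv\<^bsub>Fc p g n\<^esub> a n"
  have "?b \<in> carrier (free_prop p g)"
    unfolding free_prop_iff
  proof
    fix n
    obtain w where w: "w \<in> carrier (free_grp g)" "\<And>m. m \<le> n \<Longrightarrow> a m = Fproj p g m w"
      using a unfolding free_prop_iff by metis
    have "?b m = Fproj p g m (inv\<^bsub>free_grp g\<^esub> w)" if "m \<le> n" for m
      using w that by (simp add: group_hom.hom_inv[OF group_hom_Fproj])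
    moreover have "inv\<^bsub>free_grp g\<^esub> w \<in> carrier (free_grp g)" using w by (simp add: group.inv_closed group_free_grp)
    ultimately show "\<exists>w\<in>carrier (free_grp g). \<forall>m\<le>n. ?b m = Fproj p g m w" by blast
  qed
  moreover have "?b \<otimes>\<^bsub>free_prop p g\<^esub> a = \<one>\<^bsub>free_prop p g\<^esub>"
    using a group_Fc by (simp add: free_prop_mult free_prop_one free_prop_closed group.l_inv)
  ultimately show "\<exists>b\<in>carrier (free_prop p g). b \<otimes>\<^bsub>free_prop p g\<^esub> a = \<one>\<^bsub>free_prop p g\<^esub>" by blast
qed

lemma group_hom_coord: "group_hom (free_prop p g) (Fc p g n) (\<lambda>a. a n)"
  by (auto simp: group_hom_def group_hom_axioms_def group_free_prop group_Fc hom_def free_prop_closed free_prop_mult)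

lemma group_hom_word_seq: "group_hom (free_grp g) (free_prop p g) (word_seq p g)"
proof -
  have "word_seq p g \<in> hom (free_grp g) (free_prop p g)"
  proof (rule homI)
    show "word_seq p g (u \<otimes>\<^bsub>free_grp g\<^esub> v) = word_seq p g u \<otimes>\<^bsub>free_prop p g\<^esub> word_seq p g v"
      if "u \<in> carrier (free_grp g)" "v \<in> carrier (free_grp g)" for u v
      using that by (simp add: word_seq_def free_prop_mult group_hom.hom_mult[OF group_hom_Fproj])
  qed (rule word_seq_closed)
  then show ?thesis by (simp add: group_hom_def group_hom_axioms_def group_free_prop group_free_grp)
qed

lemma coord_surj: "(\<lambda>a. a n) ` carrier (free_prop p g) = carrier (Fc p g n)"
proof
  show "carrier (Fc p g n) \<subseteq> (\<lambda>a. a n) ` carrier (free_prop p g)"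
  proof
    fix C assume "C \<in> carrier (Fc p g n)"
    then obtain w where "w \<in> carrier (free_grp g)" "C = Fproj p g n w" unfolding Fproj_surj[symmetric] by blast
    then show "C \<in> (\<lambda>a. a n) ` carrier (free_prop p g)"
      using word_seq_closed by (intro image_eqI[of _ _ "word_seq p g w"]) (auto simp: word_seq_def)
  qed
qed (auto simp: free_prop_closed)

lemma coord_mono:
  assumes "a \<in> carrier (free_prop p g)" "b \<in> carrier (free_prop p g)" "a n = b n" "m \<le> n"
  shows "a m = b m"
proof -
  obtain w where w: "w \<in> carrier (free_grp g)" "\<And>m. m \<le> n \<Longrightarrow> a m = Fproj p g m w"
    using assms(1) unfolding free_prop_iff by metis
  obtain v where v: "v \<in> carrier (free_grp g)" "\<And>m. m \<le> n \<Longrightarrow> b m = Fproj p g m v"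
    using assms(2) unfolding free_prop_iff by metis
  show ?thesis using Fproj_mono[OF assms(4) w(1) v(1)] w(2)[of n] v(2)[of n] w(2)[OF assms(4)] v(2)[OF assms(4)] assms(3) by auto
qed

lemma topspace_free_prop: "topspace (free_prop_top p g) = carrier (free_prop p g)"
  by (auto simp: free_prop_top_def free_prop_closed)

lemma openin_coord: "openin (free_prop_top p g) {a \<in> carrier (free_prop p g). a n = C}"
proof -
  have "continuous_map (free_prop_top p g) (discrete_topology (carrier (Fc p g n))) (\<lambda>a. a n)"
    unfolding free_prop_top_def by (intro continuous_map_from_subtopology continuous_map_product_projection) simp
  from openin_continuous_map_preimage[OF this, of "{C} \<inter> carrier (Fc p g n)"]
  have "openin (free_prop_top p g) {a \<in> carrier (free_prop p g). a n \<in> {C} \<inter> carrier (Fc p g n)}"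
    by (simp add: topspace_free_prop)
  moreover have "{a \<in> carrier (free_prop p g). a n \<in> {C} \<inter> carrier (Fc p g n)} = {a \<in> carrier (free_prop p g). a n = C}"
    using free_prop_closed by auto
  ultimately show ?thesis by simp
qed

text \<open>A basic open set restricts finitely many coordinates, and a coordinate determines all
  lower ones.\<close>

lemma free_prop_nbhd:
  assumes "openin (free_prop_top p g) T" "a \<in> T"
  shows "\<exists>n. \<forall>b\<in>carrier (free_prop p g). b n = a n \<longrightarrow> b \<in> T"
proof -
  obtain T' where T': "openin (product_topology (\<lambda>n. discrete_topology (carrier (Fc p g n))) UNIV) T'"
    "T = T' \<inter> carrier (free_prop p g)"
    using assms(1) unfolding free_prop_top_def openin_subtopology by blast
  then have aT: "a \<in> T'" "a \<in> carrier (free_prop p g)" using assms(2) by auto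
  obtain U where U: "finite {i. U i \<noteq> carrier (Fc p g i)}" "a \<in> Pi\<^sub>E UNIV U" "Pi\<^sub>E UNIV U \<subseteq> T'"
    using T'(1) aT(1) unfolding openin_product_topology_alt by auto
  obtain n where n: "\<And>i. U i \<noteq> carrier (Fc p g i) \<Longrightarrow> i \<le> n"
    using finite_nat_set_iff_bounded_le[of "{i. U i \<noteq> carrier (Fc p g i)}"] U(1) by auto
  have "b \<in> T" if b: "b \<in> carrier (free_prop p g)" "b n = a n" for b
  proof -
    have "b i \<in> U i" for i
    proof (cases "U i = carrier (Fc p g i)")
      case True
      then show ?thesis using free_prop_closed[OF b(1)] by simp
    next
      case False
      then have "b i = a i" using coord_mono[OF b(1) aT(2) b(2)] n by blast
      then show ?thesis using U(2) by (auto simp: PiE_iff)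
    qed
    then show ?thesis using U(3) T'(2) b(1) by (auto simp: PiE_iff)
  qed
  then show ?thesis by blast
qed

lemma word_seq_dense:
  assumes "openin (free_prop_top p g) T" "a \<in> T"
  shows "\<exists>w\<in>carrier (free_grp g). word_seq p g w \<in> T \<and> (\<forall>m\<le>k. a m = Fproj p g m w)"
proof -
  have a: "a \<in> carrier (free_prop p g)" using assms openin_subset topspace_free_prop by blast
  obtain n where n: "\<And>b. b \<in> carrier (free_prop p g) \<Longrightarrow> b n = a n \<Longrightarrow> b \<in> T"
    using free_prop_nbhd[OF assms] by blast
  obtain w where w: "w \<in> carrier (free_grp g)" "\<And>m. m \<le> max n k \<Longrightarrow> a m = Fproj p g m w"
    using a unfolding free_prop_iff by metis
  have "word_seq p g w \<in> T" using n[OF word_seq_closed[OF w(1)]] w(2)[of n] by (simp add: word_seq_def)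
  then show ?thesis using w by (intro bexI[of _ w]) auto
qed

text \<open>The coordinate map kills P_n because P_n(F_n) = 1. Conversely, an element of its kernel
  is a limit of words from P_n of the free group, whose images lie in the closed subgroup
  P_n.\<close>

lemma plcs_free_prop:
  "plcs p (free_prop p g) (free_prop_top p g) n = {a \<in> carrier (free_prop p g). a n = \<one>\<^bsub>Fc p g n\<^esub>}"
proof
  interpret C: group_hom "free_prop p g" "Fc p g n" "\<lambda>a. a n" by (rule group_hom_coord)
  let ?P = "plcs p (free_prop p g) (free_prop_top p g)"
  have sub: "?P k \<subseteq> carrier (free_prop p g)" for k
    using closure_of_subset_topspace[of "free_prop_top p g"] topspace_free_prop by (cases k) auto
  show "?P n \<subseteq> {a \<in> carrier (free_prop p g). a n = \<one>\<^bsub>Fc p g n\<^esub>}"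
    using C.plcs_img_discrete[OF topspace_free_prop openin_coord, of p n] lpc_Fc[of p g n] sub[of n] by auto
  have emb: "word_seq p g ` lpc p (free_grp g) k \<subseteq> ?P k" for k
  proof (induction k)
    case 0
    then show ?case using word_seq_closed by auto
  next
    case (Suc k)
    interpret E: group_hom "free_grp g" "free_prop p g" "word_seq p g" by (rule group_hom_word_seq)
    have "word_seq p g ` pstar p (free_grp g) (lpc p (free_grp g) k) \<subseteq> pstar p (free_prop p g) (?P k)"
      by (rule E.pstar_img_subset[OF E.G.lpc_carrier Suc sub])
    moreover have "pstar p (free_prop p g) (?P k) \<subseteq> carrier (free_prop p g)"
      using subgroup.subset[OF C.G.pstar_subgroup[OF sub]] .
    then have "pstar p (free_prop p g) (?P k) \<subseteq> ?P (Suc k)"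
      using closure_of_subset[of "pstar p (free_prop p g) (?P k)" "free_prop_top p g"] topspace_free_prop
      by (simp add: pstar_def)
    ultimately show ?case unfolding lpc.simps by (rule order_trans)
  qed
  have closed: "closedin (free_prop_top p g) (?P n)"
    by (cases n) (auto simp: topspace_free_prop[symmetric])
  show "{a \<in> carrier (free_prop p g). a n = \<one>\<^bsub>Fc p g n\<^esub>} \<subseteq> ?P n"
  proof
    fix a assume a: "a \<in> {a \<in> carrier (free_prop p g). a n = \<one>\<^bsub>Fc p g n\<^esub>}"
    have "a \<in> free_prop_top p g closure_of ?P n"
      unfolding in_closure_of
    proof (intro conjI allI impI)
      show "a \<in> topspace (free_prop_top p g)" using a by (simp add: topspace_free_prop)
      fix T assume "a \<in> T \<and> openin (free_prop_top p g) T"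
      then obtain w where w: "w \<in> carrier (free_grp g)" "word_seq p g w \<in> T" "a n = Fproj p g n w"
        using word_seq_dense[of p g T a n] by blast
      then have "w \<in> lpc p (free_grp g) n" using a Fproj_eq_one_iff by force
      then show "\<exists>y. y \<in> ?P n \<and> y \<in> T" using emb w(2) by blast
    qed
    then show "a \<in> ?P n" using closed by (simp add: closure_of_closedin)
  qed
qed

text \<open>A topologically finitely generated pro-\<open>p\<close> group has finite quotients \<open>H/P\<^sub>n(H)\<close>: the closed
  cosets meeting the image of the free group are finite in number and cover a dense subgroup.\<close>

lemma finite_rcosets_plcs:
  assumes H: "topgroup H tau" and p: "p > 0" and fp: "finitely_presented p H tau"
  shows "finite (rcosets\<^bsub>H\<^esub> (plcs p H tau n))"
proof -
  interpret H: topgroup H tau by fact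
  obtain k \<phi> where \<phi>: "\<phi> \<in> hom (free_prop p k) H" "\<phi> ` carrier (free_prop p k) = carrier H"
    "continuous_map (free_prop_top p k) tau \<phi>"
    using fp unfolding finitely_presented_def by blast
  interpret P: group_hom "free_prop p k" H \<phi>
    using \<phi>(1) by (simp add: group_hom_def group_hom_axioms_def group_free_prop H.group_axioms)
  interpret E: group_hom "free_grp k" "free_prop p k" "word_seq p k" by (rule group_hom_word_seq)
  have rh: "\<phi> \<circ> word_seq p k \<in> hom (free_grp k) H" by (rule Group.hom_compose[OF E.homh \<phi>(1)])
  interpret R: group_hom "free_grp k" H "\<phi> \<circ> word_seq p k"
    using rh by (simp add: group_hom_def group_hom_axioms_def group_free_grp H.group_axioms)
  let ?P = "plcs p H tau n"
  have Psub: "subgroup ?P H" using normal_imp_subgroup[OF H.plcs_normal] .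
  have "E.G.finite_index (lpc p (free_grp k) n)"
    by (rule E.G.finite_index_lpc[OF _ _ free_grp_generated p]) (auto simp: gen_in_free_grp)
  then obtain T where T: "finite T" "T \<subseteq> carrier (free_grp k)"
    "\<And>x. x \<in> carrier (free_grp k) \<Longrightarrow> \<exists>w\<in>lpc p (free_grp k) n. \<exists>t\<in>T. x = w \<otimes>\<^bsub>free_grp k\<^esub> t"
    unfolding E.G.finite_index_def by blast
  define D where "D = (\<phi> \<circ> word_seq p k) ` T"
  have D: "finite D" "D \<subseteq> carrier H" using T(1,2) R.hom_closed unfolding D_def by blast+
  let ?U = "\<Union>d\<in>D. ?P #>\<^bsub>H\<^esub> d"
  have "closedin tau ?U" using D H.closedin_coset[OF H.plcs_closed H.plcs_carrier] by (intro closedin_Union) auto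
  have im: "(\<phi> \<circ> word_seq p k) x \<in> ?U" if x: "x \<in> carrier (free_grp k)" for x
  proof -
    obtain w t where wt: "w \<in> lpc p (free_grp k) n" "t \<in> T" "x = w \<otimes>\<^bsub>free_grp k\<^esub> t" using T(3)[OF x] by blast
    have "(\<phi> \<circ> word_seq p k) w \<in> ?P" using R.lpc_img_plcs[OF H] wt(1) by blast
    moreover have "w \<in> carrier (free_grp k)" "t \<in> carrier (free_grp k)" using wt T(2) E.G.lpc_carrier by blast+
    then have "(\<phi> \<circ> word_seq p k) x = (\<phi> \<circ> word_seq p k) w \<otimes>\<^bsub>H\<^esub> (\<phi> \<circ> word_seq p k) t" using wt(3) R.hom_mult by blast
    ultimately show ?thesis using wt(2) unfolding D_def r_coset_def by blast
  qed
  have cover: "carrier H \<subseteq> ?U"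
  proof
    fix y assume "y \<in> carrier H"
    then obtain a where a: "a \<in> carrier (free_prop p k)" "y = \<phi> a" unfolding \<phi>(2)[symmetric] by blast
    have "y \<in> tau closure_of ?U"
      unfolding in_closure_of
    proof (intro conjI allI impI)
      show "y \<in> topspace tau" using \<open>y \<in> carrier H\<close> H.topsp by simp
      fix V assume V: "y \<in> V \<and> openin tau V"
      then have "openin (free_prop_top p k) {x \<in> carrier (free_prop p k). \<phi> x \<in> V}"
        using openin_continuous_map_preimage[OF \<phi>(3), of V] unfolding topspace_free_prop by blast
      then obtain w where w: "w \<in> carrier (free_grp k)" "word_seq p k w \<in> {x \<in> carrier (free_prop p k). \<phi> x \<in> V}"
        using word_seq_dense[of p k _ a 0] a V by blast
      show "\<exists>z. z \<in> ?U \<and> z \<in> V"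
        by (intro exI[of _ "(\<phi> \<circ> word_seq p k) w"] conjI im[OF w(1)]) (use w(2) in simp)
    qed
    then show "y \<in> ?U" using \<open>closedin tau ?U\<close> by (simp add: closure_of_closedin)
  qed
  have "rcosets\<^bsub>H\<^esub> ?P \<subseteq> (\<lambda>d. ?P #>\<^bsub>H\<^esub> d) ` D"
  proof
    fix A assume "A \<in> rcosets\<^bsub>H\<^esub> ?P"
    then obtain x where x: "x \<in> carrier H" "A = ?P #>\<^bsub>H\<^esub> x" by (auto simp: RCOSETS_def)
    then obtain d where d: "d \<in> D" "x \<in> ?P #>\<^bsub>H\<^esub> d" using cover by blast
    then have "?P #>\<^bsub>H\<^esub> d = ?P #>\<^bsub>H\<^esub> x" using H.repr_independence[OF d(2) _ Psub] D(2) by blast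
    then show "A \<in> (\<lambda>d. ?P #>\<^bsub>H\<^esub> d) ` D" using x d by blast
  qed
  then show ?thesis using D(1) finite_subset by blast
qed

section \<open>Integer relations\<close>

text \<open>Gaussian elimination without division: one equation with a nonzero pivot is solved for
  the unknown \<open>k\<close>, and the remaining unknowns are multiplied by the pivot.\<close>

lemma integer_relation:
  fixes A :: "'j \<Rightarrow> 'i \<Rightarrow> int"
  assumes "finite J" "finite I" "card J < card I"
  shows "\<exists>x. (\<exists>i\<in>I. x i \<noteq> 0) \<and> (\<forall>j\<in>J. (\<Sum>i\<in>I. x i * A j i) = 0)"
  using assms
proof (induction J arbitrary: I A rule: finite_induct)
  case empty
  then obtain i where "i \<in> I" by fastforce
  then show ?case by (intro exI[of _ "\<lambda>_. 1"]) auto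
next
  case (insert j J)
  show ?case
  proof (cases "\<forall>i\<in>I. A j i = 0")
    case True
    have "card J < card I" using insert by simp
    then obtain x where "\<exists>i\<in>I. x i \<noteq> 0" "\<forall>j\<in>J. (\<Sum>i\<in>I. x i * A j i) = 0" using insert.IH insert.prems by blast
    then show ?thesis using True by (intro exI[of _ x]) simp
  next
    case False
    then obtain k where k: "k \<in> I" "A j k \<noteq> 0" by blast
    let ?I = "I - {k}" and ?a = "A j k"
    have "card J < card ?I" using insert k by simp
    then obtain x where x: "\<exists>i\<in>?I. x i \<noteq> 0" "\<forall>j'\<in>J. (\<Sum>i\<in>?I. x i * (?a * A j' i - A j' k * A j i)) = 0"
      using insert.IH[of ?I "\<lambda>j' i. ?a * A j' i - A j' k * A j i"] insert.prems by blast
    define y where "y i = (if i = k then - (\<Sum>i\<in>?I. x i * A j i) else ?a * x i)" for i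
    have sum_y: "(\<Sum>i\<in>I. y i * A j' i) = ?a * (\<Sum>i\<in>?I. x i * A j' i) - A j' k * (\<Sum>i\<in>?I. x i * A j i)" for j'
    proof -
      have "(\<Sum>i\<in>I. y i * A j' i) = y k * A j' k + (\<Sum>i\<in>?I. y i * A j' i)"
        using k insert.prems by (simp add: sum.remove)
      also have "(\<Sum>i\<in>?I. y i * A j' i) = ?a * (\<Sum>i\<in>?I. x i * A j' i)"
        unfolding sum_distrib_left by (intro sum.cong) (auto simp: y_def)
      finally show ?thesis by (simp add: y_def)
    qed
    have "(\<Sum>i\<in>I. y i * A j' i) = 0" if "j' \<in> J" for j'
    proof -
      have "(\<Sum>i\<in>?I. x i * (?a * A j' i - A j' k * A j i)) = ?a * (\<Sum>i\<in>?I. x i * A j' i) - A j' k * (\<Sum>i\<in>?I. x i * A j i)"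
        unfolding sum_distrib_left sum_subtractf[symmetric] by (intro sum.cong) (auto simp: algebra_simps)
      then show ?thesis using x(2) that sum_y by simp
    qed
    moreover have "(\<Sum>i\<in>I. y i * A j i) = 0" unfolding sum_y by simp
    moreover have "\<exists>i\<in>I. y i \<noteq> 0" using x(1) k by (auto simp: y_def)
    ultimately show ?thesis by (intro exI[of _ y]) auto
  qed
qed

text \<open>Among the nonzero solutions take one with least sum of absolute values; if p divided all
  its entries, dividing by p would give a smaller one.\<close>

lemma primitive_integer_relation:
  fixes A :: "'j \<Rightarrow> 'i \<Rightarrow> int" and p :: nat
  assumes "finite J" "finite I" "card J < card I" "p > 1"
  shows "\<exists>x. (\<exists>i\<in>I. \<not> int p dvd x i) \<and> (\<forall>j\<in>J. (\<Sum>i\<in>I. x i * A j i) = 0)"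
proof -
  let ?P = "\<lambda>x. (\<exists>i\<in>I. x i \<noteq> 0) \<and> (\<forall>j\<in>J. (\<Sum>i\<in>I. x i * A j i) = 0)"
  let ?m = "\<lambda>x. nat (\<Sum>i\<in>I. \<bar>x i\<bar>)"
  obtain x0 where "?P x0" using integer_relation[OF assms(1-3)] by blast
  then obtain x where x: "?P x" and min: "\<And>y. ?P y \<Longrightarrow> ?m x \<le> ?m y"
    using ex_has_least_nat[of ?P x0 ?m] by blast
  have "\<exists>i\<in>I. \<not> int p dvd x i"
  proof (rule ccontr)
    assume "\<not> ?thesis"
    then have d: "x i = int p * (x i div int p)" if "i \<in> I" for i using that by auto
    let ?y = "\<lambda>i. x i div int p"
    have s: "int p * (\<Sum>i\<in>I. ?y i * A j i) = (\<Sum>i\<in>I. x i * A j i)" for j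
      unfolding sum_distrib_left using d by (intro sum.cong) (auto simp: mult.assoc[symmetric])
    have "(\<Sum>i\<in>I. ?y i * A j i) = 0" if "j \<in> J" for j
      using s[of j] x that assms(4) by simp
    moreover obtain i where "i \<in> I" "x i \<noteq> 0" using x by blast
    then have "\<exists>i\<in>I. ?y i \<noteq> 0" using d[of i] by (metis mult_zero_right)
    ultimately have "?P ?y" by blast
    then have le: "?m x \<le> ?m ?y" by (rule min)
    have e: "(\<Sum>i\<in>I. \<bar>x i\<bar>) = int p * (\<Sum>i\<in>I. \<bar>?y i\<bar>)"
      unfolding sum_distrib_left by (intro sum.cong refl) (metis abs_mult abs_of_nat d)
    obtain i where i: "i \<in> I" "x i \<noteq> 0" using x by blast
    have "\<bar>x i\<bar> \<le> (\<Sum>i\<in>I. \<bar>x i\<bar>)" using i assms(2) by (intro member_le_sum) auto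
    then have pos: "(\<Sum>i\<in>I. \<bar>x i\<bar>) > 0" using i by simp
    then have "(\<Sum>i\<in>I. \<bar>?y i\<bar>) > 0" using e assms(4) by (metis of_nat_0_less_iff zero_less_mult_pos less_trans zero_less_one)
    then have "(\<Sum>i\<in>I. \<bar>?y i\<bar>) < (\<Sum>i\<in>I. \<bar>x i\<bar>)" unfolding e using assms(4) by simp
    then show False using le pos by linarith
  qed
  then show ?thesis using x by blast
qed

text \<open>The group is abelian, so each step only takes p-th multiples and P_n consists of
  multiples of p^n.\<close>

lemma lpc_integer_mod:
  assumes "p > 0" shows "lpc p (integer_mod_group (p ^ m)) m = {0}"
proof -
  let ?Z = "integer_mod_group (p ^ m)"
  interpret Z: comm_group ?Z by simp
  have c: "carrier ?Z = {0..<int (p ^ m)}" using assms by (simp add: carrier_integer_mod_group)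
  have "lpc p ?Z n \<subseteq> {x \<in> carrier ?Z. int (p ^ n) dvd x}" if "n \<le> m" for n
    using that
  proof (induction n)
    case (Suc n)
    have dv: "int (p ^ Suc n) dvd int (p ^ m)" using Suc.prems by (metis of_nat_dvd_iff le_imp_power_dvd)
    let ?D = "{x \<in> carrier ?Z. int (p ^ Suc n) dvd x}"
    have D: "subgroup ?D ?Z"
    proof (rule Z.subgroupI)
      show "?D \<noteq> {}" using assms by (auto simp: c intro!: exI[of _ 0])
      show "inv\<^bsub>?Z\<^esub> a \<in> ?D" if "a \<in> ?D" for a
      proof -
        have "inv\<^bsub>?Z\<^esub> a = (- a) mod int (p ^ m)" using that by (intro inv_integer_mod_group) auto
        then show ?thesis using that dv Z.inv_closed[of a] by (simp add: dvd_mod_iff del: of_nat_power)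
      qed
      show "a \<otimes>\<^bsub>?Z\<^esub> b \<in> ?D" if "a \<in> ?D" "b \<in> ?D" for a b
        using that dv Z.m_closed[of a b] by (simp add: mult_integer_mod_group dvd_mod_iff del: of_nat_power)
    qed auto
    have "pstar p ?Z (lpc p ?Z n) \<subseteq> ?D"
    proof (rule Z.pstar_least[OF D])
      fix x y assume x: "x \<in> carrier ?Z" and y: "y \<in> lpc p ?Z n"
      then have y': "y \<in> carrier ?Z" using Z.lpc_carrier by blast
      have "x \<otimes>\<^bsub>?Z\<^esub> y \<otimes>\<^bsub>?Z\<^esub> inv\<^bsub>?Z\<^esub> x \<otimes>\<^bsub>?Z\<^esub> inv\<^bsub>?Z\<^esub> y = \<one>\<^bsub>?Z\<^esub>"
        using x y' by (metis Z.m_assoc Z.m_comm Z.m_closed Z.inv_closed Z.r_inv Z.r_one)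
      then show "x \<otimes>\<^bsub>?Z\<^esub> y \<otimes>\<^bsub>?Z\<^esub> inv\<^bsub>?Z\<^esub> x \<otimes>\<^bsub>?Z\<^esub> inv\<^bsub>?Z\<^esub> y \<in> ?D" using subgroup.one_closed[OF D] by metis
    next
      fix y assume "y \<in> lpc p ?Z n"
      then have y: "y \<in> carrier ?Z" "int (p ^ n) dvd y" using Suc by auto
      have "y [^]\<^bsub>?Z\<^esub> p = int p * y mod int (p ^ m)" using y(1) by (simp add: pow_integer_mod_group)
      moreover have "int (p ^ Suc n) dvd int p * y" using y(2) by simp
      ultimately show "y [^]\<^bsub>?Z\<^esub> p \<in> ?D" using dv Z.nat_pow_closed[OF y(1), of p] by (simp add: dvd_mod_iff del: of_nat_power)
    qed
    then show ?case by (simp add: lpc.simps del: of_nat_power)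
  qed auto
  from this[OF order_refl] have "lpc p ?Z m \<subseteq> {x. 0 \<le> x \<and> x < int (p ^ m) \<and> int (p ^ m) dvd x}"
    unfolding c by auto
  moreover have "x = 0" if "0 \<le> x" "x < n" "n dvd x" for x n :: int
    using that zdvd_not_zless[of x n] by fastforce
  ultimately have "lpc p ?Z m \<subseteq> {0}" by blast
  moreover have "\<one>\<^bsub>?Z\<^esub> \<in> lpc p ?Z m" by (rule subgroup.one_closed[OF Z.lpc_subgroup])
  ultimately show ?thesis by auto
qed

text \<open>The coefficients of \<open>e\<close> on the right are the exponent sums of the
  word.\<close>

lemma word_val_integer:
  assumes "\<forall>x\<in>set w. fst x < g"
  shows "word_val integer_group e w = (\<Sum>i<g. e i * word_val integer_group (\<lambda>k. if k = i then 1 else 0) w)"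
  using assms
proof (induction w)
  case Nil
  then show ?case by (simp add: word_val_def)
next
  case (Cons x w)
  interpret Z: group integer_group by simp
  have l: "letter_val integer_group d x = (if snd x then d (fst x) else - d (fst x))" for d
    by (simp add: letter_val_def)
  have "letter_val integer_group e x = (\<Sum>i<g. e i * letter_val integer_group (\<lambda>k. if k = i then 1 else 0) x)"
    using Cons.prems by (simp add: l sum.delta' if_distrib cong: if_cong)
  then show ?case using Cons by (simp add: Z.word_val_Cons distrib_left sum.distrib)
qed

section \<open>Schur\<open>+1\<close> groups\<close>

lemma continuous_map_fibres_open:
  assumes "\<And>y. openin tau {x \<in> topspace tau. f x = y}" "f \<in> topspace tau \<rightarrow> A"
  shows "continuous_map tau (discrete_topology A) f"
  unfolding continuous_map_def
proof (intro conjI allI impI)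
  show "openin tau {x \<in> topspace tau. f x \<in> U}" for U
    by (rule openin_combine[of tau "topspace tau" f f "\<lambda>i j. i \<in> U", OF assms(1) assms(1)])
qed (use assms(2) in auto)

lemma continuous_map_discrete_fibre:
  assumes "continuous_map tau (discrete_topology A) f"
  shows "openin tau {x \<in> topspace tau. f x = y}"
proof -
  have "openin tau {x \<in> topspace tau. f x \<in> {y} \<inter> A}"
    by (rule openin_continuous_map_preimage[OF assms]) simp
  moreover have "{x \<in> topspace tau. f x \<in> {y} \<inter> A} = {x \<in> topspace tau. f x = y}"
    using assms by (auto simp: continuous_map_def Pi_iff)
  ultimately show ?thesis by simp
qed

lemma closure_fibre_image:
  assumes "\<And>y. openin tau {x \<in> C. f x = y}" "topspace tau = C" "x \<in> tau closure_of S"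
  shows "f x \<in> f ` S"
proof -
  have "x \<in> {z \<in> C. f z = f x}" using assms(2,3) closure_of_subset_topspace[of tau S] by auto
  then have "\<exists>y. y \<in> S \<and> y \<in> {z \<in> C. f z = f x}"
    using assms(3) assms(1)[of "f x"] unfolding in_closure_of
    by (elim conjE allE[of _ "{z \<in> C. f z = f x}"]) simp
  then obtain y where "y \<in> S" "f x = f y" by auto
  then show ?thesis by blast
qed

lemma (in group) derived_subset_lpc: "derived G (carrier G) \<subseteq> lpc p G 1"
  unfolding derived_def
proof (rule generate_subgroup_incl[OF _ lpc_subgroup], safe)
  fix x y assume "x \<in> carrier G" "y \<in> carrier G"
  then show "x \<otimes> y \<otimes> inv x \<otimes> inv y \<in> lpc p G 1" using comm_in_pstar by (simp add: lpc_1)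
qed

text \<open>A continuous character kills P_1 and hence the kernel of h, so it is inflated from H.
  The group Z/p serves as target in order to apply \<open>hom_factor\<close>.\<close>

lemma (in group_hom) card_H1:
  assumes p: "prime p" and surj: "h ` carrier G = carrier H" and top: "topspace tau = carrier G"
    and op: "\<And>y. openin tau {x \<in> carrier G. h x = y}" and ker: "kernel G H h \<subseteq> plcs p G tau 1"
  shows "card (H1 p G tau) = card (chars p H (carrier H) (lpc p H 1))"
proof -
  have p0: "p > 0" using p prime_gt_0_nat by blast
  let ?C = "chars p H (carrier H) (lpc p H 1)"
  let ?Z = "integer_mod_group (p ^ 1)"
  interpret Z: comm_group ?Z by simp
  have cZ: "carrier ?Z = {0..<int p}" using p0 by (simp add: carrier_integer_mod_group)
  have homZ: "u (x \<otimes>\<^bsub>K\<^esub> y) = u x \<otimes>\<^bsub>?Z\<^esub> u y"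
    if "(u (x \<otimes>\<^bsub>K\<^esub> y) - (u x + u y)) mod int p = 0" "u (x \<otimes>\<^bsub>K\<^esub> y) \<in> {0..<int p}"
    for u :: "'z \<Rightarrow> int" and x y K
  proof -
    have "[u (x \<otimes>\<^bsub>K\<^esub> y) = u x + u y] (mod int p)" using that(1) by (simp add: cong_iff_dvd_diff dvd_eq_mod_eq_0)
    then show ?thesis using that(2) by (simp add: cong_def)
  qed
  have "bij_betw (\<lambda>\<phi>. restrict (\<phi> \<circ> h) (carrier G)) ?C (H1 p G tau)"
    unfolding bij_betw_def
  proof
    show "inj_on (\<lambda>\<phi>. restrict (\<phi> \<circ> h) (carrier G)) ?C"
    proof (rule inj_onI)
      fix \<phi> \<phi>' assume *: "\<phi> \<in> ?C" "\<phi>' \<in> ?C" "restrict (\<phi> \<circ> h) (carrier G) = restrict (\<phi>' \<circ> h) (carrier G)"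
      have "\<phi> y = \<phi>' y" if "y \<in> carrier H" for y
      proof -
        from that obtain x where x: "x \<in> carrier G" "y = h x" unfolding surj[symmetric] by blast
        then show ?thesis using fun_cong[OF *(3), of x] by simp
      qed
      then show "\<phi> = \<phi>'" using * unfolding chars_def by (auto intro: PiE_ext)
    qed
    show "(\<lambda>\<phi>. restrict (\<phi> \<circ> h) (carrier G)) ` ?C = H1 p G tau"
    proof (intro equalityI subsetI)
      fix u assume "u \<in> (\<lambda>\<phi>. restrict (\<phi> \<circ> h) (carrier G)) ` ?C"
      then obtain \<phi> where \<phi>: "\<phi> \<in> ?C" "u = restrict (\<phi> \<circ> h) (carrier G)" by blast
      have "openin tau {x \<in> carrier G. u x = k}" for k
      proof -
        have "{x \<in> carrier G. u x = k} = {x \<in> carrier G. \<phi> (h x) = k}" using \<phi>(2) by auto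
        then show ?thesis using openin_combine[of tau "carrier G" h h "\<lambda>i j. \<phi> i = k", OF op op] by simp
      qed
      then show "u \<in> H1 p G tau"
        using \<phi> unfolding H1_def cochain1_def chars_def by (auto simp: PiE_iff)
    next
      fix u assume u: "u \<in> H1 p G tau"
      then have uc: "u \<in> carrier G \<rightarrow>\<^sub>E {0..<int p}" "\<And>k. openin tau {x \<in> carrier G. u x = k}"
        "\<And>a b. a \<in> carrier G \<Longrightarrow> b \<in> carrier G \<Longrightarrow> (u (a \<otimes> b) - (u a + u b)) mod int p = 0"
        by (auto simp: H1_def cochain1_def)
      have ur: "u a \<in> {0..<int p}" if "a \<in> carrier G" for a using uc(1) that by blast
      have uh: "u \<in> hom G ?Z"
      proof (rule homI)
        show "u (a \<otimes> b) = u a \<otimes>\<^bsub>?Z\<^esub> u b" if "a \<in> carrier G" "b \<in> carrier G" for a b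
          by (rule homZ[OF uc(3)[OF that] ur]) (use that in simp)
      qed (use ur cZ in auto)
      interpret U: group_hom G ?Z u using uh by (simp add: group_hom_def group_hom_axioms_def)
      have "u ` plcs p G tau 1 \<subseteq> {0}"
        using U.plcs_img_discrete[OF top uc(2), of p 1] lpc_integer_mod[OF p0, of 1] by metis
      then have "kernel G H h \<subseteq> kernel G ?Z u" using ker by (auto simp: kernel_def)
      then obtain \<theta> where \<theta>: "\<theta> \<in> hom H ?Z" "\<And>x. x \<in> carrier G \<Longrightarrow> \<theta> (h x) = u x"
        using hom_factor[OF surj uh Z.group_axioms] by blast
      interpret T: group_hom H ?Z \<theta> using \<theta>(1) by (simp add: group_hom_def group_hom_axioms_def)
      define \<phi> where "\<phi> = restrict \<theta> (carrier H)"
      have "\<theta> ` lpc p H 1 \<subseteq> {0}" using T.lpc_img_subset[of p 1] lpc_integer_mod[OF p0, of 1] by metis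
      moreover have "(\<theta> (a \<otimes>\<^bsub>H\<^esub> b) - (\<theta> a + \<theta> b)) mod int p = 0" if "a \<in> carrier H" "b \<in> carrier H" for a b
      proof -
        have "\<theta> (a \<otimes>\<^bsub>H\<^esub> b) = (\<theta> a + \<theta> b) mod int p" using T.hom_mult[OF that] by simp
        then show ?thesis by (simp add: mod_diff_left_eq)
      qed
      ultimately have "\<phi> \<in> ?C"
        unfolding chars_def \<phi>_def using T.hom_closed cZ H.lpc_carrier[of p 1] by (auto simp: subset_iff image_subset_iff)
      moreover have "u = restrict (\<phi> \<circ> h) (carrier G)"
        using uc(1) \<theta>(2) by (intro extensionalityI[of _ "carrier G"]) (auto simp: \<phi>_def PiE_iff)
      ultimately show "u \<in> (\<lambda>\<phi>. restrict (\<phi> \<circ> h) (carrier G)) ` ?C" by blast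
    qed
  qed
  from bij_betw_same_card[OF this] show ?thesis by simp
qed

lemma (in group) card_chars_carrier:
  assumes "prime p" "finite (carrier G)"
  shows "card (chars p G (carrier G) (lpc p G 1)) * card (lpc p G 1) = card (carrier G)"
  using card_chars[OF assms normal_self lpc_subgroup[of p 1] _ subgroup_self lpc_carrier order_refl] by (simp add: lpc_1)

text \<open>Inversion on the abelianisation is weakened to inversion modulo the Frattini subgroup,
  as the derived subgroup lies in P_1.\<close>

lemma gi_aut_involution:
  assumes "group G" "finite (carrier G)" "odd (card (carrier G))" "gi_aut G (discrete_topology (carrier G)) \<sigma>"
  shows "involution_group G \<sigma>" "\<And>x. x \<in> carrier G \<Longrightarrow> \<sigma> x \<otimes>\<^bsub>G\<^esub> x \<in> lpc p G 1"
proof -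
  interpret group G by fact
  show "involution_group G \<sigma>"
    using assms by (simp add: involution_group_def involution_group_axioms_def gi_aut_def iso_def)
  have "derived G (carrier G) \<subseteq> carrier G" by (rule derived_in_carrier) simp
  then show "\<sigma> x \<otimes>\<^bsub>G\<^esub> x \<in> lpc p G 1" if "x \<in> carrier G" for x
    using assms(4) that derived_subset_lpc[of p] by (auto simp: gi_aut_def discrete_topology_closure_of)
qed

text \<open>Prepares a Schur+1 group H for use above its quotient G. The projection is continuous
  because its kernel is closed of finite index, and the rank is read off from H^1(H). The involution
  of H induces one on G, and an automorphism of G conjugates the latter to the prescribed
  \<sigma>.\<close>

lemma schur_quotient:
  fixes H :: "('h, 'k) monoid_scheme" and G :: "('a, 'b) monoid_scheme"
  assumes p: "prime p" "odd p" and H: "schur1_sigma_group p g H tau"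
    and k0: "group_hom H G \<kappa>0" and surj: "\<kappa>0 ` carrier H = carrier G" and ker: "kernel H G \<kappa>0 = plcs p H tau c"
    and c: "1 \<le> c" "m \<le> c" and m: "lpc p G m = {\<one>\<^bsub>G\<^esub>}"
    and gi: "gi_aut G (discrete_topology (carrier G)) \<sigma>"
  shows "rank_group G \<sigma> p g m"
    and "\<exists>\<kappa> \<tau>. group_hom H G \<kappa> \<and> \<kappa> ` carrier H = carrier G \<and> (\<forall>a. openin tau {x \<in> carrier H. \<kappa> x = a}) \<and>
      kernel H G \<kappa> \<subseteq> plcs p H tau m \<and> inverts_H2 p H tau \<tau> \<and>
      (\<forall>x\<in>carrier H. \<tau> x \<in> carrier H \<and> \<kappa> (\<tau> x) = \<sigma> (\<kappa> x))"
proof -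
  interpret k: group_hom H G \<kappa>0 by fact
  have top: "topgroup H tau" using H pro_p_topgroup by (auto simp: schur1_sigma_group_def)
  interpret T: topgroup H tau by fact
  have p0: "p > 0" "p > 1" using p prime_gt_0_nat prime_gt_1_nat by auto
  let ?P = "plcs p H tau c"
  have Psub: "subgroup ?P H" using normal_imp_subgroup[OF T.plcs_normal] .
  have finR: "finite (rcosets\<^bsub>H\<^esub> ?P)"
    using finite_rcosets_plcs[OF top p0(1)] H by (simp add: schur1_sigma_group_def)
  have fib: "{x \<in> carrier H. \<kappa>0 x = \<kappa>0 x0} = ?P #>\<^bsub>H\<^esub> x0" if x0: "x0 \<in> carrier H" for x0
  proof (intro equalityI subsetI)
    fix x assume x: "x \<in> {x \<in> carrier H. \<kappa>0 x = \<kappa>0 x0}"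
    then have "x \<otimes>\<^bsub>H\<^esub> inv\<^bsub>H\<^esub> x0 \<in> kernel H G \<kappa>0" using x0 by (auto simp: kernel_def)
    moreover have "x = x \<otimes>\<^bsub>H\<^esub> inv\<^bsub>H\<^esub> x0 \<otimes>\<^bsub>H\<^esub> x0" using x x0 by (auto simp: k.G.m_assoc)
    ultimately show "x \<in> ?P #>\<^bsub>H\<^esub> x0" unfolding ker r_coset_def by blast
  next
    fix x assume "x \<in> ?P #>\<^bsub>H\<^esub> x0"
    then obtain y where "y \<in> kernel H G \<kappa>0" "x = y \<otimes>\<^bsub>H\<^esub> x0" unfolding ker r_coset_def by blast
    then show "x \<in> {x \<in> carrier H. \<kappa>0 x = \<kappa>0 x0}" using x0 by (auto simp: kernel_def)
  qed
  have op: "openin tau {x \<in> carrier H. \<kappa>0 x = a}" for a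
  proof (cases "a \<in> \<kappa>0 ` carrier H")
    case True
    then obtain x0 where x0: "x0 \<in> carrier H" "a = \<kappa>0 x0" by blast
    have "?P #>\<^bsub>H\<^esub> x0 \<in> rcosets\<^bsub>H\<^esub> ?P" using k.G.rcosetsI[OF T.plcs_carrier x0(1)] .
    then show ?thesis unfolding x0(2) fib[OF x0(1)] by (rule T.openin_coset[OF Psub T.plcs_closed finR])
  next
    case False
    then have eq: "{x \<in> carrier H. \<kappa>0 x = a} = {}" by blast
    show ?thesis unfolding eq by (rule openin_empty)
  qed
  have finG: "finite (carrier G)"
  proof (rule finite_subset)
    show "carrier G \<subseteq> (\<lambda>A. \<kappa>0 (SOME x. x \<in> A)) ` (rcosets\<^bsub>H\<^esub> ?P)"
    proof
      fix y assume "y \<in> carrier G"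
      then obtain x0 where x0: "x0 \<in> carrier H" "y = \<kappa>0 x0" unfolding surj[symmetric] by blast
      let ?A = "?P #>\<^bsub>H\<^esub> x0"
      have "x0 \<in> ?A" using fib[OF x0(1)] x0(1) by blast
      then have "(SOME x. x \<in> ?A) \<in> ?A" by (rule someI)
      then have "\<kappa>0 (SOME x. x \<in> ?A) = y" using fib[OF x0(1)] x0(2) by blast
      moreover have "?A \<in> rcosets\<^bsub>H\<^esub> ?P" using k.G.rcosetsI[OF T.plcs_carrier x0(1)] .
      ultimately show "y \<in> (\<lambda>A. \<kappa>0 (SOME x. x \<in> A)) ` (rcosets\<^bsub>H\<^esub> ?P)" by (metis image_eqI)
    qed
  qed (use finR in simp)
  obtain n where n: "card (carrier G) = p ^ n" using k.H.card_prime_power[OF finG p(1) m] by blast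
  have odd: "odd (card (carrier G))" using n p(2) by simp
  note gi_inv = gi_aut_involution[OF k.H.group_axioms finG odd gi]
  interpret S: involution_group G \<sigma> by (rule gi_inv(1))
  have "kernel H G \<kappa>0 \<subseteq> plcs p H tau 1" unfolding ker by (rule T.plcs_antimono[OF c(1)])
  then have "card (chars p G (carrier G) (lpc p G 1)) = p ^ g"
    using k.card_H1[OF p(1) surj T.topsp op] H by (simp add: schur1_sigma_group_def)
  then have rank: "card (carrier G) = p ^ g * card (lpc p G 1)"
    using k.H.card_chars_carrier[OF p(1) finG] by simp
  show R: "rank_group G \<sigma> p g m"
    using p m gi_inv(2)[of _ p] rank gi_inv(1) by (simp add: rank_group_def rank_group_axioms_def)
  interpret R: rank_group G \<sigma> p g m by (rule R)
  obtain \<tau> where \<tau>: "gi_aut H tau \<tau>" "inverts_H2 p H tau \<tau>" using H by (auto simp: schur1_sigma_group_def)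
  have \<tau>h: "\<tau> \<in> hom H H" "continuous_map tau tau \<tau>" "\<And>x. x \<in> carrier H \<Longrightarrow> \<tau> (\<tau> x) = x"
    "\<And>x. x \<in> carrier H \<Longrightarrow> \<tau> x \<otimes>\<^bsub>H\<^esub> x \<in> tau closure_of derived H (carrier H)"
    using \<tau>(1) by (auto simp: gi_aut_def iso_def)
  interpret t: group_hom H H \<tau> by unfold_locales fact
  \<comment> \<open>Continuous endomorphisms preserve the closed series, so \<tau> descends to
    G.\<close>
  have "\<tau> ` ?P \<subseteq> ?P" by (rule T.plcs_continuous_endo[OF \<tau>h(1,2)])
  then have "kernel H G \<kappa>0 \<subseteq> kernel H G (\<kappa>0 \<circ> \<tau>)" unfolding ker[symmetric] by (auto simp: kernel_def)
  then obtain \<tau>' where \<tau>': "\<tau>' \<in> hom G G" "\<And>x. x \<in> carrier H \<Longrightarrow> \<tau>' (\<kappa>0 x) = \<kappa>0 (\<tau> x)"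
    using k.hom_factor[OF surj Group.hom_compose[OF \<tau>h(1) k.homh] k.H.group_axioms] by auto
  have "involution_group G \<tau>'"
  proof
    fix y assume "y \<in> carrier G"
    then obtain x where x: "x \<in> carrier H" "y = \<kappa>0 x" unfolding surj[symmetric] by blast
    then show "\<tau>' (\<tau>' y) = y" using \<tau>'(2)[OF x(1)] \<tau>'(2)[of "\<tau> x"] \<tau>h(3) by simp
  qed (use finG odd \<tau>'(1) in auto)
  moreover have "\<tau>' y \<otimes>\<^bsub>G\<^esub> y \<in> lpc p G 1" if "y \<in> carrier G" for y
  proof -
    from that obtain x where x: "x \<in> carrier H" "y = \<kappa>0 x" unfolding surj[symmetric] by blast
    have "\<kappa>0 (\<tau> x \<otimes>\<^bsub>H\<^esub> x) \<in> \<kappa>0 ` derived H (carrier H)"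
      by (rule closure_fibre_image[OF op T.topsp \<tau>h(4)[OF x(1)]])
    also have "\<dots> \<subseteq> lpc p G 1"
      using k.G.derived_subset_lpc[of p] k.lpc_img_subset[of p 1] by blast
    finally show ?thesis using x \<tau>'(2) by simp
  qed
  ultimately have "\<exists>\<alpha>\<in>iso G G. \<forall>x\<in>carrier G. \<alpha> (\<tau>' x) = \<sigma> (\<alpha> x)"
    by (intro involutions_conjugate[OF gi_inv(1) _ k.H.lpc_normal R.frattini_cover gi_inv(2)])
  then obtain \<alpha> where \<alpha>: "\<alpha> \<in> iso G G" "\<And>x. x \<in> carrier G \<Longrightarrow> \<alpha> (\<tau>' x) = \<sigma> (\<alpha> x)" by blast
  have \<alpha>h: "\<alpha> \<in> hom G G" "bij_betw \<alpha> (carrier G) (carrier G)" using \<alpha>(1) by (auto simp: iso_def)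
  interpret A: group_hom G G \<alpha> by unfold_locales fact
  have "\<alpha> \<circ> \<kappa>0 \<in> hom H G" by (rule Group.hom_compose[OF k.homh \<alpha>h(1)])
  then have 1: "group_hom H G (\<alpha> \<circ> \<kappa>0)" by (simp add: group_hom_def group_hom_axioms_def)
  have 2: "(\<alpha> \<circ> \<kappa>0) ` carrier H = carrier G"
    using \<alpha>h(2) unfolding image_comp[symmetric] surj bij_betw_def by blast
  have 3: "openin tau {x \<in> carrier H. (\<alpha> \<circ> \<kappa>0) x = a}" for a
    using openin_combine[of tau "carrier H" \<kappa>0 \<kappa>0 "\<lambda>i j. \<alpha> i = a", OF op op] by simp
  have "\<alpha> y = \<one>\<^bsub>G\<^esub> \<longleftrightarrow> y = \<one>\<^bsub>G\<^esub>" if "y \<in> carrier G" for y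
    using that \<alpha>h(2) A.hom_one by (metis bij_betw_def inj_on_def k.H.one_closed)
  then have "kernel H G (\<alpha> \<circ> \<kappa>0) = kernel H G \<kappa>0" by (force simp: kernel_def)
  then have 4: "kernel H G (\<alpha> \<circ> \<kappa>0) \<subseteq> plcs p H tau m" unfolding ker using T.plcs_antimono[OF c(2)] by simp
  have 5: "\<tau> x \<in> carrier H \<and> (\<alpha> \<circ> \<kappa>0) (\<tau> x) = \<sigma> ((\<alpha> \<circ> \<kappa>0) x)" if "x \<in> carrier H" for x
    using that \<alpha>(2)[of "\<kappa>0 x"] \<tau>'(2) by simp
  show "\<exists>\<kappa> \<tau>. group_hom H G \<kappa> \<and> \<kappa> ` carrier H = carrier G \<and> (\<forall>a. openin tau {x \<in> carrier H. \<kappa> x = a}) \<and>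
      kernel H G \<kappa> \<subseteq> plcs p H tau m \<and> inverts_H2 p H tau \<tau> \<and>
      (\<forall>x\<in>carrier H. \<tau> x \<in> carrier H \<and> \<kappa> (\<tau> x) = \<sigma> (\<kappa> x))"
    using 1 2 3 4 5 \<tau>(2) by blast
qed

section \<open>Relation modules of ancestors\<close>

context rank_group
begin

lemma Etup_nonempty: "Etup \<noteq> {}"
proof -
  have "\<one> \<in> inverted G \<sigma> (lpc p G 1)"
    using subgroup.one_closed[OF lpc_subgroup[of p 1]] by (simp add: inverted_def)
  then have "card (inverted G \<sigma> (lpc p G 1)) > 0"
    using finite_inverted[OF lpc_carrier[of p 1]] card_gt_0_iff by blast
  moreover have "(\<Prod>i<g. real p ^ g - real p ^ i) > 0"
    using p_gt_1 by (intro prod_pos) (auto intro!: power_strict_increasing)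
  ultimately have "real (card Etup) > 0" unfolding card_Etup by simp
  then show ?thesis by auto
qed

text \<open>The relation module of an ancestor embeds into the dual of \<open>H\<^sup>2\<close> of the Schur\<open>+1\<close> group above it.\<close>

lemma ancestor_kernel:
  assumes s: "s \<in> Etup" and H: "card (H2 p H tau) = p ^ g \<or> card (H2 p H tau) = p ^ (g + 1)" and top: "topspace tau = carrier H"
    and k: "group_hom H G \<kappa>" "\<kappa> ` carrier H = carrier G" "\<And>a. openin tau {x \<in> carrier H. \<kappa> x = a}"
      "kernel H G \<kappa> \<subseteq> plcs p H tau m" "inverts_H2 p H tau \<tau>"
      "\<And>x. x \<in> carrier H \<Longrightarrow> \<tau> x \<in> carrier H \<and> \<kappa> (\<tau> x) = \<sigma> (\<kappa> x)"
  shows "\<And>x. x \<in> kernel F G (lift s) \<Longrightarrow> sigma_Fc x \<otimes>\<^bsub>F\<^esub> x \<in> pstar p F (kernel F G (lift s))"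
    and "card (kernel F G (lift s)) \<le> p ^ (g + 1) * card (pstar p F (kernel F G (lift s)))"
proof -
  interpret L: group_hom F G "lift s" using lift_group_hom[OF Etup_closed[OF s]] .
  interpret k: group_hom H G \<kappa> by fact
  interpret tr: transgression F G H "lift s" \<kappa> p m tau
    using prime_p F.fin lpc_Fc lift_surj[OF s] surj_index(2)[OF lift_hom[OF Etup_closed[OF s]] lift_surj[OF s]] k(2,3,4) top
    by unfold_locales auto
  show "sigma_Fc x \<otimes>\<^bsub>F\<^esub> x \<in> pstar p F (kernel F G (lift s))" if "x \<in> kernel F G (lift s)" for x
    using tr.sigma_Chars[OF k(5) sigma_Fc_hom lift_equivariant[OF s], of x] k(6) sig_hom that by (auto simp: tr.N_def)
  have "card (H2 p H tau) \<noteq> 0" using H p_gt_1 by auto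
  then have "finite (H2 p H tau)" by (metis card.infinite)
  then have "card tr.Chars \<le> card (H2 p H tau)" by (rule tr.card_Chars_le_H2)
  also have "\<dots> \<le> p ^ (g + 1)" using H p_gt_1 by auto
  finally have "card tr.Chars \<le> p ^ (g + 1)" .
  from mult_le_mono1[OF this, of "card (pstar p F tr.N)"]
  show "card (kernel F G (lift s)) \<le> p ^ (g + 1) * card (pstar p F (kernel F G (lift s)))"
    unfolding tr.card_Chars(2) by (simp only: tr.N_def)
qed

text \<open>The relation modules of two presentations are isomorphic, as the presentations differ by
  an automorphism of the relatively free group.\<close>

lemma kernel_pstar_cards:
  assumes \<psi>: "\<psi> \<in> hom F G" "\<psi> ` carrier F = carrier G" and s: "s \<in> Etup"
  shows "card (kernel F G \<psi>) = card (kernel F G (lift s))"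
    "card (pstar p F (kernel F G \<psi>)) = card (pstar p F (kernel F G (lift s)))"
proof -
  interpret L: group_hom F G "lift s" using lift_group_hom[OF Etup_closed[OF s]] .
  interpret P: group_hom F G \<psi> using \<psi>(1) by (simp add: group_hom_def group_hom_axioms_def group_Fc)
  have "\<exists>y. y \<in> carrier F \<and> lift s y = \<psi> (Fgen p g m i)" if "i < g" for i
  proof -
    have "\<psi> (Fgen p g m i) \<in> lift s ` carrier F" using lift_surj[OF s] Fgen_closed[OF that] by simp
    then show ?thesis by force
  qed
  then obtain y where y: "\<And>i. i < g \<Longrightarrow> y i \<in> carrier F \<and> lift s (y i) = \<psi> (Fgen p g m i)" by metis
  then have "y \<in> {..<g} \<rightarrow> carrier F" by auto
  from Fc_universal[OF group_Fc lpc_Fc this]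
  obtain \<theta> where \<theta>: "\<theta> \<in> hom F F" "\<And>i. i < g \<Longrightarrow> \<theta> (Fgen p g m i) = y i" by blast
  interpret T: group_hom F F \<theta> by unfold_locales fact
  have eq: "lift s (\<theta> x) = \<psi> x" if "x \<in> carrier F" for x
    using Fc_hom_unique[OF Group.hom_compose[OF \<theta>(1) L.homh] \<psi>(1) group_axioms _ that] \<theta>(2) y by simp
  have "carrier F \<subseteq> generate F (\<theta> ` carrier F \<union> pstar p F (carrier F))"
  proof
    fix x assume x: "x \<in> carrier F"
    have "lift s x \<in> \<psi> ` carrier F" using \<psi>(2) x by simp
    then obtain z where z: "z \<in> carrier F" "\<psi> z = lift s x" by force
    have "inv\<^bsub>F\<^esub> \<theta> z \<otimes>\<^bsub>F\<^esub> x \<in> kernel F G (lift s)" using x z eq by (simp add: kernel_def)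
    then have "inv\<^bsub>F\<^esub> \<theta> z \<otimes>\<^bsub>F\<^esub> x \<in> pstar p F (carrier F)"
      using surj_index(2)[OF L.homh lift_surj[OF s]] by (auto simp: lpc_1)
    then have "\<theta> z \<otimes>\<^bsub>F\<^esub> (inv\<^bsub>F\<^esub> \<theta> z \<otimes>\<^bsub>F\<^esub> x) \<in> generate F (\<theta> ` carrier F \<union> pstar p F (carrier F))"
      using z by (intro generate.eng generate.incl) auto
    then show "x \<in> generate F (\<theta> ` carrier F \<union> pstar p F (carrier F))" using x z by simp
  qed
  then have surj: "\<theta> ` carrier F = carrier F"
    by (intro F.frattini_argument[OF F.fin lpc_Fc F.normal_self T.img_is_subgroup]) auto
  then have inj: "inj_on \<theta> (carrier F)" using F.fin by (simp add: eq_card_imp_inj_on)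
  have im: "\<theta> ` kernel F G \<psi> = kernel F G (lift s)"
  proof (intro equalityI subsetI)
    fix x assume x: "x \<in> kernel F G (lift s)"
    then have "x \<in> \<theta> ` carrier F" using surj by (simp add: kernel_def)
    then obtain z where z: "z \<in> carrier F" "x = \<theta> z" by blast
    then show "x \<in> \<theta> ` kernel F G \<psi>" using x eq by (auto simp: kernel_def)
  qed (auto simp: kernel_def eq)
  have kc: "kernel F G \<psi> \<subseteq> carrier F" by (auto simp: kernel_def)
  show "card (kernel F G \<psi>) = card (kernel F G (lift s))"
    using card_image[OF inj_on_subset[OF inj kc]] im by simp
  have "pstar p F (kernel F G \<psi>) \<subseteq> carrier F" using subgroup.subset[OF F.pstar_subgroup[OF kc]] .
  then show "card (pstar p F (kernel F G \<psi>)) = card (pstar p F (kernel F G (lift s)))"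
    using card_image[OF inj_on_subset[OF inj]] T.pstar_img[OF kc surj, of p] im by metis
qed

lemma card_subgroup_prime_power: "subgroup U F \<Longrightarrow> \<exists>k. card U = p ^ k"
proof -
  assume U: "subgroup U F"
  obtain n where n: "card (carrier F) = p ^ n" using card_Fc[OF prime_p] by blast
  have "card (rcosets\<^bsub>F\<^esub> U) * card U = order F" by (rule F.lagrange[OF U])
  then have "card U dvd p ^ n" using n unfolding order_def by (metis dvd_triv_right)
  then show ?thesis using divides_primepow_nat[OF prime_p] by blast
qed

lemma index_prime_power:
  assumes "subgroup U F" "subgroup V F" "k * card V = card U" shows "\<exists>h. k = p ^ h"
proof -
  obtain n where n: "card U = p ^ n" using card_subgroup_prime_power[OF assms(1)] by blast
  have "k dvd p ^ n" using n assms(3) by (metis dvd_triv_left)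
  then show ?thesis using divides_primepow_nat[OF prime_p] by blast
qed

text \<open>\<open>h_inv\<close> starts from an arbitrary surjection \<pi> of the free pro-p group.
  Since P_m(G) = 1 it factors through F_m, and the m-th coordinate identifies the quotient in
  \<open>h_inv\<close> with the relation module of F_m. By \<open>kernel_pstar_cards\<close> its
  order is the same for all choices.\<close>

lemma h_inv_kernel:
  assumes s: "s \<in> Etup"
  shows "card (kernel F G (lift s)) = p ^ h_inv p g m G * card (pstar p F (kernel F G (lift s)))"
proof -
  let ?P = "free_prop p g" and ?t = "free_prop_top p g"
  interpret L: group_hom F G "lift s" using lift_group_hom[OF Etup_closed[OF s]] .
  interpret C: group_hom ?P F "\<lambda>a. a m" by (rule group_hom_coord)
  define good where "good \<pi> \<longleftrightarrow> \<pi> \<in> hom ?P G \<and> \<pi> ` carrier ?P = carrier G \<and>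
     continuous_map ?t (discrete_topology (carrier G)) \<pi>" for \<pi>
  have good0: "good (\<lambda>a. lift s (a m))"
    unfolding good_def
  proof (intro conjI)
    show "(\<lambda>a. lift s (a m)) \<in> hom ?P G" using Group.hom_compose[OF C.homh L.homh] by (simp add: comp_def)
    show "(\<lambda>a. lift s (a m)) ` carrier ?P = carrier G"
      using lift_surj[OF s] coord_surj[where p = p and g = g and n = m] by (metis image_image)
    show "continuous_map ?t (discrete_topology (carrier G)) (\<lambda>a. lift s (a m))"
    proof (rule continuous_map_fibres_open)
      show "openin ?t {x \<in> topspace ?t. lift s (x m) = y}" for y
        unfolding topspace_free_prop
        by (rule openin_combine[of ?t "carrier ?P" "\<lambda>a. a m" "\<lambda>a. a m" "\<lambda>i j. lift s i = y", OF openin_coord openin_coord])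
    qed (auto simp: topspace_free_prop free_prop_closed)
  qed
  define \<pi> where "\<pi> = (SOME \<pi>. good \<pi>)"
  have "good \<pi>" unfolding \<pi>_def by (rule someI[of good, OF good0])
  then have \<pi>: "\<pi> \<in> hom ?P G" "\<pi> ` carrier ?P = carrier G" "continuous_map ?t (discrete_topology (carrier G)) \<pi>"
    by (auto simp: good_def)
  interpret P: group_hom ?P G \<pi> using \<pi>(1) by (simp add: group_hom_def group_hom_axioms_def group_free_prop)
  have op: "openin ?t {a \<in> carrier ?P. \<pi> a = x}" for x
    using continuous_map_discrete_fibre[OF \<pi>(3)] by (simp add: topspace_free_prop)
  have "kernel ?P F (\<lambda>a. a m) \<subseteq> kernel ?P G \<pi>"
    using P.plcs_img_discrete[OF topspace_free_prop op, of p m] lpc_m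
    unfolding plcs_free_prop kernel_def by blast
  then obtain \<psi> where \<psi>: "\<psi> \<in> hom F G" "\<And>a. a \<in> carrier ?P \<Longrightarrow> \<psi> (a m) = \<pi> a"
    using C.hom_factor[OF coord_surj \<pi>(1) group_axioms] by blast
  have \<psi>_surj: "\<psi> ` carrier F = carrier G"
    unfolding \<pi>(2)[symmetric] coord_surj[where p = p and g = g and n = m, symmetric] image_image using \<psi>(2) by (intro image_cong) auto
  interpret Q: group_hom F G \<psi> using \<psi>(1) by (simp add: group_hom_def group_hom_axioms_def group_Fc)
  define R where "R = kernel ?P G \<pi>"
  define N where "N = kernel F G \<psi>"
  have Nn: "N \<lhd> F" unfolding N_def by (rule Q.normal_kernel)
  interpret N: normal N F by fact
  have Rc: "R \<subseteq> carrier ?P" by (auto simp: R_def kernel_def)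
  have RN: "(\<lambda>a. a m) ` R = N"
  proof (intro equalityI subsetI)
    fix x assume x: "x \<in> N"
    then have "x \<in> (\<lambda>a. a m) ` carrier ?P" unfolding coord_surj by simp
    then show "x \<in> (\<lambda>a. a m) ` R" using x \<psi>(2) unfolding R_def N_def kernel_def by auto
  next
    fix x assume "x \<in> (\<lambda>a. a m) ` R"
    then obtain a where a: "a \<in> carrier ?P" "\<pi> a = \<one>" "x = a m" unfolding R_def kernel_def by blast
    then show "x \<in> N" using \<psi>(2)[OF a(1)] free_prop_closed[OF a(1), of m] unfolding N_def kernel_def by simp
  qed
  define S where "S = pstar p ?P R"
  have Sc: "S \<subseteq> carrier ?P" unfolding S_def using subgroup.subset[OF C.G.pstar_subgroup[OF Rc]] .
  have imS: "(\<lambda>a. a m) ` S = pstar p F N" unfolding S_def RN[symmetric] by (rule C.pstar_img[OF Rc coord_surj])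
  \<comment> \<open>This is the full preimage of \<open>pstar p F N\<close>: coordinates have open
    fibres, so the closure adds no new values, and the second factor is the kernel of the m-th
    coordinate.\<close>
  define K where "K = (?t closure_of S) <#>\<^bsub>?P\<^esub> plcs p ?P ?t m"
  have clos: "a \<in> carrier ?P \<and> a m \<in> pstar p F N" if "a \<in> ?t closure_of S" for a
    using closure_fibre_image[OF openin_coord topspace_free_prop that, of m] imS that
      closure_of_subset_topspace[of ?t S] topspace_free_prop by blast
  have K: "K = {a \<in> carrier ?P. a m \<in> pstar p F N}"
  proof (intro equalityI subsetI)
    fix a assume "a \<in> K"
    then obtain b d where bd: "b \<in> ?t closure_of S" "d \<in> carrier ?P" "d m = \<one>\<^bsub>F\<^esub>" "a = b \<otimes>\<^bsub>?P\<^esub> d"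
      unfolding K_def set_mult_def plcs_free_prop by blast
    have b: "b \<in> carrier ?P" "b m \<in> pstar p F N" using clos[OF bd(1)] by auto
    have "a m = b m \<otimes>\<^bsub>F\<^esub> d m" using bd(4) by (simp add: free_prop_mult)
    then have "a m = b m" using bd(3) free_prop_closed[OF b(1), of m] by simp
    then show "a \<in> {a \<in> carrier ?P. a m \<in> pstar p F N}" using b bd(2,4) by simp
  next
    fix a assume "a \<in> {a \<in> carrier ?P. a m \<in> pstar p F N}"
    then have a: "a \<in> carrier ?P" "a m \<in> (\<lambda>a. a m) ` S" using imS by auto
    then obtain b where b: "b \<in> S" "b m = a m" by force
    have bc: "b \<in> carrier ?P" "b \<in> ?t closure_of S"
      using b Sc closure_of_subset[of S ?t] topspace_free_prop by auto
    have "inv\<^bsub>?P\<^esub> b \<otimes>\<^bsub>?P\<^esub> a \<in> plcs p ?P ?t m"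
      unfolding plcs_free_prop using a(1) bc(1) b(2) C.hom_mult[of "inv\<^bsub>?P\<^esub> b" a] C.hom_inv[of b] free_prop_closed[OF a(1), of m] by simp
    moreover have "a = b \<otimes>\<^bsub>?P\<^esub> (inv\<^bsub>?P\<^esub> b \<otimes>\<^bsub>?P\<^esub> a)" using a(1) bc(1) by simp
    ultimately show "a \<in> K" unfolding K_def set_mult_def using bc(2) by blast
  qed
  \<comment> \<open>The coset of \<open>K\<close> above an element of N, written as a preimage so
    that cosets can be counted in F_m.\<close>
  define f where "f n = {a \<in> carrier ?P. a m \<in> pstar p F N #>\<^bsub>F\<^esub> n}" for n
  have pS: "subgroup (pstar p F N) F" by (rule F.pstar_subgroup[OF N.subset])
  have Kr: "K #>\<^bsub>?P\<^esub> r = f (r m)" if r: "r \<in> R" for r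
  proof (intro equalityI subsetI)
    fix a assume "a \<in> K #>\<^bsub>?P\<^esub> r"
    then obtain k where k: "k \<in> carrier ?P" "k m \<in> pstar p F N" "a = k \<otimes>\<^bsub>?P\<^esub> r" unfolding r_coset_def K by blast
    have rc: "r \<in> carrier ?P" using r Rc by blast
    have "a m = k m \<otimes>\<^bsub>F\<^esub> r m" unfolding k(3) by (rule C.hom_mult[OF k(1) rc])
    moreover have "a \<in> carrier ?P" unfolding k(3) using k(1) rc by (rule C.G.m_closed)
    ultimately show "a \<in> f (r m)" using k(2) unfolding f_def r_coset_def by blast
  next
    fix a assume a: "a \<in> f (r m)"
    then obtain k where k: "a \<in> carrier ?P" "k \<in> pstar p F N" "a m = k \<otimes>\<^bsub>F\<^esub> r m" unfolding f_def r_coset_def by blast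
    have rc: "r \<in> carrier ?P" using r Rc by blast
    have "(a \<otimes>\<^bsub>?P\<^esub> inv\<^bsub>?P\<^esub> r) m = k"
      using C.hom_mult[of a "inv\<^bsub>?P\<^esub> r"] C.hom_inv[OF rc] k rc free_prop_closed[OF rc, of m] subgroup.mem_carrier[OF pS k(2)]
      by (simp add: F.m_assoc)
    then have "a \<otimes>\<^bsub>?P\<^esub> inv\<^bsub>?P\<^esub> r \<in> K" unfolding K using k rc by simp
    moreover have "a = a \<otimes>\<^bsub>?P\<^esub> inv\<^bsub>?P\<^esub> r \<otimes>\<^bsub>?P\<^esub> r" using k(1) rc by (simp add: C.G.m_assoc)
    ultimately show "a \<in> K #>\<^bsub>?P\<^esub> r" unfolding r_coset_def by blast
  qed
  have cosets: "{K #>\<^bsub>?P\<^esub> r | r. r \<in> R} = f ` N"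
    unfolding RN[symmetric] image_image using Kr by auto
  have "card N = card (f ` N) * card (pstar p F N)"
  proof (rule card_eq_fibres[where f = f])
    fix b assume "b \<in> f ` N"
    then obtain n where n: "n \<in> N" "b = f n" by blast
    have nF: "n \<in> carrier F" using n by simp
    have "{x \<in> N. f x = b} = pstar p F N #>\<^bsub>F\<^esub> n"
    proof (intro equalityI subsetI)
      fix x assume x: "x \<in> {x \<in> N. f x = b}"
      then have xF: "x \<in> carrier F" by auto
      then have "x \<in> (\<lambda>a. a m) ` carrier ?P" unfolding coord_surj .
      then obtain a where a: "a \<in> carrier ?P" "x = a m" by blast
      have "a \<in> f x" unfolding f_def using a F.rcos_self[OF xF pS] by simp
      then show "x \<in> pstar p F N #>\<^bsub>F\<^esub> n" using x n(2) a unfolding f_def by auto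
    next
      fix x assume x: "x \<in> pstar p F N #>\<^bsub>F\<^esub> n"
      then have "pstar p F N #>\<^bsub>F\<^esub> n = pstar p F N #>\<^bsub>F\<^esub> x" using F.repr_independence[OF x nF pS] by simp
      moreover have "x \<in> N" using x F.pstar_subset[OF Nn, of p] n by (auto simp: r_coset_def)
      ultimately show "x \<in> {x \<in> N. f x = b}" using n(2) by (simp add: f_def)
    qed
    moreover have "pstar p F N #>\<^bsub>F\<^esub> n \<in> rcosets\<^bsub>F\<^esub> (pstar p F N)" using F.rcosetsI[OF subgroup.subset[OF pS] nF] .
    ultimately show "card {x \<in> N. f x = b} = card (pstar p F N)"
      using F.card_rcosets_equal[OF _ subgroup.subset[OF pS]] by simp
  qed (use finite_subset[OF N.subset F.fin] in auto)
  then have cf: "card {K #>\<^bsub>?P\<^esub> r | r. r \<in> R} * card (pstar p F N) = card N" using cosets by simp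
  then obtain h where h: "card {K #>\<^bsub>?P\<^esub> r | r. r \<in> R} = p ^ h"
    using index_prime_power[OF N.subgroup_axioms pS] by blast
  have "h_inv p g m G = (THE h. card {K #>\<^bsub>?P\<^esub> r | r. r \<in> R} = p ^ h)"
    unfolding h_inv_def Let_def good_def[symmetric] \<pi>_def[symmetric] R_def[symmetric] K_def S_def pstar_def
    by (simp only: Un_commute)
  also have "\<dots> = h" using h p_gt_1 by (intro the_equality) auto
  finally have "card N = p ^ h_inv p g m G * card (pstar p F N)" using cf h by simp
  then show ?thesis using kernel_pstar_cards[OF \<psi>(1) \<psi>_surj s] by (simp add: N_def)
qed

text \<open>With fewer than \<open>g\<close> relations, some integer functional \<open>x\<close> on exponent vectors, not divisible
  by \<open>p\<close>, vanishes on all of them; this yields an element of order \<open>p\<^sup>m\<close> in \<open>G\<^sup>a\<^sup>b\<close>.\<close>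

lemma rank_le_relation_rank:
  assumes m: "m = Suc c" and lpc_c: "lpc p G c = {\<one>}" and s: "s \<in> Etup"
    and inv: "\<And>x. x \<in> kernel F G (lift s) \<Longrightarrow> sigma_Fc x \<otimes>\<^bsub>F\<^esub> x \<in> pstar p F (kernel F G (lift s))"
    and h: "card (kernel F G (lift s)) = p ^ h * card (pstar p F (kernel F G (lift s)))"
  shows "g \<le> h"
proof (rule ccontr)
  assume "\<not> g \<le> h"
  then have hg: "h < g" by simp
  interpret L: group_hom F G "lift s" using lift_group_hom[OF Etup_closed[OF s]] .
  define N where "N = kernel F G (lift s)"
  have Nn: "N \<lhd> F" unfolding N_def by (rule L.normal_kernel)
  interpret N: normal N F by fact
  have pS: "subgroup (pstar p F N) F" by (rule F.pstar_subgroup[OF N.subset])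
  have "\<one>\<^bsub>F\<^esub> \<in> inverted F sigma_Fc (pstar p F N)" using subgroup.one_closed[OF pS] by (simp add: inverted_def)
  then have "card (inverted F sigma_Fc (pstar p F N)) > 0"
    using F.finite_inverted[OF subgroup.subset[OF pS]] card_gt_0_iff by blast
  moreover have "(\<Prod>i<h. real p ^ h - real p ^ i) > 0"
    using p_gt_1 by (intro prod_pos) (auto intro!: power_strict_increasing)
  \<comment> \<open>The count for tuples of length h is positive, so some h inverted elements
    generate N modulo \<open>pstar p F N\<close>.\<close>
  ultimately have "real (card {t \<in> {..<h} \<rightarrow>\<^sub>E inverted F sigma_Fc N. generate F (t ` {..<h} \<union> pstar p F N) = N}) > 0"
    using F.card_generating_tuples[OF prime_p Nn inv[folded N_def], of "{..<h}" "pstar p F N" h] pS F.pstar_subset[OF Nn] h[folded N_def]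
    by simp
  then have "{t \<in> {..<h} \<rightarrow>\<^sub>E inverted F sigma_Fc N. generate F (t ` {..<h} \<union> pstar p F N) = N} \<noteq> {}" by (metis card.empty less_irrefl of_nat_0)
  then obtain u where u: "u \<in> {..<h} \<rightarrow>\<^sub>E inverted F sigma_Fc N" "generate F (u ` {..<h} \<union> pstar p F N) = N" by blast
  have uN: "u ` {..<h} \<subseteq> N" using u(1) by (auto simp: inverted_def PiE_iff)
  have ncl: "generate F {x \<otimes>\<^bsub>F\<^esub> s \<otimes>\<^bsub>F\<^esub> inv\<^bsub>F\<^esub> x | x s. x \<in> carrier F \<and> s \<in> u ` {..<h}} = N"
    using F.ncl_eq_iff[OF F.fin lpc_Fc Nn uN] u(2) by blast
  have "\<exists>w. w \<in> carrier (free_grp g) \<and> Fproj p g m w = u j" if "j < h" for j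
  proof -
    have "u j \<in> Fproj p g m ` carrier (free_grp g)" unfolding Fproj_surj using uN that N.subset by auto
    then show ?thesis by force
  qed
  then obtain w where w: "\<And>j. j < h \<Longrightarrow> w j \<in> carrier (free_grp g) \<and> Fproj p g m (w j) = u j" by metis
  obtain x where x: "\<exists>i\<in>{..<g}. \<not> int p dvd x i"
    "\<forall>j\<in>{..<h}. (\<Sum>i\<in>{..<g}. x i * word_val integer_group (\<lambda>k. if k = i then 1 else 0) (w j)) = 0"
    using primitive_integer_relation[of "{..<h}" "{..<g}" p "\<lambda>j i. word_val integer_group (\<lambda>k. if k = i then 1 else 0) (w j)"] hg p_gt_1
    by auto
  have xw: "word_val integer_group x (w j) = 0" if "j < h" for j
    using word_val_integer[of "w j" g x] w[OF that] x(2) that by (simp add: free_grp_carrier)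
  interpret ZZ: group integer_group by simp
  let ?Z = "integer_mod_group (p ^ m)"
  interpret Z: comm_group ?Z by simp
  have p0: "p > 0" using p_gt_1 by simp
  have cZ: "carrier ?Z = {0..<int (p ^ m)}" using p0 by (simp add: carrier_integer_mod_group)
  have vh: "word_val integer_group x \<in> hom (free_grp g) integer_group" by (rule ZZ.word_val_hom) simp
  \<comment> \<open>The functional vanishes on all h relators. Reduced modulo p^m it kills P_m, so
    it factors through F_m and then has N in its kernel.\<close>
  define \<rho> where "\<rho> v = word_val integer_group x v mod int (p ^ m)" for v
  have \<rho>: "\<rho> \<in> hom (free_grp g) ?Z"
  proof (rule homI)
    show "\<rho> v \<in> carrier ?Z" for v unfolding cZ \<rho>_def using p0 by simp
    show "\<rho> (v \<otimes>\<^bsub>free_grp g\<^esub> v') = \<rho> v \<otimes>\<^bsub>?Z\<^esub> \<rho> v'" if "v \<in> carrier (free_grp g)" "v' \<in> carrier (free_grp g)" for v v'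
      using hom_mult[OF vh that] by (simp add: \<rho>_def mod_add_eq)
  qed
  interpret R: group_hom "free_grp g" ?Z \<rho> using \<rho> by (simp add: group_hom_def group_hom_axioms_def group_free_grp)
  have "\<rho> ` lpc p (free_grp g) m \<subseteq> {\<one>\<^bsub>?Z\<^esub>}"
    using R.lpc_img_subset[of p m] lpc_integer_mod[OF p0, of m] by simp
  from Fc_lift_hom[OF Z.group_axioms \<rho> this]
  obtain \<Psi> where \<Psi>: "\<Psi> \<in> hom F ?Z" "\<And>v. v \<in> carrier (free_grp g) \<Longrightarrow> \<Psi> (Fproj p g m v) = \<rho> v" by blast
  interpret P: group_hom F ?Z \<Psi> using \<Psi>(1) by (simp add: group_hom_def group_hom_axioms_def group_Fc)
  have "u ` {..<h} \<subseteq> kernel F ?Z \<Psi>"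
  proof (rule image_subsetI)
    fix j assume j: "j \<in> {..<h}"
    then have "\<Psi> (u j) = 0" using w[of j] \<Psi>(2)[of "w j"] xw[of j] by (simp add: \<rho>_def)
    then show "u j \<in> kernel F ?Z \<Psi>" using uN j N.subset by (auto simp: kernel_def)
  qed
  then have NK: "N \<subseteq> kernel F ?Z \<Psi>"
    unfolding ncl[symmetric] by (rule F.ncl_least[OF P.normal_kernel])
  \<comment> \<open>P_c(G) = 1 puts the p^c-th power of a generator into N, whence p^c x_i is
    divisible by p^(c+1). The level m = c+1 leaves exactly one factor p.\<close>
  have "int p dvd x i" if i: "i < g" for i
  proof -
    let ?e = "Fgen p g m i"
    have e: "?e \<in> carrier F" by (rule Fgen_closed[OF i])
    have "lift s (?e [^]\<^bsub>F\<^esub> (p ^ c)) = lift s ?e [^] (p ^ c)" by (rule L.hom_nat_pow[OF e])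
    also have "\<dots> = \<one>" using lpc_pow[of "lift s ?e" p c] lpc_c e by simp
    finally have "?e [^]\<^bsub>F\<^esub> (p ^ c) \<in> N" unfolding N_def kernel_def using F.nat_pow_closed[OF e] by blast
    then have "\<Psi> (?e [^]\<^bsub>F\<^esub> (p ^ c)) = 0" using NK by (auto simp: kernel_def)
    moreover have "\<Psi> (?e [^]\<^bsub>F\<^esub> (p ^ c)) = \<Psi> ?e [^]\<^bsub>?Z\<^esub> (p ^ c)" by (rule P.hom_nat_pow[OF e])
    moreover have "\<Psi> ?e = x i mod int (p ^ m)"
      using \<Psi>(2)[OF gen_in_free_grp[OF i]] ZZ.word_val_gen[of x g i] i by (simp add: Fgen_def \<rho>_def)
    ultimately have "(int (p ^ c) * (x i mod int (p ^ m))) mod int (p ^ m) = 0" by simp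
    then have "(int (p ^ c) * x i) mod int (p ^ m) = 0" by (simp add: mod_mult_right_eq)
    then have "int p ^ c * int p dvd int p ^ c * x i" unfolding m by (simp add: mod_eq_0_iff_dvd mult.commute)
    then show ?thesis using p0 by simp
  qed
  then show False using x(1) by blast
qed

end

section \<open>A tuple at level c+1 makes G a Schur+1 group\<close>

lemma discrete_pro_p:
  assumes "group G" "finite (carrier G)" "prime p" "card (carrier G) = p ^ n"
  shows "pro_p_group p G (discrete_topology (carrier G))"
proof -
  interpret group G by fact
  have "connected_component_of_set (discrete_topology (carrier G)) x = {x}" if "x \<in> carrier G" for x
    using that unfolding connected_component_of_def connectedin_discrete_topology by (auto intro!: exI[of _ "{x}"])
  moreover have "\<exists>k. card (rcosets\<^bsub>G\<^esub> N) = p ^ k" if "N \<lhd> G" for N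
  proof -
    have "card (rcosets\<^bsub>G\<^esub> N) * card N = p ^ n"
      using lagrange[OF normal_imp_subgroup[OF that]] assms(4) by (simp add: order_def)
    then have "card (rcosets\<^bsub>G\<^esub> N) dvd p ^ n" by (metis dvd_triv_left)
    then show ?thesis using divides_primepow_nat[OF assms(3)] by blast
  qed
  ultimately show ?thesis
    using assms(2) group_axioms unfolding pro_p_group_def
    by (auto simp: prod_topology_discrete_topology[symmetric] compact_space_discrete_topology)
qed

context rank_group_Suc
begin

text \<open>The relators are lifted to the free pro-p group, and their normal closure W has to be
  dense in the kernel onto G. At level n \<ge> m an element trivial in F_m lies in P_{c+1}(F_n); as
  P_c(F_n) is contained in the kernel \<open>Nn\<close> onto G, that element lies in
  \<open>pstar p ?F Nn\<close>. So the image of W generates \<open>Nn\<close> modulo non-generators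
  and equals \<open>Nn\<close>.\<close>

lemma finitely_presented_of_Tc:
  assumes t: "t \<in> Tc p g m G" and ker: "kernel F G (lift s) = ncl_tuple p g m t"
  shows "finitely_presented p G (discrete_topology (carrier G))"
proof -
  let ?P = "free_prop p g" and ?t = "free_prop_top p g"
  have tX: "t \<in> {0..g} \<rightarrow>\<^sub>E Xc p g m" using t by (simp add: Tc_def)
  note tc = Xc_closed[OF tX]
  interpret C: group_hom ?P F "\<lambda>a. a m" by (rule group_hom_coord)
  define N where "N = kernel F G (lift s)"
  have ncl: "generate F {x \<otimes>\<^bsub>F\<^esub> s \<otimes>\<^bsub>F\<^esub> inv\<^bsub>F\<^esub> x | x s. x \<in> carrier F \<and> s \<in> t ` {0..g}} = N"
    using ker ncl_tuple_alt[OF tc] by (simp add: N_def)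
  have "\<exists>b. b \<in> carrier ?P \<and> b m = t i" if "i \<in> {0..g}" for i
  proof -
    have "t i \<in> (\<lambda>a. a m) ` carrier ?P" unfolding coord_surj using tc that by blast
    then show ?thesis by force
  qed
  then obtain b where b: "\<And>i. i \<in> {0..g} \<Longrightarrow> b i \<in> carrier ?P \<and> b i m = t i" by metis
  define S where "S = b ` {0..g}"
  have S: "finite S" "S \<subseteq> carrier ?P" using b by (auto simp: S_def)
  have Sm: "(\<lambda>a. a m) ` S = t ` {0..g}" unfolding S_def image_image using b by (intro image_cong) auto
  define W where "W = generate ?P {x \<otimes>\<^bsub>?P\<^esub> s \<otimes>\<^bsub>?P\<^esub> inv\<^bsub>?P\<^esub> x | x s. x \<in> carrier ?P \<and> s \<in> S}"
  have Wn: "W \<lhd> ?P" unfolding W_def by (rule C.G.ncl_normal[OF S(2)])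
  interpret W: normal W ?P by fact
  have im: "(\<lambda>a. a m) ` W = N"
  proof -
    have "(\<lambda>a. a m) ` {x \<otimes>\<^bsub>?P\<^esub> s \<otimes>\<^bsub>?P\<^esub> inv\<^bsub>?P\<^esub> x | x s. x \<in> carrier ?P \<and> s \<in> S} =
      {x \<otimes>\<^bsub>F\<^esub> s \<otimes>\<^bsub>F\<^esub> inv\<^bsub>F\<^esub> x | x s. x \<in> carrier F \<and> s \<in> t ` {0..g}}" (is "_ ` ?A = ?B")
    proof (intro equalityI subsetI)
      fix y assume "y \<in> (\<lambda>a. a m) ` ?A"
      then obtain x s where xs: "x \<in> carrier ?P" "s \<in> S" "y = (x \<otimes>\<^bsub>?P\<^esub> s \<otimes>\<^bsub>?P\<^esub> inv\<^bsub>?P\<^esub> x) m" by blast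
      have "s \<in> carrier ?P" using xs S by blast
      then have "y = x m \<otimes>\<^bsub>F\<^esub> s m \<otimes>\<^bsub>F\<^esub> inv\<^bsub>F\<^esub> (x m)" using xs C.hom_mult C.hom_inv by simp
      moreover have "s m \<in> t ` {0..g}" unfolding Sm[symmetric] using xs(2) by (rule imageI)
      moreover have "x m \<in> carrier F" by (rule free_prop_closed[OF xs(1)])
      ultimately show "y \<in> ?B" by blast
    next
      fix y assume "y \<in> ?B"
      then obtain x' s' where xs: "x' \<in> carrier F" "s' \<in> t ` {0..g}" "y = x' \<otimes>\<^bsub>F\<^esub> s' \<otimes>\<^bsub>F\<^esub> inv\<^bsub>F\<^esub> x'" by blast
      then have "x' \<in> (\<lambda>a. a m) ` carrier ?P" "s' \<in> (\<lambda>a. a m) ` S" using Sm coord_surj by auto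
      then obtain x s where x: "x \<in> carrier ?P" "x' = x m" "s \<in> S" "s' = s m" by blast
      have "s \<in> carrier ?P" using x S by blast
      then have "y = (x \<otimes>\<^bsub>?P\<^esub> s \<otimes>\<^bsub>?P\<^esub> inv\<^bsub>?P\<^esub> x) m" using xs x C.hom_mult C.hom_inv by simp
      then show "y \<in> (\<lambda>a. a m) ` ?A" using x by blast
    qed
    moreover have "?A \<subseteq> carrier ?P" using S by auto
    ultimately show ?thesis unfolding W_def ncl[symmetric] by (simp only: C.generate_img[symmetric])
  qed
  define \<phi> where "\<phi> a = lift s (a m)" for a
  have \<phi>h: "\<phi> \<in> hom ?P G" using Group.hom_compose[OF C.homh tr.psi.homh] by (simp add: comp_def \<phi>_def[abs_def])
  interpret Q: group_hom ?P G \<phi> using \<phi>h by (simp add: group_hom_def group_hom_axioms_def group_free_prop)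
  have \<phi>s: "\<phi> ` carrier ?P = carrier G"
    using lift_surj[OF s] coord_surj[where p = p and g = g and n = m] unfolding \<phi>_def by (metis image_image)
  have op: "openin ?t {x \<in> carrier ?P. \<phi> x = y}" for y
    unfolding \<phi>_def
    by (rule openin_combine[of ?t "carrier ?P" "\<lambda>a. a m" "\<lambda>a. a m" "\<lambda>i j. lift s i = y", OF openin_coord openin_coord])
  have cont: "continuous_map ?t (discrete_topology (carrier G)) \<phi>"
    using op Q.hom_closed by (intro continuous_map_fibres_open) (auto simp: topspace_free_prop)
  have kerm: "a \<in> kernel ?P G \<phi> \<longleftrightarrow> a \<in> carrier ?P \<and> a m \<in> N" for a
    by (auto simp: kernel_def N_def \<phi>_def free_prop_closed)
  have "kernel ?P G \<phi> = ?t closure_of W"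
  proof (intro equalityI subsetI)
    fix a assume a: "a \<in> ?t closure_of W"
    have "\<phi> a \<in> \<phi> ` W" by (rule closure_fibre_image[OF op topspace_free_prop a])
    moreover have "\<phi> ` W \<subseteq> {\<one>}" using im unfolding \<phi>_def N_def kernel_def by auto
    moreover have "a \<in> carrier ?P" using a closure_of_subset_topspace[of ?t W] topspace_free_prop by blast
    ultimately show "a \<in> kernel ?P G \<phi>" by (auto simp: kernel_def)
  next
    fix a assume a: "a \<in> kernel ?P G \<phi>"
    show "a \<in> ?t closure_of W"
      unfolding in_closure_of
    proof (intro conjI allI impI)
      show "a \<in> topspace ?t" using a kerm topspace_free_prop by blast
      fix T assume T: "a \<in> T \<and> openin ?t T"
      then obtain n0 where n0: "\<forall>b\<in>carrier ?P. b n0 = a n0 \<longrightarrow> b \<in> T" using free_prop_nbhd[of p g T a] by blast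
      \<comment> \<open>n0 controls the neighbourhood \<open>T\<close>, and n \<ge> m lets \<phi>
        factor through F_n.\<close>
      define n where "n = max n0 m"
      let ?F = "Fc p g n"
      interpret D: group_hom ?P ?F "\<lambda>a. a n" by (rule group_hom_coord)
      have "kernel ?P ?F (\<lambda>a. a n) \<subseteq> kernel ?P G \<phi>"
      proof
        fix d assume d: "d \<in> kernel ?P ?F (\<lambda>a. a n)"
        then have dc: "d \<in> carrier ?P" "d n = \<one>\<^bsub>?P\<^esub> n" by (auto simp: kernel_def free_prop_one)
        have "d m = \<one>\<^bsub>?P\<^esub> m" by (rule coord_mono[OF dc(1) C.G.one_closed dc(2)]) (simp add: n_def)
        then show "d \<in> kernel ?P G \<phi>" using dc(1) by (simp add: kernel_def \<phi>_def free_prop_one)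
      qed
      then obtain \<psi> where \<psi>: "\<psi> \<in> hom ?F G" "\<And>a. a \<in> carrier ?P \<Longrightarrow> \<psi> (a n) = \<phi> a"
        using D.hom_factor[OF coord_surj \<phi>h group_axioms] by blast
      interpret E: group_hom ?F G \<psi> using \<psi>(1) by (simp add: group_hom_def group_hom_axioms_def group_Fc)
      define Nn where "Nn = kernel ?F G \<psi>"
      have Nnn: "Nn \<lhd> ?F" unfolding Nn_def by (rule E.normal_kernel)
      define M where "M = (\<lambda>a. a n) ` W"
      have Wk: "W \<subseteq> kernel ?P G \<phi>" using im kerm W.subset by blast
      have Msub: "subgroup M ?F" unfolding M_def by (rule D.subgroup_img_is_subgroup[OF W.subgroup_axioms])
      have MN: "M \<subseteq> Nn"
        using Wk \<psi>(2) free_prop_closed unfolding M_def Nn_def kernel_def by fastforce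
      have Mn: "M \<lhd> ?F"
      proof -
        have "x \<otimes>\<^bsub>?F\<^esub> y \<otimes>\<^bsub>?F\<^esub> inv\<^bsub>?F\<^esub> x \<in> M" if x: "x \<in> carrier ?F" and y: "y \<in> M" for x y
        proof -
          have "x \<in> (\<lambda>a. a n) ` carrier ?P" using x coord_surj by blast
          then obtain x' where x': "x' \<in> carrier ?P" "x = x' n" by blast
          obtain y' where y': "y' \<in> W" "y = y' n" using y by (auto simp: M_def)
          have w: "x' \<otimes>\<^bsub>?P\<^esub> y' \<otimes>\<^bsub>?P\<^esub> inv\<^bsub>?P\<^esub> x' \<in> W" by (rule W.inv_op_closed2[OF x'(1) y'(1)])
          have "(x' \<otimes>\<^bsub>?P\<^esub> y' \<otimes>\<^bsub>?P\<^esub> inv\<^bsub>?P\<^esub> x') n = x \<otimes>\<^bsub>?F\<^esub> y \<otimes>\<^bsub>?F\<^esub> inv\<^bsub>?F\<^esub> x"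
            using x' y' D.hom_mult D.hom_inv W.mem_carrier[OF y'(1)] by simp
          from this[symmetric] w show ?thesis unfolding M_def by (rule image_eqI)
        qed
        then show ?thesis using Msub by (simp add: D.H.normal_inv_iff)
      qed
      have "Nn \<subseteq> generate ?F (M \<union> pstar p ?F Nn)"
      proof
        fix x assume x: "x \<in> Nn"
        then have "x \<in> (\<lambda>a. a n) ` carrier ?P" using coord_surj by (auto simp: Nn_def kernel_def)
        then obtain a' where a': "a' \<in> carrier ?P" "x = a' n" by blast
        have "\<phi> a' = \<one>" using x a' \<psi>(2) by (auto simp: Nn_def kernel_def)
        then have "a' m \<in> (\<lambda>a. a m) ` W" unfolding im using a'(1) kerm[of a'] by (simp add: kernel_def)
        then obtain b' where b': "b' \<in> W" "b' m = a' m" by force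
        have b'c: "b' \<in> carrier ?P" using b' by simp
        define d where "d = inv\<^bsub>?P\<^esub> b' \<otimes>\<^bsub>?P\<^esub> a'"
        have dc: "d \<in> carrier ?P" using a' b'c by (simp add: d_def)
        have dm: "d m = \<one>\<^bsub>F\<^esub>"
          using C.hom_mult[of "inv\<^bsub>?P\<^esub> b'" a'] C.hom_inv[OF b'c] a'(1) b'c b'(2) free_prop_closed[OF a'(1), of m]
          by (simp add: d_def)
        obtain v where v: "v \<in> carrier (free_grp g)" "\<And>k. k \<le> n \<Longrightarrow> d k = Fproj p g k v"
          using dc unfolding free_prop_iff by metis
        have "d m = Fproj p g m v" by (rule v(2)) (simp add: n_def)
        then have "v \<in> lpc p (free_grp g) m" using dm Fproj_eq_one_iff[OF v(1)] by metis
        interpret PJ: group_hom "free_grp g" ?F "Fproj p g n" by (rule group_hom_Fproj)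
        have "d n \<in> lpc p ?F m"
          using v(2)[OF order_refl] PJ.lpc_img_subset[of p m] \<open>v \<in> lpc p (free_grp g) m\<close> by auto
        moreover have "lpc p ?F c \<subseteq> Nn"
          using E.lpc_img_subset[of p c] lpc_c D.H.lpc_carrier[of p c] unfolding Nn_def kernel_def by auto
        then have "lpc p ?F m \<subseteq> pstar p ?F Nn"
          unfolding m lpc.simps using normal_imp_subgroup[OF Nnn] subgroup.subset by (intro D.H.pstar_mono) auto
        ultimately have dp: "d n \<in> pstar p ?F Nn" by blast
        have "a' = b' \<otimes>\<^bsub>?P\<^esub> d" using a'(1) b'c by (simp add: d_def)
        then have "x = b' n \<otimes>\<^bsub>?F\<^esub> d n" using a'(2) D.hom_mult[OF b'c dc] by simp
        moreover have "b' n \<in> M" using b' by (auto simp: M_def)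
        ultimately show "x \<in> generate ?F (M \<union> pstar p ?F Nn)"
          using dp by (simp only:) (intro generate.eng generate.incl UnI1 UnI2)
      qed
      then have "M = Nn"
        using D.H.frattini_argument[OF finite_Fc lpc_Fc Nnn Msub MN] Mn tr.p0(1) by blast
      moreover have "a n \<in> Nn" using a \<psi>(2)[of a] free_prop_closed by (auto simp: Nn_def kernel_def)
      ultimately obtain b' where b': "b' \<in> W" "b' n = a n" by (force simp: M_def)
      have ac: "a \<in> carrier ?P" using a kerm by blast
      have "b' n0 = a n0" by (rule coord_mono[OF W.mem_carrier[OF b'(1)] ac b'(2)]) (simp add: n_def)
      then show "\<exists>y. y \<in> W \<and> y \<in> T" using n0 b'(1) W.mem_carrier[OF b'(1)] by blast
    qed
  qed
  then have "kernel ?P G \<phi> = cl_ncl ?P ?t S" by (simp add: cl_ncl_def W_def)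
  then show ?thesis
    unfolding finitely_presented_def using S \<phi>h \<phi>s cont by blast
qed

text \<open>\<sigma> inverts the relators, hence the relation module and H^2(G). The dimension is at
  least g by \<open>rank_le_relation_rank\<close> and at most g+1, the number of relators.\<close>

lemma schur_of_Tc:
  assumes t: "t \<in> Tc p g m G" and ker: "kernel F G (lift s) = ncl_tuple p g m t"
    and gi: "gi_aut G (discrete_topology (carrier G)) \<sigma>"
  shows "schur1_sigma_group p g G (discrete_topology (carrier G))"
proof -
  let ?t = "discrete_topology (carrier G)"
  have tX: "t \<in> {0..g} \<rightarrow>\<^sub>E Xc p g m" using t by (simp add: Tc_def)
  note tc = Xc_closed[OF tX]
  define N where "N = kernel F G (lift s)"
  have N_tr: "N = tr.N" by (simp add: N_def tr.N_def)
  have Nn: "N \<lhd> F" unfolding N_def by (rule tr.psi.normal_kernel)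
  interpret N: normal N F by fact
  have pS: "subgroup (pstar p F N) F" by (rule F.pstar_subgroup[OF N.subset])
  have pN: "pstar p F N \<subseteq> N" by (rule F.pstar_subset[OF Nn])
  have nclN: "generate F {x \<otimes>\<^bsub>F\<^esub> s \<otimes>\<^bsub>F\<^esub> inv\<^bsub>F\<^esub> x | x s. x \<in> carrier F \<and> s \<in> t ` {0..g}} = N"
    using ker ncl_tuple_alt[OF tc] by (simp add: N_def)
  have tN: "t ` {0..g} \<subseteq> N" using F.ncl_incl[OF tc] nclN by blast
  have gen: "generate F (t ` {0..g} \<union> pstar p F N) = N"
    using F.ncl_eq_iff[OF F.fin lpc_Fc Nn tN] nclN by blast
  have sN: "sigma_Fc n \<in> N" if "n \<in> N" for n
    unfolding N_def
  proof (rule tr.N_I[unfolded tr.N_def])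
    have n: "n \<in> carrier F" by (rule N.mem_carrier[OF that])
    then show "sigma_Fc n \<in> carrier F" by (rule F.sig.hom_closed)
    have "lift s n = \<one>" using that unfolding N_def kernel_def by simp
    then show "lift s (sigma_Fc n) = \<one>" unfolding lift_equivariant[OF s n] by simp
  qed
  have sp: "sigma_Fc w \<in> pstar p F N" if "w \<in> pstar p F N" for w
    using F.sig.pstar_img_subset[OF N.subset _ N.subset, of p] sN that by blast
  \<comment> \<open>Relators are inverted exactly and \<open>pstar p F N\<close> is stable under
    \<sigma>; products are covered because the commutator of \<sigma>(b) and a lies in
    \<open>pstar p F N\<close>.\<close>
  have inv: "sigma_Fc n \<otimes>\<^bsub>F\<^esub> n \<in> pstar p F N" if n: "n \<in> N" for n
  proof -
    have "n \<in> generate F (t ` {0..g} \<union> pstar p F N)" using n gen by simp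
    then show ?thesis
    proof (induction rule: generate.induct)
      case one
      then show ?case using subgroup.one_closed[OF pS] by simp
    next
      case (incl h)
      then show ?case
      proof
        assume "h \<in> t ` {0..g}"
        then have "sigma_Fc h = inv\<^bsub>F\<^esub> h" "h \<in> carrier F" using tX tc by (auto simp: Xc_def PiE_iff)
        then show ?thesis using subgroup.one_closed[OF pS] by simp
      qed (use subgroup.m_closed[OF pS] sp in blast)
    next
      case (inv h)
      then show ?case
      proof
        assume "h \<in> t ` {0..g}"
        then have "sigma_Fc h = inv\<^bsub>F\<^esub> h" "h \<in> carrier F" using tX tc by (auto simp: Xc_def PiE_iff)
        then show ?thesis using subgroup.one_closed[OF pS] by simp
      next
        assume "h \<in> pstar p F N"
        then have "inv\<^bsub>F\<^esub> h \<in> pstar p F N" using subgroup.m_inv_closed[OF pS] by blast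
        then show ?thesis using subgroup.m_closed[OF pS] sp by blast
      qed
    next
      case (eng a b)
      have ab: "a \<in> N" "b \<in> N" using eng gen by auto
      have c: "a \<in> carrier F" "b \<in> carrier F" using ab N.subset by auto
      have k: "sigma_Fc b \<otimes>\<^bsub>F\<^esub> a \<otimes>\<^bsub>F\<^esub> inv\<^bsub>F\<^esub> (sigma_Fc b) \<otimes>\<^bsub>F\<^esub> inv\<^bsub>F\<^esub> a \<in> pstar p F N"
        using F.comm_in_pstar[of "sigma_Fc b" a N p] ab c by simp
      have "(sigma_Fc a \<otimes>\<^bsub>F\<^esub> (sigma_Fc b \<otimes>\<^bsub>F\<^esub> a \<otimes>\<^bsub>F\<^esub> inv\<^bsub>F\<^esub> (sigma_Fc b) \<otimes>\<^bsub>F\<^esub> inv\<^bsub>F\<^esub> a) \<otimes>\<^bsub>F\<^esub> inv\<^bsub>F\<^esub> (sigma_Fc a))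
          \<otimes>\<^bsub>F\<^esub> (sigma_Fc a \<otimes>\<^bsub>F\<^esub> a) \<otimes>\<^bsub>F\<^esub> (sigma_Fc b \<otimes>\<^bsub>F\<^esub> b) \<in> pstar p F N"
        using c by (intro subgroup.m_closed[OF pS] eng.IH normal.inv_op_closed2[OF F.pstar_normal[OF Nn] _ k] F.sig.hom_closed)
      then show ?case using c by (simp add: F.m_assoc)
    qed
  qed
  obtain h where h: "card (H2 p G ?t) = p ^ h"
    using index_prime_power[OF N.subgroup_axioms pS] card_H2 N_tr by metis
  have cN: "card N = p ^ h * card (pstar p F N)" using card_H2 h N_tr by simp
  have "g \<le> h"
    by (rule rank_le_relation_rank[OF m lpc_c s]) (use inv cN in \<open>auto simp: N_def\<close>)
  \<comment> \<open>For larger h the factor i = g+1 makes the number of tuples with normal closure N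
    zero, yet \<open>t\<close> is one of them.\<close>
  moreover have "h \<le> g + 1"
  proof (rule ccontr)
    assume "\<not> h \<le> g + 1"
    then have z: "(\<Prod>i<h. real p ^ (g + 1) - real p ^ i) = 0" by (intro prod_zero) (auto intro!: bexI[of _ "g + 1"])
    have "card {t \<in> Tc p g m G. ncl_tuple p g m t = N} = 0"
      using card_kernel_tuples[OF s N_def inv cN] unfolding z by simp
    moreover have "finite {t \<in> Tc p g m G. ncl_tuple p g m t = N}"
      unfolding Tc_def using F.finite_inverted[OF F.lpc_carrier]
      by (intro finite_subset[OF _ finite_PiE[of "{0..g}" "\<lambda>_. Xc p g m"]]) (auto simp: Xc_alt[OF prime_p])
    ultimately show False using t ker by (auto simp: N_def)
  qed
  ultimately have H2: "card (H2 p G ?t) = p ^ g \<or> card (H2 p G ?t) = p ^ (g + 1)"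
    using h by (metis Suc_eq_plus1 le_SucE le_antisym)
  have "kernel G G id \<subseteq> plcs p G ?t 1"
    using subgroup.one_closed[OF lpc_subgroup[of p 1]] plcs_discrete[of p 1] by (auto simp: kernel_def)
  then have "card (H1 p G ?t) = card (chars p G (carrier G) (lpc p G 1))"
    by (intro tr.kap.card_H1[OF prime_p]) auto
  then have "card (H1 p G ?t) * card (lpc p G 1) = p ^ g * card (lpc p G 1)"
    using card_chars_carrier[OF prime_p fin] rank by simp
  moreover have "card (lpc p G 1) > 0"
    using lpc_carrier fin subgroup.one_closed[OF lpc_subgroup] by (metis card_gt_0_iff empty_iff finite_subset)
  ultimately have H1: "card (H1 p G ?t) = p ^ g" by simp
  have "finite (rcosets (?t closure_of derived G (carrier G)))"
    using fin by (simp add: RCOSETS_def)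
  moreover obtain k where k: "card (carrier G) = p ^ k" using card_prime_power[OF fin prime_p lpc_m] by blast
  have "pro_p_group p G ?t" by (rule discrete_pro_p[OF group_axioms fin prime_p k])
  moreover have "inverts_H2 p G ?t \<sigma>" by (rule inverts_H2_of_kernel) (use inv N_tr in simp)
  ultimately show ?thesis
    unfolding schur1_sigma_group_def using finitely_presented_of_Tc[OF t ker] H1 H2 gi by blast
qed

end

section \<open>The measure formulas\<close>

lemma Meas_ancestor:
  assumes p: "prime p" "odd p" and H: "schur1_sigma_group p g H tau"
    and k0: "group_hom H G \<kappa>0" "\<kappa>0 ` carrier H = carrier G" "kernel H G \<kappa>0 = plcs p H tau c"
    and c: "1 \<le> c" "m \<le> c" and m: "lpc p G m = {\<one>\<^bsub>G\<^esub>}"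
    and gi: "gi_aut G (discrete_topology (carrier G)) \<sigma>"
    and h: "\<And>s. rank_group G \<sigma> p g m \<Longrightarrow> s \<in> rank_group.Etup G \<sigma> g \<Longrightarrow>
       card (kernel (Fc p g m) G (rank_group.lift G p g m s)) = p ^ h * card (pstar p (Fc p g m) (kernel (Fc p g m) G (rank_group.lift G p g m s)))"
  shows "Meas p g m G = real (y_inv G \<sigma>) / (real (card (Aut_sigma G \<sigma>)) * real (card (carrier G)))
     * real p ^ (g * (g + 1)) * (eta g p * eta (g + 1) p / eta (g + 1 - h) p)"
proof -
  note sq = schur_quotient[OF p H k0 c m gi]
  interpret R: rank_group G \<sigma> p g m by (rule sq(1))
  obtain \<kappa> \<tau> where k: "group_hom H G \<kappa>" "\<kappa> ` carrier H = carrier G" "\<And>a. openin tau {x \<in> carrier H. \<kappa> x = a}"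
    "kernel H G \<kappa> \<subseteq> plcs p H tau m" "inverts_H2 p H tau \<tau>"
    "\<And>x. x \<in> carrier H \<Longrightarrow> \<tau> x \<in> carrier H \<and> \<kappa> (\<tau> x) = \<sigma> (\<kappa> x)"
    using sq(2) by blast
  have H2: "card (H2 p H tau) = p ^ g \<or> card (H2 p H tau) = p ^ (g + 1)" "topspace tau = carrier H"
    using H by (auto simp: schur1_sigma_group_def pro_p_group_def)
  note anc = R.ancestor_kernel[OF _ H2 k]
  obtain s where s: "s \<in> R.Etup" using R.Etup_nonempty by blast
  let ?N = "kernel (Fc p g m) G (R.lift s)"
  have "card (pstar p (Fc p g m) ?N) > 0"
  proof -
    have "subgroup (pstar p (Fc p g m) ?N) (Fc p g m)" by (rule R.F.pstar_subgroup) (auto simp: kernel_def)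
    then show ?thesis using R.F.fin by (metis card_gt_0_iff empty_iff finite_subset subgroup.one_closed subgroup.subset)
  qed
  \<comment> \<open>The bound is inherited from H^2(H), and it keeps the subtraction g+1-h from
    being truncated at 0.\<close>
  then have "p ^ h \<le> p ^ (g + 1)" using anc(2)[OF s] h[OF sq(1) s] by simp
  then have "h \<le> g + 1" using R.p_gt_1 power_le_imp_le_exp by blast
  then show ?thesis by (intro R.Meas_formula) (use anc(1) h[OF sq(1)] in auto)
qed

theorem theorem2p21:
  fixes p g c :: nat
    and G :: "('a, 'b) monoid_scheme"
    and H :: "('h, 'k) monoid_scheme" and tauH :: "'h topology"
  assumes "prime p" and "odd p" and "g \<ge> 1"
    and "group G"
    and "schur1_ancestor_of p g G H tauH"
    and "has_p_class p G (discrete_topology (carrier G)) c"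
  shows "\<forall>\<sigma>. gi_aut G (discrete_topology (carrier G)) \<sigma> \<longrightarrow>
      Meas p g c G =
        real (y_inv G \<sigma>) / (real (card (Aut_sigma G \<sigma>)) * real (card (carrier G)))
        * real p ^ (g * (g + 1))
        * (eta g p * eta (g + 1) p / eta (g + 1 - h_inv p g c G) p)
      \<and> (schur1_sigma_group p g G (discrete_topology (carrier G)) \<longrightarrow>
          Meas p g (c + 1) G =
            real (y_inv G \<sigma>) / (real (card (Aut_sigma G \<sigma>)) * real (card (carrier G)))
            * real p ^ (g * (g + 1))
            * (eta g p * eta (g + 1) p
               / eta (g + 1 - r_inv p G (discrete_topology (carrier G))) p))
      \<and> (\<not> schur1_sigma_group p g G (discrete_topology (carrier G)) \<longrightarrow>
          Meas p g (c + 1) G = 0)"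
proof (intro allI impI)
  fix \<sigma> assume gi: "gi_aut G (discrete_topology (carrier G)) \<sigma>"
  let ?t = "discrete_topology (carrier G)"
  interpret G: group G by fact
  \<comment> \<open>The index c0 of the quotient may exceed the class c, for instance when P_c(H) is
    already trivial.\<close>
  obtain c0 where H: "schur1_sigma_group p g H tauH" and c0: "1 \<le> c0" and iso: "G \<cong> H Mod plcs p H tauH c0"
    using assms(5) by (auto simp: schur1_ancestor_of_def)
  have top: "topgroup H tauH" using H pro_p_topgroup by (auto simp: schur1_sigma_group_def)
  interpret T: topgroup H tauH by fact
  interpret P: normal "plcs p H tauH c0" H by (rule T.plcs_normal)
  interpret Q: group "H Mod plcs p H tauH c0" by (rule P.factorgroup_is_group)
  obtain \<beta>0 where "\<beta>0 \<in> iso G (H Mod plcs p H tauH c0)" using iso by (auto simp: is_iso_def)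
  then obtain \<beta> where \<beta>: "\<beta> \<in> iso (H Mod plcs p H tauH c0) G" using G.iso_set_sym by blast
  have \<beta>h: "\<beta> \<in> hom (H Mod plcs p H tauH c0) G" "bij_betw \<beta> (carrier (H Mod plcs p H tauH c0)) (carrier G)"
    using \<beta> by (auto simp: iso_def)
  define \<kappa> where "\<kappa> = \<beta> \<circ> (\<lambda>x. plcs p H tauH c0 #>\<^bsub>H\<^esub> x)"
  have "\<kappa> \<in> hom H G" unfolding \<kappa>_def by (rule Group.hom_compose[OF P.r_coset_hom_Mod \<beta>h(1)])
  then have kh: "group_hom H G \<kappa>" by (simp add: group_hom_def group_hom_axioms_def T.group_axioms G.group_axioms)
  interpret k: group_hom H G \<kappa> by (rule kh)
  interpret B: group_hom "H Mod plcs p H tauH c0" G \<beta> using \<beta>h(1) by (simp add: group_hom_def group_hom_axioms_def)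
  have surj: "\<kappa> ` carrier H = carrier G"
    using \<beta>h(2) by (simp add: \<kappa>_def bij_betw_def carrier_FactGroup image_image)
  have "\<kappa> x = \<one>\<^bsub>G\<^esub> \<longleftrightarrow> x \<in> plcs p H tauH c0" if x: "x \<in> carrier H" for x
  proof -
    have "plcs p H tauH c0 #>\<^bsub>H\<^esub> x \<in> carrier (H Mod plcs p H tauH c0)" using x by (simp add: carrier_FactGroup)
    then have "\<kappa> x = \<one>\<^bsub>G\<^esub> \<longleftrightarrow> plcs p H tauH c0 #>\<^bsub>H\<^esub> x = plcs p H tauH c0"
      using \<beta>h(2) B.hom_one Q.one_closed unfolding \<kappa>_def bij_betw_def inj_on_def by (metis comp_apply one_FactGroup)
    also have "\<dots> \<longleftrightarrow> x \<in> plcs p H tauH c0"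
      using T.coset_join1[OF _ x P.subgroup_axioms] T.coset_join2[OF x P.subgroup_axioms] by blast
    finally show ?thesis .
  qed
  then have ker: "kernel H G \<kappa> = plcs p H tauH c0" unfolding kernel_def using P.subset by blast
  have lc: "lpc p G c = {\<one>\<^bsub>G\<^esub>}" "\<And>n. n < c \<Longrightarrow> lpc p G n \<noteq> {\<one>\<^bsub>G\<^esub>}"
    using assms(6) unfolding has_p_class_def G.plcs_discrete by auto
  have lpc_ge: "lpc p G n = {\<one>\<^bsub>G\<^esub>}" if "c \<le> n" for n
    using G.lpc_antimono[OF that, of p] lc(1) subgroup.one_closed[OF G.lpc_subgroup] by blast
  have "c \<le> c0"
  proof (rule ccontr)
    assume "\<not> c \<le> c0"
    have "\<kappa> ` lpc p H c0 \<subseteq> {\<one>\<^bsub>G\<^esub>}"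
      using group_hom.lpc_img_plcs[of H H id tauH p c0] ker top by (auto simp: group_hom_def group_hom_axioms_def hom_def kernel_def T.group_axioms)
    then have "lpc p G c0 \<subseteq> {\<one>\<^bsub>G\<^esub>}" unfolding k.lpc_img[OF surj] .
    then have "lpc p G c0 = {\<one>\<^bsub>G\<^esub>}" using subgroup.one_closed[OF G.lpc_subgroup] by blast
    then show False using lc(2) \<open>\<not> c \<le> c0\<close> by simp
  qed
  note Rc = schur_quotient(1)[OF assms(1,2) H kh surj ker c0 \<open>c \<le> c0\<close> lc(1) gi]
  interpret R: rank_group G \<sigma> p g c by (rule Rc)
  have m: "lpc p G (Suc c) = {\<one>\<^bsub>G\<^esub>}" by (rule lpc_ge) simp
  have Rm: "rank_group G \<sigma> p g (Suc c)"
    using R.rank_group_axioms m by (simp add: rank_group_def rank_group_axioms_def)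
  interpret M: rank_group G \<sigma> p g "Suc c" by (rule Rm)
  have Msuc: "rank_group_Suc G \<sigma> p g (Suc c) c s" if "s \<in> M.Etup" for s
    using that Rm lc(1) by (simp add: rank_group_Suc_def rank_group_Suc_axioms_def)
  show "Meas p g c G =
        real (y_inv G \<sigma>) / (real (card (Aut_sigma G \<sigma>)) * real (card (carrier G)))
        * real p ^ (g * (g + 1))
        * (eta g p * eta (g + 1) p / eta (g + 1 - h_inv p g c G) p)
      \<and> (schur1_sigma_group p g G ?t \<longrightarrow>
          Meas p g (c + 1) G =
            real (y_inv G \<sigma>) / (real (card (Aut_sigma G \<sigma>)) * real (card (carrier G)))
            * real p ^ (g * (g + 1))
            * (eta g p * eta (g + 1) p
               / eta (g + 1 - r_inv p G ?t) p))
      \<and> (\<not> schur1_sigma_group p g G ?t \<longrightarrow> Meas p g (c + 1) G = 0)"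
  proof (intro conjI impI)
    show "Meas p g c G =
        real (y_inv G \<sigma>) / (real (card (Aut_sigma G \<sigma>)) * real (card (carrier G)))
        * real p ^ (g * (g + 1))
        * (eta g p * eta (g + 1) p / eta (g + 1 - h_inv p g c G) p)"
      by (rule Meas_ancestor[OF assms(1,2) H kh surj ker c0 \<open>c \<le> c0\<close> lc(1) gi R.h_inv_kernel])
  next
    assume S: "schur1_sigma_group p g G ?t"
    have "\<exists>r. card (H2 p G ?t) = p ^ r" using S unfolding schur1_sigma_group_def by blast
    then obtain r where r: "card (H2 p G ?t) = p ^ r" by blast
    have "r_inv p G ?t = r" unfolding r_inv_def using r R.p_gt_1 by (intro the_equality) auto
    then have h2: "card (H2 p G ?t) = p ^ r_inv p G ?t" using r by simp
    \<comment> \<open>Here G serves as its own Schur+1 group, as a quotient by P_{c+1}(G) =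
      1.\<close>
    have idh: "group_hom G G id" by (auto simp: group_hom_def group_hom_axioms_def hom_def G.group_axioms)
    have kid: "kernel G G id = plcs p G ?t (Suc c)" unfolding G.plcs_discrete m by (auto simp: kernel_def)
    have "card (kernel (Fc p g (Suc c)) G (M.lift s)) =
        p ^ r_inv p G ?t * card (pstar p (Fc p g (Suc c)) (kernel (Fc p g (Suc c)) G (M.lift s)))" if s: "s \<in> M.Etup" for s
    proof -
      interpret X: rank_group_Suc G \<sigma> p g "Suc c" c s by (rule Msuc[OF s])
      show ?thesis using X.card_H2 h2 by (simp add: X.tr.N_def)
    qed
    then show "Meas p g (c + 1) G =
            real (y_inv G \<sigma>) / (real (card (Aut_sigma G \<sigma>)) * real (card (carrier G)))
            * real p ^ (g * (g + 1))
            * (eta g p * eta (g + 1) p / eta (g + 1 - r_inv p G ?t) p)"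
      using Meas_ancestor[OF assms(1,2) S idh _ kid _ order_refl m gi, of "r_inv p G ?t"] by simp
  next
    assume nS: "\<not> schur1_sigma_group p g G ?t"
    have "Tc p g (Suc c) G = {}"
    proof (rule ccontr)
      assume "Tc p g (Suc c) G \<noteq> {}"
      then obtain t where t: "t \<in> Tc p g (Suc c) G" by blast
      obtain s where s: "s \<in> M.Etup" "kernel (Fc p g (Suc c)) G (M.lift s) = ncl_tuple p g (Suc c) t"
        using M.Tc_kernel[OF t] by blast
      interpret X: rank_group_Suc G \<sigma> p g "Suc c" c s by (rule Msuc[OF s(1)])
      show False using X.schur_of_Tc[OF t s(2) gi] nS by blast
    qed
    then show "Meas p g (c + 1) G = 0" by (simp add: Meas_def)
  qed
qed

end
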